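(* All isolated singularities with zero $6$-jet deform to $J_{3,0}$. Consequently, they have Lipschitz modality at least $2$.
   Context: Let $\mathfrak{m}_n$ be the maximal ideal of the ring of germs at $0$ of complex analytic functions on $\mathbb{C}^n$; singularities are germs in $\mathfrak{m}_n^2$. Germs $f,g\in\mathfrak{m}_n$ are smoothly right equivalent if $f=g\circ\varphi$ for a germ of biholomorphism $\varphi$ of $(\mathbb{C}^n,0)$, and bi-Lipschitz right equivalent if $f=g\circ\varphi$ for a germ of bi-Lipschitz homeomorphism $\varphi$ of $(\mathbb{C}^n,0)$. The corank of $f\in\mathfrak{m}_n^2$ is $n$ minus the rank of its Hessian at $0$. By the Thom splitting lemma, a germ of corank $c$ with isolated singularity is smoothly right equivalent to $g(x_1,\dots,x_c)+x_{c+1}^2+\dots+x_n^2$ with $g$ unique up to smooth right equivalence; by convention the quadratic part is omitted when writing germs, and "zero $6$-jet" refers to $g$. $J_{3,0}$ is the family of germs $x^3+bx^2y^3+y^9+cxy^7+z_1^2+\dots+z_{n-2}^2$ with $b,c\in\mathbb{C}$, $4b^3+27\neq0$. A deformation of $f$ is an analytic map germ $F:(\mathbb{C}^n\times\mathbb{C}^l,0)\to(\mathbb{C},0)$, $F_t(x)=F(x,t)$, with $F_0=f$. The germ $f$ deforms to a family $\mathcal{D}$ if there is a deformation $F$ of $f$ such that for some sufficiently small $t\ne0$ the germ $F_t$ is smoothly right equivalent to some germ in $\mathcal{D}$. $J_0^k(n,1)$ is the complex vector space of $k$-jets at $0$ of germs in $\mathfrak{m}_n$, regarded as a real vector space for semialgebraicity,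 (real) dimension and closure. Lipschitz modality: let $f\in\mathfrak{m}_n^2$ be finitely determined (equivalently, with isolated singularity), with Milnor number $\mu(f)$, and let $k\ge\mu(f)+1$. Let $m$ be the largest integer for which there exists a semialgebraic set $S\subset J_0^k(n,1)$ of dimension $m$ such that (1) $j^kf(0)\in\overline{S}$; (2) for any distinct $g_1,g_2\in S$, the germs at the origin corresponding to $g_1,g_2$ are not bi-Lipschitz right equivalent. Then the Lipschitz modality of $f$ is $\mathrm{Lmod}(f)=\lfloor m/2\rfloor$.
   Formalization: The singularities are assumed to have corank at least 2; in corank 0 and 1 the claim is false, e.g. x^7+z^2 has zero 6-jet but, by semicontinuity of the corank, cannot deform to the corank-2 family J_{3,0}. *)

theory Defs
  imports "HOL-Analysis.Analysis" "HOL-Analysis.Finite_Function_Topology"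
begin

text \<open>
  A germ at the origin of \<open>complex ^ 'n\<close> is represented by any total function having that germ;
  all notions below depend only on the values near \<open>0\<close>.
  A multi-index is a function \<open>'n \<Rightarrow> nat\<close>, and a polynomial is a finitely supported
  family of coefficients indexed by multi-indices.
\<close>

section \<open>Analytic germs, partial derivatives and jets\<close>

definition mon :: "('n::finite \<Rightarrow> nat) \<Rightarrow> complex ^ 'n \<Rightarrow> complex" where
  "mon \<alpha> x = (\<Prod>i\<in>UNIV. (x $ i) ^ \<alpha> i)"

definition mdeg :: "('n::finite \<Rightarrow> nat) \<Rightarrow> nat" where
  "mdeg \<alpha> = (\<Sum>i\<in>UNIV. \<alpha> i)"

definition has_power_series :: "(complex ^ 'n::finite \<Rightarrow> complex) \<Rightarrow> (('n \<Rightarrow> nat) \<Rightarrow> complex) \<Rightarrow> bool" where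
  "has_power_series f a \<longleftrightarrow>
     (\<forall>\<^sub>F x in nhds 0. ((\<lambda>\<alpha>. a \<alpha> * mon \<alpha> x) has_sum f x) UNIV)"

definition analytic_germ :: "(complex ^ 'n::finite \<Rightarrow> complex) \<Rightarrow> bool" where
  "analytic_germ f \<longleftrightarrow> (\<exists>a. has_power_series f a)"

definition taylor_coeff :: "(complex ^ 'n::finite \<Rightarrow> complex) \<Rightarrow> ('n \<Rightarrow> nat) \<Rightarrow> complex" where
  "taylor_coeff f = (THE a. has_power_series f a)"

lemma finite_mdeg_le: "finite {\<alpha> :: 'n::finite \<Rightarrow> nat. mdeg \<alpha> \<le> k}"
proof (rule finite_subset)
  show "{\<alpha> :: 'n \<Rightarrow> nat. mdeg \<alpha> \<le> k} \<subseteq> (\<Pi>\<^sub>E i\<in>UNIV. {..k})"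
  proof
    fix \<alpha> :: "'n \<Rightarrow> nat"
    assume "\<alpha> \<in> {\<alpha>. mdeg \<alpha> \<le> k}"
    moreover have "\<alpha> i \<le> mdeg \<alpha>" for i
      unfolding mdeg_def by (rule member_le_sum) auto
    ultimately show "\<alpha> \<in> (\<Pi>\<^sub>E i\<in>UNIV. {..k})"
      by (auto simp: PiE_def intro: order_trans)
  qed
  show "finite (\<Pi>\<^sub>E i\<in>(UNIV :: 'n set). {..k})"
    by (rule finite_PiE) auto
qed

definition jet :: "nat \<Rightarrow> (complex ^ 'n::finite \<Rightarrow> complex) \<Rightarrow> ('n \<Rightarrow> nat) \<Rightarrow>\<^sub>0 complex" where
  "jet k f = (\<Sum>\<alpha> | mdeg \<alpha> \<le> k. Poly_Mapping.single \<alpha> (taylor_coeff f \<alpha>))"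

definition poly_eval :: "(('n::finite \<Rightarrow> nat) \<Rightarrow>\<^sub>0 complex) \<Rightarrow> complex ^ 'n \<Rightarrow> complex" where
  "poly_eval p x = (\<Sum>\<alpha>\<in>Poly_Mapping.keys p. Poly_Mapping.lookup p \<alpha> * mon \<alpha> x)"

definition partial_deriv ::
    "'n::finite \<Rightarrow> (complex ^ 'n \<Rightarrow> complex) \<Rightarrow> complex ^ 'n \<Rightarrow> complex" where
  "partial_deriv i f x = deriv (\<lambda>s. f (x + axis i s)) 0"

section \<open>Singularities and their invariants\<close>

definition max_ideal :: "(complex ^ 'n::finite \<Rightarrow> complex) set" where
  "max_ideal = {f. analytic_germ f \<and> f 0 = 0}"

definition max_ideal_sq :: "(complex ^ 'n::finite \<Rightarrow> complex) set" where
  "max_ideal_sq = {f. \<exists>(N::nat) u v. (\<forall>i<N. u i \<in> max_ideal \<and> v i \<in> max_ideal) \<and>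
     (\<forall>\<^sub>F x in nhds 0. f x = (\<Sum>i<N. u i x * v i x))}"

definition isolated_singularity :: "(complex ^ 'n::finite \<Rightarrow> complex) \<Rightarrow> bool" where
  "isolated_singularity f \<longleftrightarrow>
     f \<in> max_ideal_sq \<and> (\<forall>\<^sub>F x in at 0. \<exists>i. partial_deriv i f x \<noteq> 0)"

definition hessian0 :: "(complex ^ 'n::finite \<Rightarrow> complex) \<Rightarrow> complex ^ 'n ^ 'n" where
  "hessian0 f = (\<chi> i j. partial_deriv i (partial_deriv j f) 0)"

definition corank :: "(complex ^ 'n::finite \<Rightarrow> complex) \<Rightarrow> nat" where
  "corank f = CARD('n) - rank (hessian0 f)"

definition jacobian_ideal :: "(complex ^ 'n::finite \<Rightarrow> complex) \<Rightarrow> (complex ^ 'n \<Rightarrow> complex) set" where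
  "jacobian_ideal f = {h. \<exists>u. (\<forall>i. analytic_germ (u i)) \<and>
     (\<forall>\<^sub>F x in nhds 0. h x = (\<Sum>i\<in>UNIV. u i x * partial_deriv i f x))}"

text \<open>
  The dimension of the quotient of the ring of analytic germs by the Jacobian ideal: the supremum
  of the sizes of families of germs whose classes are linearly independent (\<open>\<infinity>\<close> if unbounded).
\<close>

definition milnor_number :: "(complex ^ 'n::finite \<Rightarrow> complex) \<Rightarrow> enat" where
  "milnor_number f = Sup (enat ` {m. \<exists>e :: nat \<Rightarrow> complex ^ 'n \<Rightarrow> complex.
     (\<forall>i<m. analytic_germ (e i)) \<and>
     (\<forall>c :: nat \<Rightarrow> complex. (\<lambda>x. \<Sum>i<m. c i * e i x) \<in> jacobian_ideal f \<longrightarrow> (\<forall>i<m. c i = 0))})"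

section \<open>Right equivalences\<close>

definition biholomorphism_germ :: "(complex ^ 'n::finite \<Rightarrow> complex ^ 'n) \<Rightarrow> bool" where
  "biholomorphism_germ \<phi> \<longleftrightarrow>
     \<phi> 0 = 0 \<and> (\<forall>i. analytic_germ (\<lambda>x. \<phi> x $ i)) \<and>
     (\<exists>\<psi>. \<psi> 0 = 0 \<and> (\<forall>i. analytic_germ (\<lambda>x. \<psi> x $ i)) \<and>
          (\<forall>\<^sub>F x in nhds 0. \<psi> (\<phi> x) = x \<and> \<phi> (\<psi> x) = x))"

definition smoothly_equiv ::
    "(complex ^ 'n::finite \<Rightarrow> complex) \<Rightarrow> (complex ^ 'n \<Rightarrow> complex) \<Rightarrow> bool" where
  "smoothly_equiv f g \<longleftrightarrow> (\<exists>\<phi>. biholomorphism_germ \<phi> \<and> (\<forall>\<^sub>F x in nhds 0. f x = g (\<phi> x)))"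

definition bilipschitz_germ :: "(complex ^ 'n::finite \<Rightarrow> complex ^ 'n) \<Rightarrow> bool" where
  "bilipschitz_germ \<phi> \<longleftrightarrow>
     \<phi> 0 = 0 \<and>
     (\<exists>U V \<psi> L. open U \<and> 0 \<in> U \<and> open V \<and> homeomorphism U V \<phi> \<psi> \<and>
        L-lipschitz_on U \<phi> \<and> L-lipschitz_on V \<psi>)"

definition bilipschitz_equiv ::
    "(complex ^ 'n::finite \<Rightarrow> complex) \<Rightarrow> (complex ^ 'n \<Rightarrow> complex) \<Rightarrow> bool" where
  "bilipschitz_equiv f g \<longleftrightarrow> (\<exists>\<phi>. bilipschitz_germ \<phi> \<and> (\<forall>\<^sub>F x in nhds 0. f x = g (\<phi> x)))"

section \<open>Residual germs\<close>

text \<open>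
  The \<open>c\<close> variables of the residual germ \<open>g\<close> of the splitting lemma are the coordinates
  with index in a set \<open>I\<close> of cardinality \<open>c = corank f\<close>; a germ in these variables is a
  function on the whole space that does not depend on the other coordinates.
\<close>

definition residual_germ ::
    "(complex ^ 'n::finite \<Rightarrow> complex) \<Rightarrow> 'n set \<Rightarrow> (complex ^ 'n \<Rightarrow> complex) \<Rightarrow> bool" where
  "residual_germ f I g \<longleftrightarrow>
     card I = corank f \<and> g \<in> max_ideal_sq \<and>
     (\<forall>x y. (\<forall>i\<in>I. x $ i = y $ i) \<longrightarrow> g x = g y) \<and>
     smoothly_equiv f (\<lambda>x. g x + (\<Sum>i\<in>-I. (x $ i)\<^sup>2))"

definition zero_residual_jet :: "nat \<Rightarrow> (complex ^ 'n::finite \<Rightarrow> complex) \<Rightarrow> bool" where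
  "zero_residual_jet k f \<longleftrightarrow> (\<exists>I g. residual_germ f I g \<and> jet k g = 0)"

section \<open>Deformations\<close>

text \<open>
  The parameter space of dimension \<open>l\<close> consists of the functions \<open>nat \<Rightarrow> complex\<close> vanishing
  outside \<open>{..<l}\<close>.
\<close>

definition param_space :: "nat \<Rightarrow> (nat \<Rightarrow> complex) set" where
  "param_space l = {t. \<forall>i\<ge>l. t i = 0}"

definition analytic_family ::
    "nat \<Rightarrow> (complex ^ 'n::finite \<Rightarrow> (nat \<Rightarrow> complex) \<Rightarrow> complex) \<Rightarrow> bool" where
  "analytic_family l F \<longleftrightarrow>
     (\<exists>(A :: ('n \<Rightarrow> nat) \<Rightarrow> (nat \<Rightarrow> nat) \<Rightarrow> complex) r. r > 0 \<and>
        (\<forall>x. \<forall>t\<in>param_space l. norm x < r \<and> (\<forall>i<l. norm (t i) < r) \<longrightarrow>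
           ((\<lambda>(\<alpha>, \<beta>). A \<alpha> \<beta> * (mon \<alpha> x * (\<Prod>i<l. t i ^ \<beta> i))) has_sum F x t)
             (UNIV \<times> {\<beta>. \<forall>i\<ge>l. \<beta> i = 0})))"

definition deforms_to ::
    "(complex ^ 'n::finite \<Rightarrow> complex) \<Rightarrow> (complex ^ 'n \<Rightarrow> complex) set \<Rightarrow> bool" where
  "deforms_to f D \<longleftrightarrow>
     (\<exists>l F. analytic_family l F \<and>
        (\<forall>\<^sub>F x in nhds 0. F x (\<lambda>_. 0) = f x) \<and>
        (\<forall>\<epsilon>>0. \<exists>t\<in>param_space l. t \<noteq> (\<lambda>_. 0) \<and> (\<forall>i<l. norm (t i) < \<epsilon>) \<and>
           (\<exists>g\<in>D. smoothly_equiv (\<lambda>x. F x t) g)))"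

text \<open>
  The coordinates \<open>x\<close> and \<open>y\<close> are any two distinct coordinates of the space; the
  different choices are related by permutations of the coordinates.
\<close>

definition J30 :: "(complex ^ 'n::finite \<Rightarrow> complex) set" where
  "J30 = {\<lambda>v. (v $ i) ^ 3 + b * (v $ i)\<^sup>2 * (v $ j) ^ 3 + (v $ j) ^ 9 + c * (v $ i) * (v $ j) ^ 7
              + (\<Sum>k\<in>- {i, j}. (v $ k)\<^sup>2) | i j b c. i \<noteq> j \<and> 4 * b ^ 3 + 27 \<noteq> 0}"

section \<open>Semialgebraic sets and their dimension\<close>

text \<open>
  Semialgebraic subsets of a finite-dimensional linear subspace \<open>V\<close> of a real normed space: finite
  unions of sets given by finitely many polynomial equations and strict inequalities.
\<close>

definition semialgebraic_in :: "'v::real_normed_vector set \<Rightarrow> 'v set \<Rightarrow> bool" where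
  "semialgebraic_in V S \<longleftrightarrow>
     (\<exists>B :: (('v \<Rightarrow> real) set \<times> ('v \<Rightarrow> real) set) set. finite B \<and>
        (\<forall>(P, Q)\<in>B. finite P \<and> finite Q \<and> (\<forall>p\<in>P \<union> Q. real_polynomial_function p)) \<and>
        S = (\<Union>(P, Q)\<in>B. {x\<in>V. (\<forall>p\<in>P. p x = 0) \<and> (\<forall>q\<in>Q. q x > 0)}))"

text \<open>The real coordinate space of dimension \<open>d\<close>, for a variable number \<open>d\<close>, and its open unit cube.\<close>

definition coord_space :: "nat \<Rightarrow> (nat \<Rightarrow>\<^sub>0 real) set" where
  "coord_space d = {u. Poly_Mapping.keys u \<subseteq> {..<d}}"

definition open_cube :: "nat \<Rightarrow> (nat \<Rightarrow>\<^sub>0 real) set" where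
  "open_cube d = {u\<in>coord_space d. \<forall>i<d. 0 < Poly_Mapping.lookup u i \<and> Poly_Mapping.lookup u i < 1}"

definition semialgebraic_cell :: "'v::real_normed_vector set \<Rightarrow> 'v set \<Rightarrow> nat \<Rightarrow> bool" where
  "semialgebraic_cell V C d \<longleftrightarrow>
     semialgebraic_in V C \<and>
     (\<exists>\<phi> \<psi>. homeomorphism (open_cube d) C \<phi> \<psi> \<and>
        semialgebraic_in (coord_space d \<times> V) ((\<lambda>u. (u, \<phi> u)) ` open_cube d))"

text \<open>
  The dimension of a nonempty semialgebraic set is the largest dimension of a cell in a finite
  partition into cells, i.e. into semialgebraic sets that are semialgebraically homeomorphic to open
  cubes.
\<close>

definition has_semialgebraic_dim :: "'v::real_normed_vector set \<Rightarrow> 'v set \<Rightarrow> nat \<Rightarrow> bool" where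
  "has_semialgebraic_dim V S d \<longleftrightarrow>
     (\<exists>(\<C> :: 'v set set) e. finite \<C> \<and> \<C> \<noteq> {} \<and> disjoint \<C> \<and> \<Union>\<C> = S \<and>
        (\<forall>C\<in>\<C>. semialgebraic_cell V C (e C)) \<and> d = Max (e ` \<C>))"

section \<open>Lipschitz modality\<close>

definition jet_space :: "nat \<Rightarrow> (('n::finite \<Rightarrow> nat) \<Rightarrow>\<^sub>0 complex) set" where
  "jet_space k = jet k ` max_ideal"

text \<open>
  The modality is computed in the space of \<open>k\<close>-jets; \<open>k\<close> has to be at least the Milnor number
  plus one.
\<close>

definition lipschitz_modality :: "nat \<Rightarrow> (complex ^ 'n::finite \<Rightarrow> complex) \<Rightarrow> nat" where
  "lipschitz_modality k f =
     (GREATEST m. \<exists>S :: (('n \<Rightarrow> nat) \<Rightarrow>\<^sub>0 complex) set.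
        S \<subseteq> jet_space k \<and> semialgebraic_in (jet_space k) S \<and>
        has_semialgebraic_dim (jet_space k) S m \<and>
        jet k f \<in> closure S \<and>
        (\<forall>g1\<in>S. \<forall>g2\<in>S. g1 \<noteq> g2 \<longrightarrow>
           \<not> bilipschitz_equiv (poly_eval g1) (poly_eval g2))) div 2"

end

(*
  Write g for the residual germ, u = y^2 - s x for a smooth curve and Z_k for the remaining
  coordinates. Since g has zero 6-jet, terms of g in the first two coordinates can be perturbed by
  multiples of powers of s so that the result lies in the ideal (u^3, y^9), up to terms which
  are absorbed by completing squares. For s <> 0 this gives a germ X^3 + Y^9 + sum Z_k^2 with
  X = u A, Y = y D, hence the deformation to J_{3,0}.

  For the modality, beta u^2 y^3 + gamma u y^7 is added. The points where the derivative of
  X^3 + b X^2 Y^3 + Y^9 + c X Y^7 + ... is O(|p|^7) form a zone invariant under bi-Lipschitz maps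
  that has two branches, X = O(Y^4) and X = -2b/3 Y^3 + O(Y^4); comparing the values of the germ on
  the two branches shows that b and c, up to finitely many choices, are bi-Lipschitz invariants.
  On a cuspidal region of the parameters (s, beta, gamma) the choices are separated, and the four
  real parameters give a semialgebraic cell of pairwise inequivalent jets adherent to the jet of f.
*)
theory Submission
  imports "HOL-Complex_Analysis.Cauchy_Integral_Formula" "HOL-Real_Asymp.Real_Asymp"
    "HOL-Homology.Invariance_of_Domain" Defs
begin

section \<open>Separately holomorphic functions and power series\<close>

text \<open>The curve u = y^2 - s x is chosen because u^3 tends to y^6 as s tends to 0: the part of
  g divisible by y^6 is \<open>y^6 fA\<close>, the limit of \<open>u^3 fA\<close>. Since x = (y^2 -
  u) / s, a monomial x^a y^b becomes s^(-a) (y^2 - u)^a y^b and lies in (u^3, y^9) as soon as 2a + b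
  >= 13. Among the monomials of degree at least 7 with b < 6 exactly six fail this; they are
  repaired by adding copies of themselves in which y^2 is traded for s x.

  The obstacle for the modality is that only b^3 and a ninth power are invariant, that the latter
  mixes c with the first-order variation of b, and that every two jets of the family must be
  separated. The exponent 20 of the cusp answers this: s enters the denominators with exponent at
  most 15, so for beta of size s^20 the mixing term has size beta^2 / s^15, that is s^25, which is
  negligible against gamma of size s^20.

  The order k of the jets matters only through k >= 11, which follows from a Milnor number of at
  least 10: terms of degree 11 do not affect the invariants, so monomials of degree k can carry the
  parameters.\<close>

definition polydisc :: "real \<Rightarrow> (complex ^ 'n::finite) set" where
  "polydisc R = {x. \<forall>i. norm (x $ i) < R}"

definition vupd :: "complex ^ 'n::finite \<Rightarrow> 'n \<Rightarrow> complex \<Rightarrow> complex ^ 'n" where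
  "vupd x i t = (\<chi> j. if j = i then t else x $ j)"

lemma vupd_nth [simp]: "vupd x i t $ j = (if j = i then t else x $ j)"
  by (simp add: vupd_def)

lemma vupd_same [simp]: "vupd x i (x $ i) = x"
  by (simp add: vec_eq_iff)

lemma vupd_vupd_same [simp]: "vupd (vupd x i s) i t = vupd x i t"
  by (simp add: vec_eq_iff)

lemma vupd_in_polydisc: "x \<in> polydisc R \<Longrightarrow> norm t < R \<Longrightarrow> vupd x i t \<in> polydisc R"
  by (simp add: polydisc_def)

lemma mon_add: "mon (\<lambda>i. \<alpha> i + \<beta> i) x = mon \<alpha> x * mon \<beta> x"
  by (simp add: mon_def power_add prod.distrib)

lemma mon_upd: "mon (\<alpha>(i := k)) x = x $ i ^ k * (\<Prod>j\<in>UNIV - {i}. x $ j ^ \<alpha> j)"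
  by (simp add: mon_def prod.remove[of UNIV i])

lemma mdeg_upd: "mdeg (\<alpha>(i := k)) + \<alpha> i = mdeg \<alpha> + k"
  by (simp add: mdeg_def sum.remove[of UNIV i])

lemma norm_mon: "norm (mon \<alpha> x) = (\<Prod>i\<in>UNIV. norm (x $ i) ^ \<alpha> i)"
  by (simp add: mon_def prod_norm [symmetric] norm_power)

lemma mon_const: "(\<Prod>i\<in>UNIV. c ^ \<alpha> i) = (c::'a::comm_semiring_1) ^ mdeg \<alpha>"
  by (simp add: mdeg_def power_sum)

text \<open>A finite set of multi-indices lies in a box, and over a box the sum factors into
  one-variable geometric sums; this bounds all partial sums uniformly.\<close>

lemma summable_on_geometric_multi:
  fixes t :: "'n::finite \<Rightarrow> real"
  assumes "\<And>i. 0 \<le> t i" "\<And>i. t i < 1"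
  shows "(\<lambda>\<alpha>. \<Prod>i\<in>UNIV. t i ^ \<alpha> i) summable_on UNIV"
proof -
  have nn: "0 \<le> (\<Prod>i\<in>UNIV. t i ^ \<alpha> i)" for \<alpha> :: "'n \<Rightarrow> nat"
    using assms by (intro prod_nonneg) auto
  have "bdd_above (sum (\<lambda>\<alpha>. norm (\<Prod>i\<in>UNIV. t i ^ \<alpha> i)) ` {F. F \<subseteq> UNIV \<and> finite F})"
  proof (rule bdd_aboveI)
    fix s assume "s \<in> sum (\<lambda>\<alpha>. norm (\<Prod>i\<in>UNIV. t i ^ \<alpha> i)) ` {F. F \<subseteq> UNIV \<and> finite F}"
    then obtain F :: "('n \<Rightarrow> nat) set" where F: "finite F" and s: "s = (\<Sum>\<alpha>\<in>F. norm (\<Prod>i\<in>UNIV. t i ^ \<alpha> i))" by auto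
    define N where "N = Max (insert 0 ((\<lambda>\<alpha>. mdeg \<alpha>) ` F))"
    have N: "\<alpha> i \<le> N" if "\<alpha> \<in> F" for \<alpha> i
    proof -
      have "\<alpha> i \<le> mdeg \<alpha>" unfolding mdeg_def by (rule member_le_sum) auto
      also have "\<dots> \<le> N" unfolding N_def using F that by (intro Max_ge) auto
      finally show ?thesis .
    qed
    have "s = (\<Sum>\<alpha>\<in>F. \<Prod>i\<in>UNIV. t i ^ \<alpha> i)" using nn by (simp add: s)
    also have "\<dots> \<le> (\<Sum>\<alpha>\<in>PiE UNIV (\<lambda>_. {..N}). \<Prod>i\<in>UNIV. t i ^ \<alpha> i)"
      using N nn by (intro sum_mono2) (auto intro!: finite_PiE)
    also have "\<dots> = (\<Prod>i\<in>UNIV. \<Sum>k\<le>N. t i ^ k)"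
      by (subst prod_sum_PiE) auto
    also have "\<dots> \<le> (\<Prod>i\<in>UNIV. 1 / (1 - t i))"
    proof (rule prod_mono, safe)
      fix i
      show "0 \<le> (\<Sum>k\<le>N. t i ^ k)" using assms by (intro sum_nonneg) auto
      have "(\<Sum>k\<le>N. t i ^ k) = (1 - t i ^ Suc N) / (1 - t i)"
        using assms(2)[of i] by (subst lessThan_Suc_atMost [symmetric], subst sum_gp_strict) auto
      also have "\<dots> \<le> 1 / (1 - t i)"
        using assms[of i] by (intro divide_right_mono) auto
      finally show "(\<Sum>k\<le>N. t i ^ k) \<le> 1 / (1 - t i)" .
    qed
    finally show "s \<le> (\<Prod>i\<in>UNIV. 1 / (1 - t i))" .
  qed
  then show ?thesis
    using abs_summable_iff_bdd_above[of "\<lambda>\<alpha>. \<Prod>i\<in>UNIV. t i ^ \<alpha> i" UNIV] nn by simp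
qed

lemma abs_summable_bounded_coeffs:
  assumes R: "R > 0" and a: "\<And>\<alpha>. norm (a \<alpha>) \<le> M / R ^ mdeg \<alpha>" and x: "x \<in> polydisc R"
  shows "(\<lambda>\<alpha>. norm (a \<alpha> * mon \<alpha> x)) summable_on UNIV"
proof -
  have s: "(\<lambda>\<alpha>. norm (M * (\<Prod>i\<in>UNIV. (norm (x $ i) / R) ^ \<alpha> i))) summable_on UNIV"
    unfolding summable_on_iff_abs_summable_on_real[symmetric]
    using x R by (intro summable_on_cmult_right summable_on_geometric_multi) (auto simp: polydisc_def)
  show ?thesis
  proof (rule Infinite_Sum.abs_summable_on_comparison_test[OF s])
    fix \<alpha> :: "'a \<Rightarrow> nat"
    have "norm (a \<alpha> * mon \<alpha> x) \<le> M / R ^ mdeg \<alpha> * norm (mon \<alpha> x)"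
      unfolding norm_mult by (intro mult_right_mono a) simp
    also have "\<dots> = M * (\<Prod>i\<in>UNIV. (norm (x $ i) / R) ^ \<alpha> i)"
      by (simp add: norm_mon power_divide prod_dividef mon_const)
    also have "\<dots> \<le> norm (M * (\<Prod>i\<in>UNIV. (norm (x $ i) / R) ^ \<alpha> i))" by simp
    finally show "norm (a \<alpha> * mon \<alpha> x) \<le> norm (M * (\<Prod>i\<in>UNIV. (norm (x $ i) / R) ^ \<alpha> i))" .
  qed
qed

text \<open>Boundedness takes the place of joint continuity: together with holomorphy in each
  variable it already forces a power series expansion (Osgood's lemma).\<close>

definition sepholo :: "real \<Rightarrow> real \<Rightarrow> (complex ^ 'n::finite \<Rightarrow> complex) \<Rightarrow> bool" where
  "sepholo R M f \<longleftrightarrow> (\<forall>x\<in>polydisc R. norm (f x) \<le> M) \<and>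
     (\<forall>x\<in>polydisc R. \<forall>i. (\<lambda>t. f (vupd x i t)) holomorphic_on ball 0 R)"

definition slice_coeff :: "(complex ^ 'n::finite \<Rightarrow> complex) \<Rightarrow> 'n \<Rightarrow> nat \<Rightarrow> complex ^ 'n \<Rightarrow> complex" where
  "slice_coeff f i k x = (deriv ^^ k) (\<lambda>t. f (vupd x i t)) 0 / fact k"

lemma slice_coeff_sums:
  assumes "sepholo R M f" "x \<in> polydisc R" "norm w < R"
  shows "(\<lambda>k. slice_coeff f i k x * w ^ k) sums f (vupd x i w)"
  using holomorphic_power_series[of "\<lambda>t. f (vupd x i t)" 0 R w] assms
  by (simp add: sepholo_def slice_coeff_def)

lemma slice_coeff_bound:
  assumes f: "sepholo R M f" and x: "x \<in> polydisc R" and R: "R > 0"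
  shows "norm (slice_coeff f i k x) \<le> M / R ^ k"
proof -
  have *: "norm (slice_coeff f i k x) \<le> M / r ^ k" if "0 < r" "r < R" for r
  proof -
    have h: "(\<lambda>t. f (vupd x i t)) holomorphic_on ball 0 R" using f x by (auto simp: sepholo_def)
    have "norm ((deriv ^^ k) (\<lambda>t. f (vupd x i t)) 0) \<le> fact k * M / r ^ k"
    proof (rule Cauchy_inequality)
      show "(\<lambda>t. f (vupd x i t)) holomorphic_on ball 0 r" 
        using that by (intro holomorphic_on_subset[OF h]) auto
      show "continuous_on (cball 0 r) (\<lambda>t. f (vupd x i t))"
        using that by (intro holomorphic_on_imp_continuous_on holomorphic_on_subset[OF h]) auto
      show "norm (f (vupd x i z)) \<le> M" if "norm (0 - z) = r" for z
        using that \<open>r < R\<close> f x vupd_in_polydisc[of x R z i] by (auto simp: sepholo_def)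
    qed fact
    then show ?thesis by (simp add: slice_coeff_def norm_divide field_simps)
  qed
  have "((\<lambda>r. M / r ^ k) \<longlongrightarrow> M / R ^ k) (at_left R)"
    using R by (intro tendsto_intros) auto
  moreover have "\<forall>\<^sub>F r in at_left R. norm (slice_coeff f i k x) \<le> M / r ^ k"
    using eventually_at_left_real[OF R] by eventually_elim (auto intro: *)
  ultimately show ?thesis
    by (rule tendsto_lowerbound) simp
qed

text \<open>Strong induction on k: the k-th coefficient is the uniform limit, as w tends to 0, of f
  minus its lower terms divided by w^k. Holomorphy in the other variables passes to this limit,
  which avoids integrals depending on a parameter.\<close>

lemma slice_coeff_holomorphic:
  assumes f: "sepholo R M f" and x: "x \<in> polydisc R" and R: "R > 0"
  shows "(\<lambda>t. slice_coeff f i k (vupd x j t)) holomorphic_on ball 0 R"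
proof (cases "j = i")
  case True
  then show ?thesis by (simp add: slice_coeff_def)
next
  case False
  show ?thesis
  proof (induction k rule: less_induct)
    case (less k)
    \<comment> \<open>These points tend to 0 and stay below R / 2, so that the tail of the expansion
      is dominated by a geometric series of ratio 1/2.\<close>
    define w where "w n = R / (real n + 2)" for n
    define q where "q n t = (f (vupd (vupd x j t) i (of_real (w n)))
        - (\<Sum>l<k. slice_coeff f i l (vupd x j t) * of_real (w n) ^ l)) / of_real (w n) ^ k" for n t
    have w: "0 < w n" "w n < R" "w n \<le> R / 2" for n using R by (auto simp: w_def field_simps intro: add_pos_nonneg)
    have w0: "w \<longlonglongrightarrow> 0" unfolding w_def by real_asymp
    have swap: "vupd (vupd x j t) i s = vupd (vupd x i s) j t" for s t
      using False by (auto simp: vec_eq_iff)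
    have M0: "0 \<le> M" using f x order_trans[OF norm_ge_zero] by (auto simp: sepholo_def)
    have q: "q n holomorphic_on ball 0 R" for n
      unfolding q_def
    proof (intro holomorphic_intros less.IH)
      show "(\<lambda>t. f (vupd (vupd x j t) i (of_real (w n)))) holomorphic_on ball 0 R"
        unfolding swap using f x w[of n] vupd_in_polydisc[of x R "of_real (w n)" i] by (auto simp: sepholo_def)
    qed (use w(1)[of n] in auto)
    have est: "norm (q n t - slice_coeff f i k (vupd x j t)) \<le> 2 * M / R ^ k * (w n / R)"
      if t: "norm t < R" for n t
    proof -
      let ?c = "\<lambda>l. slice_coeff f i l (vupd x j t)"
      let ?W = "of_real (w n) :: complex"
      have xt: "vupd x j t \<in> polydisc R" using x t by (rule vupd_in_polydisc)
      have s: "(\<lambda>l. ?c l * ?W ^ l) sums f (vupd (vupd x j t) i ?W)"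
        using w[of n] by (intro slice_coeff_sums[OF f xt]) auto
      from sums_iff_shift[of "\<lambda>l. ?c l * ?W ^ l" k] s
      have "(\<lambda>l. ?c (l + k) * ?W ^ (l + k)) sums (f (vupd (vupd x j t) i ?W) - (\<Sum>l<k. ?c l * ?W ^ l))"
        by (metis (no_types, lifting) add_diff_cancel_right' diff_add_cancel sums_iff_shift)
      then have "(\<lambda>l. ?c (l + k) * ?W ^ (l + k) / ?W ^ k) sums q n t"
        unfolding q_def by (rule sums_divide)
      then have "(\<lambda>l. ?c (l + k) * ?W ^ l) sums q n t"
        using w(1)[of n] by (simp add: power_add)
      then have "(\<lambda>l. ?c (Suc l + k) * ?W ^ Suc l) sums (q n t - ?c k)"
        by (subst sums_Suc_iff) simp
      moreover have "summable (\<lambda>l. M / R ^ k * (w n / R) * (1/2) ^ l)"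
        by (intro summable_mult summable_geometric) simp
      moreover have "norm (?c (Suc l + k) * ?W ^ Suc l) \<le> M / R ^ k * (w n / R) * (1/2) ^ l" for l
      proof -
        have "norm (?c (Suc l + k) * ?W ^ Suc l) \<le> M / R ^ (Suc l + k) * w n ^ Suc l"
          unfolding norm_mult norm_power using w[of n]
          by (intro mult_mono slice_coeff_bound[OF f xt R]) (auto simp: M0)
        also have "\<dots> = M / R ^ k * (w n / R) * (w n / R) ^ l"
          by (simp add: power_add power_divide mult_ac)
        also have "\<dots> \<le> M / R ^ k * (w n / R) * (1/2) ^ l"
          using w[of n] R M0 by (intro mult_left_mono power_mono) (auto simp: field_simps)
        finally show ?thesis .
      qed
      ultimately have "norm (q n t - ?c k) \<le> suminf (\<lambda>l. M / R ^ k * (w n / R) * (1/2) ^ l)"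
        by (metis (no_types, lifting) norm_suminf_le sums_unique)
      also have "\<dots> = 2 * M / R ^ k * (w n / R)"
        by (subst suminf_mult) (auto simp: suminf_geometric)
      finally show ?thesis .
    qed
    show ?case
    proof (rule holomorphic_uniform_sequence)
      show "open (ball (0::complex) R)" by simp
      show "q n holomorphic_on ball 0 R" for n by (rule q)
      fix z :: complex assume z: "z \<in> ball 0 R"
      obtain d where d: "d > 0" "cball z d \<subseteq> ball 0 R"
        using z open_contains_cball[of "ball (0::complex) R"] by (meson open_ball)
      have lim: "(\<lambda>n. 2 * M / R ^ k * (w n / R)) \<longlonglongrightarrow> 0"
        by (rule tendsto_eq_intros w0 refl)+ (use R in auto)
      have "uniform_limit (cball z d) q (\<lambda>t. slice_coeff f i k (vupd x j t)) sequentially"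
      proof (rule uniform_limitI)
        fix e :: real assume "e > 0"
        with lim have "\<forall>\<^sub>F n in sequentially. 2 * M / R ^ k * (w n / R) < e"
          by (simp add: order_tendstoD)
        then show "\<forall>\<^sub>F n in sequentially. \<forall>t\<in>cball z d. dist (q n t) (slice_coeff f i k (vupd x j t)) < e"
        proof eventually_elim
          case (elim n)
          show ?case
          proof
            fix t assume "t \<in> cball z d"
            then have "norm t < R" using d by auto
            from est[OF this, of n] elim show "dist (q n t) (slice_coeff f i k (vupd x j t)) < e"
              by (simp add: dist_norm)
          qed
        qed
      qed
      then show "\<exists>d>0. cball z d \<subseteq> ball 0 R \<and> uniform_limit (cball z d) q (\<lambda>t. slice_coeff f i k (vupd x j t)) sequentially"
        using d by blast
    qed
  qed
qed

lemma slice_coeff_sepholo: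
  assumes "sepholo R M f" "R > 0"
  shows "sepholo R (M / R ^ k) (slice_coeff f i k)"
  unfolding sepholo_def using slice_coeff_bound[OF assms(1)] slice_coeff_holomorphic[OF assms(1)] assms(2) by blast

text \<open>Induction over the set of variables on which f depends: f is expanded in one of them,
  and the coefficients of this expansion depend only on the others. The Cauchy bounds of the
  successive expansions multiply to M / R^mdeg.\<close>

lemma sepholo_power_series_aux:
  fixes f :: "complex ^ 'n::finite \<Rightarrow> complex"
  assumes "finite S" and R: "R > 0" and "sepholo R M f"
    and "\<And>x y. x \<in> polydisc R \<Longrightarrow> y \<in> polydisc R \<Longrightarrow> (\<forall>i\<in>S. x $ i = y $ i) \<Longrightarrow> f x = f y"
  shows "\<exists>a. (\<forall>\<alpha>. norm (a \<alpha>) \<le> M / R ^ mdeg \<alpha>) \<and> (\<forall>\<alpha>. (\<exists>i. i \<notin> S \<and> \<alpha> i \<noteq> 0) \<longrightarrow> a \<alpha> = 0) \<and>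
     (\<forall>x\<in>polydisc R. ((\<lambda>\<alpha>. a \<alpha> * mon \<alpha> x) has_sum f x) UNIV)"
  using assms(1,3,4)
proof (induction S arbitrary: f M rule: finite_induct)
  case empty
  have z: "0 \<in> polydisc R" using R by (simp add: polydisc_def)
  then have M: "norm (f 0) \<le> M" using empty(1) unfolding sepholo_def by blast
  let ?a = "\<lambda>\<alpha>::'n \<Rightarrow> nat. if \<alpha> = (\<lambda>_. 0) then f 0 else 0"
  have "norm (?a \<alpha>) \<le> M / R ^ mdeg \<alpha>" for \<alpha>
    using M R order_trans[OF norm_ge_zero M] by (auto simp: mdeg_def)
  moreover have "((\<lambda>\<alpha>. ?a \<alpha> * mon \<alpha> x) has_sum f x) UNIV" if "x \<in> polydisc R" for x
  proof -
    have "f x = f 0" using empty(2)[OF that z] by simp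
    then show ?thesis
      by (intro has_sum_finite_neutralI[where B="{\<lambda>_. 0}"]) (auto simp: mon_def)
  qed
  ultimately show ?case by (intro exI[of _ ?a]) (auto simp: fun_eq_iff)
next
  case (insert i S)
  let ?c = "slice_coeff f i"
  have "\<exists>a. (\<forall>\<alpha>. norm (a \<alpha>) \<le> (M / R ^ k) / R ^ mdeg \<alpha>) \<and> (\<forall>\<alpha>. (\<exists>i. i \<notin> S \<and> \<alpha> i \<noteq> 0) \<longrightarrow> a \<alpha> = 0) \<and>
     (\<forall>x\<in>polydisc R. ((\<lambda>\<alpha>. a \<alpha> * mon \<alpha> x) has_sum ?c k x) UNIV)" for k
  proof (rule insert.IH)
    show "sepholo R (M / R ^ k) (?c k)" by (rule slice_coeff_sepholo) fact+
    fix x y :: "complex ^ 'n" assume xy: "x \<in> polydisc R" "y \<in> polydisc R" "\<forall>i\<in>S. x $ i = y $ i"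
    have "\<forall>\<^sub>F t in nhds 0. f (vupd x i t) = f (vupd y i t)"
      using eventually_nhds_in_open[of "ball (0::complex) R" 0] R
      by (auto elim!: eventually_mono intro!: insert.prems(2) vupd_in_polydisc simp: xy)
    then have "(deriv ^^ k) (\<lambda>t. f (vupd x i t)) 0 = (deriv ^^ k) (\<lambda>t. f (vupd y i t)) 0"
      by (rule higher_deriv_cong_ev) simp
    then show "?c k x = ?c k y" by (simp add: slice_coeff_def)
  qed
  then obtain a where a: "\<And>k \<alpha>. norm (a k \<alpha>) \<le> (M / R ^ k) / R ^ mdeg \<alpha>"
      "\<And>k \<alpha> i. i \<notin> S \<Longrightarrow> \<alpha> i \<noteq> 0 \<Longrightarrow> a k \<alpha> = 0"
      "\<And>k x. x \<in> polydisc R \<Longrightarrow> ((\<lambda>\<alpha>. a k \<alpha> * mon \<alpha> x) has_sum ?c k x) UNIV"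
    by metis
  \<comment> \<open>The exponent of the variable i selects the slice coefficient, the remaining
    exponents select a coefficient of that slice.\<close>
  define b where "b \<alpha> = a (\<alpha> i) (\<alpha>(i := 0))" for \<alpha>
  have b: "norm (b \<alpha>) \<le> M / R ^ mdeg \<alpha>" for \<alpha>
    using a(1)[of "\<alpha> i" "\<alpha>(i := 0)"] mdeg_upd[of \<alpha> i 0]
    by (simp add: b_def power_add [symmetric] add.commute)
  have b0: "b \<alpha> = 0" if "j \<notin> insert i S" "\<alpha> j \<noteq> 0" for \<alpha> j
    unfolding b_def using that by (intro a(2)[of j]) auto
  have "((\<lambda>\<alpha>. b \<alpha> * mon \<alpha> x) has_sum f x) UNIV" if x: "x \<in> polydisc R" for x
  proof -
    have summ: "(\<lambda>\<alpha>. b \<alpha> * mon \<alpha> x) summable_on UNIV"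
      using abs_summable_summable[OF abs_summable_bounded_coeffs[of R b M x]] R b x by simp
    \<comment> \<open>The bounds provide some sum s; summing first over the fibres with fixed
      exponent of i identifies it with \<open>f x\<close>.\<close>
    then obtain s where s: "((\<lambda>\<alpha>. b \<alpha> * mon \<alpha> x) has_sum s) UNIV" by (auto simp: summable_on_def)
    have inner: "((\<lambda>\<alpha>. b \<alpha> * mon \<alpha> x) has_sum (?c k x * x $ i ^ k)) {\<alpha>. \<alpha> i = k}" for k
    proof -
      have "((\<lambda>\<alpha>. a k \<alpha> * mon \<alpha> x * x $ i ^ k) has_sum (?c k x * x $ i ^ k)) UNIV"
        by (intro has_sum_cmult_left a x)
      also have "?this \<longleftrightarrow> ((\<lambda>\<alpha>. a k \<alpha> * mon \<alpha> x * x $ i ^ k) has_sum (?c k x * x $ i ^ k)) {\<alpha>. \<alpha> i = 0}"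
        using a(2)[of i _ k] insert.hyps by (intro has_sum_cong_neutral) auto
      also have "\<dots> \<longleftrightarrow> ?thesis"
      proof (rule has_sum_reindex_bij_witness[of _ "\<lambda>\<alpha>. \<alpha>(i := 0)" "\<lambda>\<alpha>. \<alpha>(i := k)"])
        fix \<alpha> assume "\<alpha> \<in> {\<alpha>::'n \<Rightarrow> nat. \<alpha> i = 0}"
        then have e: "\<alpha>(i := 0) = \<alpha>" by auto
        show "b (\<alpha>(i := k)) * mon (\<alpha>(i := k)) x = a k \<alpha> * mon \<alpha> x * x $ i ^ k"
          using mon_upd[of \<alpha> i 0 x] mon_upd[of \<alpha> i k x] e by (simp add: b_def)
      qed auto
      finally show ?thesis .
    qed
    have "((\<lambda>(k,\<alpha>). b \<alpha> * mon \<alpha> x) has_sum s) (Sigma UNIV (\<lambda>k. {\<alpha>. \<alpha> i = k}))"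
      using s by (subst has_sum_reindex_bij_witness[of _ "\<lambda>\<alpha>. (\<alpha> i, \<alpha>)" snd]) auto
    from has_sum_SigmaD[OF this, of "\<lambda>k. ?c k x * x $ i ^ k"] inner
    have "((\<lambda>k. ?c k x * x $ i ^ k) has_sum s) UNIV" by auto
    then have "(\<lambda>k. ?c k x * x $ i ^ k) sums s" by (rule has_sum_imp_sums)
    moreover have "(\<lambda>k. ?c k x * x $ i ^ k) sums f (vupd x i (x $ i))"
      using x by (intro slice_coeff_sums[OF insert.prems(1)]) (auto simp: polydisc_def)
    ultimately have "s = f x" using sums_unique2 by fastforce
    with s show ?thesis by simp
  qed
  with b b0 show ?case by (intro exI[of _ b]) blast
qed

lemma sepholo_power_series:
  assumes "R > 0" "sepholo R M f"
  shows "\<exists>a. (\<forall>\<alpha>. norm (a \<alpha>) \<le> M / R ^ mdeg \<alpha>) \<and>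
    (\<forall>x\<in>polydisc R. ((\<lambda>\<alpha>. a \<alpha> * mon \<alpha> x) has_sum f x) UNIV)"
proof -
  have "f x = f y" if "\<forall>i\<in>UNIV. x $ i = y $ i" for x y using that by (simp add: vec_eq_iff[symmetric])
  from sepholo_power_series_aux[OF finite assms this] show ?thesis by blast
qed

section \<open>Complex differentiability\<close>

text \<open>Homogeneity is enough, because additivity comes with
  \<open>has_derivative\<close>.\<close>

definition complex_linear :: "(complex ^ 'n::finite \<Rightarrow> complex) \<Rightarrow> bool" where
  "complex_linear D \<longleftrightarrow> (\<forall>c v. D (c *s v) = c * D v)"

definition holo_at :: "(complex ^ 'n::finite \<Rightarrow> complex) \<Rightarrow> complex ^ 'n \<Rightarrow> bool" where
  "holo_at f x \<longleftrightarrow> (\<exists>D. (f has_derivative D) (at x) \<and> complex_linear D)"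

lemma holo_at_const [simp]: "holo_at (\<lambda>_. c) x"
  unfolding holo_at_def complex_linear_def by (intro exI[of _ "\<lambda>_. 0"]) auto

lemma holo_at_nth [simp]: "holo_at (\<lambda>x. x $ i) x"
  unfolding holo_at_def complex_linear_def
  by (intro exI[of _ "\<lambda>x. x $ i"]) (auto intro: bounded_linear_imp_has_derivative bounded_linear_vec_nth)

lemma holo_at_add: "holo_at f x \<Longrightarrow> holo_at g x \<Longrightarrow> holo_at (\<lambda>x. f x + g x) x"
proof -
  assume "holo_at f x" "holo_at g x"
  then obtain D E where D: "(f has_derivative D) (at x)" "complex_linear D"
    and E: "(g has_derivative E) (at x)" "complex_linear E" by (auto simp: holo_at_def)
  have "complex_linear (\<lambda>h. D h + E h)"
    using D(2) E(2) by (simp add: complex_linear_def algebra_simps)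
  with has_derivative_add[OF D(1) E(1)] show ?thesis unfolding holo_at_def by blast
qed

lemma holo_at_mult: "holo_at f x \<Longrightarrow> holo_at g x \<Longrightarrow> holo_at (\<lambda>x. f x * g x) x"
proof -
  assume "holo_at f x" "holo_at g x"
  then obtain D E where D: "(f has_derivative D) (at x)" "complex_linear D"
    and E: "(g has_derivative E) (at x)" "complex_linear E" by (auto simp: holo_at_def)
  have "complex_linear (\<lambda>h. f x * E h + D h * g x)"
    using D(2) E(2) by (simp add: complex_linear_def algebra_simps)
  with has_derivative_mult[OF D(1) E(1)] show ?thesis unfolding holo_at_def by blast
qed

lemma holo_at_comp_field:
  assumes "holo_at f x" "(g has_field_derivative g') (at (f x))"
  shows "holo_at (\<lambda>x. g (f x)) x"
proof -
  obtain D where D: "(f has_derivative D) (at x)" "complex_linear D" using assms(1) by (auto simp: holo_at_def)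
  have "((\<lambda>x. g (f x)) has_derivative (\<lambda>h. g' * D h)) (at x)"
    using has_derivative_compose[OF D(1), of g "(*) g'"] assms(2) by (simp add: has_field_derivative_def)
  then show ?thesis using D(2) unfolding holo_at_def complex_linear_def by (auto simp: algebra_simps)
qed

lemma bounded_linear_axis: "bounded_linear (axis i :: complex \<Rightarrow> complex ^ 'n::finite)"
  unfolding linear_conv_bounded_linear[symmetric]
  by (rule linearI) (auto simp: vec_eq_iff axis_def)

lemma has_derivative_vec_nth_iff:
  fixes \<phi> :: "'a::real_normed_vector \<Rightarrow> complex ^ 'n::finite"
  assumes "\<And>i. ((\<lambda>x. \<phi> x $ i) has_derivative D i) (at x)"
  shows "(\<phi> has_derivative (\<lambda>h. \<chi> i. D i h)) (at x)"
proof -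
  have bl: "bounded_linear (D i)" for i using assms has_derivative_bounded_linear by blast
  have "bounded_linear (\<lambda>h. \<Sum>i\<in>UNIV. axis i (D i h))"
  proof (intro bounded_linear_sum)
    fix i
    show "bounded_linear (\<lambda>h. axis i (D i h))"
      using bounded_linear_compose[OF bounded_linear_axis bl] .
  qed
  moreover have "(\<Sum>i\<in>UNIV. axis i (D i h)) = (\<chi> i. D i h)" for h
    by (simp add: vec_eq_iff axis_def if_distrib cong: if_cong)
  ultimately have "bounded_linear (\<lambda>h. \<chi> i. D i h)" by simp
  moreover have "((\<lambda>y. (1 / norm (y - x)) *\<^sub>R (\<phi> y - (\<phi> x + (\<chi> i. D i (y - x))))) \<longlongrightarrow> 0) (at x)"
  proof (rule vec_tendstoI)
    fix i
    have "((\<lambda>y. (1 / norm (y - x)) *\<^sub>R (\<phi> y $ i - (\<phi> x $ i + D i (y - x)))) \<longlongrightarrow> 0) (at x)"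
      using assms[of i] by (simp add: has_derivative_within)
    then show "((\<lambda>y. ((1 / norm (y - x)) *\<^sub>R (\<phi> y - (\<phi> x + (\<chi> i. D i (y - x))))) $ i) \<longlongrightarrow> 0 $ i) (at x)"
      by simp
  qed
  ultimately show ?thesis by (simp add: has_derivative_within)
qed

lemma holo_at_compose:
  assumes f: "holo_at f (\<phi> x)" and \<phi>: "\<And>i. holo_at (\<lambda>x. \<phi> x $ i) x"
  shows "holo_at (\<lambda>x. f (\<phi> x)) x"
proof -
  obtain D where D: "(f has_derivative D) (at (\<phi> x))" "complex_linear D" using f by (auto simp: holo_at_def)
  obtain E where E: "\<And>i. ((\<lambda>x. \<phi> x $ i) has_derivative E i) (at x)" "\<And>i. complex_linear (E i)"
    using \<phi> unfolding holo_at_def by metis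
  have "((\<lambda>x. f (\<phi> x)) has_derivative (\<lambda>h. D (\<chi> i. E i h))) (at x)"
    using has_derivative_compose[OF has_derivative_vec_nth_iff[OF E(1)] D(1)] by simp
  moreover have "(\<chi> i. E i (c *s v)) = c *s (\<chi> i. E i v)" for c v
    using E(2) by (simp add: vec_eq_iff complex_linear_def)
  ultimately show ?thesis using D(2) unfolding holo_at_def complex_linear_def by auto
qed

lemma complex_linear_expand:
  assumes "linear D" "complex_linear D"
  shows "D v = (\<Sum>i\<in>UNIV. v $ i * D (axis i 1))"
proof -
  have "v = (\<Sum>i\<in>UNIV. v $ i *s axis i 1)" by (simp add: vec_eq_iff axis_def if_distrib cong: if_cong)
  then have "D v = (\<Sum>i\<in>UNIV. D (v $ i *s axis i 1))" using linear_sum[OF assms(1)] by metis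
  then show ?thesis using assms(2) by (simp add: complex_linear_def)
qed

lemma has_derivative_imp_partial_deriv:
  assumes "(f has_derivative D) (at x)" "complex_linear D"
  shows "((\<lambda>s. f (x + axis i s)) has_field_derivative D (axis i 1)) (at 0)"
    and "partial_deriv i f x = D (axis i 1)"
proof -
  have ax: "((\<lambda>s::complex. x + axis i s) has_derivative (\<lambda>s. axis i s)) (at 0)"
  proof -
    from has_derivative_add[OF has_derivative_const bounded_linear_imp_has_derivative[OF bounded_linear_axis]]
    show ?thesis by simp
  qed
  have "x + axis i 0 = x" by (simp add: vec_eq_iff axis_def)
  with has_derivative_compose[OF ax, of f D] assms
  have *: "((\<lambda>s. f (x + axis i s)) has_derivative (\<lambda>s. D (axis i s))) (at 0)" by simp
  have "axis i s = s *s (axis i 1 :: complex ^ 'a)" for s by (simp add: vec_eq_iff axis_def)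
  then have "D (axis i s) = D (s *s axis i 1)" for s by (rule arg_cong)
  then have "D (axis i s) = D (axis i 1) * s" for s
    by (rule trans) (subst mult.commute, rule assms(2)[unfolded complex_linear_def, rule_format])
  then have e: "(\<lambda>s. D (axis i s)) = (*) (D (axis i 1))" by (rule ext)
  show "((\<lambda>s. f (x + axis i s)) has_field_derivative D (axis i 1)) (at 0)"
    unfolding has_field_derivative_def by (rule subst[where P = "\<lambda>d. ((\<lambda>s. f (x + axis i s)) has_derivative d) (at 0)", OF e *])
  then show "partial_deriv i f x = D (axis i 1)"
    unfolding partial_deriv_def by (rule DERIV_imp_deriv)
qed

lemma holo_at_has_derivative:
  assumes "holo_at f x"
  shows "(f has_derivative (\<lambda>v. \<Sum>i\<in>UNIV. v $ i * partial_deriv i f x)) (at x)"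
proof -
  obtain D where D: "(f has_derivative D) (at x)" "complex_linear D" using assms by (auto simp: holo_at_def)
  have "D = (\<lambda>v. \<Sum>i\<in>UNIV. v $ i * partial_deriv i f x)"
    unfolding has_derivative_imp_partial_deriv(2)[OF D]
    using complex_linear_expand[OF has_derivative_linear[OF D(1)] D(2)] by (rule ext)
  with D show ?thesis by simp
qed

lemma complex_linear_partials [simp]: "complex_linear (\<lambda>v. \<Sum>i\<in>UNIV. v $ i * c i)"
  by (simp add: complex_linear_def sum_distrib_left mult_ac)

lemma holo_at_slice:
  assumes "holo_at f (vupd x i t)"
  shows "\<exists>D. ((\<lambda>t. f (vupd x i t)) has_field_derivative D) (at t)"
proof -
  obtain D where D: "(f has_derivative D) (at (vupd x i t))" "complex_linear D"
    using assms by (auto simp: holo_at_def)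
  have "((\<lambda>s. f (vupd x i t + axis i s)) has_field_derivative D (axis i 1)) (at (t - t))"
    using has_derivative_imp_partial_deriv(1)[OF D] by simp
  then have "((\<lambda>s. f (vupd x i t + axis i (s - t))) has_field_derivative D (axis i 1)) (at t)"
    using DERIV_shift[of "\<lambda>s. f (vupd x i t + axis i (s - t))" "D (axis i 1)" 0 t] by (simp add: add.commute)
  moreover have "vupd x i t + axis i (s - t) = vupd x i s" for s
    by (simp add: vec_eq_iff axis_def)
  ultimately show ?thesis by auto
qed

lemma holo_at_line:
  assumes "holo_at f (x + t *s h)"
  shows "\<exists>D. ((\<lambda>t. f (x + t *s h)) has_field_derivative D) (at t)"
proof -
  obtain D where D: "(f has_derivative D) (at (x + t *s h))" "complex_linear D"
    using assms by (auto simp: holo_at_def)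
  have "((\<lambda>t. x + t *s h) has_derivative (\<lambda>s. \<chi> i. s * h $ i)) (at t)"
    by (rule has_derivative_vec_nth_iff) (auto intro!: derivative_eq_intros)
  from has_derivative_compose[OF this D(1)]
  have "((\<lambda>t. f (x + t *s h)) has_derivative (\<lambda>s. D (\<chi> i. s * h $ i))) (at t)" .
  moreover have "D (\<chi> i. s * h $ i) = D h * s" for s
    using D(2) by (simp add: complex_linear_def vector_scalar_mult_def mult.commute)
  ultimately show ?thesis by (auto simp: has_field_derivative_def)
qed

lemma norm_vec_scale [simp]: "norm (c *s (v :: complex ^ 'n::finite)) = norm c * norm v"
  by (simp add: norm_vec_def norm_mult L2_set_right_distrib)

text \<open>Cauchy's inequality for the restriction of f to the complex line through x in direction
  v.\<close>

lemma holo_at_derivative_bound: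
  assumes h: "\<And>y. y \<in> ball x \<delta> \<Longrightarrow> holo_at f y" and b: "\<And>y. y \<in> ball x \<delta> \<Longrightarrow> norm (f y) \<le> B"
    and \<delta>: "\<delta> > 0" and D: "(f has_derivative D) (at x)" and lin: "complex_linear D"
  shows "norm (D v) \<le> 2 * B / \<delta> * norm v"
proof (cases "v = 0")
  case True
  then show ?thesis using has_derivative_linear[OF D] by (simp add: linear_0)
next
  case False
  \<comment> \<open>Half of the largest admissible radius keeps the closed disc inside the ball;
    this is the origin of the factor 2.\<close>
  define r where "r = \<delta> / (2 * norm v)"
  have r: "r > 0" using False \<delta> by (simp add: r_def)
  have mem: "x + t *s v \<in> ball x \<delta>" if "norm t \<le> r" for t
  proof -
    have "norm t * norm v \<le> r * norm v" using that by (intro mult_right_mono) auto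
    also have "\<dots> < \<delta>" using False \<delta> by (simp add: r_def)
    finally show ?thesis by (simp add: dist_norm)
  qed
  have hl: "(\<lambda>t. f (x + t *s v)) holomorphic_on cball 0 r"
    unfolding holomorphic_on_def field_differentiable_def using holo_at_line[OF h[OF mem]]
    by (meson has_field_derivative_at_within mem_cball_0)
  have "norm ((deriv ^^ 1) (\<lambda>t. f (x + t *s v)) 0) \<le> fact 1 * B / r ^ 1"
  proof (rule Cauchy_inequality)
    show "(\<lambda>t. f (x + t *s v)) holomorphic_on ball 0 r"
      by (rule holomorphic_on_subset[OF hl]) auto
    show "norm (f (x + t *s v)) \<le> B" if "norm (0 - t) = r" for t
      using b[OF mem[of t]] that by simp
  qed (use hl r holomorphic_on_imp_continuous_on in auto)
  moreover have "((\<lambda>t. f (x + t *s v)) has_field_derivative D v) (at 0)"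
  proof -
    have "((\<lambda>t. x + t *s v) has_derivative (\<lambda>s. \<chi> i. s * v $ i)) (at 0)"
      by (rule has_derivative_vec_nth_iff) (auto intro!: derivative_eq_intros)
    then have "((\<lambda>t. f (x + t *s v)) has_derivative (\<lambda>s. D (\<chi> i. s * v $ i))) (at 0)"
      by (rule has_derivative_compose) (use D in simp)
    moreover have "D (\<chi> i. s * v $ i) = D v * s" for s
      using lin by (simp add: complex_linear_def vector_scalar_mult_def mult.commute)
    ultimately show ?thesis by (simp add: has_field_derivative_def)
  qed
  ultimately show ?thesis using False \<delta> by (simp add: DERIV_imp_deriv r_def field_simps)
qed

definition holo_germ :: "(complex ^ 'n::finite \<Rightarrow> complex) \<Rightarrow> bool" where
  "holo_germ f \<longleftrightarrow> (\<forall>\<^sub>F x in nhds 0. holo_at f x)"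

lemma polydisc_nhds: "R > 0 \<Longrightarrow> \<forall>\<^sub>F x in nhds 0. x \<in> polydisc R"
  unfolding eventually_nhds_metric polydisc_def
  by (auto intro!: exI[of _ R] simp: dist_norm) (meson Finite_Cartesian_Product.norm_nth_le le_less_trans)

lemma polydisc_in_ball:
  assumes "e > 0"
  obtains R where "R > 0" "polydisc R \<subseteq> ball (0 :: complex ^ 'n::finite) e"
proof
  define R where "R = e / (real CARD('n) + 1)"
  show "R > 0" using assms by (simp add: R_def add_pos_nonneg)
  show "polydisc R \<subseteq> ball (0 :: complex ^ 'n) e"
  proof
    fix x :: "complex ^ 'n" assume "x \<in> polydisc R"
    then have x: "norm (x $ i) \<le> R" for i by (auto simp: polydisc_def intro: less_imp_le)
    have "norm x \<le> (\<Sum>i\<in>UNIV. norm (x $ i))" unfolding norm_vec_def by (rule L2_set_le_sum) simp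
    also have "\<dots> \<le> (\<Sum>i\<in>(UNIV::'n set). R)" using x by (intro sum_mono)
    also have "\<dots> = real CARD('n) * R" by simp
    also have "\<dots> < e" using assms by (simp add: R_def field_simps add_pos_nonneg)
    finally show "x \<in> ball 0 e" by simp
  qed
qed

lemma has_power_series_if_holo_on_polydisc:
  assumes R: "R > 0" and h: "\<And>x. x \<in> polydisc R \<Longrightarrow> holo_at f x" and b: "\<And>x. x \<in> polydisc R \<Longrightarrow> norm (f x) \<le> M"
  shows "\<exists>a. (\<forall>\<alpha>. norm (a \<alpha>) \<le> M / R ^ mdeg \<alpha>) \<and>
    (\<forall>x\<in>polydisc R. ((\<lambda>\<alpha>. a \<alpha> * mon \<alpha> x) has_sum f x) UNIV)"
proof -
  have "sepholo R M f"
    unfolding sepholo_def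
  proof (intro conjI ballI allI)
    fix x :: "complex ^ 'a" and i assume x: "x \<in> polydisc R"
    show "(\<lambda>t. f (vupd x i t)) holomorphic_on ball 0 R"
      unfolding holomorphic_on_def
      using holo_at_slice[OF h[OF vupd_in_polydisc[OF x]]] unfolding field_differentiable_def
      by (meson has_field_derivative_at_within mem_ball_0)
  qed (use b in auto)
  then show ?thesis by (rule sepholo_power_series[OF R])
qed

lemma holo_germ_imp_analytic:
  assumes "holo_germ f"
  shows "analytic_germ f"
proof -
  obtain e where e: "e > 0" "\<And>x. norm x < e \<Longrightarrow> holo_at f x"
    using assms by (auto simp: holo_germ_def eventually_nhds_metric)
  obtain D where "(f has_derivative D) (at 0)" using e(2)[of 0] e(1) by (auto simp: holo_at_def)
  then have "isCont f 0" by (rule has_derivative_continuous)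
  then have "(f \<longlongrightarrow> f 0) (nhds 0)" by (simp add: isCont_def tendsto_at_iff_tendsto_nhds)
  then have "\<forall>\<^sub>F x in nhds 0. dist (f x) (f 0) < 1" by (rule tendstoD) simp
  then obtain e' where e': "e' > 0" "\<And>x. norm x < e' \<Longrightarrow> dist (f x) (f 0) < 1"
    by (auto simp: eventually_nhds_metric)
  obtain R where R: "R > 0" "polydisc R \<subseteq> ball (0 :: complex ^ 'a) (min e e')"
    using polydisc_in_ball[of "min e e'"] e e' by auto
  have Rb: "norm x < e \<and> norm x < e'" if "x \<in> polydisc R" for x :: "complex ^ 'a"
    using subsetD[OF R(2) that] by simp
  have b: "norm (f x) \<le> norm (f 0) + 1" if "x \<in> polydisc R" for x
  proof -
    have "dist (f x) (f 0) < 1" using e'(2) Rb[OF that] by blast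
    then show ?thesis using norm_triangle_sub[of "f x" "f 0"] by (simp add: dist_norm)
  qed
  have h: "holo_at f x" if "x \<in> polydisc R" for x using e(2) Rb[OF that] by blast
  obtain a where "\<forall>x\<in>polydisc R. ((\<lambda>\<alpha>. a \<alpha> * mon \<alpha> x) has_sum f x) UNIV"
    using has_power_series_if_holo_on_polydisc[OF R(1) h b] by auto
  then show ?thesis
    unfolding analytic_germ_def has_power_series_def
    by (intro exI[of _ a] eventually_mono[OF polydisc_nhds[OF R(1)]]) auto
qed

lemma holo_at_mon: "holo_at (mon \<alpha>) x"
proof -
  have pw: "holo_at (\<lambda>x. (x $ i) ^ k) x" for i k
    by (induction k) (auto intro: holo_at_mult)
  have "finite A \<Longrightarrow> holo_at (\<lambda>x. \<Prod>i\<in>A. (x $ i) ^ \<alpha> i) x" for A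
    by (induction A rule: finite_induct) (auto intro: holo_at_mult pw)
  then show ?thesis by (simp add: mon_def[abs_def])
qed

lemma holo_at_sum: "(\<And>a. a \<in> A \<Longrightarrow> holo_at (f a) x) \<Longrightarrow> holo_at (\<lambda>x. \<Sum>a\<in>A. f a x) x"
  by (induction A rule: infinite_finite_induct) (auto intro: holo_at_add)

text \<open>Unconditional convergence of complex families is absolute. Applied at the point all of
  whose coordinates equal r, it majorises the series on the closed polydisc of radius r.\<close>

lemma power_series_abs_summable:
  assumes "has_power_series f a"
  obtains r where "r > 0" "(\<lambda>\<alpha>. norm (a \<alpha>) * r ^ mdeg \<alpha>) summable_on UNIV"
    "\<And>x. (\<And>i. norm (x $ i) \<le> r) \<Longrightarrow> ((\<lambda>\<alpha>. a \<alpha> * mon \<alpha> x) has_sum f x) UNIV"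
proof -
  obtain e where e: "e > 0" "\<And>x. norm x < e \<Longrightarrow> ((\<lambda>\<alpha>. a \<alpha> * mon \<alpha> x) has_sum f x) UNIV"
    using assms by (auto simp: has_power_series_def eventually_nhds_metric)
  obtain R where R: "R > 0" "polydisc R \<subseteq> ball (0 :: complex ^ 'a) e"
    using polydisc_in_ball[of e] e by auto
  define r where "r = R / 2"
  have r: "0 < r" "r < R" using R by (auto simp: r_def)
  have mem: "norm x < e" if "\<And>i. norm (x $ i) \<le> r" for x :: "complex ^ 'a"
  proof -
    have "x \<in> polydisc R" using that r(2) by (auto simp: polydisc_def intro: le_less_trans)
    then show ?thesis using R(2) by auto
  qed
  let ?x = "\<chi> i. of_real r"
  have "(\<lambda>\<alpha>. a \<alpha> * mon \<alpha> ?x) summable_on UNIV" 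
    using e(2)[OF mem[of ?x]] r by (auto simp: summable_on_def)
  then have "(\<lambda>\<alpha>. norm (a \<alpha> * mon \<alpha> ?x)) summable_on UNIV"
    by (simp add: summable_on_iff_abs_summable_on_complex)
  then have "(\<lambda>\<alpha>. norm (a \<alpha>) * r ^ mdeg \<alpha>) summable_on UNIV"
    using r by (simp add: norm_mult norm_mon mon_const)
  with r(1) show ?thesis using that e(2) mem by blast
qed

lemma norm_mon_le: "(\<And>i. norm (x $ i) \<le> r) \<Longrightarrow> norm (mon \<alpha> x) \<le> r ^ mdeg \<alpha>"
  unfolding norm_mon mon_const[symmetric] by (intro prod_mono) (auto intro: power_mono)

text \<open>The partial sums by total degree are uniformly Cauchy near 0. By the Cauchy estimate
  their derivatives are uniformly Cauchy on a ball of half the radius, so the limit is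
  differentiable, and its derivative is complex linear as a limit of such maps.\<close>

lemma analytic_imp_holo_germ:
  assumes "analytic_germ f"
  shows "holo_germ f"
proof -
  obtain a where a: "has_power_series f a" using assms by (auto simp: analytic_germ_def)
  obtain r where r: "r > 0" and sm: "(\<lambda>\<alpha>. norm (a \<alpha>) * r ^ mdeg \<alpha>) summable_on UNIV"
    and hs: "\<And>x. (\<And>i. norm (x $ i) \<le> r) \<Longrightarrow> ((\<lambda>\<alpha>. a \<alpha> * mon \<alpha> x) has_sum f x) UNIV"
    using power_series_abs_summable[OF a] by blast
  define P where "P n x = (\<Sum>\<alpha> | mdeg \<alpha> \<le> n. a \<alpha> * mon \<alpha> x)" for n :: nat and x
  \<comment> \<open>The tail of the majorant series bounds the distance between partial sums, and
    hence between their derivatives.\<close>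
  define T where "T n = (\<Sum>\<^sub>\<infinity>\<alpha>\<in>{\<alpha>. mdeg \<alpha> > n}. norm (a \<alpha>) * r ^ mdeg \<alpha>)" for n :: nat
  have hP: "holo_at (P n) x" for n x
    unfolding P_def[abs_def] by (intro holo_at_sum holo_at_mult holo_at_const holo_at_mon)
  have inr: "norm (x $ i) \<le> r" if "x \<in> ball 0 r" for x :: "complex ^ 'a" and i
    using that Finite_Cartesian_Product.norm_nth_le[of x i] by auto
  have fin: "finite {\<alpha> :: 'a \<Rightarrow> nat. mdeg \<alpha> \<le> n}" for n by (rule finite_mdeg_le)
  let ?t = "\<lambda>\<alpha>. norm (a \<alpha>) * r ^ mdeg \<alpha>"
  have T: "T n = (\<Sum>\<^sub>\<infinity>\<alpha>. ?t \<alpha>) - (\<Sum>\<alpha> | mdeg \<alpha> \<le> n. ?t \<alpha>)" for n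
  proof -
    have "{\<alpha>. mdeg \<alpha> > n} = UNIV - {\<alpha> :: 'a \<Rightarrow> nat. mdeg \<alpha> \<le> n}" by auto
    then show ?thesis unfolding T_def
      using infsum_Diff[OF sm, of "{\<alpha>. mdeg \<alpha> \<le> n}"] fin by (simp add: summable_on_finite)
  qed
  have T0: "T \<longlonglongrightarrow> 0"
  proof -
    have "(sum ?t \<longlongrightarrow> (\<Sum>\<^sub>\<infinity>\<alpha>. ?t \<alpha>)) (finite_subsets_at_top UNIV)"
      using sm by (simp add: has_sum_def[symmetric])
    moreover have "filterlim (\<lambda>n. {\<alpha> :: 'a \<Rightarrow> nat. mdeg \<alpha> \<le> n}) (finite_subsets_at_top UNIV) sequentially"
      unfolding filterlim_finite_subsets_at_top
    proof (intro allI impI)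
      fix X :: "('a \<Rightarrow> nat) set" assume X: "finite X \<and> X \<subseteq> UNIV"
      show "\<forall>\<^sub>F n in sequentially. finite {\<alpha> :: 'a \<Rightarrow> nat. mdeg \<alpha> \<le> n} \<and> X \<subseteq> {\<alpha>. mdeg \<alpha> \<le> n} \<and> {\<alpha> :: 'a \<Rightarrow> nat. mdeg \<alpha> \<le> n} \<subseteq> UNIV"
        using eventually_ge_at_top[of "Max (insert 0 (mdeg ` X))"]
        by eventually_elim (use X fin in auto)
    qed
    ultimately have "(\<lambda>n. \<Sum>\<alpha> | mdeg \<alpha> \<le> n. ?t \<alpha>) \<longlonglongrightarrow> (\<Sum>\<^sub>\<infinity>\<alpha>. ?t \<alpha>)"
      by (rule filterlim_compose)
    from tendsto_diff[OF tendsto_const[of "\<Sum>\<^sub>\<infinity>\<alpha>. ?t \<alpha>"] this] show ?thesis by (simp add: T[abs_def])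
  qed
  have Pdiff: "norm (P n x - P m x) \<le> T m" if x: "x \<in> ball 0 r" and mn: "m \<le> n" for x m n
  proof -
    have "P n x - P m x = (\<Sum>\<alpha>\<in>{\<alpha>. mdeg \<alpha> \<le> n} - {\<alpha>. mdeg \<alpha> \<le> m}. a \<alpha> * mon \<alpha> x)"
      unfolding P_def using mn fin by (subst sum_diff) auto
    also have "norm \<dots> \<le> (\<Sum>\<alpha>\<in>{\<alpha>. mdeg \<alpha> \<le> n} - {\<alpha>. mdeg \<alpha> \<le> m}. ?t \<alpha>)"
      using norm_mon_le[OF inr[OF x]] by (intro sum_norm_le) (auto simp: norm_mult intro!: mult_left_mono)
    also have "\<dots> = (\<Sum>\<alpha> | mdeg \<alpha> \<le> n. ?t \<alpha>) - (\<Sum>\<alpha> | mdeg \<alpha> \<le> m. ?t \<alpha>)"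
      using mn fin by (subst sum_diff) auto
    also have "\<dots> \<le> T m"
      unfolding T using r(1) fin sm by (intro diff_right_mono finite_sum_le_infsum) auto
    finally show ?thesis .
  qed
  define D where "D n x v = (\<Sum>i\<in>UNIV. v $ i * partial_deriv i (P n) x)" for n x v
  have D: "(P n has_derivative D n x) (at x)" for n x
    unfolding D_def[abs_def] by (rule holo_at_has_derivative[OF hP])
  have Dlin: "complex_linear (D n x)" for n x unfolding D_def[abs_def] by simp
  have Dcauchy: "norm (D n x v - D m x v) \<le> 4 * T m / r * norm v"
    if x: "x \<in> ball 0 (r/2)" and mn: "m \<le> n" for n m x v
  proof -
    have "norm ((\<lambda>v. D n x v - D m x v) v) \<le> 2 * T m / (r/2) * norm v"
    proof (rule holo_at_derivative_bound)
      have sub: "y \<in> ball 0 r" if "y \<in> ball x (r/2)" for y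
        using that x dist_triangle[of 0 y x] by (auto simp: dist_norm)
      show "norm ((\<lambda>x. P n x - P m x) y) \<le> T m" if "y \<in> ball x (r/2)" for y
        using Pdiff[OF sub[OF that] mn] by simp
      show "((\<lambda>x. P n x - P m x) has_derivative (\<lambda>v. D n x v - D m x v)) (at x)"
        by (intro has_derivative_diff D)
      show "complex_linear (\<lambda>v. D n x v - D m x v)" 
        using Dlin by (simp add: complex_linear_def algebra_simps)
      show "holo_at (\<lambda>x. P n x - P m x) y" for y
        using holo_at_add[OF hP[of n] holo_at_mult[OF holo_at_const[of "-1"] hP[of m]], of y] by simp
    qed (use r in auto)
    then show ?thesis by simp
  qed
  define E where "E x v = lim (\<lambda>n. D n x v)" for x v
  have Elim: "(\<lambda>n. D n x v) \<longlonglongrightarrow> E x v" if x: "x \<in> ball 0 (r/2)" for x v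
  proof -
    have "Cauchy (\<lambda>n. D n x v)"
    proof (rule CauchyI')
      fix e :: real assume e: "e > 0"
      have "(\<lambda>m. 4 * T m / r * norm v) \<longlonglongrightarrow> 0"
        by (rule tendsto_eq_intros T0 refl)+ (use r in auto)
      with e have "\<forall>\<^sub>F m in sequentially. 4 * T m / r * norm v < e" by (simp add: order_tendstoD)
      then obtain M where M: "\<And>m. m \<ge> M \<Longrightarrow> 4 * T m / r * norm v < e" by (auto simp: eventually_sequentially)
      have "norm (D m x v - D n x v) < e" if "m \<ge> M" "n > m" for m n
        using Dcauchy[OF x, of m n v] M[OF that(1)] that(2) by (simp add: norm_minus_commute)
      then show "\<exists>M. \<forall>m\<ge>M. \<forall>n>m. dist (D m x v) (D n x v) < e" unfolding dist_norm by blast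
    qed
    then show ?thesis unfolding E_def by (simp add: Cauchy_convergent_iff convergent_LIMSEQ_iff)
  qed
  have DE: "norm (D m x v - E x v) \<le> 4 * T m / r * norm v" if x: "x \<in> ball 0 (r/2)" for x v m
  proof (rule tendsto_upperbound)
    show "((\<lambda>n. norm (D m x v - D n x v)) \<longlongrightarrow> norm (D m x v - E x v)) sequentially"
      by (intro tendsto_intros Elim x)
    show "\<forall>\<^sub>F n in sequentially. norm (D m x v - D n x v) \<le> 4 * T m / r * norm v"
      using eventually_ge_at_top[of m]
    proof eventually_elim
      case (elim n)
      then show ?case using Dcauchy[OF x elim, of v] by (simp add: norm_minus_commute)
    qed
  qed simp
  have Plim: "(\<lambda>n. P n x) \<longlonglongrightarrow> f x" if x: "x \<in> ball 0 r" for x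
  proof -
    have "((\<lambda>\<alpha>. a \<alpha> * mon \<alpha> x) has_sum f x) UNIV" by (rule hs) (use inr x in auto)
    then have "(sum (\<lambda>\<alpha>. a \<alpha> * mon \<alpha> x) \<longlongrightarrow> f x) (finite_subsets_at_top UNIV)"
      by (simp add: has_sum_def)
    moreover have "filterlim (\<lambda>n. {\<alpha> :: 'a \<Rightarrow> nat. mdeg \<alpha> \<le> n}) (finite_subsets_at_top UNIV) sequentially"
      unfolding filterlim_finite_subsets_at_top
    proof (intro allI impI)
      fix X :: "('a \<Rightarrow> nat) set" assume X: "finite X \<and> X \<subseteq> UNIV"
      show "\<forall>\<^sub>F n in sequentially. finite {\<alpha> :: 'a \<Rightarrow> nat. mdeg \<alpha> \<le> n} \<and> X \<subseteq> {\<alpha>. mdeg \<alpha> \<le> n} \<and> {\<alpha> :: 'a \<Rightarrow> nat. mdeg \<alpha> \<le> n} \<subseteq> UNIV"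
        using eventually_ge_at_top[of "Max (insert 0 (mdeg ` X))"]
        by eventually_elim (use X fin in auto)
    qed
    ultimately show ?thesis unfolding P_def by (rule filterlim_compose)
  qed
  have "\<exists>g. \<forall>x\<in>ball 0 (r/2). (\<lambda>n. P n x) \<longlonglongrightarrow> g x \<and> (g has_derivative E x) (at x within ball 0 (r/2))"
  proof (rule has_derivative_sequence)
    show "(P n has_derivative D n x) (at x within ball 0 (r/2))" for n x
      using D has_derivative_at_withinI by blast
    show "\<forall>\<^sub>F n in sequentially. \<forall>x\<in>ball 0 (r/2). \<forall>h. norm (D n x h - E x h) \<le> e * norm h" if "e > 0" for e
    proof -
      have "(\<lambda>m. 4 * T m / r) \<longlonglongrightarrow> 0"
        by (rule tendsto_eq_intros T0 refl)+ (use r in auto)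
      with that have "\<forall>\<^sub>F m in sequentially. 4 * T m / r < e" by (simp add: order_tendstoD)
      then show ?thesis
      proof eventually_elim
        case (elim n)
        show ?case
        proof (intro ballI allI)
          fix x h :: "complex ^ 'a" assume "x \<in> ball 0 (r/2)"
          from DE[OF this, of n h] show "norm (D n x h - E x h) \<le> e * norm h"
            using mult_right_mono[OF less_imp_le[OF elim], of "norm h"] by simp
        qed
      qed
    qed
    show "0 \<in> ball (0 :: complex ^ 'a) (r/2)" using r by simp
    show "(\<lambda>n. P n 0) \<longlonglongrightarrow> f 0" by (rule Plim) (use r in simp)
  qed simp
  then obtain g where g: "\<And>x. x \<in> ball 0 (r/2) \<Longrightarrow> (\<lambda>n. P n x) \<longlonglongrightarrow> g x"
    "\<And>x. x \<in> ball 0 (r/2) \<Longrightarrow> (g has_derivative E x) (at x within ball 0 (r/2))" by blast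
  have gf: "g x = f x" if "x \<in> ball 0 (r/2)" for x
    using LIMSEQ_unique[OF g(1)[OF that] Plim[of x]] that r by auto
  have "holo_at f x" if x: "x \<in> ball 0 (r/2)" for x
  proof -
    have "(g has_derivative E x) (at x)" using g(2)[OF x] by (simp only: at_within_open[OF x open_ball])
    then have "(f has_derivative E x) (at x)"
      by (rule has_derivative_transform_within_open[OF _ open_ball x]) (use gf in auto)
    moreover have "complex_linear (E x)"
      unfolding complex_linear_def
    proof (intro allI)
      fix c v
      have "(\<lambda>n. D n x (c *s v)) \<longlonglongrightarrow> E x (c *s v)" by (rule Elim[OF x])
      moreover have "(\<lambda>n. D n x (c *s v)) \<longlonglongrightarrow> c * E x v"
        using tendsto_mult_left[OF Elim[OF x]] Dlin by (simp add: complex_linear_def)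
      ultimately show "E x (c *s v) = c * E x v" by (rule LIMSEQ_unique)
    qed
    ultimately show ?thesis by (auto simp: holo_at_def)
  qed
  moreover have "\<forall>\<^sub>F x in nhds 0. x \<in> ball (0 :: complex ^ 'a) (r/2)"
    by (rule eventually_nhds_in_open) (use r in auto)
  ultimately show ?thesis unfolding holo_germ_def by (blast intro: eventually_mono)
qed

text \<open>Closure under products, composition, roots and local inverses is quick for complex
  differentiability and laborious for coefficients; the operations on germs below use this
  equivalence.\<close>

lemma analytic_germ_iff_holo_germ: "analytic_germ f \<longleftrightarrow> holo_germ f"
  using analytic_imp_holo_germ holo_germ_imp_analytic by blast

section \<open>Taylor coefficients and order of vanishing\<close>

lemma powser_zero_coeffs:
  fixes F :: "nat \<Rightarrow> complex"
  assumes r: "r > 0" and s: "\<And>w. norm w \<le> r \<Longrightarrow> (\<lambda>k. F k * w ^ k) sums 0"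
  shows "F k = 0"
proof (rule ccontr)
  assume nz: "F k \<noteq> 0"
  have "F 0 = 0" using s[of 0] r by simp
  with nz have k: "k > 0" by (metis gr0I)
  obtain d where d: "0 < d" "\<And>z::complex. z \<in> cball 0 d - {0} \<Longrightarrow> (\<lambda>_. 0::complex) z \<noteq> 0"
    by (rule powser_0_nonzero[OF r, of 0 F "\<lambda>_. 0" k]) (use s nz k in auto)
  from d(2)[of "of_real d"] d(1) show False by auto
qed

text \<open>The variables are removed one at a time. For a set T of removed variables, the subseries
  with prescribed exponents on T still sums to 0 in the remaining variables; when T is everything, a
  single coefficient is left.\<close>

lemma power_series_unique_aux:
  fixes a :: "('n::finite \<Rightarrow> nat) \<Rightarrow> complex"
  assumes r: "r > 0" and sm: "(\<lambda>\<alpha>. norm (a \<alpha>) * r ^ mdeg \<alpha>) summable_on UNIV"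
    and hs: "\<And>x. (\<And>i. norm (x $ i) \<le> r) \<Longrightarrow> ((\<lambda>\<alpha>. a \<alpha> * mon \<alpha> x) has_sum 0) UNIV"
    and T: "finite T" and x: "\<And>i. norm (x $ i) \<le> r"
  shows "((\<lambda>\<alpha>. a \<alpha> * (\<Prod>j\<in>-T. x $ j ^ \<alpha> j)) has_sum 0) {\<alpha>. \<forall>j\<in>T. \<alpha> j = \<beta> j}"
  using T x
proof (induction T arbitrary: x rule: finite_induct)
  case empty
  then show ?case using hs[of x] by (simp add: mon_def)
next
  case (insert i T)
  let ?f = "\<lambda>\<alpha>. a \<alpha> * (\<Prod>j\<in>-insert i T. x $ j ^ \<alpha> j)"
  let ?A = "\<lambda>k. {\<alpha>. (\<forall>j\<in>T. \<alpha> j = \<beta> j) \<and> \<alpha> i = k}"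
  have i: "-T = insert i (- insert i T)" using insert.hyps by auto
  define F where "F k = infsum ?f (?A k)" for k
  have nb: "norm (\<Prod>j\<in>-insert i T. x $ j ^ \<alpha> j) * r ^ \<alpha> i \<le> (\<Prod>j\<in>-T. r ^ \<alpha> j)" for \<alpha>
  proof -
    have "norm (\<Prod>j\<in>-insert i T. x $ j ^ \<alpha> j) \<le> (\<Prod>j\<in>-insert i T. r ^ \<alpha> j)"
      unfolding prod_norm[symmetric] norm_power
      by (intro prod_mono) (use insert.prems in \<open>auto intro: power_mono\<close>)
    then show ?thesis unfolding i using r by (subst prod.insert) (auto simp: mult.commute intro: mult_right_mono)
  qed
  have sm1: "(\<lambda>\<alpha>. norm (?f \<alpha>)) summable_on ?A k" for k
  proof -
    \<comment> \<open>On \<open>?A k\<close> the exponents of i and of the variables in T are fixed,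
      so they contribute this constant factor to r^mdeg.\<close>
    let ?B = "r ^ k * (\<Prod>j\<in>T. r ^ \<beta> j)"
    have B: "?B > 0" using r by (intro mult_pos_pos prod_pos) auto
    have "(\<lambda>\<alpha>. norm (inverse ?B * (norm (a \<alpha>) * r ^ mdeg \<alpha>))) summable_on ?A k"
      unfolding summable_on_iff_abs_summable_on_real[symmetric]
      by (intro summable_on_cmult_right summable_on_subset[OF sm]) auto
    then show ?thesis
    proof (rule Infinite_Sum.abs_summable_on_comparison_test)
      fix \<alpha> assume \<alpha>: "\<alpha> \<in> ?A k"
      have "norm (\<Prod>j\<in>-insert i T. x $ j ^ \<alpha> j) * ?B \<le> (\<Prod>j\<in>-T. r ^ \<alpha> j) * (\<Prod>j\<in>T. r ^ \<alpha> j)"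
        using mult_right_mono[OF nb[of \<alpha>], of "\<Prod>j\<in>T. r ^ \<alpha> j"] \<alpha> r by (simp add: prod_nonneg mult_ac)
      also have "\<dots> = r ^ mdeg \<alpha>"
        unfolding mon_const[symmetric] using prod.union_disjoint[of "-T" T "\<lambda>j. r ^ \<alpha> j"] by (simp add: Compl_partition2)
      finally have "norm (\<Prod>j\<in>-insert i T. x $ j ^ \<alpha> j) \<le> inverse ?B * r ^ mdeg \<alpha>"
        using B by (simp add: field_simps)
      then have "norm (?f \<alpha>) \<le> norm (a \<alpha>) * (inverse ?B * r ^ mdeg \<alpha>)"
        unfolding norm_mult by (rule mult_left_mono) simp
      also have "\<dots> = norm (inverse ?B * (norm (a \<alpha>) * r ^ mdeg \<alpha>))"
        using B r by (simp add: abs_mult abs_of_pos prod_pos)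
      finally show "norm (?f \<alpha>) \<le> norm (inverse ?B * (norm (a \<alpha>) * r ^ mdeg \<alpha>))" .
    qed
  qed
  have F: "(?f has_sum F k) (?A k)" for k
    unfolding F_def using sm1[of k] by (intro has_sum_infsum) (simp add: summable_on_iff_abs_summable_on_complex)
  \<comment> \<open>Letting only the coordinate i vary turns the induction hypothesis into a
    vanishing power series in w with coefficients \<open>F k\<close>.\<close>
  have "(\<lambda>k. F k * w ^ k) sums 0" if w: "norm w \<le> r" for w
  proof -
    let ?x = "vupd x i w"
    have e: "a \<alpha> * (\<Prod>j\<in>-T. ?x $ j ^ \<alpha> j) = ?f \<alpha> * w ^ \<alpha> i" for \<alpha>
      unfolding i using insert.hyps by (subst prod.insert) (auto simp: mult_ac intro!: prod.cong)
    have "((\<lambda>\<alpha>. a \<alpha> * (\<Prod>j\<in>-T. ?x $ j ^ \<alpha> j)) has_sum 0) {\<alpha>. \<forall>j\<in>T. \<alpha> j = \<beta> j}"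
      by (rule insert.IH) (use insert.prems w in auto)
    then have s: "((\<lambda>\<alpha>. ?f \<alpha> * w ^ \<alpha> i) has_sum 0) {\<alpha>. \<forall>j\<in>T. \<alpha> j = \<beta> j}" unfolding e .
    have s2: "((\<lambda>(k,\<alpha>). ?f \<alpha> * w ^ \<alpha> i) has_sum 0) (Sigma UNIV ?A)"
      using s by (subst has_sum_reindex_bij_witness[of _ "\<lambda>\<alpha>. (\<alpha> i, \<alpha>)" snd]) auto
    have inner: "((\<lambda>\<alpha>. ?f \<alpha> * w ^ \<alpha> i) has_sum (F k * w ^ k)) (?A k)" for k
      using has_sum_cmult_left[OF F[of k], of "w ^ k"] by (subst has_sum_cong[where g="\<lambda>\<alpha>. ?f \<alpha> * w ^ k"]) auto
    from has_sum_SigmaD[OF s2, of "\<lambda>k. F k * w ^ k"] inner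
    have "((\<lambda>k. F k * w ^ k) has_sum 0) UNIV" by auto
    then show ?thesis by (rule has_sum_imp_sums)
  qed
  from powser_zero_coeffs[OF r this] have "F k = 0" for k .
  then show ?case using F[of "\<beta> i"] by (simp add: conj_commute)
qed

lemma has_power_series_zero:
  assumes "has_power_series (\<lambda>_. 0) a"
  shows "a \<alpha> = 0"
proof -
  obtain r where r: "r > 0" "(\<lambda>\<alpha>. norm (a \<alpha>) * r ^ mdeg \<alpha>) summable_on UNIV"
    "\<And>x. (\<And>i. norm (x $ i) \<le> r) \<Longrightarrow> ((\<lambda>\<alpha>. a \<alpha> * mon \<alpha> x) has_sum 0) UNIV"
    by (rule power_series_abs_summable[OF assms]) blast
  have "((\<lambda>\<alpha>. a \<alpha> * (\<Prod>j\<in>-UNIV. 0 $ j ^ \<alpha> j)) has_sum 0) {\<gamma>. \<forall>j\<in>UNIV. \<gamma> j = \<alpha> j}"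
    by (rule power_series_unique_aux[OF r(1,2)]) (use r in auto)
  moreover have "{\<gamma>. \<forall>j\<in>UNIV. \<gamma> j = \<alpha> j} = {\<alpha>}" by auto
  ultimately show ?thesis by (simp add: has_sum_finite_iff)
qed

lemma has_power_series_add:
  assumes "has_power_series f a" "has_power_series g b"
  shows "has_power_series (\<lambda>x. f x + g x) (\<lambda>\<alpha>. a \<alpha> + b \<alpha>)"
  using assms unfolding has_power_series_def
proof eventually_elim
  case (elim x)
  from has_sum_add[OF elim] show ?case by (simp add: algebra_simps)
qed

lemma has_power_series_cmult:
  assumes "has_power_series f a"
  shows "has_power_series (\<lambda>x. c * f x) (\<lambda>\<alpha>. c * a \<alpha>)"
  using assms unfolding has_power_series_def
proof eventually_elim
  case (elim x)
  from has_sum_cmult_right[OF elim, of c] show ?case by (simp add: mult_ac)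
qed

lemma has_power_series_diff:
  assumes "has_power_series f a" "has_power_series g b"
  shows "has_power_series (\<lambda>x. f x - g x) (\<lambda>\<alpha>. a \<alpha> - b \<alpha>)"
  using has_power_series_add[OF assms(1) has_power_series_cmult[OF assms(2), of "-1"]] by simp

lemma has_power_series_cong:
  assumes "\<forall>\<^sub>F x in nhds 0. f x = g x"
  shows "has_power_series f a \<longleftrightarrow> has_power_series g a"
  unfolding has_power_series_def using assms by (intro eventually_subst) (auto elim: eventually_mono)

lemma has_power_series_unique:
  assumes "has_power_series f a" "has_power_series f b"
  shows "a = b"
  using has_power_series_zero[of "\<lambda>\<alpha>. a \<alpha> - b \<alpha>"] has_power_series_diff[OF assms] by (auto simp: fun_eq_iff)

lemma taylor_coeff_eqI: "has_power_series f a \<Longrightarrow> taylor_coeff f = a"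
  unfolding taylor_coeff_def by (rule the_equality) (auto intro: has_power_series_unique)

lemma has_power_series_taylor: "analytic_germ f \<Longrightarrow> has_power_series f (taylor_coeff f)"
  using taylor_coeff_eqI by (auto simp: analytic_germ_def)

section \<open>Convergent families of coefficients and division by monomials\<close>

definition conv_coeffs :: "(('n::finite \<Rightarrow> nat) \<Rightarrow> complex) \<Rightarrow> bool" where
  "conv_coeffs a \<longleftrightarrow> (\<exists>r>0. (\<lambda>\<alpha>. norm (a \<alpha>) * r ^ mdeg \<alpha>) summable_on UNIV)"

definition psum :: "(('n::finite \<Rightarrow> nat) \<Rightarrow> complex) \<Rightarrow> complex ^ 'n \<Rightarrow> complex" where
  "psum a x = (\<Sum>\<^sub>\<infinity>\<alpha>. a \<alpha> * mon \<alpha> x)"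

lemma conv_coeffs_if: "has_power_series f a \<Longrightarrow> conv_coeffs a"
  unfolding conv_coeffs_def by (rule power_series_abs_summable) auto

lemma has_sum_psum:
  assumes r: "r > 0" "(\<lambda>\<alpha>. norm (a \<alpha>) * r ^ mdeg \<alpha>) summable_on UNIV" and x: "\<And>i. norm (x $ i) \<le> r"
  shows "((\<lambda>\<alpha>. a \<alpha> * mon \<alpha> x) has_sum psum a x) UNIV"
proof -
  have "(\<lambda>\<alpha>. norm (norm (a \<alpha>) * r ^ mdeg \<alpha>)) summable_on UNIV" using r by simp
  then have "(\<lambda>\<alpha>. norm (a \<alpha> * mon \<alpha> x)) summable_on UNIV"
  proof (rule Infinite_Sum.abs_summable_on_comparison_test)
    fix \<alpha>
    have "norm (a \<alpha> * mon \<alpha> x) \<le> norm (a \<alpha>) * r ^ mdeg \<alpha>"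
      unfolding norm_mult by (intro mult_left_mono norm_mon_le x) simp
    then show "norm (a \<alpha> * mon \<alpha> x) \<le> norm (norm (a \<alpha>) * r ^ mdeg \<alpha>)" using r by simp
  qed
  then show ?thesis unfolding psum_def
    by (intro has_sum_infsum) (simp add: summable_on_iff_abs_summable_on_complex)
qed

lemma has_power_series_psum: "conv_coeffs a \<Longrightarrow> has_power_series (psum a) a"
  unfolding conv_coeffs_def has_power_series_def
proof (elim exE conjE)
  fix r :: real assume r: "r > 0" "(\<lambda>\<alpha>. norm (a \<alpha>) * r ^ mdeg \<alpha>) summable_on UNIV"
  show "\<forall>\<^sub>F x in nhds 0. ((\<lambda>\<alpha>. a \<alpha> * mon \<alpha> x) has_sum psum a x) UNIV"
    by (rule eventually_mono[OF polydisc_nhds[OF r(1)]])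
      (rule has_sum_psum[OF r], auto simp: polydisc_def intro: less_imp_le)
qed

lemma has_power_series_eq_psum:
  assumes "has_power_series f a"
  shows "\<forall>\<^sub>F x in nhds 0. f x = psum a x"
  using assms has_power_series_psum[OF conv_coeffs_if[OF assms]]
  unfolding has_power_series_def by eventually_elim (rule has_sum_unique)

lemma conv_coeffs_mono:
  assumes "conv_coeffs a" "\<And>\<alpha>. norm (b \<alpha>) \<le> norm (a \<alpha>)"
  shows "conv_coeffs b"
proof -
  obtain r where r: "r > 0" "(\<lambda>\<alpha>. norm (a \<alpha>) * r ^ mdeg \<alpha>) summable_on UNIV"
    using assms(1) by (auto simp: conv_coeffs_def)
  have "(\<lambda>\<alpha>. norm (b \<alpha>) * r ^ mdeg \<alpha>) summable_on UNIV"
    using r(1) assms(2) by (intro summable_on_comparison_test[OF r(2)] mult_right_mono) auto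
  then show ?thesis using r(1) by (auto simp: conv_coeffs_def)
qed

lemma mdeg_add: "mdeg (\<lambda>i. \<alpha> i + \<beta> i) = mdeg \<alpha> + mdeg \<beta>"
  by (simp add: mdeg_def sum.distrib)

text \<open>Division by the monomial with exponent e: the shift of indices is injective and its
  range contains the support of a.\<close>

lemma psum_shift:
  assumes a: "conv_coeffs a" and e: "\<And>\<alpha>. a \<alpha> \<noteq> 0 \<Longrightarrow> (\<forall>i. e i \<le> \<alpha> i)"
  shows "conv_coeffs (\<lambda>\<beta>. a (\<lambda>i. \<beta> i + e i))"
    and "\<forall>\<^sub>F x in nhds 0. psum a x = mon e x * psum (\<lambda>\<beta>. a (\<lambda>i. \<beta> i + e i)) x"
proof -
  let ?b = "\<lambda>\<beta>. a (\<lambda>i. \<beta> i + e i)"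
  obtain r where r: "r > 0" "(\<lambda>\<alpha>. norm (a \<alpha>) * r ^ mdeg \<alpha>) summable_on UNIV"
    using a by (auto simp: conv_coeffs_def)
  have inj: "inj (\<lambda>\<beta> i. \<beta> i + e i)" by (auto simp: inj_def fun_eq_iff)
  have "(\<lambda>\<alpha>. norm (a \<alpha>) * r ^ mdeg \<alpha>) summable_on range (\<lambda>\<beta> i. \<beta> i + e i)"
    by (rule summable_on_subset[OF r(2)]) auto
  then have "(\<lambda>\<beta>. norm (?b \<beta>) * r ^ (mdeg \<beta> + mdeg e)) summable_on UNIV"
    using summable_on_reindex[OF inj, of "\<lambda>\<alpha>. norm (a \<alpha>) * r ^ mdeg \<alpha>"] by (simp add: o_def mdeg_add)
  then have "(\<lambda>\<beta>. norm (?b \<beta>) * r ^ (mdeg \<beta> + mdeg e) * inverse (r ^ mdeg e)) summable_on UNIV"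
    by (rule summable_on_cmult_left)
  then have s: "(\<lambda>\<beta>. norm (?b \<beta>) * r ^ mdeg \<beta>) summable_on UNIV"
    using r by (simp add: power_add field_simps)
  then show "conv_coeffs ?b" using r by (auto simp: conv_coeffs_def)
  show "\<forall>\<^sub>F x in nhds 0. psum a x = mon e x * psum ?b x"
  proof (rule eventually_mono[OF polydisc_nhds[OF r(1)]])
    fix x :: "complex ^ 'a" assume "x \<in> polydisc r"
    then have x: "\<And>i. norm (x $ i) \<le> r" by (auto simp: polydisc_def intro: less_imp_le)
    have "((\<lambda>\<beta>. mon e x * (?b \<beta> * mon \<beta> x)) has_sum (mon e x * psum ?b x)) UNIV"
      by (intro has_sum_cmult_right has_sum_psum[OF r(1) s] x)
    also have "(\<lambda>\<beta>. mon e x * (?b \<beta> * mon \<beta> x)) = (\<lambda>\<alpha>. a \<alpha> * mon \<alpha> x) \<circ> (\<lambda>\<beta> i. \<beta> i + e i)"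
      by (auto simp: fun_eq_iff mon_add)
    finally have "((\<lambda>\<alpha>. a \<alpha> * mon \<alpha> x) has_sum (mon e x * psum ?b x)) (range (\<lambda>\<beta> i. \<beta> i + e i))"
      using has_sum_reindex[OF inj] by blast
    also have "?this \<longleftrightarrow> ((\<lambda>\<alpha>. a \<alpha> * mon \<alpha> x) has_sum (mon e x * psum ?b x)) UNIV"
    proof (rule has_sum_cong_neutral)
      fix \<alpha> assume "\<alpha> \<in> UNIV - range (\<lambda>\<beta> i. \<beta> i + e i)"
      moreover have "\<alpha> \<in> range (\<lambda>\<beta> i. \<beta> i + e i)" if "\<forall>i. e i \<le> \<alpha> i"
        using that by (intro image_eqI[of _ _ "\<lambda>i. \<alpha> i - e i"]) auto
      ultimately show "a \<alpha> * mon \<alpha> x = 0" using e[of \<alpha>] by auto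
    qed auto
    finally show "psum a x = mon e x * psum ?b x" by (rule has_sum_unique[OF has_sum_psum[OF r x]])
  qed
qed

text \<open>Each occurring monomial is assigned to one generator that divides it, and the monomials
  of a class are divided by their generator. The clause on Taylor coefficients records that the
  quotients inherit their terms from a; it yields the vanishing of quotients at 0.\<close>

lemma power_series_decomposition:
  fixes E :: "'c \<Rightarrow> 'n::finite \<Rightarrow> nat"
  assumes f: "has_power_series f a" and C: "finite C"
    and cl: "\<And>\<alpha>. a \<alpha> \<noteq> 0 \<Longrightarrow> \<exists>c\<in>C. \<forall>i. E c i \<le> \<alpha> i"
  shows "\<exists>h. (\<forall>c\<in>C. analytic_germ (h c) \<and> (\<forall>\<beta>. taylor_coeff (h c) \<beta> \<noteq> 0 \<longrightarrow> a (\<lambda>i. \<beta> i + E c i) \<noteq> 0)) \<and>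
    (\<forall>\<^sub>F x in nhds 0. f x = (\<Sum>c\<in>C. mon (E c) x * h c x))"
proof -
  define k where "k \<alpha> = (SOME c. c \<in> C \<and> (\<forall>i. E c i \<le> \<alpha> i))" for \<alpha>
  have k: "k \<alpha> \<in> C" "\<forall>i. E (k \<alpha>) i \<le> \<alpha> i" if "a \<alpha> \<noteq> 0" for \<alpha>
    using someI_ex[of "\<lambda>c. c \<in> C \<and> (\<forall>i. E c i \<le> \<alpha> i)"] cl[OF that] by (auto simp: k_def)
  define b where "b c \<alpha> = (if k \<alpha> = c then a \<alpha> else 0)" for c \<alpha>
  define h where "h c = psum (\<lambda>\<beta>. b c (\<lambda>i. \<beta> i + E c i))" for c
  have cb: "conv_coeffs (b c)" for c
    by (rule conv_coeffs_mono[OF conv_coeffs_if[OF f]]) (auto simp: b_def)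
  have eb: "\<forall>i. E c i \<le> \<alpha> i" if "b c \<alpha> \<noteq> 0" for c \<alpha>
    using k(2)[of \<alpha>] that by (auto simp: b_def split: if_splits)
  note sh = psum_shift[OF cb eb]
  have hp: "has_power_series (h c) (\<lambda>\<beta>. b c (\<lambda>i. \<beta> i + E c i))" for c
    unfolding h_def by (rule has_power_series_psum[OF sh(1)])
  have part: "has_power_series (\<lambda>x. \<Sum>c\<in>C'. psum (b c) x) (\<lambda>\<alpha>. \<Sum>c\<in>C'. b c \<alpha>)" if "finite C'" for C'
    using that
  proof (induction C' rule: finite_induct)
    case empty
    then show ?case by (simp add: has_power_series_def)
  next
    case (insert c C')
    then show ?case using has_power_series_add[OF has_power_series_psum[OF cb[of c]] insert.IH] by simp
  qed
  have "(\<Sum>c\<in>C. b c \<alpha>) = a \<alpha>" for \<alpha>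
  proof (cases "a \<alpha> = 0")
    case False
    then show ?thesis unfolding b_def using k(1) C by (simp add: sum.delta)
  next
    case True
    then have "b c \<alpha> = 0" for c by (simp add: b_def)
    with True show ?thesis by simp
  qed
  with part[OF C] have "has_power_series (\<lambda>x. \<Sum>c\<in>C. psum (b c) x) a" by simp
  from has_power_series_diff[OF f this] have "has_power_series (\<lambda>x. f x - (\<Sum>c\<in>C. psum (b c) x)) (\<lambda>_. 0)" by simp
  then have "\<forall>\<^sub>F x in nhds 0. f x = (\<Sum>c\<in>C. psum (b c) x)"
    unfolding has_power_series_def by eventually_elim (drule infsumI, simp)
  moreover have "\<forall>\<^sub>F x in nhds 0. \<forall>c\<in>C. psum (b c) x = mon (E c) x * h c x"
    unfolding h_def using C sh(2) by (simp add: eventually_ball_finite)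
  ultimately have "\<forall>\<^sub>F x in nhds 0. f x = (\<Sum>c\<in>C. mon (E c) x * h c x)"
    by eventually_elim simp
  moreover have "analytic_germ (h c) \<and> (\<forall>\<beta>. taylor_coeff (h c) \<beta> \<noteq> 0 \<longrightarrow> a (\<lambda>i. \<beta> i + E c i) \<noteq> 0)" for c
    using hp[of c] taylor_coeff_eqI[OF hp[of c]] by (auto simp: analytic_germ_def b_def)
  ultimately show ?thesis by blast
qed

text \<open>The order of vanishing is expressed by growth rather than by coefficients, because
  growth is transported by Lipschitz maps and can be evaluated along curves.\<close>

definition ordge :: "nat \<Rightarrow> (complex ^ 'n::finite \<Rightarrow> complex) \<Rightarrow> bool" where
  "ordge N f \<longleftrightarrow> (\<exists>C. \<forall>\<^sub>F x in nhds 0. norm (f x) \<le> C * norm x ^ N)"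

lemma ordge_if_coeffs_zero:
  assumes f: "has_power_series f a" and z: "\<And>\<alpha>. mdeg \<alpha> < N \<Longrightarrow> a \<alpha> = 0"
  shows "ordge N f"
proof -
  obtain r where r: "r > 0" "(\<lambda>\<alpha>. norm (a \<alpha>) * r ^ mdeg \<alpha>) summable_on UNIV"
    using conv_coeffs_if[OF f] by (auto simp: conv_coeffs_def)
  define S where "S = (\<Sum>\<^sub>\<infinity>\<alpha>. norm (a \<alpha>) * r ^ mdeg \<alpha>)"
  have "norm (psum a x) \<le> S / r ^ N * norm x ^ N" if x: "norm x \<le> r" for x
  proof -
    have xi: "norm (x $ i) \<le> norm x" for i by (rule Finite_Cartesian_Product.norm_nth_le)
    have hs: "((\<lambda>\<alpha>. a \<alpha> * mon \<alpha> x) has_sum psum a x) UNIV"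
      by (rule has_sum_psum[OF r]) (use xi x order_trans in blast)
    have b: "norm (a \<alpha> * mon \<alpha> x) \<le> (norm x / r) ^ N * (norm (a \<alpha>) * r ^ mdeg \<alpha>)" for \<alpha>
    proof (cases "mdeg \<alpha> < N")
      case False
      have "norm (mon \<alpha> x) \<le> norm x ^ mdeg \<alpha>" by (rule norm_mon_le) (rule xi)
      also have "\<dots> = (norm x / r) ^ mdeg \<alpha> * r ^ mdeg \<alpha>" using r by (simp add: power_divide)
      also have "\<dots> \<le> (norm x / r) ^ N * r ^ mdeg \<alpha>"
        using False r x by (intro mult_right_mono power_decreasing) auto
      finally show ?thesis by (simp add: norm_mult mult_left_mono mult.left_commute)
    qed (use z r in auto)
    have "norm (psum a x) \<le> (\<Sum>\<^sub>\<infinity>\<alpha>. (norm x / r) ^ N * (norm (a \<alpha>) * r ^ mdeg \<alpha>))"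
      by (rule norm_infsum_le[OF hs _ b]) (intro has_sum_infsum summable_on_cmult_right r)
    also have "\<dots> = (norm x / r) ^ N * S" unfolding S_def by (rule infsum_cmult_right') 
    finally show ?thesis by (simp add: power_divide mult.commute)
  qed
  then have "\<forall>\<^sub>F x in nhds 0. norm (psum a x) \<le> S / r ^ N * norm x ^ N"
    unfolding eventually_nhds_metric using r by (auto intro!: exI[of _ r])
  with has_power_series_eq_psum[OF f] have "\<forall>\<^sub>F x in nhds 0. norm (f x) \<le> S / r ^ N * norm x ^ N"
    by eventually_elim simp
  then show ?thesis unfolding ordge_def by blast
qed

lemma ordge_mono: "ordge N f \<Longrightarrow> M \<le> N \<Longrightarrow> ordge M f"
proof -
  assume "ordge N f" and M: "M \<le> N"
  then obtain C where C: "\<forall>\<^sub>F x in nhds 0. norm (f x) \<le> C * norm x ^ N" by (auto simp: ordge_def)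
  have "\<forall>\<^sub>F x in nhds (0 :: complex ^ 'a). norm x < 1"
    unfolding eventually_nhds_metric by (auto intro!: exI[of _ 1])
  with C have "\<forall>\<^sub>F x in nhds 0. norm (f x) \<le> \<bar>C\<bar> * norm x ^ M"
  proof eventually_elim
    case (elim x)
    have "C * norm x ^ N \<le> \<bar>C\<bar> * norm x ^ M"
      using M elim(2) by (intro mult_mono power_decreasing) auto
    then show ?case using elim by linarith
  qed
  then show ?thesis by (auto simp: ordge_def)
qed

lemma ordge_add: "ordge N f \<Longrightarrow> ordge N g \<Longrightarrow> ordge N (\<lambda>x. f x + g x)"
proof -
  assume "ordge N f" "ordge N g"
  then obtain C D where "\<forall>\<^sub>F x in nhds 0. norm (f x) \<le> C * norm x ^ N"
    "\<forall>\<^sub>F x in nhds 0. norm (g x) \<le> D * norm x ^ N" by (auto simp: ordge_def)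
  then have "\<forall>\<^sub>F x in nhds 0. norm (f x + g x) \<le> (C + D) * norm x ^ N"
    by eventually_elim (auto simp: distrib_right intro: norm_triangle_le)
  then show ?thesis by (auto simp: ordge_def)
qed

lemma ordge_cmult: "ordge N f \<Longrightarrow> ordge N (\<lambda>x. c * f x)"
proof -
  assume "ordge N f"
  then obtain C where "\<forall>\<^sub>F x in nhds 0. norm (f x) \<le> C * norm x ^ N" by (auto simp: ordge_def)
  then have "\<forall>\<^sub>F x in nhds 0. norm (c * f x) \<le> (norm c * C) * norm x ^ N"
    by eventually_elim (auto simp: norm_mult mult.assoc intro: mult_left_mono)
  then show ?thesis by (auto simp: ordge_def)
qed

lemma ordge_diff: "ordge N f \<Longrightarrow> ordge N g \<Longrightarrow> ordge N (\<lambda>x. f x - g x)"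
  using ordge_add[OF _ ordge_cmult[of N g "-1"]] by simp

lemma mon_scale: "mon \<alpha> (c *s x) = c ^ mdeg \<alpha> * mon \<alpha> x"
  by (simp add: mon_def power_mult_distrib prod.distrib mon_const)

text \<open>Induction on the degree: once the lower terms vanish, the homogeneous part P of degree d
  differs from f by terms of order d + 1, hence is itself of order d + 1.\<close>

lemma coeffs_zero_if_ordge:
  assumes f: "has_power_series f a" and o: "ordge N f" and m: "mdeg \<alpha> < N"
  shows "a \<alpha> = 0"
proof -
  have "\<forall>\<alpha>. mdeg \<alpha> = d \<longrightarrow> a \<alpha> = 0" if "d < N" for d
    using that
  proof (induction d rule: less_induct)
    case (less d)
    define b where "b \<alpha> = (if mdeg \<alpha> = d then a \<alpha> else 0)" for \<alpha>
    define P where "P x = (\<Sum>\<alpha> | mdeg \<alpha> \<le> d. b \<alpha> * mon \<alpha> x)" for x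
    have "((\<lambda>\<alpha>. b \<alpha> * mon \<alpha> x) has_sum P x) UNIV" for x
      unfolding P_def by (rule has_sum_finite_neutralI) (auto simp: b_def finite_mdeg_le)
    then have hP: "has_power_series P b" by (simp add: has_power_series_def)
    have "ordge (Suc d) (\<lambda>x. f x - P x)"
    proof (rule ordge_if_coeffs_zero[OF has_power_series_diff[OF f hP]])
      fix \<alpha> :: "'a \<Rightarrow> nat" assume "mdeg \<alpha> < Suc d"
      then show "a \<alpha> - b \<alpha> = 0" using less.IH[of "mdeg \<alpha>"] less.prems by (auto simp: b_def less_Suc_eq)
    qed
    from ordge_diff[OF ordge_mono[OF o, of "Suc d"] this] less.prems have "ordge (Suc d) P" by simp
    then obtain C where "\<forall>\<^sub>F x in nhds 0. norm (P x) \<le> C * norm x ^ Suc d" by (auto simp: ordge_def)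
    then obtain e where e: "e > 0" "\<And>x. norm x < e \<Longrightarrow> norm (P x) \<le> C * norm x ^ Suc d"
      by (auto simp: eventually_nhds_metric)
    have Ps: "P (c *s x) = c ^ d * P x" for c x
      unfolding P_def sum_distrib_left by (intro sum.cong) (auto simp: b_def mon_scale)
    \<comment> \<open>On the ray through x, P scales like t^d but is bounded by a multiple of
      t^(d+1).\<close>
    have "P x = 0" for x
    proof (rule ccontr)
      assume nz: "P x \<noteq> 0"
      have lim: "((\<lambda>t. C * t * norm x ^ Suc d) \<longlongrightarrow> C * 0 * norm x ^ Suc d) (at_right 0)"
        by (intro tendsto_intros)
      have "\<forall>\<^sub>F t in at_right 0. norm (P x) \<le> C * t * norm x ^ Suc d"
        using eventually_at_right_real[of 0 "e / (norm x + 1)"]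
      proof (rule eventually_mono)
        fix t assume t: "t \<in> {0<..<e / (norm x + 1)}"
        have "norm (of_real t *s x) < e"
        proof -
          have "t * norm x \<le> t * (norm x + 1)" using t by (intro mult_left_mono) auto
          also have "\<dots> < e" using t by (simp add: pos_less_divide_eq add_nonneg_pos)
          finally show ?thesis using t by simp
        qed
        from e(2)[OF this] have "t ^ d * norm (P x) \<le> t ^ d * (C * t * norm x ^ Suc d)"
          using t by (simp add: Ps norm_mult norm_power power_mult_distrib mult_ac)
        then show "norm (P x) \<le> C * t * norm x ^ Suc d" using t by simp
      qed (use e(1) in \<open>simp add: add_nonneg_pos\<close>)
      from tendsto_lowerbound[OF lim this] nz show False by simp
    qed
    then have "P = (\<lambda>_. 0)" by auto
    with hP have "b \<alpha> = 0" for \<alpha> using has_power_series_zero by metis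
    then show ?case by (metis b_def)
  qed
  with m show ?thesis by blast
qed

section \<open>Operations on analytic germs\<close>

lemma analytic_germ_holoD: "analytic_germ f \<Longrightarrow> \<forall>\<^sub>F x in nhds 0. holo_at f x"
  by (simp add: analytic_germ_iff_holo_germ holo_germ_def)

lemma analytic_germ_holoI: "\<forall>\<^sub>F x in nhds 0. holo_at f x \<Longrightarrow> analytic_germ f"
  by (simp add: analytic_germ_iff_holo_germ holo_germ_def)

lemma analytic_germ_cong: "\<forall>\<^sub>F x in nhds 0. f x = g x \<Longrightarrow> analytic_germ f \<longleftrightarrow> analytic_germ g"
  unfolding analytic_germ_def using has_power_series_cong by blast

lemma analytic_germ_const [simp]: "analytic_germ (\<lambda>_. c)"
  by (rule analytic_germ_holoI) simp

lemma analytic_germ_nth [simp]: "analytic_germ (\<lambda>x. x $ i)"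
  by (rule analytic_germ_holoI) simp

lemma analytic_germ_add: "analytic_germ f \<Longrightarrow> analytic_germ g \<Longrightarrow> analytic_germ (\<lambda>x. f x + g x)"
  by (rule analytic_germ_holoI, drule (1) eventually_conj[OF analytic_germ_holoD analytic_germ_holoD])
    (auto elim!: eventually_mono intro: holo_at_add)

lemma analytic_germ_mult: "analytic_germ f \<Longrightarrow> analytic_germ g \<Longrightarrow> analytic_germ (\<lambda>x. f x * g x)"
  by (rule analytic_germ_holoI, drule (1) eventually_conj[OF analytic_germ_holoD analytic_germ_holoD])
    (auto elim!: eventually_mono intro: holo_at_mult)

lemma analytic_germ_diff: "analytic_germ f \<Longrightarrow> analytic_germ g \<Longrightarrow> analytic_germ (\<lambda>x. f x - g x)"
  using analytic_germ_add[OF _ analytic_germ_mult[OF analytic_germ_const[of "-1"]], of f g] by simp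

lemma analytic_germ_uminus: "analytic_germ f \<Longrightarrow> analytic_germ (\<lambda>x. - f x)"
  using analytic_germ_mult[OF analytic_germ_const[of "-1"], of f] by simp

lemma analytic_germ_power: "analytic_germ f \<Longrightarrow> analytic_germ (\<lambda>x. f x ^ k)"
  by (induction k) (auto intro: analytic_germ_mult)

lemma analytic_germ_sum: "(\<And>a. a \<in> A \<Longrightarrow> analytic_germ (f a)) \<Longrightarrow> analytic_germ (\<lambda>x. \<Sum>a\<in>A. f a x)"
  by (induction A rule: infinite_finite_induct) (auto intro: analytic_germ_add)

lemma analytic_germ_divide_const: "analytic_germ f \<Longrightarrow> analytic_germ (\<lambda>x. f x / c)"
  using analytic_germ_mult[OF _ analytic_germ_const[of "inverse c"], of f] by (simp add: divide_inverse)

lemma analytic_germ_mon: "analytic_germ (mon \<alpha>)"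
  by (rule analytic_germ_holoI) (simp add: holo_at_mon)

lemmas analytic_intros = analytic_germ_const analytic_germ_nth analytic_germ_add analytic_germ_mult
  analytic_germ_diff analytic_germ_uminus analytic_germ_power analytic_germ_sum analytic_germ_divide_const
  analytic_germ_mon

lemma holo_at_isCont: "holo_at f x \<Longrightarrow> isCont f x"
  unfolding holo_at_def using has_derivative_continuous by blast

lemma analytic_germ_tendsto: "analytic_germ f \<Longrightarrow> (f \<longlongrightarrow> f 0) (nhds 0)"
  using eventually_nhds_x_imp_x[OF analytic_germ_holoD] holo_at_isCont[of f 0]
  by (auto simp: isCont_def tendsto_at_iff_tendsto_nhds)

lemma tendsto_map_germ:
  fixes \<phi> :: "complex ^ 'n::finite \<Rightarrow> complex ^ 'm::finite"
  assumes "\<And>i. analytic_germ (\<lambda>x. \<phi> x $ i)" "\<phi> 0 = 0"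
  shows "filterlim \<phi> (nhds 0) (nhds 0)"
proof -
  have "(\<phi> \<longlongrightarrow> \<phi> 0) (nhds 0)" by (rule vec_tendstoI) (rule analytic_germ_tendsto[OF assms(1)])
  then show ?thesis by (simp add: assms(2))
qed

lemma eventually_compose_germ:
  assumes "filterlim \<phi> (nhds 0) (nhds 0)" "\<forall>\<^sub>F y in nhds 0. P y"
  shows "\<forall>\<^sub>F x in nhds 0. P (\<phi> x)"
  using eventually_compose_filterlim[OF assms(2,1)] .

lemma analytic_germ_compose:
  assumes "analytic_germ f" "\<And>i. analytic_germ (\<lambda>x. \<phi> x $ i)" "\<phi> 0 = 0"
  shows "analytic_germ (\<lambda>x. f (\<phi> x))"
proof (rule analytic_germ_holoI)
  have "\<forall>\<^sub>F x in nhds 0. holo_at f (\<phi> x)"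
    by (rule eventually_compose_germ[OF tendsto_map_germ[OF assms(2,3)] analytic_germ_holoD[OF assms(1)]])
  moreover have "\<forall>\<^sub>F x in nhds 0. \<forall>i. holo_at (\<lambda>x. \<phi> x $ i) x"
    by (intro eventually_all_finite analytic_germ_holoD assms)
  ultimately show "\<forall>\<^sub>F x in nhds 0. holo_at (\<lambda>x. f (\<phi> x)) x"
    by eventually_elim (auto intro: holo_at_compose)
qed

lemma analytic_germ_comp_holomorphic:
  assumes f: "analytic_germ f" and g: "g holomorphic_on S" "open S" "f 0 \<in> S"
  shows "analytic_germ (\<lambda>x. g (f x))"
proof (rule analytic_germ_holoI)
  have "\<forall>\<^sub>F x in nhds 0. f x \<in> S"
    using analytic_germ_tendsto[OF f] g(2,3) by (rule topological_tendstoD)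
  with analytic_germ_holoD[OF f] show "\<forall>\<^sub>F x in nhds 0. holo_at (\<lambda>x. g (f x)) x"
  proof eventually_elim
    case (elim x)
    then show ?case using holo_at_comp_field[of f x g] holomorphic_derivI[OF g(1,2)] by blast
  qed
qed

lemma analytic_germ_inverse:
  assumes "analytic_germ f" "f 0 \<noteq> 0"
  shows "analytic_germ (\<lambda>x. inverse (f x))"
  by (rule analytic_germ_comp_holomorphic[OF assms(1), of inverse "-{0}"])
    (use assms in \<open>auto intro!: holomorphic_intros\<close>)

lemma analytic_germ_nonzero: "analytic_germ f \<Longrightarrow> f 0 \<noteq> 0 \<Longrightarrow> \<forall>\<^sub>F x in nhds 0. f x \<noteq> 0"
  using tendsto_imp_eventually_ne[OF analytic_germ_tendsto] .

lemma analytic_germ_root: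
  assumes A: "analytic_germ A" and c: "c ^ n = A 0" "A 0 \<noteq> 0" "n > 0"
  shows "\<exists>B. analytic_germ B \<and> B 0 = c \<and> (\<forall>\<^sub>F x in nhds 0. B x ^ n = A x)"
proof (intro exI conjI)
  \<comment> \<open>Division by \<open>A 0\<close> moves the value at 0 to 1, away from the branch
    cut of \<open>Ln\<close>; the chosen root c of \<open>A 0\<close> fixes the branch.\<close>
  let ?B = "\<lambda>x. c * exp (Ln (A x / A 0) / of_nat n)"
  have "analytic_germ (\<lambda>x. (\<lambda>z. exp (Ln z / of_nat n)) (A x / A 0))"
    by (rule analytic_germ_comp_holomorphic[of _ _ "-\<real>\<^sub>\<le>\<^sub>0"])
      (use c(2,3) in \<open>auto intro!: holomorphic_intros analytic_germ_divide_const A\<close>)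
  then show "analytic_germ ?B" by (intro analytic_intros)
  show "?B 0 = c" using c by simp
  show "\<forall>\<^sub>F x in nhds 0. ?B x ^ n = A x"
    using analytic_germ_nonzero[OF A c(2)]
  proof eventually_elim
    case (elim x)
    have "exp (Ln (A x / A 0) / of_nat n) ^ n = exp (Ln (A x / A 0))"
      unfolding exp_of_nat_mult[symmetric] using c(3) by simp
    then show ?case using elim c by (simp add: power_mult_distrib)
  qed
qed

lemma analytic_germ_DERIV:
  assumes "analytic_germ f"
  shows "((\<lambda>s. f (axis i s)) has_field_derivative partial_deriv i f 0) (at 0)"
proof -
  have "holo_at f 0" using eventually_nhds_x_imp_x[OF analytic_germ_holoD[OF assms]] .
  then obtain D where "(f has_derivative D) (at 0)" "complex_linear D" by (auto simp: holo_at_def)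
  from has_derivative_imp_partial_deriv[OF this, of i] show ?thesis by simp
qed

lemma partial_deriv_0I:
  "((\<lambda>s. f (axis i s)) has_field_derivative D) (at 0) \<Longrightarrow> partial_deriv i f 0 = D"
  unfolding partial_deriv_def by (rule DERIV_imp_deriv) simp

lemma axis_zero_c [simp]: "axis i (0::complex) = 0"
  by (simp add: vec_eq_iff axis_def)

lemma partial_deriv_0_mult:
  assumes "analytic_germ f" "analytic_germ g"
  shows "partial_deriv i (\<lambda>x. f x * g x) 0 = partial_deriv i f 0 * g 0 + f 0 * partial_deriv i g 0"
  by (rule partial_deriv_0I)
    (rule DERIV_cong[OF DERIV_mult[OF analytic_germ_DERIV[OF assms(1)] analytic_germ_DERIV[OF assms(2)]]], simp)

lemma partial_deriv_0_add:
  assumes "analytic_germ f" "analytic_germ g"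
  shows "partial_deriv i (\<lambda>x. f x + g x) 0 = partial_deriv i f 0 + partial_deriv i g 0"
  by (rule partial_deriv_0I) (rule DERIV_add[OF analytic_germ_DERIV[OF assms(1)] analytic_germ_DERIV[OF assms(2)]])

lemma partial_deriv_0_nth: "partial_deriv i (\<lambda>x. x $ j) 0 = (if i = j then 1 else 0)"
  by (rule partial_deriv_0I) (auto simp: axis_def)

lemma partial_deriv_0_const [simp]: "partial_deriv i (\<lambda>x. c) 0 = 0"
  by (rule partial_deriv_0I) auto

lemma partial_deriv_0_cmult:
  "analytic_germ f \<Longrightarrow> partial_deriv i (\<lambda>x. c * f x) 0 = c * partial_deriv i f 0"
  using partial_deriv_0_mult[of "\<lambda>_. c" f i] by simp

lemma partial_deriv_0_power:
  assumes "analytic_germ f"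
  shows "partial_deriv i (\<lambda>x. f x ^ n) 0 = of_nat n * f 0 ^ (n - 1) * partial_deriv i f 0"
  by (rule partial_deriv_0I)
    (rule DERIV_cong[OF DERIV_power[OF analytic_germ_DERIV[OF assms]]], simp add: mult_ac)

lemma partial_deriv_0_sum:
  assumes "\<And>a. a \<in> A \<Longrightarrow> analytic_germ (f a)"
  shows "partial_deriv i (\<lambda>x. \<Sum>a\<in>A. f a x) 0 = (\<Sum>a\<in>A. partial_deriv i (f a) 0)"
  by (rule partial_deriv_0I) (intro DERIV_sum analytic_germ_DERIV assms)

lemma partial_deriv_0_inverse:
  assumes "analytic_germ f" "f 0 \<noteq> 0"
  shows "partial_deriv i (\<lambda>x. inverse (f x)) 0 = - partial_deriv i f 0 / (f 0)\<^sup>2"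
  by (rule partial_deriv_0I)
    (rule DERIV_cong[OF DERIV_inverse'[OF analytic_germ_DERIV[OF assms(1)]]],
      use assms in \<open>simp_all add: power2_eq_square field_simps\<close>)

lemma partial_deriv_0_cong:
  assumes "\<forall>\<^sub>F x in nhds 0. f x = g x"
  shows "partial_deriv i f 0 = partial_deriv i g 0"
proof -
  have "((\<lambda>s::complex. axis i s :: complex ^ 'a) \<longlongrightarrow> axis i 0) (nhds 0)"
    using linear_continuous_at[OF bounded_linear_axis, of "0::complex" i]
    unfolding isCont_def tendsto_at_iff_tendsto_nhds .
  then have "\<forall>\<^sub>F s in nhds 0. f (0 + axis i s) = g (0 + axis i s)"
    using eventually_compose_filterlim[OF assms] by simp
  then show ?thesis unfolding partial_deriv_def by (rule deriv_cong_ev) simp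
qed

lemma analytic_germ_has_derivative_0:
  assumes "analytic_germ f"
  shows "(f has_derivative (\<lambda>v. \<Sum>i\<in>UNIV. v $ i * partial_deriv i f 0)) (at 0)"
  by (rule holo_at_has_derivative) (rule eventually_nhds_x_imp_x[OF analytic_germ_holoD[OF assms]])

lemma partial_deriv_0_compose:
  assumes f: "analytic_germ f" and \<phi>: "\<And>i. analytic_germ (\<lambda>x. \<phi> x $ i)" "\<phi> 0 = 0"
  shows "partial_deriv j (\<lambda>x. f (\<phi> x)) 0 = (\<Sum>i\<in>UNIV. partial_deriv j (\<lambda>x. \<phi> x $ i) 0 * partial_deriv i f 0)"
proof -
  have "((\<lambda>s. f (\<phi> (axis j s))) has_derivative
     (\<lambda>s. \<Sum>i\<in>UNIV. (\<chi> i. partial_deriv j (\<lambda>x. \<phi> x $ i) 0 * s) $ i * partial_deriv i f 0)) (at 0)"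
  proof (rule has_derivative_compose[of "\<lambda>s. \<phi> (axis j s)" _ _ UNIV f, simplified])
    show "((\<lambda>s. \<phi> (axis j s)) has_derivative (\<lambda>s. \<chi> i. partial_deriv j (\<lambda>x. \<phi> x $ i) 0 * s)) (at 0)"
      by (rule has_derivative_vec_nth_iff)
        (use analytic_germ_DERIV[OF \<phi>(1)] in \<open>simp add: has_field_derivative_def\<close>)
    show "(f has_derivative (\<lambda>v. \<Sum>i\<in>UNIV. v $ i * partial_deriv i f 0)) (at (\<phi> (axis j 0)))"
      using analytic_germ_has_derivative_0[OF f] \<phi>(2) by simp
  qed
  moreover have "(\<lambda>s. \<Sum>i\<in>UNIV. (\<chi> i. partial_deriv j (\<lambda>x. \<phi> x $ i) 0 * s) $ i * partial_deriv i f 0) =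
      (*) (\<Sum>i\<in>UNIV. partial_deriv j (\<lambda>x. \<phi> x $ i) 0 * partial_deriv i f 0)"
    by (simp add: fun_eq_iff sum_distrib_left mult_ac)
  ultimately have "((\<lambda>s. f (\<phi> (axis j s))) has_field_derivative
     (\<Sum>i\<in>UNIV. partial_deriv j (\<lambda>x. \<phi> x $ i) 0 * partial_deriv i f 0)) (at 0)"
    unfolding has_field_derivative_def by (simp only:)
  then show ?thesis by (rule partial_deriv_0I)
qed

text \<open>Provides the continuous differentiability required by the inverse function
  theorem.\<close>

lemma holo_partial_deriv_isCont:
  fixes f :: "complex ^ 'n::finite \<Rightarrow> complex"
  assumes U: "open U" and h: "\<And>x. x \<in> U \<Longrightarrow> holo_at f x" and x0: "x0 \<in> U"
  shows "isCont (partial_deriv j f) x0"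
proof -
  obtain r0 where r0: "r0 > 0" "cball x0 r0 \<subseteq> U" using U x0 open_contains_cball by blast
  define r where "r = r0 / 2"
  have r: "r > 0" using r0 by (simp add: r_def)
  have cont: "continuous_on (cball x0 r0) f"
    using h r0 holo_at_isCont by (intro continuous_at_imp_continuous_on) blast
  have uc: "uniformly_continuous_on (cball x0 r0) f"
    by (rule compact_uniformly_continuous[OF cont compact_cball])
  have nax: "norm (axis j (1::complex) :: complex ^ 'n) \<le> 1" by (simp add: norm_axis_1)
  show ?thesis
    unfolding isCont_def
  proof (rule LIM_I)
    fix e :: real assume e: "e > 0"
    define e' where "e' = e * r / 4"
    have e': "e' > 0" using e r by (simp add: e'_def)
    obtain d where d: "d > 0" "\<And>x y. x \<in> cball x0 r0 \<Longrightarrow> y \<in> cball x0 r0 \<Longrightarrow> dist y x < d \<Longrightarrow> dist (f y) (f x) < e'"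
      using uc e' unfolding uniformly_continuous_on_def by metis
    show "\<exists>s>0. \<forall>x. x \<noteq> x0 \<and> norm (x - x0) < s \<longrightarrow> norm (partial_deriv j f x - partial_deriv j f x0) < e"
    proof (intro exI[of _ "min d r"] conjI allI impI)
      show "0 < min d r" using d r by simp
      fix x assume x: "x \<noteq> x0 \<and> norm (x - x0) < min d r"
      define w where "w = x - x0"
      \<comment> \<open>The derivative of this difference at x0 compares the derivatives of f at x
        and x0, and uniform continuity makes it small, so the Cauchy estimate applies.\<close>
      define g where "g = (\<lambda>z. f (z + w) - f z)"
      have in0: "z \<in> cball x0 r0" "z + w \<in> cball x0 r0" if "z \<in> ball x0 r" for z
      proof -
        show "z \<in> cball x0 r0" using that r by (simp add: r_def)
        have "dist x0 (z + w) \<le> dist x0 z + norm w" by norm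
        then show "z + w \<in> cball x0 r0" using that x by (simp add: r_def w_def)
      qed
      have sh: "holo_at (\<lambda>z. f (z + w)) z" if "z + w \<in> U" for z
        by (rule holo_at_compose[of f "\<lambda>z. z + w"]) (use h[OF that] in \<open>auto intro: holo_at_add\<close>)
      have hg: "holo_at g z" if "z \<in> ball x0 r" for z
      proof -
        have "holo_at (\<lambda>z. f (z + w)) z" "holo_at f z" using sh h in0[OF that] r0(2) by blast+
        from holo_at_add[OF this(1) holo_at_mult[OF holo_at_const[of "-1"] this(2)]] show ?thesis
          by (simp add: g_def)
      qed
      have bg: "norm (g z) \<le> e'" if "z \<in> ball x0 r" for z
        using d(2)[OF in0[OF that]] x by (simp add: g_def dist_norm w_def)
      have hx: "holo_at f x0" "holo_at f x" using h x0 in0(2)[of x0] r r0(2) by (auto simp: w_def)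
      obtain D1 where D1: "(f has_derivative D1) (at x)" "complex_linear D1" using hx by (auto simp: holo_at_def)
      obtain D0 where D0: "(f has_derivative D0) (at x0)" "complex_linear D0" using hx by (auto simp: holo_at_def)
      have "((\<lambda>z. z + w) has_derivative (\<lambda>h. h)) (at x0)" by (auto intro!: derivative_eq_intros)
      from has_derivative_compose[OF this, of f D1] D1(1)
      have "((\<lambda>z. f (z + w)) has_derivative D1) (at x0)" by (simp add: w_def)
      then have dg: "(g has_derivative (\<lambda>v. D1 v - D0 v)) (at x0)"
        unfolding g_def using D0 by (intro has_derivative_diff) auto
      have "complex_linear (\<lambda>v. D1 v - D0 v)"
        using D1(2) D0(2) by (simp add: complex_linear_def algebra_simps)
      from holo_at_derivative_bound[OF hg bg r dg this, of "axis j 1"]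
      have "norm (D1 (axis j 1) - D0 (axis j 1)) \<le> 2 * e' / r * norm (axis j (1::complex) :: complex ^ 'n)" .
      also have "\<dots> \<le> 2 * e' / r * 1" using e' r nax by (intro mult_left_mono) auto
      also have "\<dots> < e" using e r by (simp add: e'_def)
      finally show "norm (partial_deriv j f x - partial_deriv j f x0) < e"
        using has_derivative_imp_partial_deriv(2)[OF D1] has_derivative_imp_partial_deriv(2)[OF D0] by simp
    qed
  qed
qed

text \<open>The coordinate changes to be inverted have a diagonal Jacobian at 0, which makes the
  inverse of the derivative explicit. The derivatives of the inverse are part of the conclusion
  because the coefficient e of the normal form is computed from them.\<close>

lemma inverse_function_germ:
  fixes \<phi> :: "complex ^ 'n::finite \<Rightarrow> complex ^ 'n"
  assumes an: "\<And>i. analytic_germ (\<lambda>x. \<phi> x $ i)" and \<phi>0: "\<phi> 0 = 0"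
    and diag: "\<And>i j. partial_deriv j (\<lambda>x. \<phi> x $ i) 0 = (if i = j then d i else 0)" and d: "\<And>i. d i \<noteq> 0"
  shows "\<exists>\<psi>. \<psi> 0 = 0 \<and> (\<forall>i. analytic_germ (\<lambda>x. \<psi> x $ i)) \<and>
    (\<forall>\<^sub>F x in nhds 0. \<psi> (\<phi> x) = x \<and> \<phi> (\<psi> x) = x) \<and>
    (\<forall>i j. partial_deriv j (\<lambda>x. \<psi> x $ i) 0 = (if i = j then inverse (d i) else 0))"
proof -
  have "\<forall>\<^sub>F x in nhds 0. \<forall>i. holo_at (\<lambda>x. \<phi> x $ i) x"
    by (intro eventually_all_finite analytic_germ_holoD an)
  then obtain U where U: "open U" "0 \<in> U" "\<And>x i. x \<in> U \<Longrightarrow> holo_at (\<lambda>x. \<phi> x $ i) x"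
    unfolding eventually_nhds by blast
  define L where "L x h = (\<chi> i. \<Sum>j\<in>UNIV. h $ j * partial_deriv j (\<lambda>x. \<phi> x $ i) x)" for x h
  have der: "(\<phi> has_derivative L x) (at x)" if "x \<in> U" for x
    unfolding L_def[abs_def] by (intro has_derivative_vec_nth_iff holo_at_has_derivative U(3) that)
  have bl: "bounded_linear (L x)" for x
  proof -
    have "linear (L x)"
      by (rule linearI) (auto simp: L_def vec_eq_iff algebra_simps sum.distrib scaleR_sum_right)
    then show ?thesis by (simp add: linear_conv_bounded_linear)
  qed
  define f' where "f' x = Blinfun (L x)" for x
  have f': "blinfun_apply (f' x) = L x" for x
    unfolding f'_def by (rule bounded_linear_Blinfun_apply[OF bl])
  have L0: "L 0 h = (\<chi> i. d i * h $ i)" for h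
    by (simp add: L_def diag vec_eq_iff if_distrib mult.commute cong: if_cong)
  have blI: "bounded_linear (\<lambda>h::complex ^ 'n. \<chi> i. h $ i / d i)"
  proof -
    have "linear (\<lambda>h::complex ^ 'n. \<chi> i. h $ i / d i)"
      by (rule linearI) (auto simp: vec_eq_iff add_divide_distrib scaleR_conv_of_real)
    then show ?thesis by (simp add: linear_conv_bounded_linear)
  qed
  obtain U' V g g' where U': "open U'" "U' \<subseteq> U" "0 \<in> U'" and V: "open V" "\<phi> 0 \<in> V"
    and hom: "homeomorphism U' V \<phi> g"
    and g: "\<And>y. y \<in> V \<Longrightarrow> (g has_derivative (g' y)) (at y)"
      "\<And>y. y \<in> V \<Longrightarrow> g' y = inv_into UNIV (blinfun_apply (f'(g y)))"
      "\<And>y. y \<in> V \<Longrightarrow> bij (blinfun_apply (f'(g y)))"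
  proof (rule inverse_function_theorem[OF U(1), of \<phi> f' 0 "Blinfun (\<lambda>h. \<chi> i. h $ i / d i)"])
    show "(\<phi> has_derivative blinfun_apply (f' x)) (at x)" if "x \<in> U" for x
      using der[OF that] by (simp add: f')
    show "continuous_on U f'"
    proof (rule continuous_on_blinfun_componentwise)
      fix b :: "complex ^ 'n"
      have "continuous_on U (\<lambda>x. L x b)"
        unfolding L_def
        by (intro continuous_on_vec_lambda continuous_on_sum continuous_on_mult continuous_on_const
            continuous_at_imp_continuous_on ballI holo_partial_deriv_isCont[OF U(1) U(3)])
      then show "continuous_on U (\<lambda>x. blinfun_apply (f' x) b)" by (simp add: f')
    qed
    show "Blinfun (\<lambda>h. \<chi> i. h $ i / d i) o\<^sub>L f' 0 = id_blinfun"
      by (rule blinfun_eqI) (use d in \<open>simp add: bounded_linear_Blinfun_apply[OF blI] f' L0 vec_eq_iff\<close>)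
  qed (use U in auto)
  have gphi: "g (\<phi> x) = x" if "x \<in> U'" for x using hom that by (simp add: homeomorphism_def)
  have phig: "\<phi> (g y) = y" if "y \<in> V" for y using hom that by (simp add: homeomorphism_def)
  have gU: "g y \<in> U'" if "y \<in> V" for y using hom that by (auto simp: homeomorphism_def)
  have g0: "g 0 = 0" using gphi[of 0] U'(3) \<phi>0 by simp
  have V0: "0 \<in> V" using V \<phi>0 by simp
  have Lc: "L x (c *s v) = c *s L x v" for x c v
    by (simp add: L_def vec_eq_iff sum_distrib_left mult_ac)
  \<comment> \<open>The inverse function theorem is real; complex linearity of the derivative of the
    inverse is inherited from the map that it inverts.\<close>
  have lin: "complex_linear (\<lambda>h. g' y h $ i)" if y: "y \<in> V" for y i
    unfolding complex_linear_def
  proof (intro allI)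
    fix c v
    have b: "bij (L (g y))" using g(3)[OF y] by (simp add: f')
    have "L (g y) (c *s inv_into UNIV (L (g y)) v) = c *s v" 
      using b by (simp add: Lc bij_inv_eq_iff surj_f_inv_f bij_is_surj)
    then have "inv_into UNIV (L (g y)) (c *s v) = c *s inv_into UNIV (L (g y)) v"
      using b by (metis bij_inv_eq_iff)
    then show "g' y (c *s v) $ i = c * g' y v $ i" using g(2)[OF y] by (simp add: f')
  qed
  have gi: "((\<lambda>y. g y $ i) has_derivative (\<lambda>h. g' y h $ i)) (at y)" if "y \<in> V" for y i
    using bounded_linear.has_derivative[OF bounded_linear_vec_nth g(1)[OF that]] .
  have evV: "\<forall>\<^sub>F y in nhds 0. y \<in> V" using V(1) V0 by (rule eventually_nhds_in_open)
  have evU: "\<forall>\<^sub>F y in nhds 0. y \<in> U'" using U'(1,3) by (rule eventually_nhds_in_open)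
  have gh: "holo_at (\<lambda>y. g y $ i) y" if "y \<in> V" for y i
    using gi[OF that] lin[OF that] unfolding holo_at_def by blast
  have "analytic_germ (\<lambda>y. g y $ i)" for i
    by (rule analytic_germ_holoI, rule eventually_mono[OF evV]) (rule gh)
  moreover have "\<forall>\<^sub>F x in nhds 0. g (\<phi> x) = x \<and> \<phi> (g x) = x"
    using evV evU by eventually_elim (simp add: gphi phig)
  moreover have "partial_deriv j (\<lambda>x. g x $ i) 0 = (if i = j then inverse (d i) else 0)" for i j
  proof -
    have "bij (L 0)" using g(3)[OF V0] by (simp add: f' g0)
    moreover have "L 0 (axis j (inverse (d j))) = axis j 1"
      using d by (simp add: L0 vec_eq_iff axis_def)
    ultimately have "inv_into UNIV (L 0) (axis j 1) = axis j (inverse (d j))" by (metis bij_inv_eq_iff)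
    then have "g' 0 (axis j 1) $ i = (if i = j then inverse (d i) else 0)"
      using g(2)[OF V0] by (simp add: f' g0 axis_def)
    then show ?thesis using has_derivative_imp_partial_deriv(2)[OF gi[OF V0] lin[OF V0]] by simp
  qed
  ultimately show ?thesis using g0 by (intro exI[of _ g]) blast
qed

section \<open>Biholomorphic and bi-Lipschitz germs\<close>

lemma biholomorphism_germI:
  assumes "\<And>i. analytic_germ (\<lambda>x. \<phi> x $ i)" "\<phi> 0 = 0" "\<psi> 0 = 0" "\<And>i. analytic_germ (\<lambda>x. \<psi> x $ i)"
    "\<forall>\<^sub>F x in nhds 0. \<psi> (\<phi> x) = x \<and> \<phi> (\<psi> x) = x"
  shows "biholomorphism_germ \<phi>"
  using assms unfolding biholomorphism_germ_def by blast

lemma analytic_map_compose: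
  assumes "\<And>i. analytic_germ (\<lambda>x. \<phi> x $ i)" "\<phi> 0 = 0" "\<And>i. analytic_germ (\<lambda>x. \<psi> x $ i)"
  shows "analytic_germ (\<lambda>x. \<psi> (\<phi> x) $ i)"
  by (rule analytic_germ_compose[of "\<lambda>y. \<psi> y $ i"]) (use assms in auto)

lemma biholomorphism_germ_compose:
  assumes "biholomorphism_germ \<phi>" "biholomorphism_germ \<theta>"
  shows "biholomorphism_germ (\<lambda>x. \<theta> (\<phi> x))"
proof -
  obtain \<psi> where \<phi>: "\<phi> 0 = 0" "\<And>i. analytic_germ (\<lambda>x. \<phi> x $ i)" "\<psi> 0 = 0" "\<And>i. analytic_germ (\<lambda>x. \<psi> x $ i)"
    "\<forall>\<^sub>F x in nhds 0. \<psi> (\<phi> x) = x \<and> \<phi> (\<psi> x) = x"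
    using assms(1) unfolding biholomorphism_germ_def by blast
  obtain \<omega> where \<theta>: "\<theta> 0 = 0" "\<And>i. analytic_germ (\<lambda>x. \<theta> x $ i)" "\<omega> 0 = 0" "\<And>i. analytic_germ (\<lambda>x. \<omega> x $ i)"
    "\<forall>\<^sub>F x in nhds 0. \<omega> (\<theta> x) = x \<and> \<theta> (\<omega> x) = x"
    using assms(2) unfolding biholomorphism_germ_def by blast
  have 1: "\<forall>\<^sub>F x in nhds 0. \<omega> (\<theta> (\<phi> x)) = \<phi> x \<and> \<theta> (\<omega> (\<phi> x)) = \<phi> x"
    by (rule eventually_compose_germ[OF tendsto_map_germ[OF \<phi>(2,1)] \<theta>(5)])
  have 2: "\<forall>\<^sub>F x in nhds 0. \<psi> (\<phi> (\<omega> x)) = \<omega> x \<and> \<phi> (\<psi> (\<omega> x)) = \<omega> x"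
    by (rule eventually_compose_germ[OF tendsto_map_germ[OF \<theta>(4,3)] \<phi>(5)])
  show ?thesis
  proof (rule biholomorphism_germI[where \<psi> = "\<lambda>x. \<psi> (\<omega> x)"])
    show "\<forall>\<^sub>F x in nhds 0. \<psi> (\<omega> (\<theta> (\<phi> x))) = x \<and> \<theta> (\<phi> (\<psi> (\<omega> x))) = x"
      using 1 2 \<phi>(5) \<theta>(5) by eventually_elim auto
  qed (use \<phi> \<theta> in \<open>auto intro: analytic_map_compose\<close>)
qed

section \<open>Lipschitz germs with Lipschitz inverse\<close>

definition lip_germ :: "(complex ^ 'n::finite \<Rightarrow> complex ^ 'n) \<Rightarrow> bool" where
  "lip_germ \<phi> \<longleftrightarrow> \<phi> 0 = 0 \<and> (\<exists>L e. e > 0 \<and> L-lipschitz_on (ball 0 e) \<phi>)"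

text \<open>Carrying the inverse along as a second germ allows composition and inversion without
  tracking domains.\<close>

definition lip_pair :: "(complex ^ 'n::finite \<Rightarrow> complex ^ 'n) \<Rightarrow> (complex ^ 'n \<Rightarrow> complex ^ 'n) \<Rightarrow> bool" where
  "lip_pair \<phi> \<psi> \<longleftrightarrow> lip_germ \<phi> \<and> lip_germ \<psi> \<and> (\<forall>\<^sub>F x in nhds 0. \<psi> (\<phi> x) = x \<and> \<phi> (\<psi> x) = x)"

lemma lip_germ_filterlim: "lip_germ \<phi> \<Longrightarrow> filterlim \<phi> (nhds 0) (nhds 0)"
proof -
  assume "lip_germ \<phi>"
  then obtain L e where *: "\<phi> 0 = 0" "e > 0" "L-lipschitz_on (ball 0 e) \<phi>" unfolding lip_germ_def by blast
  then have "isCont \<phi> 0" using lipschitz_on_continuous_on continuous_on_eq_continuous_at by (metis centre_in_ball open_ball)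
  then have "(\<phi> \<longlongrightarrow> \<phi> 0) (nhds 0)" unfolding isCont_def tendsto_at_iff_tendsto_nhds .
  then show ?thesis using *(1) by simp
qed

lemma lip_germ_compose:
  assumes "lip_germ \<phi>" "lip_germ \<theta>"
  shows "lip_germ (\<lambda>x. \<theta> (\<phi> x))"
proof -
  obtain L e where \<phi>: "\<phi> 0 = 0" "e > 0" "L-lipschitz_on (ball 0 e) \<phi>" using assms unfolding lip_germ_def by blast
  obtain M d where \<theta>: "\<theta> 0 = 0" "d > 0" "M-lipschitz_on (ball 0 d) \<theta>" using assms unfolding lip_germ_def by blast
  have "\<forall>\<^sub>F y in nhds 0. y \<in> ball (0 :: complex ^ 'a) d" using \<theta>(2) by (intro eventually_nhds_in_open) auto
  then have "\<forall>\<^sub>F x in nhds 0. \<phi> x \<in> ball 0 d" 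
    by (rule eventually_compose_germ[OF lip_germ_filterlim[OF assms(1)]])
  then obtain r where r: "r > 0" "\<And>x. norm x < r \<Longrightarrow> \<phi> x \<in> ball 0 d" by (auto simp: eventually_nhds_metric)
  have "L-lipschitz_on (ball 0 (min e r)) \<phi>" by (rule lipschitz_on_subset[OF \<phi>(3)]) auto
  moreover have "M-lipschitz_on (\<phi> ` ball 0 (min e r)) \<theta>" by (rule lipschitz_on_subset[OF \<theta>(3)]) (use r in auto)
  ultimately have "(M * L)-lipschitz_on (ball 0 (min e r)) (\<theta> \<circ> \<phi>)" by (rule lipschitz_on_compose)
  then show ?thesis unfolding lip_germ_def using \<phi> \<theta> r
    by (intro conjI exI[of _ "M * L"] exI[of _ "min e r"]) (auto simp: o_def)
qed

lemma lip_pair_compose: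
  assumes "lip_pair \<phi> \<psi>" "lip_pair \<theta> \<omega>"
  shows "lip_pair (\<lambda>x. \<theta> (\<phi> x)) (\<lambda>x. \<psi> (\<omega> x))"
proof -
  have 1: "\<forall>\<^sub>F x in nhds 0. \<omega> (\<theta> (\<phi> x)) = \<phi> x \<and> \<theta> (\<omega> (\<phi> x)) = \<phi> x"
    by (rule eventually_compose_germ[OF lip_germ_filterlim]) (use assms in \<open>auto simp: lip_pair_def\<close>)
  have 2: "\<forall>\<^sub>F x in nhds 0. \<psi> (\<phi> (\<omega> x)) = \<omega> x \<and> \<phi> (\<psi> (\<omega> x)) = \<omega> x"
    by (rule eventually_compose_germ[OF lip_germ_filterlim]) (use assms in \<open>auto simp: lip_pair_def\<close>)
  have 3: "\<forall>\<^sub>F x in nhds 0. \<psi> (\<phi> x) = x \<and> \<phi> (\<psi> x) = x" "\<forall>\<^sub>F x in nhds 0. \<omega> (\<theta> x) = x \<and> \<theta> (\<omega> x) = x"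
    using assms by (auto simp: lip_pair_def)
  have "\<forall>\<^sub>F x in nhds 0. \<psi> (\<omega> (\<theta> (\<phi> x))) = x \<and> \<theta> (\<phi> (\<psi> (\<omega> x))) = x"
    using 1 2 3 by eventually_elim auto
  then show ?thesis using assms lip_germ_compose unfolding lip_pair_def by blast
qed

lemma lip_pair_sym: "lip_pair \<phi> \<psi> \<Longrightarrow> lip_pair \<psi> \<phi>"
  unfolding lip_pair_def by (auto elim: eventually_mono)

lemma holo_bounded_nhds:
  assumes "analytic_germ f"
  obtains \<delta> B where "\<delta> > 0" "B > 0" "\<forall>x. norm x < \<delta> \<longrightarrow> holo_at f x \<and> norm (f x) \<le> B"
proof -
  have "\<forall>\<^sub>F x in nhds 0. dist (f x) (f 0) < 1" using analytic_germ_tendsto[OF assms] by (rule tendstoD) simp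
  then have "\<forall>\<^sub>F x in nhds 0. holo_at f x \<and> norm (f x) \<le> norm (f 0) + 1"
    using analytic_germ_holoD[OF assms]
  proof eventually_elim
    case (elim x)
    then show ?case using norm_triangle_sub[of "f x" "f 0"] by (simp add: dist_norm)
  qed
  then obtain \<delta> where "\<delta> > 0" "\<forall>x. norm x < \<delta> \<longrightarrow> holo_at f x \<and> norm (f x) \<le> norm (f 0) + 1"
    by (auto simp: eventually_nhds_metric)
  then show thesis by (intro that[of \<delta> "norm (f 0) + 1"]) (auto simp: add_nonneg_pos)
qed

lemma analytic_derivative_bounded:
  assumes "analytic_germ f"
  obtains \<delta> B where "\<delta> > 0" "B > 0"
    "\<forall>x. norm x < \<delta> \<longrightarrow> (\<forall>v. norm (\<Sum>i\<in>UNIV. v $ i * partial_deriv i f x) \<le> B * norm v)"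
    "\<forall>x. norm x < \<delta> \<longrightarrow> holo_at f x"
proof -
  obtain \<delta> B where \<delta>: "\<delta> > 0" "B > 0" "\<forall>x. norm x < \<delta> \<longrightarrow> holo_at f x \<and> norm (f x) \<le> B"
    by (rule holo_bounded_nhds[OF assms])
  have "norm (\<Sum>i\<in>UNIV. v $ i * partial_deriv i f x) \<le> (2 * B / (\<delta> / 2)) * norm v" if x: "norm x < \<delta> / 2" for x v
  proof (rule holo_at_derivative_bound)
    have y: "norm y < \<delta>" if "y \<in> ball x (\<delta> / 2)" for y
      using that x norm_triangle_sub[of y x] by (auto simp: dist_norm norm_minus_commute)
    show "holo_at f y" "norm (f y) \<le> B" if "y \<in> ball x (\<delta> / 2)" for y using \<delta> y[OF that] by auto
    show "(f has_derivative (\<lambda>v. \<Sum>i\<in>UNIV. v $ i * partial_deriv i f x)) (at x)"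
      by (rule holo_at_has_derivative) (use \<delta> x in auto)
  qed (use \<delta> in auto)
  then show thesis using \<delta> by (intro that[of "\<delta> / 2" "2 * B / (\<delta> / 2)"]) auto
qed

lemma lip_germ_if_analytic:
  fixes \<phi> :: "complex ^ 'n::finite \<Rightarrow> complex ^ 'n"
  assumes "\<And>i. analytic_germ (\<lambda>x. \<phi> x $ i)" "\<phi> 0 = 0"
  shows "lip_germ \<phi>"
proof -
  have "\<exists>e B. e > 0 \<and> B > 0 \<and> (\<forall>x\<in>ball 0 e. \<forall>y\<in>ball 0 e. norm (\<phi> x $ i - \<phi> y $ i) \<le> B * norm (x - y))" for i
  proof -
    obtain \<delta> B where \<delta>: "\<delta> > 0" "B > 0"
      "\<forall>x. norm x < \<delta> \<longrightarrow> (\<forall>v. norm (\<Sum>j\<in>UNIV. v $ j * partial_deriv j (\<lambda>x. \<phi> x $ i) x) \<le> B * norm v)"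
      "\<forall>x. norm x < \<delta> \<longrightarrow> holo_at (\<lambda>x. \<phi> x $ i) x"
      by (rule analytic_derivative_bounded[OF assms(1)])
    have "norm (\<phi> x $ i - \<phi> y $ i) \<le> B * norm (x - y)" if "x \<in> ball 0 \<delta>" "y \<in> ball 0 \<delta>" for x y :: "complex ^ 'n"
    proof (rule differentiable_bound[OF convex_ball _ _ that(1,2)])
      fix z assume z: "z \<in> ball (0 :: complex ^ 'n) \<delta>"
      show "((\<lambda>x. \<phi> x $ i) has_derivative (\<lambda>v. \<Sum>j\<in>UNIV. v $ j * partial_deriv j (\<lambda>x. \<phi> x $ i) z)) (at z within ball 0 \<delta>)"
        by (rule has_derivative_at_withinI, rule holo_at_has_derivative) (use \<delta> z in auto)
      show "onorm (\<lambda>v. \<Sum>j\<in>UNIV. v $ j * partial_deriv j (\<lambda>x. \<phi> x $ i) z) \<le> B"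
        by (rule onorm_bound) (use \<delta> z in auto)
    qed
    with \<delta> show ?thesis by blast
  qed
  then obtain e B where eB: "\<And>i. e i > 0" "\<And>i. B i > 0"
    "\<And>i x y. x \<in> ball 0 (e i) \<Longrightarrow> y \<in> ball 0 (e i) \<Longrightarrow> norm (\<phi> x $ i - \<phi> y $ i) \<le> B i * norm (x - y)"
    by metis
  define d where "d = Min (range e)"
  have d: "d > 0" "d \<le> e i" for i using eB(1) by (auto simp: d_def)
  have "(\<Sum>i\<in>UNIV. B i)-lipschitz_on (ball 0 d) \<phi>"
  proof (rule lipschitz_onI)
    fix x y :: "complex ^ 'n" assume xy: "x \<in> ball 0 d" "y \<in> ball 0 d"
    have "dist (\<phi> x) (\<phi> y) \<le> (\<Sum>i\<in>UNIV. norm (\<phi> x $ i - \<phi> y $ i))"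
      unfolding dist_norm norm_vec_def by (rule order_trans[OF L2_set_le_sum]) auto
    also have "\<dots> \<le> (\<Sum>i\<in>UNIV. B i * norm (x - y))"
    proof (rule sum_mono)
      fix i show "norm (\<phi> x $ i - \<phi> y $ i) \<le> B i * norm (x - y)"
        by (rule eB(3)) (use xy d(2)[of i] in auto)
    qed
    finally show "dist (\<phi> x) (\<phi> y) \<le> (\<Sum>i\<in>UNIV. B i) * dist x y" by (simp add: dist_norm sum_distrib_right)
  qed (use eB(2) in \<open>auto intro: sum_nonneg less_imp_le\<close>)
  then show ?thesis using d(1) assms(2) unfolding lip_germ_def by blast
qed

lemma lip_pair_if_biholo:
  assumes "\<And>i. analytic_germ (\<lambda>x. \<phi> x $ i)" "\<phi> 0 = 0" "\<psi> 0 = 0" "\<And>i. analytic_germ (\<lambda>x. \<psi> x $ i)"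
    "\<forall>\<^sub>F x in nhds 0. \<psi> (\<phi> x) = x \<and> \<phi> (\<psi> x) = x"
  shows "lip_pair \<phi> \<psi>"
  using assms lip_germ_if_analytic unfolding lip_pair_def by blast

lemma bilipschitz_germ_lip_pair:
  assumes "bilipschitz_germ \<phi>"
  obtains \<psi> where "lip_pair \<phi> \<psi>"
proof -
  obtain U V \<psi> L where *: "\<phi> 0 = 0" "open U" "0 \<in> U" "open V" "homeomorphism U V \<phi> \<psi>"
    "L-lipschitz_on U \<phi>" "L-lipschitz_on V \<psi>" using assms unfolding bilipschitz_germ_def by blast
  have V0: "0 \<in> V" using * unfolding homeomorphism_def by force
  have \<psi>0: "\<psi> 0 = 0" using * unfolding homeomorphism_def by force
  obtain e where e: "e > 0" "ball 0 e \<subseteq> U" using *(2,3) open_contains_ball by blast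
  obtain d where d: "d > 0" "ball 0 d \<subseteq> V" using *(4) V0 open_contains_ball by blast
  have "lip_germ \<phi>" unfolding lip_germ_def using * e lipschitz_on_subset by blast
  moreover have "lip_germ \<psi>" unfolding lip_germ_def using * d \<psi>0 lipschitz_on_subset by blast
  moreover have "\<forall>\<^sub>F x in nhds 0. \<psi> (\<phi> x) = x \<and> \<phi> (\<psi> x) = x"
    using eventually_nhds_in_open[OF *(2,3)] eventually_nhds_in_open[OF *(4) V0]
    by eventually_elim (use *(5) in \<open>auto simp: homeomorphism_def\<close>)
  ultimately show thesis using that unfolding lip_pair_def by blast
qed

section \<open>Decomposition of germs with vanishing 6-jet\<close>

definition expo :: "'n \<Rightarrow> 'n \<Rightarrow> nat \<Rightarrow> nat \<Rightarrow> 'n::finite \<Rightarrow> nat" where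
  "expo i j a b k = (if k = i then a else if k = j then b else 0)"

lemma mon_expo: "i \<noteq> j \<Longrightarrow> mon (expo i j a b) x = x $ i ^ a * x $ j ^ b"
proof -
  assume ij: "i \<noteq> j"
  have "mon (expo i j a b) x = (\<Prod>k\<in>{i,j}. x $ k ^ expo i j a b k)"
    unfolding mon_def by (rule prod.mono_neutral_right) (auto simp: expo_def)
  then show ?thesis using ij by (simp add: expo_def)
qed

lemma mdeg_expo: "i \<noteq> j \<Longrightarrow> mdeg (expo i j a b) = a + b"
proof -
  assume ij: "i \<noteq> j"
  have "mdeg (expo i j a b) = (\<Sum>k\<in>{i,j}. expo i j a b k)"
    unfolding mdeg_def by (rule sum.mono_neutral_right) (auto simp: expo_def)
  then show ?thesis using ij by (simp add: expo_def)
qed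

definition unit_expo :: "'n \<Rightarrow> 'n::finite \<Rightarrow> nat" where
  "unit_expo k = (\<lambda>m. if m = k then 1 else 0)"

lemma mon_unit_expo: "mon (unit_expo k) x = x $ k"
proof -
  have "mon (unit_expo k) x = (\<Prod>m\<in>{k}. x $ m ^ unit_expo k m)"
    unfolding mon_def by (rule prod.mono_neutral_right) (auto simp: unit_expo_def)
  then show ?thesis by (simp add: unit_expo_def)
qed

lemma mdeg_unit_expo: "mdeg (unit_expo k) = 1"
  by (simp add: mdeg_def unit_expo_def)

lemma power_series_at_0:
  assumes "has_power_series f a"
  shows "f 0 = a (\<lambda>_. 0)"
proof -
  have "((\<lambda>\<alpha>. a \<alpha> * mon \<alpha> 0) has_sum f 0) UNIV"
    using assms unfolding has_power_series_def by (rule eventually_nhds_x_imp_x)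
  moreover have "((\<lambda>\<alpha>. a \<alpha> * mon \<alpha> 0) has_sum a (\<lambda>_. 0)) UNIV"
    by (rule has_sum_finite_neutralI[where B = "{\<lambda>_. 0}"]) (auto simp: mon_def fun_eq_iff)
  ultimately show ?thesis by (rule has_sum_unique)
qed

lemma has_power_series_mon: "has_power_series (\<lambda>x. c * mon \<alpha> x) (\<lambda>\<beta>. if \<beta> = \<alpha> then c else 0)"
proof -
  have "((\<lambda>\<beta>. (if \<beta> = \<alpha> then c else 0) * mon \<beta> x) has_sum c * mon \<alpha> x) UNIV" for x
    by (rule has_sum_finite_neutralI[where B = "{\<alpha>}"]) auto
  then show ?thesis by (simp add: has_power_series_def)
qed

lemma has_power_series_sum:
  "finite A \<Longrightarrow> (\<And>c. c \<in> A \<Longrightarrow> has_power_series (f c) (a c)) \<Longrightarrow>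
    has_power_series (\<lambda>x. \<Sum>c\<in>A. f c x) (\<lambda>\<alpha>. \<Sum>c\<in>A. a c \<alpha>)"
proof (induction A rule: finite_induct)
  case empty
  then show ?case by (simp add: has_power_series_def)
next
  case (insert c A)
  then show ?case using has_power_series_add[of "f c" "a c"] by simp
qed

lemma mdeg_split:
  assumes "i \<noteq> j"
  shows "mdeg \<alpha> = \<alpha> i + \<alpha> j + (\<Sum>k\<in>-{i,j}. \<alpha> k)"
proof -
  have "UNIV = {i,j} \<union> -{i,j}" by auto
  then have "mdeg \<alpha> = (\<Sum>k\<in>{i,j}. \<alpha> k) + (\<Sum>k\<in>-{i,j}. \<alpha> k)"
    unfolding mdeg_def by (metis finite sum.union_disjoint Compl_disjoint)
  then show ?thesis using assms by simp
qed

text \<open>Labels for monomials that generate all but six of the monomials of degree at least 7.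
  With x, y for the coordinates i, j and z for the others, they stand for y^6, for x^4 y^5, x^5 y^3,
  x^6 y, x^7, for z_k x^(6-b) y^b, and for z_k z_l.\<close>

datatype 'n jet_class = CY | CX nat | CZ 'n nat | CZZ 'n 'n

primrec class_expo :: "'n \<Rightarrow> 'n \<Rightarrow> 'n jet_class \<Rightarrow> 'n::finite \<Rightarrow> nat" where
  "class_expo i j CY = expo i j 0 6"
| "class_expo i j (CX m) = expo i j ([4,5,6,7] ! m) ([5,3,1,0] ! m)"
| "class_expo i j (CZ k b) = (\<lambda>m. unit_expo k m + expo i j (6 - b) b m)"
| "class_expo i j (CZZ k l) = (\<lambda>m. unit_expo k m + unit_expo l m)"

text \<open>The six monomials x^a y^b with a + b >= 7 and b < 6 that no \<open>CX\<close> generator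
  divides; equivalently, those with 2a + b < 13.\<close>

definition low_expos :: "(nat \<times> nat) set" where
  "low_expos = {(2,5),(3,5),(3,4),(4,4),(4,3),(5,2)}"

lemma low_expos_cases:
  assumes "(x, y) \<notin> low_expos" "x + y \<ge> 7" "y < 6"
  shows "(x \<ge> 4 \<and> y \<ge> 5) \<or> (x \<ge> 5 \<and> y \<ge> 3) \<or> (x \<ge> 6 \<and> y \<ge> 1) \<or> x \<ge> 7"
proof -
  have n: "\<not> (x = 2 \<and> y = 5)" "\<not> (x = 3 \<and> y = 5)" "\<not> (x = 3 \<and> y = 4)" "\<not> (x = 4 \<and> y = 4)"
    "\<not> (x = 4 \<and> y = 3)" "\<not> (x = 5 \<and> y = 2)"
    using assms(1) by (auto simp: low_expos_def)
  consider "y = 0" | "y = 1" | "y = 2" | "y = 3" | "y = 4" | "y = 5" using assms(3) by linarith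
  then show ?thesis
    by cases (use n assms(2) in presburger)+
qed

lemma class_expo_exists:
  assumes ij: "i \<noteq> j" and d: "mdeg \<alpha> \<ge> 7" and low: "\<And>a b. (a,b) \<in> low_expos \<Longrightarrow> \<alpha> \<noteq> expo i j a b"
  shows "\<exists>c\<in>{CY} \<union> CX ` {..<4} \<union> case_prod CZ ` ((-{i,j}) \<times> {..<6}) \<union> case_prod CZZ ` ((-{i,j}) \<times> (-{i,j})).
    \<forall>m. class_expo i j c m \<le> \<alpha> m"
proof -
  let ?C = "{CY} \<union> CX ` {..<4} \<union> case_prod CZ ` ((-{i,j}) \<times> {..<6}) \<union> case_prod CZZ ` ((-{i,j}) \<times> (-{i,j}))"
  consider (y) "\<alpha> j \<ge> 6" | (zz) k l where "k \<in> -{i,j}" "l \<in> -{i,j}" "k \<noteq> l" "\<alpha> k \<ge> 1" "\<alpha> l \<ge> 1"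
    | (z2) k where "k \<in> -{i,j}" "\<alpha> k \<ge> 2"
    | (z1) k where "\<alpha> j < 6" "k \<in> -{i,j}" "\<alpha> k = 1" "\<And>l. l \<in> -{i,j} - {k} \<Longrightarrow> \<alpha> l = 0"
    | (z0) "\<alpha> j < 6" "\<And>l. l \<in> -{i,j} \<Longrightarrow> \<alpha> l = 0"
  proof (cases "\<alpha> j \<ge> 6 \<or> (\<exists>k\<in>-{i,j}. \<alpha> k \<ge> 2) \<or> (\<exists>k\<in>-{i,j}. \<exists>l\<in>-{i,j}. k \<noteq> l \<and> \<alpha> k \<ge> 1 \<and> \<alpha> l \<ge> 1)")
    case True
    then show thesis using y zz z2 by blast
  next
    case False
    show thesis
    proof (cases "\<exists>k\<in>-{i,j}. \<alpha> k \<noteq> 0")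
      case True
      then obtain k where k: "k \<in> -{i,j}" "\<alpha> k \<noteq> 0" by blast
      have "\<alpha> k = 1" using False k by (metis One_nat_def Suc_1 le_neq_implies_less less_2_cases not_le_imp_less leI)
      moreover have "\<alpha> l = 0" if "l \<in> -{i,j} - {k}" for l
        using False k that by (metis Diff_iff insertI1 less_one not_le)
      ultimately show thesis using z1 k False by (metis not_le_imp_less)
    qed (use z0 False in auto)
  qed
  then show ?thesis
  proof cases
    case y
    then show ?thesis by (intro bexI[of _ CY]) (auto simp: expo_def)
  next
    case zz
    then show ?thesis by (intro bexI[of _ "CZZ k l"]) (auto simp: unit_expo_def)
  next
    case z2
    then show ?thesis by (intro bexI[of _ "CZZ k k"]) (auto simp: unit_expo_def)
  next
    case z1
    \<comment> \<open>A single factor z_k leaves degree at least 6 for x and y; as the exponent b of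
      y is below 6, the exponent of x is at least 6 - b.\<close>
    have "(\<Sum>l\<in>-{i,j}. \<alpha> l) = (\<Sum>l\<in>{k}. \<alpha> l)"
      by (rule sum.mono_neutral_right) (use z1 in auto)
    then have "\<alpha> i + \<alpha> j \<ge> 6" using d mdeg_split[OF ij, of \<alpha>] z1 by simp
    then show ?thesis using z1
      by (intro bexI[of _ "CZ k (\<alpha> j)"]) (auto simp: unit_expo_def expo_def)
  next
    case z0
    then have s: "\<alpha> i + \<alpha> j \<ge> 7" using d mdeg_split[OF ij, of \<alpha>] by simp
    have eq: "\<alpha> = expo i j (\<alpha> i) (\<alpha> j)" using z0 by (auto simp: expo_def fun_eq_iff)
    have nl: "(\<alpha> i, \<alpha> j) \<notin> low_expos" using low eq by blast
    have "\<exists>m<4. [4,5,6,7] ! m \<le> \<alpha> i \<and> [5,3,1,0] ! m \<le> \<alpha> j"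
    proof -
      have "(\<alpha> i \<ge> 4 \<and> \<alpha> j \<ge> 5) \<or> (\<alpha> i \<ge> 5 \<and> \<alpha> j \<ge> 3) \<or> (\<alpha> i \<ge> 6 \<and> \<alpha> j \<ge> 1) \<or> \<alpha> i \<ge> 7"
        by (rule low_expos_cases[OF nl s z0(1)])
      then show ?thesis
      proof (elim disjE)
        assume "\<alpha> i \<ge> 4 \<and> \<alpha> j \<ge> 5" then show ?thesis by (intro exI[of _ 0]) auto
      next
        assume "\<alpha> i \<ge> 5 \<and> \<alpha> j \<ge> 3" then show ?thesis by (intro exI[of _ 1]) auto
      next
        assume "\<alpha> i \<ge> 6 \<and> \<alpha> j \<ge> 1" then show ?thesis by (intro exI[of _ 2]) auto
      next
        assume "\<alpha> i \<ge> 7" then show ?thesis by (intro exI[of _ 3]) auto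
      qed
    qed
    then obtain m where m: "m < 4" "[4,5,6,7] ! m \<le> \<alpha> i" "[5,3,1,0] ! m \<le> \<alpha> j" by blast
    show ?thesis by (rule bexI[of _ "CX m"]) (use m in \<open>auto simp: expo_def\<close>)
  qed
qed

text \<open>The factors \<open>fA\<close> and \<open>fz\<close> vanish at 0 because their generators
  have degree 6 and 2: a constant term would give g a monomial of degree below 7.\<close>

lemma zero_6jet_decomposition:
  fixes g :: "complex ^ 'n::finite \<Rightarrow> complex"
  assumes ij: "i \<noteq> j" and g: "has_power_series g a" and z: "\<And>\<alpha>. mdeg \<alpha> \<le> 6 \<Longrightarrow> a \<alpha> = 0"
  shows "\<exists>c fA fx fq fz. analytic_germ fA \<and> fA 0 = 0 \<and> (\<forall>m. analytic_germ (fx m)) \<and>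
    (\<forall>k b. analytic_germ (fq k b)) \<and> (\<forall>k l. analytic_germ (fz k l) \<and> fz k l 0 = 0) \<and>
    (\<forall>\<^sub>F p in nhds 0. g p = (p $ j)^6 * fA p + (\<Sum>(a,b)\<in>low_expos. c a b * ((p $ i)^a * (p $ j)^b))
      + (\<Sum>m<4. (p $ i)^([4,5,6,7] ! m) * (p $ j)^([5,3,1,0] ! m) * fx m p)
      + (\<Sum>k\<in>-{i,j}. \<Sum>b<6. p $ k * ((p $ i)^(6 - b) * (p $ j)^b) * fq k b p)
      + (\<Sum>k\<in>-{i,j}. \<Sum>l\<in>-{i,j}. p $ k * p $ l * fz k l p))"
proof -
  let ?C = "{CY} \<union> CX ` {..<4} \<union> case_prod CZ ` ((-{i,j}) \<times> {..<6}) \<union> case_prod CZZ ` ((-{i,j}) \<times> (-{i,j})) :: 'n jet_class set"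
  define c where "c x y = a (expo i j x y)" for x y
  have fl: "finite low_expos" by (simp add: low_expos_def)
  have inj: "expo i j x y = expo i j x' y' \<longleftrightarrow> x = x' \<and> y = y'" for x y x' y'
  proof
    assume "expo i j x y = expo i j x' y'"
    from fun_cong[OF this, of i] fun_cong[OF this, of j] ij show "x = x' \<and> y = y'" by (simp add: expo_def)
  qed simp
  let ?P = "\<lambda>p. \<Sum>(x,y)\<in>low_expos. c x y * ((p $ i)^x * (p $ j)^y)"
  let ?pc = "\<lambda>\<alpha>. \<Sum>(x,y)\<in>low_expos. if \<alpha> = expo i j x y then c x y else 0"
  have P: "has_power_series ?P ?pc"
    using has_power_series_sum[OF fl, of "\<lambda>q p. c (fst q) (snd q) * mon (expo i j (fst q) (snd q)) p"
        "\<lambda>q \<alpha>. if \<alpha> = expo i j (fst q) (snd q) then c (fst q) (snd q) else 0", OF has_power_series_mon]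
    by (simp add: mon_expo[OF ij] case_prod_beta)
  have pc: "?pc \<alpha> = (if \<exists>q\<in>low_expos. \<alpha> = expo i j (fst q) (snd q) then a \<alpha> else 0)" for \<alpha>
  proof (cases "\<exists>q\<in>low_expos. \<alpha> = expo i j (fst q) (snd q)")
    case True
    then obtain x y where q: "(x,y) \<in> low_expos" "\<alpha> = expo i j x y" by force
    have "?pc \<alpha> = (\<Sum>q\<in>low_expos. if (x,y) = q then c x y else 0)"
      unfolding q(2) by (rule sum.cong) (auto simp: inj split: if_splits)
    then show ?thesis using True q fl by (simp add: c_def)
  next
    case False
    then have "?pc \<alpha> = (\<Sum>q\<in>low_expos. 0)" by (intro sum.cong) auto
    then show ?thesis using False by simp
  qed
  define a' where "a' \<alpha> = a \<alpha> - ?pc \<alpha>" for \<alpha>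
  have h0: "has_power_series (\<lambda>p. g p - ?P p) a'"
    unfolding a'_def by (rule has_power_series_diff[OF g P])
  have a'deg: "mdeg \<alpha> \<ge> 7" if "a' \<alpha> \<noteq> 0" for \<alpha>
    using that z[of \<alpha>] by (cases "mdeg \<alpha> \<le> 6") (auto simp: a'_def pc split: if_splits)
  have cl: "\<exists>c\<in>?C. \<forall>m. class_expo i j c m \<le> \<alpha> m" if "a' \<alpha> \<noteq> 0" for \<alpha>
  proof (rule class_expo_exists[OF ij a'deg[OF that]])
    fix x y assume "(x,y) \<in> low_expos"
    then have "\<alpha> = expo i j x y \<Longrightarrow> \<exists>q\<in>low_expos. \<alpha> = expo i j (fst q) (snd q)" by force
    then have "\<alpha> = expo i j x y \<Longrightarrow> a' \<alpha> = 0" unfolding a'_def pc by (simp only: if_True diff_self)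
    then show "\<alpha> \<noteq> expo i j x y" using that by blast
  qed
  have fin: "finite ?C" by auto
  have "\<exists>h. (\<forall>c\<in>?C. analytic_germ (h c) \<and> (\<forall>\<beta>. taylor_coeff (h c) \<beta> \<noteq> 0 \<longrightarrow> a' (\<lambda>m. \<beta> m + class_expo i j c m) \<noteq> 0)) \<and>
    (\<forall>\<^sub>F p in nhds 0. g p - ?P p = (\<Sum>c\<in>?C. mon (class_expo i j c) p * h c p))"
    by (rule power_series_decomposition[OF h0 fin]) (rule cl)
  then obtain h where H: "\<forall>c\<in>?C. analytic_germ (h c) \<and> (\<forall>\<beta>. taylor_coeff (h c) \<beta> \<noteq> 0 \<longrightarrow> a' (\<lambda>m. \<beta> m + class_expo i j c m) \<noteq> 0)"
    and hs: "\<forall>\<^sub>F p in nhds 0. g p - ?P p = (\<Sum>c\<in>?C. mon (class_expo i j c) p * h c p)" by blast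
  have h1: "analytic_germ (h c)" if "c \<in> ?C" for c using bspec[OF H that] by blast
  have h2: "a' (\<lambda>m. \<beta> m + class_expo i j c m) \<noteq> 0" if "c \<in> ?C" "taylor_coeff (h c) \<beta> \<noteq> 0" for c \<beta>
    using bspec[OF H that(1)] that(2) by blast
  \<comment> \<open>Extension by 0 to all labels, so that the assertions hold for all indices and
    not only for those in \<open>?C\<close>.\<close>
  define h' where "h' c = (if c \<in> ?C then h c else (\<lambda>_. 0))" for c
  have h'0: "h' c 0 = 0" if "mdeg (class_expo i j c) < 7" for c
  proof (cases "c \<in> ?C")
    case True
    have "taylor_coeff (h c) (\<lambda>_. 0) = 0"
      using h2[OF True, of "\<lambda>_. 0"] a'deg[of "class_expo i j c"] that by fastforce
    then show ?thesis
      using power_series_at_0[OF has_power_series_taylor[OF h1[OF True]]] True by (simp add: h'_def)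
  qed (simp add: h'_def)
  have h'an: "analytic_germ (h' c)" for c using h1 by (simp only: h'_def analytic_germ_const split: if_split) blast
  have mY: "mon (class_expo i j CY) p = (p $ j)^6" for p by (simp add: mon_expo[OF ij])
  have mX: "mon (class_expo i j (CX m)) p = (p $ i)^([4,5,6,7] ! m) * (p $ j)^([5,3,1,0] ! m)" for p m
    by (simp add: mon_expo[OF ij])
  have mZ: "mon (class_expo i j (CZ k b)) p = p $ k * ((p $ i)^(6 - b) * (p $ j)^b)" for p k b
    by (simp add: mon_add mon_unit_expo mon_expo[OF ij])
  have mZZ: "mon (class_expo i j (CZZ k l)) p = p $ k * p $ l" for p k l
    by (simp add: mon_add mon_unit_expo)
  have split: "(\<Sum>c\<in>?C. mon (class_expo i j c) p * h c p) =
      (p $ j)^6 * h' CY p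
      + (\<Sum>m<4. (p $ i)^([4,5,6,7] ! m) * (p $ j)^([5,3,1,0] ! m) * h' (CX m) p)
      + (\<Sum>k\<in>-{i,j}. \<Sum>b<6. p $ k * ((p $ i)^(6 - b) * (p $ j)^b) * h' (CZ k b) p)
      + (\<Sum>k\<in>-{i,j}. \<Sum>l\<in>-{i,j}. p $ k * p $ l * h' (CZZ k l) p)" for p
  proof -
    let ?f = "\<lambda>c. mon (class_expo i j c) p * h' c p"
    have "(\<Sum>c\<in>?C. mon (class_expo i j c) p * h c p) = sum ?f ?C"
      by (rule sum.cong) (auto simp: h'_def)
    also have "\<dots> = sum ?f {CY} + sum ?f (CX ` {..<4}) + sum ?f (case_prod CZ ` ((-{i,j}) \<times> {..<6}))
        + sum ?f (case_prod CZZ ` ((-{i,j}) \<times> (-{i,j})))"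
      by (subst sum.union_disjoint, (auto)[3])+ simp
    also have "sum ?f {CY} = (p $ j)^6 * h' CY p" using mY by simp
    also have "sum ?f (CX ` {..<4}) = (\<Sum>m<4. (p $ i)^([4,5,6,7] ! m) * (p $ j)^([5,3,1,0] ! m) * h' (CX m) p)"
      by (subst sum.reindex) (auto simp: inj_on_def mX simp del: class_expo.simps)
    also have "sum ?f (case_prod CZ ` ((-{i,j}) \<times> {..<6})) =
      (\<Sum>k\<in>-{i,j}. \<Sum>b<6. p $ k * ((p $ i)^(6 - b) * (p $ j)^b) * h' (CZ k b) p)"
      by (subst sum.reindex, force simp: inj_on_def, subst sum.cartesian_product)
        (auto simp: mZ case_prod_beta simp del: class_expo.simps)
    also have "sum ?f (case_prod CZZ ` ((-{i,j}) \<times> (-{i,j}))) =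
      (\<Sum>k\<in>-{i,j}. \<Sum>l\<in>-{i,j}. p $ k * p $ l * h' (CZZ k l) p)"
      by (subst sum.reindex, force simp: inj_on_def, subst sum.cartesian_product)
        (auto simp: mZZ case_prod_beta simp del: class_expo.simps)
    finally show ?thesis .
  qed
  have d: "mdeg (class_expo i j CY) < 7" "mdeg (class_expo i j (CZZ k l)) < 7" for k l
    by (simp_all add: mdeg_expo[OF ij] mdeg_add mdeg_unit_expo)
  have "\<forall>\<^sub>F p in nhds 0. g p = (p $ j)^6 * h' CY p + ?P p
      + (\<Sum>m<4. (p $ i)^([4,5,6,7] ! m) * (p $ j)^([5,3,1,0] ! m) * h' (CX m) p)
      + (\<Sum>k\<in>-{i,j}. \<Sum>b<6. p $ k * ((p $ i)^(6 - b) * (p $ j)^b) * h' (CZ k b) p)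
      + (\<Sum>k\<in>-{i,j}. \<Sum>l\<in>-{i,j}. p $ k * p $ l * h' (CZZ k l) p)"
    using hs unfolding split by eventually_elim (simp only: diff_eq_eq add_ac)
  then show ?thesis
    using h'an h'0[OF d(1)] h'0[OF d(2)]
    by (intro exI[of _ c] exI[of _ "h' CY"] exI[of _ "\<lambda>m. h' (CX m)"] exI[of _ "\<lambda>k b. h' (CZ k b)"]
        exI[of _ "\<lambda>k l. h' (CZZ k l)"] conjI allI)
qed

section \<open>Orders of magnitude along a real parameter\<close>

text \<open>The filter stays arbitrary because estimates obtained at 0 from the right are later
  restricted to those parameters for which the image points lie on fixed branches.\<close>

definition Ot :: "real filter \<Rightarrow> nat \<Rightarrow> (real \<Rightarrow> complex) \<Rightarrow> bool" where
  "Ot G k f \<longleftrightarrow> (\<exists>C. \<forall>\<^sub>F t in G. norm (f t) \<le> C * t ^ k)"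

lemma OtE:
  assumes "Ot G k f" and pos: "\<forall>\<^sub>F t in G. t > 0"
  obtains C where "C > 0" "\<forall>\<^sub>F t in G. norm (f t) \<le> C * t ^ k"
proof -
  obtain C where C: "\<forall>\<^sub>F t in G. norm (f t) \<le> C * t ^ k" using assms(1) by (auto simp: Ot_def)
  have "\<forall>\<^sub>F t in G. norm (f t) \<le> (\<bar>C\<bar> + 1) * t ^ k"
    using C pos
  proof eventually_elim
    case (elim t)
    have "C * t ^ k \<le> (\<bar>C\<bar> + 1) * t ^ k" using elim by (intro mult_right_mono) auto
    with elim show ?case by linarith
  qed
  then show thesis using that[of "\<bar>C\<bar> + 1"] by simp
qed

lemma Ot_add: "Ot G k f \<Longrightarrow> Ot G k g \<Longrightarrow> Ot G k (\<lambda>t. f t + g t)"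
proof -
  assume "Ot G k f" "Ot G k g"
  then obtain C D where "\<forall>\<^sub>F t in G. norm (f t) \<le> C * t ^ k" "\<forall>\<^sub>F t in G. norm (g t) \<le> D * t ^ k"
    by (auto simp: Ot_def)
  then have "\<forall>\<^sub>F t in G. norm (f t + g t) \<le> (C + D) * t ^ k"
    by eventually_elim (auto simp: distrib_right intro: norm_triangle_le)
  then show ?thesis unfolding Ot_def by blast
qed

lemma Ot_mult: "Ot G k f \<Longrightarrow> Ot G l g \<Longrightarrow> Ot G (k + l) (\<lambda>t. f t * g t)"
proof -
  assume "Ot G k f" "Ot G l g"
  then obtain C D where "\<forall>\<^sub>F t in G. norm (f t) \<le> C * t ^ k" "\<forall>\<^sub>F t in G. norm (g t) \<le> D * t ^ l"
    by (auto simp: Ot_def)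
  then have "\<forall>\<^sub>F t in G. norm (f t * g t) \<le> (C * D) * t ^ (k + l)"
  proof eventually_elim
    case (elim t)
    have "norm (f t) * norm (g t) \<le> (C * t ^ k) * (D * t ^ l)"
      by (rule mult_mono[OF elim]) (use order_trans[OF norm_ge_zero elim(1)] in auto)
    then show ?case by (simp add: norm_mult power_add mult_ac)
  qed
  then show ?thesis unfolding Ot_def by blast
qed

lemma Ot_const [simp]: "Ot G 0 (\<lambda>_. c)"
  unfolding Ot_def by (intro exI[of _ "norm c"]) simp

lemma Ot_zero [simp]: "Ot G k (\<lambda>_. 0)"
  unfolding Ot_def by (intro exI[of _ 0]) simp

lemma Ot_cmult: "Ot G k f \<Longrightarrow> Ot G k (\<lambda>t. c * f t)"
  using Ot_mult[OF Ot_const[of G c], of k f] by simp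

lemma Ot_uminus: "Ot G k f \<Longrightarrow> Ot G k (\<lambda>t. - f t)"
  using Ot_cmult[of G k f "-1"] by simp

lemma Ot_diff: "Ot G k f \<Longrightarrow> Ot G k g \<Longrightarrow> Ot G k (\<lambda>t. f t - g t)"
  using Ot_add[OF _ Ot_uminus[of G k g], of f] by simp

lemma Ot_power: "Ot G k f \<Longrightarrow> Ot G (n * k) (\<lambda>t. f t ^ n)"
  by (induction n) (auto intro: Ot_mult)

lemma Ot_sum: "(\<And>a. a \<in> A \<Longrightarrow> Ot G k (f a)) \<Longrightarrow> Ot G k (\<lambda>t. \<Sum>a\<in>A. f a t)"
  by (induction A rule: infinite_finite_induct) (auto intro: Ot_add)

lemma Ot_mono:
  assumes "Ot G k f" "l \<le> k" and pos: "\<forall>\<^sub>F t in G. 0 < t \<and> t < 1"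
  shows "Ot G l f"
proof -
  obtain C where C: "C > 0" "\<forall>\<^sub>F t in G. norm (f t) \<le> C * t ^ k"
    by (rule OtE[OF assms(1)]) (use pos in \<open>auto elim: eventually_mono\<close>)
  have "\<forall>\<^sub>F t in G. norm (f t) \<le> C * t ^ l"
    using C(2) pos
  proof eventually_elim
    case (elim t)
    have "C * t ^ k \<le> C * t ^ l" using elim C(1) assms(2) by (intro mult_left_mono power_decreasing) auto
    with elim show ?case by linarith
  qed
  then show ?thesis unfolding Ot_def by blast
qed

lemma Ot_cong: "\<forall>\<^sub>F t in G. f t = g t \<Longrightarrow> Ot G k f \<Longrightarrow> Ot G k g"
  unfolding Ot_def by (elim exE) (rule exI, erule (1) eventually_elim2, simp)

lemma Ot_of_real: "\<forall>\<^sub>F t in G. t > 0 \<Longrightarrow> Ot G 1 (\<lambda>t. of_real t)"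
  unfolding Ot_def by (intro exI[of _ 1]) (auto elim: eventually_mono)

lemma Ot_filter_mono: "Ot G k f \<Longrightarrow> G' \<le> G \<Longrightarrow> Ot G' k f"
  unfolding Ot_def using filter_leD by blast


lemma Ot_tendsto_0:
  assumes f: "Ot G (Suc k) f" and lim: "((\<lambda>t. t) \<longlongrightarrow> 0) G"
  shows "(f \<longlongrightarrow> 0) G"
proof -
  obtain C where C: "\<forall>\<^sub>F t in G. norm (f t) \<le> C * t ^ Suc k" using f by (auto simp: Ot_def)
  have "((\<lambda>t. C * t ^ Suc k) \<longlongrightarrow> C * 0 ^ Suc k) G" by (intro tendsto_intros lim)
  then show ?thesis by (intro Lim_null_comparison[OF C]) simp
qed

lemma Ot_divide_power:
  assumes "Ot G (k + l) f" and pos: "\<forall>\<^sub>F t in G. t > 0"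
  shows "Ot G k (\<lambda>t. f t / of_real t ^ l)"
proof -
  obtain C where C: "\<forall>\<^sub>F t in G. norm (f t) \<le> C * t ^ (k + l)" using assms(1) by (auto simp: Ot_def)
  have "\<forall>\<^sub>F t in G. norm (f t / of_real t ^ l) \<le> C * t ^ k"
    using C pos by eventually_elim (simp add: norm_divide norm_power power_add field_simps)
  then show ?thesis unfolding Ot_def by blast
qed

text \<open>If X were much larger than t^3, then X^2 would dominate both terms on the right-hand
  side.\<close>

lemma Ot_quadratic:
  assumes \<alpha>: "Ot G 3 \<alpha>" and \<beta>: "Ot G 6 \<beta>" and pos: "\<forall>\<^sub>F t in G. t > 0"
    and eq: "\<forall>\<^sub>F t in G. X t ^ 2 = X t * \<alpha> t + \<beta> t"
  shows "Ot G 3 X"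
proof -
  obtain A where A: "A > 0" "\<forall>\<^sub>F t in G. norm (\<alpha> t) \<le> A * t ^ 3" by (rule OtE[OF \<alpha> pos])
  obtain B where B: "B > 0" "\<forall>\<^sub>F t in G. norm (\<beta> t) \<le> B * t ^ 6" by (rule OtE[OF \<beta> pos])
  have "\<forall>\<^sub>F t in G. norm (X t) \<le> (A + B + 1) * t ^ 3"
    using A(2) B(2) pos eq
  proof eventually_elim
    case (elim t)
    show ?case
    proof (rule ccontr)
      assume "\<not> ?thesis"
      then have c: "norm (X t) > (A + B + 1) * t ^ 3" by simp
      have t3: "t ^ 3 > 0" using elim by simp
      have x: "norm (X t) > 0" using c t3 A(1) B(1) by (smt (verit) mult_pos_pos)
      have "norm (X t) ^ 2 \<le> norm (X t) * (A * t ^ 3) + B * t ^ 6"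
        using elim by (metis (no_types, opaque_lifting) norm_power norm_triangle_mono norm_mult mult_left_mono norm_ge_zero)
      also have "B * t ^ 6 = (B * t ^ 3) * t ^ 3" by (simp add: power_add[symmetric])
      also have "(B * t ^ 3) * t ^ 3 \<le> (B * t ^ 3) * norm (X t)"
        using c t3 A(1) B(1) by (intro mult_left_mono) (smt (verit) mult_le_cancel_right1 mult_nonneg_nonneg, auto)
      finally have "norm (X t) * norm (X t) \<le> norm (X t) * ((A + B) * t ^ 3)"
        by (simp add: power2_eq_square algebra_simps)
      then have "norm (X t) \<le> (A + B) * t ^ 3" using x by simp
      also have "\<dots> \<le> (A + B + 1) * t ^ 3" using t3 by (intro mult_right_mono) auto
      finally show False using c by simp
    qed
  qed
  then show ?thesis unfolding Ot_def by blast
qed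

section \<open>Bi-Lipschitz invariants\<close>

lemma norm_axis: "norm (axis k s :: complex ^ 'n::finite) = norm s"
  by (simp add: norm_vec_def L2_set_def axis_def if_distrib[of "\<lambda>x. (norm x)\<^sup>2"] cong: if_cong)

text \<open>
  The points where the derivative is of order at most \<open>norm p ^ 7\<close> form a zone that is preserved
  by bi-Lipschitz maps.
\<close>

lemma partial_deriv_transfer:
  fixes F F' :: "complex ^ 'n::finite \<Rightarrow> complex"
  assumes F: "holo_at F p" and F': "holo_at F' q" and pq: "p = \<psi> q"
    and L: "L \<ge> 0" and lip: "\<forall>\<^sub>F x in nhds q. norm (\<psi> x - \<psi> q) \<le> L * norm (x - q)"
    and eq: "\<forall>\<^sub>F x in nhds q. F' x = F (\<psi> x)"
  shows "norm (partial_deriv k F' q) \<le> (\<Sum>i\<in>UNIV. norm (partial_deriv i F p)) * L"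
proof -
  let ?B = "\<Sum>i\<in>UNIV. norm (partial_deriv i F p)"
  let ?D = "\<lambda>v. \<Sum>i\<in>UNIV. v $ i * partial_deriv i F p"
  have D: "(F has_derivative ?D) (at p)" by (rule holo_at_has_derivative[OF F])
  have nD: "norm (?D v) \<le> ?B * norm v" for v
  proof -
    have "norm (?D v) \<le> (\<Sum>i\<in>UNIV. norm v * norm (partial_deriv i F p))"
      by (rule sum_norm_le) (auto simp: norm_mult intro!: mult_right_mono Finite_Cartesian_Product.norm_nth_le)
    then show ?thesis by (simp add: sum_distrib_left mult.commute)
  qed
  obtain E where E: "(F' has_derivative E) (at q)" "complex_linear E" using F' by (auto simp: holo_at_def)
  have der: "((\<lambda>s. F' (q + axis k s)) has_field_derivative partial_deriv k F' q) (at 0)"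
    using has_derivative_imp_partial_deriv[OF E, of k] by simp
  \<comment> \<open>The slack e absorbs the remainder in the differentiability of F and tends to 0
    at the end.\<close>
  have "norm (partial_deriv k F' q) \<le> (?B + e) * L" if e: "e > 0" for e
  proof -
    obtain d where d: "d > 0" "\<And>y. norm (y - p) < d \<Longrightarrow> norm (F y - F p - ?D (y - p)) \<le> e * norm (y - p)"
      using D e unfolding has_derivative_at_alt by blast
    have Fb: "norm (F y - F p) \<le> (?B + e) * norm (y - p)" if "norm (y - p) < d" for y
      using d(2)[OF that] nD[of "y - p"] norm_triangle_sub[of "F y - F p" "?D (y - p)"]
      by (simp add: distrib_right)
    have "\<forall>\<^sub>F x in nhds q. x \<in> ball q (d / (L + 1))"
      by (rule eventually_nhds_in_open) (use d L in \<open>auto intro: add_nonneg_pos\<close>)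
    with lip have near: "\<forall>\<^sub>F x in nhds q. norm (\<psi> x - p) < d"
    proof eventually_elim
      case (elim x)
      have "norm (\<psi> x - p) \<le> L * norm (x - q)" using elim pq by simp
      also have "\<dots> \<le> (L + 1) * norm (x - q)" by (intro mult_right_mono) auto
      also have "\<dots> < d" using elim(2) L by (simp add: dist_norm norm_minus_commute pos_less_divide_eq mult.commute)
      finally show ?case .
    qed
    have eq0: "F' q = F p" using eventually_nhds_x_imp_x[OF eq] pq by simp
    have b: "\<forall>\<^sub>F x in nhds q. norm (F' x - F' q) \<le> (?B + e) * L * norm (x - q)"
      using near lip eq
    proof eventually_elim
      case (elim x)
      have "norm (F' x - F' q) \<le> (?B + e) * norm (\<psi> x - p)" using Fb[OF elim(1)] elim(3) eq0 by simp
      also have "\<dots> \<le> (?B + e) * (L * norm (x - q))"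
        using elim(2) e pq by (intro mult_left_mono add_nonneg_nonneg sum_nonneg) auto
      finally show ?case by (simp add: mult.assoc)
    qed
    have "((\<lambda>s. q + axis k s) \<longlongrightarrow> q + axis k (0::complex)) (at 0)"
      by (intro tendsto_intros) (use linear_continuous_at[OF bounded_linear_axis, of "0::complex" k] in \<open>simp add: isCont_def\<close>)
    then have "filterlim (\<lambda>s::complex. q + axis k s) (nhds q) (at 0)" by simp
    from eventually_compose_filterlim[OF b this]
    have "\<forall>\<^sub>F s in at 0. norm ((F' (q + axis k s) - F' q) / s) \<le> (?B + e) * L"
    proof (rule eventually_mono[OF eventually_conj[OF _ eventually_at_filter[THEN iffD2]]])
      show "\<forall>\<^sub>F x in nhds 0. x \<noteq> 0 \<longrightarrow> x \<in> UNIV \<longrightarrow> x \<noteq> (0::complex)" by simp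
      fix s :: complex
      assume "norm (F' (q + axis k s) - F' q) \<le> (?B + e) * L * norm (q + axis k s - q) \<and> s \<noteq> 0"
      then show "norm ((F' (q + axis k s) - F' q) / s) \<le> (?B + e) * L"
        by (simp add: norm_divide pos_divide_le_eq norm_axis)
    qed
    moreover have "((\<lambda>s. norm ((F' (q + axis k s) - F' q) / s)) \<longlongrightarrow> norm (partial_deriv k F' q)) (at 0)"
      using der unfolding has_field_derivative_iff by (intro tendsto_norm) simp
    ultimately show ?thesis by (intro tendsto_upperbound) auto
  qed
  then have "norm (partial_deriv k F' q) \<le> ?B * L + e * L" if "e > 0" for e
    using that by (simp add: distrib_right)
  moreover have "((\<lambda>e. ?B * L + e * L) \<longlongrightarrow> ?B * L + 0 * L) (at_right 0)" by (intro tendsto_intros)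
  ultimately show ?thesis
    by (intro tendsto_lowerbound[of "\<lambda>e. ?B * L + e * L" "?B * L" "at_right 0"])
      (auto simp: eventually_at_right_less intro: eventually_mono[OF eventually_at_right_less])
qed

lemma sum_axis: "(\<Sum>i\<in>UNIV. axis k (1::complex) $ i * c i) = c k"
proof -
  have "axis k (1::complex) $ i * c i = (if i = k then c i else 0)" for i by (simp add: axis_def)
  then show ?thesis by simp
qed

text \<open>Each monomial is divided by one coordinate occurring in it. Used to expand a coefficient
  germ to first order along a curve.\<close>

lemma hadamard_germ:
  fixes f :: "complex ^ 'n::finite \<Rightarrow> complex"
  assumes "analytic_germ f" "f 0 = 0"
  shows "\<exists>h. (\<forall>k. analytic_germ (h k) \<and> h k 0 = partial_deriv k f 0) \<and>
    (\<forall>\<^sub>F p in nhds 0. f p = (\<Sum>k\<in>UNIV. p $ k * h k p))"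
proof -
  obtain a where a: "has_power_series f a" using assms(1) by (auto simp: analytic_germ_def)
  have a0: "a (\<lambda>_. 0) = 0" using power_series_at_0[OF a] assms(2) by simp
  have "\<exists>h. (\<forall>c\<in>(UNIV :: 'n set). analytic_germ (h c) \<and> (\<forall>\<beta>. taylor_coeff (h c) \<beta> \<noteq> 0 \<longrightarrow> a (\<lambda>i. \<beta> i + unit_expo c i) \<noteq> 0)) \<and>
    (\<forall>\<^sub>F p in nhds 0. f p = (\<Sum>c\<in>UNIV. mon (unit_expo c) p * h c p))"
  proof (rule power_series_decomposition[OF a])
    fix \<alpha> assume "a \<alpha> \<noteq> 0"
    then have "\<alpha> \<noteq> (\<lambda>_. 0)" using a0 by auto
    then obtain k where "\<alpha> k \<noteq> 0" by auto
    then show "\<exists>c\<in>UNIV. \<forall>i. unit_expo c i \<le> \<alpha> i" by (auto simp: unit_expo_def intro!: exI[of _ k])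
  qed simp
  then obtain h where h: "\<And>k. analytic_germ (h k)" and eq: "\<forall>\<^sub>F p in nhds 0. f p = (\<Sum>k\<in>UNIV. p $ k * h k p)"
    by (auto simp: mon_unit_expo)
  have "h k 0 = partial_deriv k f 0" for k
  proof -
    have "partial_deriv k f 0 = partial_deriv k (\<lambda>p. \<Sum>l\<in>UNIV. p $ l * h l p) 0"
      by (rule partial_deriv_0_cong[OF eq])
    also have "\<dots> = (\<Sum>l\<in>UNIV. partial_deriv k (\<lambda>p. p $ l * h l p) 0)"
      by (rule partial_deriv_0_sum) (intro analytic_intros h)
    also have "\<dots> = (\<Sum>l\<in>UNIV. if k = l then h l 0 else 0)"
      by (intro sum.cong refl) (simp add: partial_deriv_0_mult[OF analytic_germ_nth h] partial_deriv_0_nth)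
    finally show ?thesis by simp
  qed
  with h eq show ?thesis by blast
qed

lemma partial_deriv_ordge:
  assumes f: "analytic_germ f" and o: "ordge (Suc N) f"
  shows "\<exists>C. \<forall>\<^sub>F p in at 0. norm (partial_deriv k f p) \<le> C * norm p ^ N"
proof -
  obtain C where C: "\<forall>\<^sub>F x in nhds 0. norm (f x) \<le> C * norm x ^ Suc N" using o by (auto simp: ordge_def)
  obtain \<delta> where \<delta>: "\<delta> > 0" "\<And>x. norm x < \<delta> \<Longrightarrow> holo_at f x \<and> norm (f x) \<le> C * norm x ^ Suc N"
    using eventually_conj[OF analytic_germ_holoD[OF f] C] by (auto simp: eventually_nhds_metric)
  \<comment> \<open>The Cauchy estimate on the ball of radius \<open>norm p\<close> about p costs
    exactly one power of \<open>norm p\<close>; this needs p to be nonzero.\<close>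
  have b: "norm (partial_deriv k f p) \<le> (\<bar>C\<bar> * 2 ^ (N + 2)) * norm p ^ N" if p: "p \<noteq> 0" "norm p < \<delta> / 2" for p
  proof -
    have y: "norm y < 2 * norm p" if "y \<in> ball p (norm p)" for y
      using that norm_triangle_sub[of y p] by (simp add: dist_norm norm_minus_commute)
    have hp: "holo_at f p" using p \<delta> by simp
    have "norm ((\<lambda>v. \<Sum>i\<in>UNIV. v $ i * partial_deriv i f p) (axis k 1)) \<le>
        2 * (\<bar>C\<bar> * (2 * norm p) ^ Suc N) / norm p * norm (axis k (1::complex) :: complex ^ 'a)"
    proof (rule holo_at_derivative_bound)
      fix v assume v: "v \<in> ball p (norm p)"
      have vd: "norm v < \<delta>" using y[OF v] p by simp
      show "holo_at f v" using \<delta>(2)[OF vd] by simp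
      have "norm (f v) \<le> C * norm v ^ Suc N" using \<delta>(2)[OF vd] by simp
      also have "\<dots> \<le> \<bar>C\<bar> * norm v ^ Suc N" by (intro mult_right_mono) auto
      also have "\<dots> \<le> \<bar>C\<bar> * (2 * norm p) ^ Suc N" 
        by (intro mult_left_mono power_mono) (use y[OF v] in auto)
      finally show "norm (f v) \<le> \<bar>C\<bar> * (2 * norm p) ^ Suc N" .
    qed (use p holo_at_has_derivative[OF hp] in auto)
    moreover have "(\<Sum>i\<in>UNIV. axis k (1::complex) $ i * partial_deriv i f p) = partial_deriv k f p"
      by (rule sum_axis)
    ultimately show ?thesis using p by (simp add: norm_axis power_mult_distrib field_simps)
  qed
  have "\<forall>\<^sub>F p in at 0. p \<in> ball (0 :: complex ^ 'a) (\<delta> / 2) \<and> p \<noteq> 0"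
    using \<delta>(1) by (auto simp: eventually_at intro!: exI[of _ "\<delta> / 2"])
  then have "\<forall>\<^sub>F p in at 0. norm (partial_deriv k f p) \<le> (\<bar>C\<bar> * 2 ^ (N + 2)) * norm p ^ N"
    by eventually_elim (use b in auto)
  then show ?thesis by blast
qed

lemma analytic_ordge_0: "analytic_germ f \<Longrightarrow> ordge 0 f"
  using ordge_if_coeffs_zero[of f] by (auto simp: analytic_germ_def)

lemma analytic_ordge_1: 
  assumes "analytic_germ f" "f 0 = 0" 
  shows "ordge 1 f"
proof -
  obtain a where a: "has_power_series f a" using assms(1) by (auto simp: analytic_germ_def)
  show ?thesis
  proof (rule ordge_if_coeffs_zero[OF a])
    fix \<alpha> :: "'a \<Rightarrow> nat" assume "mdeg \<alpha> < 1"
    then have "\<alpha> = (\<lambda>_. 0)" by (auto simp: mdeg_def fun_eq_iff)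
    then show "a \<alpha> = 0" using power_series_at_0[OF a] assms(2) by simp
  qed
qed

text \<open>Only the size of \<open>q t\<close>, comparable to t, is prescribed and no regularity,
  since the curves include images of arcs under Lipschitz maps.\<close>

locale germ_curve =
  fixes G :: "real filter" and q :: "real \<Rightarrow> complex ^ 'n::finite"
  assumes pos: "\<forall>\<^sub>F t in G. 0 < t \<and> t < 1" and lim: "((\<lambda>t. t) \<longlongrightarrow> 0) G"
    and upper: "\<exists>C. \<forall>\<^sub>F t in G. norm (q t) \<le> C * t"
    and lower: "\<exists>c>0. \<forall>\<^sub>F t in G. c * t \<le> norm (q t)"
begin

lemma pos': "\<forall>\<^sub>F t in G. t > 0" using pos by (auto elim: eventually_mono)

lemma q_lim: "filterlim q (nhds 0) G"
proof -
  obtain C where C: "\<forall>\<^sub>F t in G. norm (q t) \<le> C * t" using upper by blast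
  have "((\<lambda>t. C * t) \<longlongrightarrow> C * 0) G" by (intro tendsto_intros lim)
  then show ?thesis by (intro Lim_null_comparison[OF C]) simp
qed

lemma q_at: "filterlim q (at 0) G"
proof -
  obtain c where c: "c > 0" "\<forall>\<^sub>F t in G. c * t \<le> norm (q t)" using lower by blast
  have "\<forall>\<^sub>F t in G. q t \<noteq> 0"
    using c(2) pos' by eventually_elim (use c(1) in \<open>auto simp: mult_le_0_iff\<close>)
  then show ?thesis using q_lim by (simp add: filterlim_at)
qed

lemma Ot_ordge: "ordge N f \<Longrightarrow> Ot G N (\<lambda>t. f (q t))"
proof -
  assume "ordge N f"
  then obtain C where C: "\<forall>\<^sub>F x in nhds 0. norm (f x) \<le> C * norm x ^ N" by (auto simp: ordge_def)
  obtain D where D: "\<forall>\<^sub>F t in G. norm (q t) \<le> D * t" using upper by blast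
  have "\<forall>\<^sub>F t in G. norm (f (q t)) \<le> (\<bar>C\<bar> * D ^ N) * t ^ N"
    using eventually_compose_filterlim[OF C q_lim] D
  proof eventually_elim
    case (elim t)
    have "norm (f (q t)) \<le> \<bar>C\<bar> * norm (q t) ^ N"
      by (rule order_trans[OF elim(1)]) (intro mult_right_mono, auto)
    also have "\<dots> \<le> \<bar>C\<bar> * (D * t) ^ N" using elim by (intro mult_left_mono power_mono) auto
    finally show ?case by (simp add: power_mult_distrib mult_ac)
  qed
  then show ?thesis unfolding Ot_def by blast
qed

lemma Ot_analytic: "analytic_germ f \<Longrightarrow> Ot G 0 (\<lambda>t. f (q t))"
  by (rule Ot_ordge[OF analytic_ordge_0])

lemma Ot_nth: "Ot G 1 (\<lambda>t. q t $ k)"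
  by (rule Ot_ordge[of 1 "\<lambda>x. x $ k"]) (rule analytic_ordge_1, auto)

lemma Ot_analytic_1: "analytic_germ f \<Longrightarrow> Ot G 1 (\<lambda>t. f (q t) - f 0)"
  by (rule Ot_ordge[of 1 "\<lambda>x. f x - f 0"]) (rule analytic_ordge_1, auto intro: analytic_intros)

lemma Ot_partial:
  assumes "analytic_germ f" "ordge (Suc N) f"
  shows "Ot G N (\<lambda>t. partial_deriv k f (q t))"
proof -
  obtain C where C: "\<forall>\<^sub>F p in at 0. norm (partial_deriv k f p) \<le> C * norm p ^ N"
    using partial_deriv_ordge[OF assms] by blast
  obtain D where D: "\<forall>\<^sub>F t in G. norm (q t) \<le> D * t" using upper by blast
  have "\<forall>\<^sub>F t in G. norm (partial_deriv k f (q t)) \<le> (\<bar>C\<bar> * D ^ N) * t ^ N"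
    using eventually_compose_filterlim[OF C q_at] D
  proof eventually_elim
    case (elim t)
    have "norm (partial_deriv k f (q t)) \<le> \<bar>C\<bar> * norm (q t) ^ N"
      by (rule order_trans[OF elim(1)]) (intro mult_right_mono, auto)
    also have "\<dots> \<le> \<bar>C\<bar> * (D * t) ^ N" using elim by (intro mult_left_mono power_mono) auto
    finally show ?case by (simp add: power_mult_distrib mult_ac)
  qed
  then show ?thesis unfolding Ot_def by blast
qed

lemma Ot_partial_0:
  assumes "analytic_germ f"
  shows "Ot G 0 (\<lambda>t. partial_deriv k f (q t))"
proof -
  obtain \<delta> B where \<delta>: "\<delta> > 0" "B > 0"
    "\<forall>x. norm x < \<delta> \<longrightarrow> (\<forall>v. norm (\<Sum>i\<in>UNIV. v $ i * partial_deriv i f x) \<le> B * norm v)"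
    by (rule analytic_derivative_bounded[OF assms])
  have "norm (partial_deriv k f x) \<le> B" if "norm x < \<delta>" for x
    using \<delta>(3)[rule_format, OF that, of "axis k 1"]
    by (simp add: norm_axis sum_axis)
  then have "\<forall>\<^sub>F x in nhds 0. norm (partial_deriv k f x) \<le> B * 1"
    using \<delta>(1) by (auto simp: eventually_nhds_metric)
  then have "\<forall>\<^sub>F t in G. norm (partial_deriv k f (q t)) \<le> B * t ^ 0"
    using eventually_compose_filterlim[OF _ q_lim] by fastforce
  then show ?thesis unfolding Ot_def by blast
qed

end

text \<open>The expression of the J_{3,0} family with the constants b and c replaced by germs M and
  N and with an error R, which will have order 11.\<close>

definition nf_expr :: "'n::finite \<Rightarrow> 'n \<Rightarrow> (complex ^ 'n \<Rightarrow> complex) \<Rightarrow> (complex ^ 'n \<Rightarrow> complex) \<Rightarrow>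
    (complex ^ 'n \<Rightarrow> complex) \<Rightarrow> complex ^ 'n \<Rightarrow> complex" where
  "nf_expr i j M N R p = (p $ i)^3 + (p $ j)^9 + (\<Sum>k\<in>-{i,j}. (p $ k)\<^sup>2)
     + (p $ i)\<^sup>2 * (p $ j)^3 * M p + p $ i * (p $ j)^7 * N p + R p"

lemma nf_expr_analytic:
  "analytic_germ M \<Longrightarrow> analytic_germ N \<Longrightarrow> analytic_germ R \<Longrightarrow> analytic_germ (nf_expr i j M N R)"
  unfolding nf_expr_def[abs_def] by (intro analytic_intros)

lemma nf_expr_partial:
  fixes p :: "complex ^ 'n::finite"
  assumes M: "holo_at M p" and N: "holo_at N p" and R: "holo_at R p" and ij: "i \<noteq> j"
  defines "\<xi> m \<equiv> if m = i then 1 else 0 :: complex" and "\<eta> m \<equiv> if m = j then 1 else 0 :: complex"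
  shows "partial_deriv m (nf_expr i j M N R) p =
     3 * (p $ i)\<^sup>2 * \<xi> m + 9 * (p $ j)^8 * \<eta> m + (if m \<in> -{i,j} then 2 * p $ m else 0)
     + (2 * p $ i * \<xi> m * (p $ j)^3 + 3 * (p $ i)\<^sup>2 * (p $ j)\<^sup>2 * \<eta> m) * M p
     + (p $ i)\<^sup>2 * (p $ j)^3 * partial_deriv m M p
     + (\<xi> m * (p $ j)^7 + 7 * p $ i * (p $ j)^6 * \<eta> m) * N p
     + p $ i * (p $ j)^7 * partial_deriv m N p + partial_deriv m R p"
proof -
  have d: "((\<lambda>s. f (p + axis m s)) has_field_derivative partial_deriv m f p) (at 0)" if "holo_at f p" for f
  proof -
    obtain D where "(f has_derivative D) (at p)" "complex_linear D" using \<open>holo_at f p\<close> by (auto simp: holo_at_def)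
    from has_derivative_imp_partial_deriv[OF this, of m] show ?thesis by simp
  qed
  have c: "(p + axis m s) $ l = p $ l + s * (if m = l then 1 else 0)" for s l
    by (simp add: axis_def)
  have "((\<lambda>s. \<Sum>k\<in>-{i,j}. ((p + axis m s) $ k)\<^sup>2) has_field_derivative (\<Sum>k\<in>-{i,j}. if m = k then 2 * p $ m else 0)) (at 0)"
    unfolding c by (intro DERIV_sum) (auto intro!: derivative_eq_intros)
  then have z: "((\<lambda>s. \<Sum>k\<in>-{i,j}. ((p + axis m s) $ k)\<^sup>2) has_field_derivative (if m \<in> -{i,j} then 2 * p $ m else 0)) (at 0)"
    by simp
  have x: "((\<lambda>s. (p + axis m s) $ i) has_field_derivative \<xi> m) (at 0)"
    unfolding c \<xi>_def by (auto intro!: derivative_eq_intros)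
  have y: "((\<lambda>s. (p + axis m s) $ j) has_field_derivative \<eta> m) (at 0)"
    unfolding c \<eta>_def by (auto intro!: derivative_eq_intros)
  show ?thesis
    unfolding partial_deriv_def[of m "nf_expr i j M N R"]
    apply (rule DERIV_imp_deriv)
    unfolding nf_expr_def
    apply (rule refl x y z d[OF M] d[OF N] d[OF R] derivative_eq_intros)+
    apply (simp add: algebra_simps)
    done
qed

locale nf_curve = germ_curve G q for G and q :: "real \<Rightarrow> complex ^ 'n::finite" +
  fixes i j :: 'n and M N R :: "complex ^ 'n \<Rightarrow> complex" and F :: "complex ^ 'n \<Rightarrow> complex"
  assumes ij: "i \<noteq> j" and an: "analytic_germ M" "analytic_germ N" "analytic_germ R" and R11: "ordge 11 R"
    and F: "\<forall>\<^sub>F p in nhds 0. F p = nf_expr i j M N R p"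
begin

abbreviation "X \<equiv> \<lambda>t. q t $ i"
abbreviation "Y \<equiv> \<lambda>t. q t $ j"

lemma mono: "Ot G k f \<Longrightarrow> l \<le> k \<Longrightarrow> Ot G l f"
  using Ot_mono[OF _ _ pos] by blast

lemma mult: "Ot G k f \<Longrightarrow> Ot G l g \<Longrightarrow> n \<le> k + l \<Longrightarrow> Ot G n (\<lambda>t. f t * g t)"
  by (rule mono[OF Ot_mult])

lemma pow: "Ot G k f \<Longrightarrow> l \<le> n * k \<Longrightarrow> Ot G l (\<lambda>t. f t ^ n)"
  by (rule mono[OF Ot_power])

lemma num_mult: "Ot G k f \<Longrightarrow> Ot G k (\<lambda>t. numeral w * f t)"
  by (rule Ot_cmult)

lemma partial_eq: "\<forall>\<^sub>F t in G. partial_deriv m F (q t) =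
     3 * (X t)\<^sup>2 * (if m = i then 1 else 0) + 9 * (Y t)^8 * (if m = j then 1 else 0) + (if m \<in> -{i,j} then 2 * q t $ m else 0)
     + (2 * X t * (if m = i then 1 else 0) * (Y t)^3 + 3 * (X t)\<^sup>2 * (Y t)\<^sup>2 * (if m = j then 1 else 0)) * M (q t)
     + (X t)\<^sup>2 * (Y t)^3 * partial_deriv m M (q t)
     + ((if m = i then 1 else 0) * (Y t)^7 + 7 * X t * (Y t)^6 * (if m = j then 1 else 0)) * N (q t)
     + X t * (Y t)^7 * partial_deriv m N (q t) + partial_deriv m R (q t)"
proof -
  have "\<forall>\<^sub>F p in nhds 0. \<forall>\<^sub>F x in nhds p. F x = nf_expr i j M N R x"
    using F by (simp add: eventually_eventually)
  then have "\<forall>\<^sub>F p in nhds 0. partial_deriv m F p = partial_deriv m (nf_expr i j M N R) p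
      \<and> holo_at M p \<and> holo_at N p \<and> holo_at R p"
    using an[THEN analytic_germ_holoD]
  proof eventually_elim
    case (elim p)
    have "((\<lambda>s. p + axis m s) \<longlongrightarrow> p + axis m (0::complex)) (nhds 0)"
      by (intro tendsto_add tendsto_const)
        (use linear_continuous_at[OF bounded_linear_axis, of "0::complex" m, unfolded isCont_def tendsto_at_iff_tendsto_nhds] in \<open>assumption\<close>)
    then have "filterlim (\<lambda>s. p + axis m (s::complex)) (nhds p) (nhds 0)" by simp
    from eventually_compose_filterlim[OF elim(1) this]
    have "\<forall>\<^sub>F s in nhds 0. F (p + axis m s) = nf_expr i j M N R (p + axis m s)" .
    then have "partial_deriv m F p = partial_deriv m (nf_expr i j M N R) p"
      unfolding partial_deriv_def by (rule deriv_cong_ev) simp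
    with elim show ?case by simp
  qed
  from eventually_compose_filterlim[OF this q_lim] show ?thesis
    by eventually_elim (simp only: nf_expr_partial[OF _ _ _ ij])
qed

lemma R_partial: "Ot G 10 (\<lambda>t. partial_deriv m R (q t))"
  by (rule Ot_partial[OF an(3)]) (use R11 in \<open>simp add: eval_nat_numeral\<close>)

text \<open>With X of order 3, all terms of the derivatives have order 7 except the leading part X
  (3 X + 2 M(0) Y^3) of the derivative in x and the linear terms 2 z_k; the hypotheses are about
  these.\<close>

lemma zone_membership:
  assumes X3: "Ot G 3 X" and z: "\<And>k. k \<in> -{i,j} \<Longrightarrow> Ot G 7 (\<lambda>t. q t $ k)"
    and crit: "Ot G 7 (\<lambda>t. X t * (3 * X t + 2 * M 0 * (Y t)^3))"
  shows "Ot G 7 (\<lambda>t. partial_deriv m F (q t))"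
proof -
  note Y1 = Ot_nth[of j]
  have M1: "Ot G 1 (\<lambda>t. M (q t) - M 0)" by (rule Ot_analytic_1[OF an(1)])
  note pd = Ot_partial_0[OF an(1), of m] Ot_partial_0[OF an(2), of m]
  have 1: "Ot G 7 (\<lambda>t. (X t)\<^sup>2 * (Y t)^3 * partial_deriv m M (q t))"
    by (rule mult[OF mult[OF pow[OF X3, of 6 2] pow[OF Y1, of 3 3], of 9] pd(1)]) auto
  have 2: "Ot G 7 (\<lambda>t. X t * (Y t)^7 * partial_deriv m N (q t))"
    by (rule mult[OF mult[OF X3 pow[OF Y1, of 7 7], of 10] pd(2)]) auto
  have 3: "Ot G 7 (\<lambda>t. partial_deriv m R (q t))" by (rule mono[OF R_partial]) simp
  note s = Ot_add[OF Ot_add[OF 1 2] 3]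
  consider "m = i" | "m = j" | "m \<in> -{i,j}" by blast
  then show ?thesis
  proof cases
    case 1
    have a: "Ot G 7 (\<lambda>t. (Y t)^7 * N (q t))"
      by (rule mult[OF pow[OF Y1, of 7 7] Ot_analytic[OF an(2)]]) auto
    have b: "Ot G 7 (\<lambda>t. (2 * (X t * (Y t)^3)) * (M (q t) - M 0))"
      by (rule mult[OF num_mult[OF mult[OF X3 pow[OF Y1, of 3 3], of 6]] M1]) auto
    show ?thesis
      by (rule Ot_cong[OF _ Ot_add[OF Ot_add[OF s crit] Ot_add[OF a b]]],
          rule eventually_mono[OF partial_eq[of m]])
        (use 1 ij in \<open>simp add: algebra_simps power2_eq_square\<close>)
  next
    case 2
    have a: "Ot G 7 (\<lambda>t. 9 * (Y t)^8)" by (rule num_mult[OF pow[OF Y1]]) simp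
    have b: "Ot G 7 (\<lambda>t. (3 * ((X t)\<^sup>2 * (Y t)\<^sup>2)) * M (q t))"
      by (rule mult[OF num_mult[OF mult[OF pow[OF X3, of 6 2] pow[OF Y1, of 2 2], of 8]] Ot_analytic[OF an(1)]]) auto
    have c: "Ot G 7 (\<lambda>t. (7 * (X t * (Y t)^6)) * N (q t))"
      by (rule mult[OF num_mult[OF mult[OF X3 pow[OF Y1, of 6 6], of 9]] Ot_analytic[OF an(2)]]) auto
    show ?thesis
      by (rule Ot_cong[OF _ Ot_add[OF Ot_add[OF s a] Ot_add[OF b c]]],
          rule eventually_mono[OF partial_eq[of m]])
        (use 2 ij in \<open>simp add: algebra_simps\<close>)
  next
    case 3
    show ?thesis
      by (rule Ot_cong[OF _ Ot_add[OF s num_mult[OF z[OF 3]]]],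
          rule eventually_mono[OF partial_eq[of m]])
        (use 3 in \<open>auto simp add: algebra_simps\<close>)
  qed
qed

text \<open>The derivative in x is a quadratic equation for X, which gives order 3; the derivatives
  in the z_k then give order 6, so Y carries the size of q. Finally X (X - w Y^3) has order 7 while
  its two roots differ by a multiple of t^3, so one of the factors has order 4.\<close>

lemma zone_points:
  assumes zone: "\<And>m. Ot G 7 (\<lambda>t. partial_deriv m F (q t))" and b: "M 0 \<noteq> 0"
  shows "Ot G 3 X" "\<exists>c>0. \<forall>\<^sub>F t in G. c * t \<le> norm (Y t)"
    "\<And>k. k \<in> -{i,j} \<Longrightarrow> Ot G 6 (\<lambda>t. q t $ k)"
    "\<exists>K. \<forall>\<^sub>F t in G. norm (X t) \<le> K * t ^ 4 \<or> norm (X t - (- 2 * M 0 / 3) * (Y t)^3) \<le> K * t ^ 4"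
proof -
  note Y1 = Ot_nth[of j] and X1 = Ot_nth[of i]
  note pd = Ot_partial_0[OF an(1)] Ot_partial_0[OF an(2)]
  let ?w = "- 2 * M 0 / 3"
  have z: "Ot G l (\<lambda>t. q t $ k)" if k: "k \<in> -{i,j}" and l: "l \<le> 7" "l \<le> 2 * e + 3" and e: "Ot G e X" for k l e
  proof -
    have 1: "Ot G l (\<lambda>t. (X t)\<^sup>2 * (Y t)^3 * partial_deriv k M (q t))"
      by (rule mult[OF mult[OF pow[OF e, of "2 * e" 2] pow[OF Y1, of 3 3], of "2 * e + 3"] pd(1)]) (use l in auto)
    have 2: "Ot G l (\<lambda>t. X t * (Y t)^7 * partial_deriv k N (q t))"
      by (rule mult[OF mult[OF X1 pow[OF Y1, of 7 7], of 8] pd(2)]) (use l in auto)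
    have 3: "Ot G l (\<lambda>t. partial_deriv k R (q t))" by (rule mono[OF R_partial]) (use l in simp)
    have 4: "Ot G l (\<lambda>t. partial_deriv k F (q t))" by (rule mono[OF zone l(1)])
    show ?thesis
      by (rule Ot_cong[OF _ Ot_cmult[OF Ot_diff[OF 4 Ot_add[OF Ot_add[OF 1 2] 3]], of "1/2"]],
          rule eventually_mono[OF partial_eq[of k]])
        (use k in auto)
  qed
  show X3: "Ot G 3 X"
  proof (rule Ot_quadratic[OF _ _ pos'])
    \<comment> \<open>The coefficients obtained by solving the formula for the derivative in x for
      X^2.\<close>
    let ?\<alpha> = "\<lambda>t. (- 1/3) * (2 * ((Y t)^3 * M (q t)) + (X t * (Y t)^3) * partial_deriv i M (q t) + (Y t)^7 * partial_deriv i N (q t))"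
    let ?\<beta> = "\<lambda>t. (1/3) * (partial_deriv i F (q t) - ((Y t)^7 * N (q t) + partial_deriv i R (q t)))"
    have 1: "Ot G 3 (\<lambda>t. 2 * ((Y t)^3 * M (q t)))"
      by (rule num_mult[OF mult[OF pow[OF Y1, of 3 3] Ot_analytic[OF an(1)]]]) auto
    have 2: "Ot G 3 (\<lambda>t. (X t * (Y t)^3) * partial_deriv i M (q t))"
      by (rule mult[OF mult[OF X1 pow[OF Y1, of 3 3], of 4] pd(1)]) auto
    have 3: "Ot G 3 (\<lambda>t. (Y t)^7 * partial_deriv i N (q t))"
      by (rule mult[OF pow[OF Y1, of 7 7] pd(2)]) auto
    show "Ot G 3 ?\<alpha>" by (rule Ot_cmult[OF Ot_add[OF Ot_add[OF 1 2] 3]])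
    have 4: "Ot G 6 (\<lambda>t. (Y t)^7 * N (q t))"
      by (rule mult[OF pow[OF Y1, of 7 7] Ot_analytic[OF an(2)]]) auto
    show "Ot G 6 ?\<beta>"
      by (rule Ot_cmult[OF Ot_diff[OF mono[OF zone] Ot_add[OF 4 mono[OF R_partial]]]]) auto
    show "\<forall>\<^sub>F t in G. (X t)\<^sup>2 = X t * ?\<alpha> t + ?\<beta> t"
      by (rule eventually_mono[OF partial_eq[of i]])
        (use ij in \<open>simp add: field_simps power2_eq_square\<close>)
  qed
  show z6: "Ot G 6 (\<lambda>t. q t $ k)" if "k \<in> -{i,j}" for k by (rule z[OF that _ _ X3]) auto
  show low: "\<exists>c>0. \<forall>\<^sub>F t in G. c * t \<le> norm (Y t)"
  proof -
    \<comment> \<open>All coordinates other than Y have order 2 and are negligible against the lower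
      bound c t for the norm.\<close>
    have o2: "Ot G 2 (\<lambda>t. q t $ k)" if "k \<noteq> j" for k
      using that X3 z6[of k] by (cases "k = i") (auto intro: mono)
    have "\<exists>C>0. \<forall>\<^sub>F t in G. norm (q t $ k) \<le> C * t\<^sup>2" if "k \<noteq> j" for k
      using OtE[OF o2[OF that] pos'] by metis
    then obtain C where C: "\<And>k. k \<noteq> j \<Longrightarrow> C k > 0 \<and> (\<forall>\<^sub>F t in G. norm (q t $ k) \<le> C k * t\<^sup>2)" by metis
    obtain c where c: "c > 0" "\<forall>\<^sub>F t in G. c * t \<le> norm (q t)" using lower by blast
    define S where "S = (\<Sum>k\<in>-{j}. C k)"
    have S: "S \<ge> 0" unfolding S_def using C by (intro sum_nonneg) (auto intro: less_imp_le)
    have small: "\<forall>\<^sub>F t in G. t < c / (2 * (S + 1))"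
      using order_tendstoD(2)[OF lim, of "c / (2 * (S + 1))"] c S by simp
    have "\<forall>\<^sub>F t in G. \<forall>k\<in>-{j}. norm (q t $ k) \<le> C k * t\<^sup>2"
      using C by (simp add: eventually_ball_finite)
    with c(2) small pos have "\<forall>\<^sub>F t in G. (c/2) * t \<le> norm (Y t)"
    proof eventually_elim
      case (elim t)
      have "norm (q t) \<le> (\<Sum>k\<in>UNIV. norm (q t $ k))" unfolding norm_vec_def by (rule L2_set_le_sum) simp
      also have "\<dots> = norm (Y t) + (\<Sum>k\<in>-{j}. norm (q t $ k))"
        by (subst sum.remove[of _ j]) (auto simp: Compl_eq_Diff_UNIV)
      also have "\<dots> \<le> norm (Y t) + (\<Sum>k\<in>-{j}. C k * t\<^sup>2)" using elim(4) by (intro add_left_mono sum_mono) auto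
      also have "(\<Sum>k\<in>-{j}. C k * t\<^sup>2) = S * t * t" unfolding S_def power2_eq_square mult.assoc sum_distrib_right ..
      also have "S * t * t \<le> (c / 2) * t"
      proof (rule mult_right_mono)
        have "S * t \<le> (S + 1) * t" using elim by simp
        also have "\<dots> \<le> (S + 1) * (c / (2 * (S + 1)))" using elim S by (intro mult_left_mono) auto
        also have "\<dots> = c / 2" using S by (simp add: field_simps)
        finally show "S * t \<le> c / 2" .
      qed (use elim in auto)
      finally show ?case using elim(1) by simp
    qed
    then show ?thesis using c(1) by (intro exI[of _ "c/2"]) simp
  qed
  have M1: "Ot G 1 (\<lambda>t. M (q t) - M 0)" by (rule Ot_analytic_1[OF an(1)])
  have prod: "Ot G 7 (\<lambda>t. X t * (X t - ?w * (Y t)^3))"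
  proof -
    have 1: "Ot G 7 (\<lambda>t. (X t)\<^sup>2 * (Y t)^3 * partial_deriv i M (q t))"
      by (rule mult[OF mult[OF pow[OF X3, of 6 2] pow[OF Y1, of 3 3], of 9] pd(1)]) auto
    have 2: "Ot G 7 (\<lambda>t. X t * (Y t)^7 * partial_deriv i N (q t))"
      by (rule mult[OF mult[OF X3 pow[OF Y1, of 7 7], of 10] pd(2)]) auto
    have 3: "Ot G 7 (\<lambda>t. partial_deriv i R (q t))" by (rule mono[OF R_partial]) simp
    have a: "Ot G 7 (\<lambda>t. (Y t)^7 * N (q t))"
      by (rule mult[OF pow[OF Y1, of 7 7] Ot_analytic[OF an(2)]]) auto
    have b: "Ot G 7 (\<lambda>t. (2 * (X t * (Y t)^3)) * (M (q t) - M 0))"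
      by (rule mult[OF num_mult[OF mult[OF X3 pow[OF Y1, of 3 3], of 6]] M1]) auto
    show ?thesis
      by (rule Ot_cong[OF _ Ot_cmult[OF Ot_diff[OF zone[of i] Ot_add[OF Ot_add[OF Ot_add[OF 1 2] 3] Ot_add[OF a b]]], of "1/3"]],
          rule eventually_mono[OF partial_eq[of i]])
        (use ij in \<open>simp add: field_simps power2_eq_square\<close>)
  qed
  obtain K where K: "K > 0" "\<forall>\<^sub>F t in G. norm (X t * (X t - ?w * (Y t)^3)) \<le> K * t ^ 7" by (rule OtE[OF prod pos'])
  obtain c where c: "c > 0" "\<forall>\<^sub>F t in G. c * t \<le> norm (Y t)" using low by blast
  \<comment> \<open>The branches are at distance at least 2 L t^3, so X is at distance at least L
    t^3 from one of them.\<close>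
  define L where "L = norm ?w * c ^ 3 / 2"
  have L: "L > 0" using b c by (simp add: L_def)
  have "\<forall>\<^sub>F t in G. norm (X t) \<le> (K / L) * t ^ 4 \<or> norm (X t - ?w * (Y t)^3) \<le> (K / L) * t ^ 4"
    using K(2) c(2) pos
  proof eventually_elim
    case (elim t)
    let ?u = "norm (X t)" and ?v = "norm (X t - ?w * (Y t)^3)"
    have "c ^ 3 * t ^ 3 \<le> norm (Y t) ^ 3"
      unfolding power_mult_distrib[symmetric] using elim c(1) by (intro power_mono) auto
    then have "2 * L * t ^ 3 \<le> norm (?w * (Y t)^3)"
      unfolding norm_mult norm_power L_def by (simp add: mult_left_mono mult.assoc)
    also have "\<dots> \<le> ?u + ?v" using norm_triangle_ineq4[of "X t" "X t - ?w * (Y t)^3"] by simp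
    finally have "L * t ^ 3 \<le> ?u \<or> L * t ^ 3 \<le> ?v" by linarith
    moreover have uv: "?u * ?v \<le> K * t ^ 7" using elim by (simp add: norm_mult)
    moreover have key: "y \<le> (K / L) * t ^ 4" if "L * t ^ 3 \<le> x" "x * y \<le> K * t ^ 7" "y \<ge> 0" for x y
    proof -
      have "(L * t ^ 3) * y \<le> K * t ^ 7" using mult_right_mono[OF that(1,3)] that(2) by linarith
      also have "K * t ^ 7 = (L * t ^ 3) * ((K / L) * t ^ 4)" using L by (simp add: power_add[symmetric])
      finally show ?thesis by (rule mult_left_le_imp_le) (use L elim in simp)
    qed
    ultimately show ?case using key[of ?u ?v] key[of ?v ?u] by (auto simp: mult.commute)
  qed
  then show "\<exists>K. \<forall>\<^sub>F t in G. norm (X t) \<le> K * t ^ 4 \<or> norm (X t - ?w * (Y t)^3) \<le> K * t ^ 4" by blast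
qed

text \<open>The condition on w says that it is a critical point of w^3 + M(0) w^2. Hence the
  deviation of order 4 of X from w Y^3 enters the value of F only quadratically, with order 2 * 4 +
  3 = 11, and the value is determined up to order 11.\<close>

lemma zone_value:
  assumes d: "Ot G 4 (\<lambda>t. X t - w * (Y t)^3)" and w: "w * (3 * w + 2 * M 0) = 0"
    and z: "\<And>k. k \<in> -{i,j} \<Longrightarrow> Ot G 6 (\<lambda>t. q t $ k)"
  shows "Ot G 11 (\<lambda>t. F (q t) - (Y t)^9 * ((w^3 + M 0 * w\<^sup>2 + 1) + Y t * (N 0 * w + partial_deriv j M 0 * w\<^sup>2)))"
proof -
  note Y1 = Ot_nth[of j]
  have wY: "Ot G 3 (\<lambda>t. w * (Y t)^3)" by (rule Ot_cmult[OF pow[OF Y1]]) simp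
  have X3: "Ot G 3 X"
    using Ot_add[OF mono[OF d, of 3] wY] by simp
  have "analytic_germ (\<lambda>p. M p - M 0)" by (intro analytic_intros an)
  from hadamard_germ[OF this] obtain h where h: "\<And>k. analytic_germ (h k)"
    "\<And>k. h k 0 = partial_deriv k (\<lambda>p. M p - M 0) 0"
    and he: "\<forall>\<^sub>F p in nhds 0. M p - M 0 = (\<Sum>k\<in>UNIV. p $ k * h k p)" by auto
  have hj: "h j 0 = partial_deriv j M 0"
    using partial_deriv_0_add[OF an(1), of "\<lambda>_. - M 0" j] by (simp add: h(2) analytic_intros)
  have M2: "Ot G 2 (\<lambda>t. M (q t) - M 0 - partial_deriv j M 0 * Y t)"
  proof -
    have o2: "Ot G 2 (\<lambda>t. q t $ k * h k (q t))" if "k \<noteq> j" for k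
    proof -
      have "Ot G 2 (\<lambda>t. q t $ k)" using that X3 z[of k] by (cases "k = i") (auto intro: mono)
      from mult[OF this Ot_analytic[OF h(1)], of 2] show ?thesis by simp
    qed
    have s: "Ot G 2 (\<lambda>t. \<Sum>k\<in>-{j}. q t $ k * h k (q t))" by (rule Ot_sum) (use o2 in auto)
    have r: "Ot G 2 (\<lambda>t. Y t * (h j (q t) - h j 0))" by (rule mult[OF Y1 Ot_analytic_1[OF h(1)]]) simp
    show ?thesis
    proof (rule Ot_cong[OF _ Ot_add[OF s r]], rule eventually_mono[OF eventually_compose_filterlim[OF he q_lim]])
      fix t assume "M (q t) - M 0 = (\<Sum>k\<in>UNIV. q t $ k * h k (q t))"
      also have "\<dots> = Y t * h j (q t) + (\<Sum>k\<in>-{j}. q t $ k * h k (q t))"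
        by (subst sum.remove[of _ j]) (auto simp: Compl_eq_Diff_UNIV)
      finally show "(\<Sum>k\<in>-{j}. q t $ k * h k (q t)) + Y t * (h j (q t) - h j 0) = M (q t) - M 0 - partial_deriv j M 0 * Y t"
        by (simp add: hj algebra_simps)
    qed
  qed
  let ?d = "\<lambda>t. X t - w * (Y t)^3"
  let ?e = "partial_deriv j M 0"
  have 1: "Ot G 11 (\<lambda>t. (?d t)\<^sup>2 * ((3 * w + M 0) * (Y t)^3))"
    by (rule mult[OF pow[OF d, of 8 2] Ot_cmult[OF pow[OF Y1, of 3 3]]]) auto
  have 2: "Ot G 11 (\<lambda>t. (?d t)^3)" by (rule pow[OF d]) simp
  have 3: "Ot G 11 (\<lambda>t. (X t)\<^sup>2 * (Y t)^3 * (M (q t) - M 0 - ?e * Y t))"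
    by (rule mult[OF mult[OF pow[OF X3, of 6 2] pow[OF Y1, of 3 3], of 9] M2]) auto
  have 4: "Ot G 11 (\<lambda>t. ?e * ((Y t)^4 * (?d t * (X t + w * (Y t)^3))))"
    by (rule Ot_cmult[OF mult[OF pow[OF Y1, of 4 4] mult[OF d Ot_add[OF X3 wY], of 7]]]) auto
  have 5: "Ot G 11 (\<lambda>t. (X t * (Y t)^7) * (N (q t) - N 0))"
    by (rule mult[OF mult[OF X3 pow[OF Y1, of 7 7], of 10] Ot_analytic_1[OF an(2)]]) auto
  have 6: "Ot G 11 (\<lambda>t. N 0 * (?d t * (Y t)^7))"
    by (rule Ot_cmult[OF mult[OF d pow[OF Y1, of 7 7]]]) auto
  have 7: "Ot G 11 (\<lambda>t. \<Sum>k\<in>-{i,j}. (q t $ k)\<^sup>2)" by (rule Ot_sum) (auto intro!: pow[OF z])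
  have 8: "Ot G 11 (\<lambda>t. R (q t))" by (rule Ot_ordge[OF R11])
  note tot = Ot_add[OF Ot_add[OF Ot_add[OF 1 2] Ot_add[OF 3 4]] Ot_add[OF Ot_add[OF 5 6] Ot_add[OF 7 8]]]
  show ?thesis
  proof (rule Ot_cong[OF _ tot], rule eventually_mono[OF eventually_compose_filterlim[OF F q_lim]])
    fix t assume "F (q t) = nf_expr i j M N R (q t)"
    \<comment> \<open>The expansion about x = w y^3; the linear term is a multiple of w (3 w + 2 b)
      and drops out.\<close>
    moreover have id: "x^3 + y^9 + x\<^sup>2 * y^3 * m - y^9 * ((w^3 + b * w\<^sup>2 + 1) + y * (e * w\<^sup>2))
      = (x - w * y^3)\<^sup>2 * ((3 * w + b) * y^3) + (x - w * y^3)^3 + x\<^sup>2 * y^3 * (m - b - e * y)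
        + e * (y^4 * ((x - w * y^3) * (x + w * y^3)))"
      if "w * (3 * w + 2 * b) = 0" for x y b m e :: complex
    proof -
      have "x^3 + y^9 + x\<^sup>2 * y^3 * m - y^9 * ((w^3 + b * w\<^sup>2 + 1) + y * (e * w\<^sup>2))
        - ((x - w * y^3)\<^sup>2 * ((3 * w + b) * y^3) + (x - w * y^3)^3 + x\<^sup>2 * y^3 * (m - b - e * y)
        + e * (y^4 * ((x - w * y^3) * (x + w * y^3)))) = (w * (3 * w + 2 * b)) * (x - w * y^3) * y^6"
        by (simp add: power_numeral_reduce eval_nat_numeral algebra_simps)
      then show ?thesis using that by simp
    qed
    ultimately show "(?d t)\<^sup>2 * ((3 * w + M 0) * (Y t)^3) + (?d t)^3 +
        ((X t)\<^sup>2 * (Y t)^3 * (M (q t) - M 0 - ?e * Y t) + ?e * ((Y t)^4 * (?d t * (X t + w * (Y t)^3)))) +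
        ((X t * (Y t)^7) * (N (q t) - N 0) + N 0 * (?d t * (Y t)^7) + ((\<Sum>k\<in>-{i,j}. (q t $ k)\<^sup>2) + R (q t)))
        = F (q t) - (Y t)^9 * ((w^3 + M 0 * w\<^sup>2 + 1) + Y t * (N 0 * w + ?e * w\<^sup>2))"
      using id[OF w, of "X t" "Y t" "M (q t)" ?e] unfolding nf_expr_def
      by (simp add: power_numeral_reduce eval_nat_numeral algebra_simps)
  qed
qed

end

text \<open>The derivative e of M is recorded along with c because on the branch x = w y^3 the
  monomials x^2 y^4 and x y^7 both have size y^10.\<close>

definition lip_normal_form :: "'n::finite \<Rightarrow> 'n \<Rightarrow> (complex ^ 'n \<Rightarrow> complex) \<Rightarrow> complex \<Rightarrow> complex \<Rightarrow> complex \<Rightarrow> bool" where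
  "lip_normal_form i j F b e c \<longleftrightarrow> (\<exists>M N R. analytic_germ M \<and> analytic_germ N \<and> analytic_germ R \<and> ordge 11 R \<and>
     M 0 = b \<and> partial_deriv j M 0 = e \<and> N 0 = c \<and> (\<forall>\<^sub>F p in nhds 0. F p = nf_expr i j M N R p))"

text \<open>
  The zone splits into two branches \<open>x = O(y ^ 4)\<close> and \<open>x = w y ^ 3 + O(y ^ 4)\<close>, \<open>w = - 2 b / 3\<close>.
  Points on the two branches with the same \<open>y\<close> are at distance \<open>O(y ^ 3)\<close>, and so are their images;
  hence the quotient of the values of the germ at such points is preserved up to \<open>O(y ^ 2)\<close>.
\<close>

theorem lip_normal_form_invariants:
  fixes F F' :: "complex ^ 'n::finite \<Rightarrow> complex"
  assumes ij: "i \<noteq> j" and nf: "lip_normal_form i j F b e c" and nf': "lip_normal_form i j F' b' e' c'"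
    and lp: "lip_pair \<phi> \<psi>" and eq: "\<forall>\<^sub>F p in nhds 0. F p = F' (\<phi> p)"
    and b: "Re (b ^ 3) > 0" and b': "Re (b' ^ 3) > 0"
  defines "w \<equiv> - 2 * b / 3" and "w' \<equiv> - 2 * b' / 3"
  shows "b ^ 3 = b' ^ 3 \<and> (c * w + e * w\<^sup>2) ^ 9 = (c' * w' + e' * w'\<^sup>2) ^ 9"
proof -
  obtain M N R where an: "analytic_germ M" "analytic_germ N" "analytic_germ R" and R11: "ordge 11 R"
    and co: "M 0 = b" "partial_deriv j M 0 = e" "N 0 = c" and F: "\<forall>\<^sub>F p in nhds 0. F p = nf_expr i j M N R p"
    using nf unfolding lip_normal_form_def by blast
  obtain M' N' R' where an': "analytic_germ M'" "analytic_germ N'" "analytic_germ R'" and R11': "ordge 11 R'"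
    and co': "M' 0 = b'" "partial_deriv j M' 0 = e'" "N' 0 = c'" and F': "\<forall>\<^sub>F p in nhds 0. F' p = nf_expr i j M' N' R' p"
    using nf' unfolding lip_normal_form_def by blast
  have anF: "analytic_germ F" using analytic_germ_cong[OF F] nf_expr_analytic[OF an] by blast
  have anF': "analytic_germ F'" using analytic_germ_cong[OF F'] nf_expr_analytic[OF an'] by blast
  have b0: "b \<noteq> 0" "b' \<noteq> 0" using b b' by auto
  define B :: "real filter" where "B = at_right 0"
  have posB: "\<forall>\<^sub>F t in B. 0 < t \<and> t < 1"
    unfolding B_def using eventually_at_right_real[of 0 1] by (auto elim: eventually_mono)
  have limB: "((\<lambda>t. t) \<longlongrightarrow> 0) B" unfolding B_def by (rule tendsto_ident_at)
  define v where "v a = (if a then w else 0)" for a :: bool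
  define v' where "v' a = (if a then w' else 0)" for a :: bool
  have v: "v a * (3 * v a + 2 * b) = 0" for a by (simp add: v_def w_def)
  have v': "v' a * (3 * v' a + 2 * b') = 0" for a by (simp add: v'_def w'_def)
  \<comment> \<open>Two test arcs with the same y = t, one on each branch of the zone: x = 0 and x =
    w t^3.\<close>
  define p :: "bool \<Rightarrow> real \<Rightarrow> complex ^ 'n"
    where "p a t = (\<chi> k. if k = i then v a * of_real t ^ 3 else if k = j then of_real t else 0)" for a t
  define q where "q a t = \<phi> (p a t)" for a t
  have pi: "p a t $ i = v a * of_real t ^ 3" and pj: "p a t $ j = of_real t"
    and pk: "k \<in> -{i,j} \<Longrightarrow> p a t $ k = 0" for a t k
    using ij by (auto simp: p_def)
  have pgc: "nf_curve B (p a) i j M N R F" for a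
  proof
    have "norm (p a t) \<le> (norm (v a) + 1) * t" if "0 < t" "t < 1" for t
    proof -
      have "norm (p a t) \<le> (\<Sum>k\<in>UNIV. norm (p a t $ k))" unfolding norm_vec_def by (rule L2_set_le_sum) simp
      also have "\<dots> = (\<Sum>k\<in>{i,j}. norm (p a t $ k))"
        by (rule sum.mono_neutral_right) (auto simp: pk)
      also have "\<dots> = norm (v a) * t ^ 3 + t" using ij that by (simp add: pi pj norm_mult norm_power)
      also have "\<dots> \<le> norm (v a) * t + t"
        using power_decreasing[of 1 3 t] that by (intro add_right_mono mult_left_mono) auto
      finally show ?thesis by (simp add: algebra_simps)
    qed
    then show "\<exists>C. \<forall>\<^sub>F t in B. norm (p a t) \<le> C * t"
      using posB by (intro exI[of _ "norm (v a) + 1"]) (auto elim: eventually_mono)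
    have "1 * t \<le> norm (p a t)" if "0 < t" for t
      using Finite_Cartesian_Product.norm_nth_le[of "p a t" j] that by (simp add: pj)
    then show "\<exists>c>0. \<forall>\<^sub>F t in B. c * t \<le> norm (p a t)"
      using posB by (intro exI[of _ 1]) (auto elim: eventually_mono)
  qed (use posB limB ij an R11 F in auto)
  have pz: "Ot B n (\<lambda>t. p a t $ k)" if "k \<in> -{i,j}" for a k n using pk[OF that] by simp
  have p4: "Ot B n (\<lambda>t. p a t $ i - v a * (p a t $ j)^3)" for a n by (simp add: pi pj)
  have pzone: "Ot B 7 (\<lambda>t. partial_deriv m F (p a t))" for a m
  proof -
    interpret nf_curve B "p a" i j M N R F by (rule pgc)
    have "Ot B 3 (\<lambda>t. v a * (p a t $ j)^3)" by (rule Ot_cmult[OF pow[OF Ot_nth]]) simp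
    then have x3: "Ot B 3 (\<lambda>t. p a t $ i)" by (simp add: pi pj)
    have "p a t $ i * (3 * p a t $ i + 2 * M 0 * (p a t $ j)^3) = 0" for t
      using v[of a] by (simp add: pi pj co(1)) (metis (no_types, opaque_lifting) distrib_right mult.assoc mult_eq_0_iff)
    then have crit: "Ot B 7 (\<lambda>t. p a t $ i * (3 * p a t $ i + 2 * M 0 * (p a t $ j)^3))" by (simp only: Ot_zero)
    show ?thesis by (rule zone_membership[OF x3 pz crit])
  qed
  obtain L1 r1 where L1: "r1 > 0" "L1-lipschitz_on (ball 0 r1) \<phi>" and \<phi>0: "\<phi> 0 = 0"
    using lp unfolding lip_pair_def lip_germ_def by blast
  obtain L2 r2 where L2: "r2 > 0" "L2-lipschitz_on (ball 0 r2) \<psi>" and \<psi>0: "\<psi> 0 = 0"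
    using lp unfolding lip_pair_def lip_germ_def by blast
  have L0: "L1 \<ge> 0" "L2 \<ge> 0" using L1(2) L2(2) lipschitz_on_nonneg by blast+
  have inv: "\<forall>\<^sub>F x in nhds 0. \<psi> (\<phi> x) = x \<and> \<phi> (\<psi> x) = x" using lp by (simp add: lip_pair_def)
  have \<phi>lim: "filterlim \<phi> (nhds 0) (nhds 0)" and \<psi>lim: "filterlim \<psi> (nhds 0) (nhds 0)"
    using lp lip_germ_filterlim unfolding lip_pair_def by blast+
  have inb: "\<forall>\<^sub>F x in nhds 0. x \<in> ball (0 :: complex ^ 'n) r" if "r > 0" for r
    using that by (intro eventually_nhds_in_open) auto
  have plim: "filterlim (p a) (nhds 0) B" for a
  proof -
    interpret nf_curve B "p a" i j M N R F by (rule pgc)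
    show ?thesis by (rule q_lim)
  qed
  have qlim: "filterlim (q a) (nhds 0) B" for a
    unfolding q_def[abs_def] using filterlim_compose[OF \<phi>lim plim] .
  have qsize: "\<forall>\<^sub>F t in B. norm (q a t) \<le> L1 * norm (p a t) \<and> norm (p a t) \<le> L2 * norm (q a t) \<and> \<psi> (q a t) = p a t" for a
    using eventually_compose_filterlim[OF inb[OF L1(1)] plim[of a]] eventually_compose_filterlim[OF inb[OF L2(1)] qlim[of a]]
      eventually_compose_filterlim[OF inv plim[of a]]
  proof eventually_elim
    case (elim t)
    have "dist (\<phi> (p a t)) (\<phi> 0) \<le> L1 * dist (p a t) 0"
      by (rule lipschitz_onD[OF L1(2)]) (use elim L1 in auto)
    moreover have "dist (\<psi> (q a t)) (\<psi> 0) \<le> L2 * dist (q a t) 0"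
      by (rule lipschitz_onD[OF L2(2)]) (use elim L2 in auto)
    ultimately show ?case using elim by (simp add: q_def \<phi>0 \<psi>0)
  qed
  have qgc: "nf_curve B (q a) i j M' N' R' F'" for a
  proof
    interpret P: nf_curve B "p a" i j M N R F by (rule pgc)
    obtain C where C: "\<forall>\<^sub>F t in B. norm (p a t) \<le> C * t" using P.upper by blast
    have "\<forall>\<^sub>F t in B. norm (q a t) \<le> (L1 * C) * t"
      using C qsize[of a]
    proof eventually_elim
      case (elim t)
      have "L1 * norm (p a t) \<le> L1 * (C * t)" using elim L0 by (intro mult_left_mono) auto
      with elim show ?case by simp
    qed
    then show "\<exists>C. \<forall>\<^sub>F t in B. norm (q a t) \<le> C * t" by blast
    obtain k where k: "k > 0" "\<forall>\<^sub>F t in B. k * t \<le> norm (p a t)" using P.lower by blast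
    have "\<forall>\<^sub>F t in B. (k / (L2 + 1)) * t \<le> norm (q a t)"
      using k(2) qsize[of a]
    proof eventually_elim
      case (elim t)
      have "k * t \<le> L2 * norm (q a t)" using elim by simp
      also have "\<dots> \<le> (L2 + 1) * norm (q a t)" by (intro mult_right_mono) auto
      finally show ?case using L0 by (simp add: pos_divide_le_eq add_nonneg_pos mult.commute)
    qed
    then show "\<exists>c>0. \<forall>\<^sub>F t in B. c * t \<le> norm (q a t)" using k(1) L0
      by (intro exI[of _ "k / (L2 + 1)"]) (simp add: add_nonneg_pos)
  qed (use posB limB ij an' R11' F' in auto)
  have eq2: "\<forall>\<^sub>F x in nhds 0. F' x = F (\<psi> x)"
    using eventually_compose_filterlim[OF eq \<psi>lim] inv by eventually_elim simp
  have lip2: "\<forall>\<^sub>F x in nhds 0. x \<in> ball 0 r2 \<and> (\<forall>\<^sub>F z in nhds x. norm (\<psi> z - \<psi> x) \<le> L2 * norm (z - x))"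
    using inb[OF L2(1)]
  proof eventually_elim
    case (elim x)
    have "\<forall>\<^sub>F z in nhds x. z \<in> ball 0 r2" using elim by (intro eventually_nhds_in_open) auto
    then have "\<forall>\<^sub>F z in nhds x. norm (\<psi> z - \<psi> x) \<le> L2 * norm (z - x)"
      by eventually_elim (use lipschitz_onD[OF L2(2)] elim in \<open>auto simp: dist_norm\<close>)
    with elim show ?case by simp
  qed
  have qzone: "Ot B 7 (\<lambda>t. partial_deriv m F' (q a t))" for a m
  proof -
    interpret P: nf_curve B "p a" i j M N R F by (rule pgc)
    have eq2': "\<forall>\<^sub>F x in nhds 0. \<forall>\<^sub>F z in nhds x. F' z = F (\<psi> z)" using eq2 by (simp add: eventually_eventually)
    have "Ot B 7 (\<lambda>t. of_real (norm (partial_deriv k F (p a t))))" for k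
      using pzone[of k a] by (simp add: Ot_def)
    then have "Ot B 7 (\<lambda>t. \<Sum>k\<in>UNIV. of_real (norm (partial_deriv k F (p a t))))" by (rule Ot_sum)
    from Ot_mult[OF this Ot_const[of B "of_real L2"]]
    have "Ot B 7 (\<lambda>t. (\<Sum>k\<in>UNIV. of_real (norm (partial_deriv k F (p a t)))) * of_real L2)" by simp
    then obtain C where C: "\<forall>\<^sub>F t in B. norm ((\<Sum>k\<in>UNIV. of_real (norm (partial_deriv k F (p a t)))) * of_real L2 :: complex) \<le> C * t ^ 7"
      unfolding Ot_def by blast
    have "\<forall>\<^sub>F t in B. norm (partial_deriv m F' (q a t)) \<le> C * t ^ 7"
      using C qsize[of a] eventually_compose_filterlim[OF eq2' qlim[of a]] eventually_compose_filterlim[OF lip2 qlim[of a]]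
        eventually_compose_filterlim[OF analytic_germ_holoD[OF anF] plim[of a]]
        eventually_compose_filterlim[OF analytic_germ_holoD[OF anF'] qlim[of a]]
    proof eventually_elim
      case (elim t)
      have "norm (partial_deriv m F' (q a t)) \<le> (\<Sum>k\<in>UNIV. norm (partial_deriv k F (p a t))) * L2"
        by (rule partial_deriv_transfer[where \<psi> = \<psi>]) (use elim L0 in auto)
      also have "\<dots> = norm ((\<Sum>k\<in>UNIV. of_real (norm (partial_deriv k F (p a t)))) * of_real L2 :: complex)"
        using L0 by (simp add: norm_mult of_real_sum[symmetric] sum_nonneg del: of_real_sum)
      also have "\<dots> \<le> C * t ^ 7" using elim by simp
      finally show ?case .
    qed
    then show ?thesis unfolding Ot_def by blast
  qed
  have "\<exists>K. \<forall>\<^sub>F t in B. norm (q a t $ i) \<le> K * t ^ 4 \<or> norm (q a t $ i - w' * (q a t $ j)^3) \<le> K * t ^ 4" for a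
  proof -
    interpret Q: nf_curve B "q a" i j M' N' R' F' by (rule qgc)
    show ?thesis using Q.zone_points(4)[OF qzone] b0 co' by (simp add: w'_def)
  qed
  then have "\<exists>K. \<forall>a. \<forall>\<^sub>F t in B. norm (q a t $ i) \<le> K a * t ^ 4 \<or> norm (q a t $ i - w' * (q a t $ j)^3) \<le> K a * t ^ 4"
    by (intro choice allI)
  then obtain K where K: "\<And>a. \<forall>\<^sub>F t in B. norm (q a t $ i) \<le> K a * t ^ 4 \<or> norm (q a t $ i - w' * (q a t $ j)^3) \<le> K a * t ^ 4"
    by blast
  define inz where "inz a s t \<longleftrightarrow> norm (q a t $ i - v' s * (q a t $ j)^3) \<le> K a * t ^ 4" for a s t
  have cov: "\<forall>\<^sub>F t in B. \<exists>s1 s2. inz False s1 t \<and> inz True s2 t"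
    using K[of False] K[of True]
  proof eventually_elim
    case (elim t)
    have "\<exists>s. inz a s t" if "norm (q a t $ i) \<le> K a * t ^ 4 \<or> norm (q a t $ i - w' * (q a t $ j)^3) \<le> K a * t ^ 4" for a
    proof -
      have "inz a False t \<or> inz a True t" using that by (simp add: inz_def v'_def)
      then show ?thesis by blast
    qed
    with elim show ?case by blast
  qed
  have Bnt: "B \<noteq> bot" unfolding B_def by simp
  \<comment> \<open>The image points may change branches as t varies. One of the four pairs of
    branches occurs for arbitrarily small t, and the filter G keeps only these t.\<close>
  have "\<exists>s1 s2. \<exists>\<^sub>F t in B. inz False s1 t \<and> inz True s2 t"
  proof (rule ccontr)
    assume "\<not> ?thesis"
    then have *: "\<forall>\<^sub>F t in B. \<not> (inz False s1 t \<and> inz True s2 t)" for s1 s2 by (simp add: not_frequently)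
    have "\<forall>\<^sub>F t in B. False"
      using cov *[of False False] *[of False True] *[of True False] *[of True True]
    proof eventually_elim
      case (elim t)
      then show ?case by (metis (full_types))
    qed
    with Bnt show False by (simp add: eventually_False)
  qed
  then obtain s1 s2 where fr: "\<exists>\<^sub>F t in B. inz False s1 t \<and> inz True s2 t" by blast
  define G where "G = inf B (principal {t. inz False s1 t \<and> inz True s2 t})"
  have GB: "G \<le> B" by (simp add: G_def)
  have Gnt: "G \<noteq> bot"
    using fr unfolding G_def frequently_def trivial_limit_def eventually_inf_principal by simp
  have inG: "\<forall>\<^sub>F t in G. inz False s1 t \<and> inz True s2 t"
    unfolding G_def eventually_inf_principal by simp
  have posG: "\<forall>\<^sub>F t in G. 0 < t \<and> t < 1" using posB GB filter_leD by blast
  have posG': "\<forall>\<^sub>F t in G. t > 0" using posG by (auto elim: eventually_mono)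
  have limG: "((\<lambda>t. t) \<longlongrightarrow> 0) G" using limB GB tendsto_mono by blast
  define sg where "sg a = (if a then s2 else s1)" for a :: bool
  have q4: "Ot G 4 (\<lambda>t. q a t $ i - v' (sg a) * (q a t $ j)^3)" for a
  proof -
    have "\<forall>\<^sub>F t in G. inz a (sg a) t" using inG by eventually_elim (cases a, auto simp: sg_def)
    then show ?thesis unfolding Ot_def inz_def by blast
  qed
  have pgG: "nf_curve G (p a) i j M N R F" for a
  proof -
    interpret P: nf_curve B "p a" i j M N R F by (rule pgc)
    show ?thesis
      by unfold_locales (use posG limG P.upper P.lower GB ij an R11 F in \<open>auto dest: filter_leD\<close>)
  qed
  have qgG: "nf_curve G (q a) i j M' N' R' F'" for a
  proof -
    interpret Q: nf_curve B "q a" i j M' N' R' F' by (rule qgc)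
    show ?thesis
      by unfold_locales (use posG limG Q.upper Q.lower GB ij an' R11' F' in \<open>auto dest: filter_leD\<close>)
  qed
  define Pv where "Pv a = v a ^ 3 + b * (v a)\<^sup>2 + 1" for a
  define Qv where "Qv a = c * v a + e * (v a)\<^sup>2" for a
  define Pv' where "Pv' a = v' a ^ 3 + b' * (v' a)\<^sup>2 + 1" for a
  define Qv' where "Qv' a = c' * v' a + e' * (v' a)\<^sup>2" for a
  have Fp: "Ot G 11 (\<lambda>t. F (p a t) - of_real t ^ 9 * (Pv a + of_real t * Qv a))" for a
  proof -
    interpret P: nf_curve G "p a" i j M N R F by (rule pgG)
    show ?thesis
      using P.zone_value[OF Ot_filter_mono[OF p4 GB] _ Ot_filter_mono[OF pz GB]] v[of a]
      by (simp add: pj co Pv_def Qv_def)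
  qed
  have Fq: "Ot G 11 (\<lambda>t. F' (q a t) - (q a t $ j) ^ 9 * (Pv' (sg a) + q a t $ j * Qv' (sg a)))" for a
  proof -
    interpret Q: nf_curve B "q a" i j M' N' R' F' by (rule qgc)
    have z6: "Ot G 6 (\<lambda>t. q a t $ k)" if "k \<in> -{i,j}" for k
      using Ot_filter_mono[OF Q.zone_points(3)[OF qzone _ that] GB] b0 co' by simp
    interpret Q': nf_curve G "q a" i j M' N' R' F' by (rule qgG)
    show ?thesis
      using Q'.zone_value[OF q4 _ z6] v'[of "sg a"] by (simp add: co' Pv'_def Qv'_def)
  qed
  have FF: "\<forall>\<^sub>F t in G. F (p a t) = F' (q a t)" for a
    using filter_leD[OF GB eventually_compose_filterlim[OF eq plim[of a]]] by (simp add: q_def)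
  have E: "Ot G 11 (\<lambda>t. (q a t $ j) ^ 9 * (Pv' (sg a) + q a t $ j * Qv' (sg a)) - of_real t ^ 9 * (Pv a + of_real t * Qv a))" for a
    by (rule Ot_cong[OF _ Ot_diff[OF Fp[of a] Fq[of a]]], rule eventually_mono[OF FF[of a]]) simp
  interpret Q0: nf_curve G "q False" i j M' N' R' F' by (rule qgG)
  interpret Q1: nf_curve G "q True" i j M' N' R' F' by (rule qgG)
  let ?Y = "\<lambda>t. q False t $ j" and ?Y2 = "\<lambda>t. q True t $ j"
  \<comment> \<open>The test points differ by w t^3 in x alone, so their images are Lipschitz-close
    and the second y-coordinate can be replaced by the first one in a tenth or ninth power up to
    order 11.\<close>
  have Yd: "Ot G 3 (\<lambda>t. ?Y2 t - ?Y t)"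
  proof -
    have "\<forall>\<^sub>F t in G. norm (?Y2 t - ?Y t) \<le> (L1 * norm w) * t ^ 3"
      using filter_leD[OF GB eventually_compose_filterlim[OF inb[OF L1(1)] plim[of False]]]
        filter_leD[OF GB eventually_compose_filterlim[OF inb[OF L1(1)] plim[of True]]] posG
    proof eventually_elim
      case (elim t)
      have d: "p True t - p False t = axis i (w * of_real t ^ 3)"
        by (simp add: vec_eq_iff p_def v_def axis_def)
      have "norm (?Y2 t - ?Y t) \<le> norm (q True t - q False t)"
        using Finite_Cartesian_Product.norm_nth_le[of "q True t - q False t" j] by simp
      also have "\<dots> \<le> L1 * norm (p True t - p False t)"
        using lipschitz_onD[OF L1(2) elim(2,1)] by (simp add: q_def dist_norm)
      also have "\<dots> = (L1 * norm w) * t ^ 3" using elim unfolding d norm_axis by (simp add: norm_mult norm_power)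
      finally show ?case .
    qed
    then show ?thesis unfolding Ot_def by blast
  qed
  have E2: "Ot G 11 (\<lambda>t. (?Y t) ^ 9 * (Pv' s2 + ?Y t * Qv' s2) - of_real t ^ 9 * (Pv True + of_real t * Qv True))"
  proof -
    have pw: "Ot G 11 (\<lambda>t. (?Y2 t) ^ Suc n - (?Y t) ^ Suc n)" if "n \<ge> 8" for n
    proof -
      have "Ot G n (\<lambda>t. \<Sum>k<Suc n. ?Y2 t ^ k * ?Y t ^ (n - k))"
        by (rule Ot_sum, rule Q0.mult[OF Ot_power[OF Q1.Ot_nth] Ot_power[OF Q0.Ot_nth]]) auto
      from Q0.mult[OF Yd this, of 11] that show ?thesis
        by (simp only: power_diff_sumr2 mult.commute) simp
    qed
    have "Ot G 11 (\<lambda>t. ((?Y2 t) ^ Suc 8 - (?Y t) ^ Suc 8) * Pv' s2 + ((?Y2 t) ^ Suc 9 - (?Y t) ^ Suc 9) * Qv' s2)"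
      by (intro Ot_add Q0.mult[OF pw Ot_const]) auto
    from Ot_diff[OF E[of True] this] show ?thesis
      by (rule Ot_cong[rotated]) (simp add: sg_def algebra_simps eval_nat_numeral)
  qed
  have E1: "Ot G 11 (\<lambda>t. (?Y t) ^ 9 * (Pv' s1 + ?Y t * Qv' s1) - of_real t ^ 9)"
    using E[of False] by (simp add: sg_def Pv_def Qv_def v_def)
  \<comment> \<open>The unknown ratio of the y-coordinates is bounded. It is the same in both
    comparisons of values and will be eliminated between them.\<close>
  define r where "r t = ?Y t / of_real t" for t
  have r0: "Ot G 0 r"
    unfolding r_def using Ot_divide_power[of G 0 1 ?Y] Q0.Ot_nth posG' by simp
  have Yr: "\<forall>\<^sub>F t in G. ?Y t = of_real t * r t" using posG' by eventually_elim (simp add: r_def)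
  have t1: "Ot G 1 (\<lambda>t. of_real t)" by (rule Ot_of_real[OF posG'])
  have D1: "Ot G 2 (\<lambda>t. r t ^ 9 * Pv' s1 + of_real t * (r t ^ 10 * Qv' s1) - 1)"
  proof -
    have "Ot G 2 (\<lambda>t. ((?Y t) ^ 9 * (Pv' s1 + ?Y t * Qv' s1) - of_real t ^ 9) / of_real t ^ 9)"
      by (rule Ot_divide_power[OF _ posG']) (use E1 in simp)
    then show ?thesis
    proof (rule Ot_cong[rotated])
      show "\<forall>\<^sub>F t in G. ((?Y t) ^ 9 * (Pv' s1 + ?Y t * Qv' s1) - of_real t ^ 9) / of_real t ^ 9 =
          r t ^ 9 * Pv' s1 + of_real t * (r t ^ 10 * Qv' s1) - 1"
        using Yr posG' by eventually_elim (simp add: power_mult_distrib field_simps eval_nat_numeral)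
    qed
  qed
  have D2: "Ot G 2 (\<lambda>t. r t ^ 9 * Pv' s2 + of_real t * (r t ^ 10 * Qv' s2) - (Pv True + of_real t * Qv True))"
  proof -
    have "Ot G 2 (\<lambda>t. ((?Y t) ^ 9 * (Pv' s2 + ?Y t * Qv' s2) - of_real t ^ 9 * (Pv True + of_real t * Qv True)) / of_real t ^ 9)"
      by (rule Ot_divide_power[OF _ posG']) (use E2 in simp)
    then show ?thesis
    proof (rule Ot_cong[rotated])
      show "\<forall>\<^sub>F t in G. ((?Y t) ^ 9 * (Pv' s2 + ?Y t * Qv' s2) - of_real t ^ 9 * (Pv True + of_real t * Qv True)) / of_real t ^ 9 =
          r t ^ 9 * Pv' s2 + of_real t * (r t ^ 10 * Qv' s2) - (Pv True + of_real t * Qv True)"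
        using Yr posG' by eventually_elim (simp add: power_mult_distrib field_simps eval_nat_numeral)
    qed
  qed
  have o1: "Ot G 1 (\<lambda>t. of_real t * (r t ^ n * x))" for n x
    using Ot_mult[OF t1 Ot_mult[OF Ot_power[OF r0] Ot_const]] by simp
  have lim1: "((\<lambda>t. r t ^ 9 * Pv' s1) \<longlongrightarrow> 1) G"
  proof -
    have "Ot G (Suc 0) (\<lambda>t. r t ^ 9 * Pv' s1 - 1)"
      using Ot_diff[OF Ot_mono[OF D1 _ posG, of 1] o1[of 10 "Qv' s1"]] by simp
    from Ot_tendsto_0[OF this limG] show ?thesis by (simp add: LIM_zero_iff)
  qed
  have lim2: "((\<lambda>t. r t ^ 9 * Pv' s2) \<longlongrightarrow> Pv True) G"
  proof -
    have q: "Ot G 1 (\<lambda>t. of_real t * Qv True)" using Ot_mult[OF t1 Ot_const] by simp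
    have d: "Ot G 1 (\<lambda>t. r t ^ 9 * Pv' s2 + of_real t * (r t ^ 10 * Qv' s2) - (Pv True + of_real t * Qv True))"
      by (rule Ot_mono[OF D2 _ posG]) simp
    have "Ot G 1 (\<lambda>t. r t ^ 9 * Pv' s2 - Pv True)"
      by (rule Ot_cong[OF _ Ot_add[OF Ot_diff[OF d o1[of 10 "Qv' s2"]] q]]) simp
    then have "Ot G (Suc 0) (\<lambda>t. r t ^ 9 * Pv' s2 - Pv True)" by simp
    from Ot_tendsto_0[OF this limG] show ?thesis by (simp add: LIM_zero_iff)
  qed
  \<comment> \<open>Both limits of r^9, multiplied crosswise, eliminate r.\<close>
  have "((\<lambda>t. (r t ^ 9 * Pv' s1) * Pv' s2) \<longlongrightarrow> 1 * Pv' s2) G" by (intro tendsto_intros lim1)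
  moreover have "((\<lambda>t. (r t ^ 9 * Pv' s2) * Pv' s1) \<longlongrightarrow> Pv True * Pv' s1) G" by (intro tendsto_intros lim2)
  ultimately have PP: "Pv' s2 = Pv True * Pv' s1"
    using tendsto_unique[OF Gnt] by (simp add: mult_ac)
  have Pt: "Pv True = 1 + 4 * b ^ 3 / 27" "Pv' True = 1 + 4 * b' ^ 3 / 27" "Pv' False = 1"
    by (simp_all add: Pv_def Pv'_def v_def v'_def w_def w'_def field_simps power2_eq_square power3_eq_cube)
  \<comment> \<open>The values at leading order are 1 on one branch and 1 + 4 b^3 / 27 on the other;
    the positive real part of b^3 makes the latter larger in norm, which rules out every assignment
    of branches but the expected one.\<close>
  have big: "norm (1 + 4 * z / 27) > 1" if "Re z > 0" for z :: complex
    using complex_Re_le_cmod[of "1 + 4 * z / 27"] that by simp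
  have P1: "norm (Pv True) > 1" "norm (Pv' True) > 1" using big b b' Pt by simp_all
  have s: "\<not> s1 \<and> s2"
  proof (cases s1; cases s2)
    assume "s1" "s2"
    then have "Pv True = 1" using PP P1 by auto
    then show ?thesis using P1 by auto
  next
    assume "s1" "\<not> s2"
    then have "1 = norm (Pv True) * norm (Pv' True)" using PP Pt(3) by (simp flip: norm_mult)
    then show ?thesis using P1 by (smt (verit) mult_less_cancel_left1)
  next
    assume "\<not> s1" "\<not> s2"
    then have "Pv True = 1" using PP Pt(3) by auto
    then show ?thesis using P1 by auto
  qed auto
  then have sv: "s1 = False" "s2 = True" by auto
  have PPt: "Pv' True = Pv True" using PP sv Pt(3) by simp
  then have bb: "b ^ 3 = b' ^ 3" using Pt by simp
  have Q0: "Qv' False = 0" by (simp add: Qv'_def v'_def)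
  have r9: "((\<lambda>t. r t ^ 9) \<longlongrightarrow> 1) G" using lim1 sv Pt(3) by simp
  \<comment> \<open>The leading terms cancel in this combination and the next order remains. As only
    r^9 has a known limit, the result is raised to the ninth power.\<close>
  have "Ot G 2 (\<lambda>t. of_real t * (r t ^ 10 * Qv' True - Qv True))"
    using Ot_diff[OF D2 Ot_cmult[OF D1, of "Pv True"]] sv Pt(3) PPt Q0 by (simp add: algebra_simps)
  then have "Ot G 1 (\<lambda>t. of_real t * (r t ^ 10 * Qv' True - Qv True) / of_real t ^ 1)"
    by (intro Ot_divide_power[OF _ posG']) (simp add: numeral_2_eq_2)
  then have "Ot G 1 (\<lambda>t. r t ^ 10 * Qv' True - Qv True)"
    by (rule Ot_cong[rotated], intro eventually_mono[OF posG']) simp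
  then have "Ot G (Suc 0) (\<lambda>t. r t ^ 10 * Qv' True - Qv True)" by simp
  from Ot_tendsto_0[OF this limG] have "((\<lambda>t. r t ^ 10 * Qv' True) \<longlongrightarrow> Qv True) G" by (simp add: LIM_zero_iff)
  then have "((\<lambda>t. (r t ^ 10 * Qv' True) ^ 9) \<longlongrightarrow> Qv True ^ 9) G" by (intro tendsto_intros)
  moreover have "((\<lambda>t. (r t ^ 9) ^ 10 * Qv' True ^ 9) \<longlongrightarrow> 1 ^ 10 * Qv' True ^ 9) G" by (intro tendsto_intros r9)
  ultimately have "Qv True ^ 9 = Qv' True ^ 9"
    using tendsto_unique[OF Gnt] by (simp add: power_mult_distrib power_mult[symmetric])
  with bb show ?thesis by (simp add: Qv_def Qv'_def v_def v'_def)
qed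

section \<open>Normal form of the perturbed germ\<close>

text \<open>One variable is completed at a time. S is a set of admissible coefficients of the linear
  terms and T a set containing their squares times germs, so that everything left over lands in T.
  The hypotheses on M and h belong to the conclusion because the induction replaces both.\<close>

lemma complete_squares:
  fixes M :: "'n::finite \<Rightarrow> 'n \<Rightarrow> complex ^ 'n \<Rightarrow> complex"
  assumes K: "finite K"
    and S_add: "\<And>f g. S f \<Longrightarrow> S g \<Longrightarrow> S (\<lambda>p. f p + g p)"
    and S_mult: "\<And>f g. S f \<Longrightarrow> analytic_germ g \<Longrightarrow> S (\<lambda>p. f p * g p)"
    and S_an: "\<And>f. S f \<Longrightarrow> analytic_germ f \<and> f 0 = 0 \<and> (\<forall>l. partial_deriv l f 0 = 0)"
    and T_zero: "T (\<lambda>_. 0)"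
    and T_add: "\<And>f g. T f \<Longrightarrow> T g \<Longrightarrow> T (\<lambda>p. f p + g p)"
    and T_sq: "\<And>f g. S f \<Longrightarrow> analytic_germ g \<Longrightarrow> T (\<lambda>p. (f p)\<^sup>2 * g p)"
  shows "(\<And>k l. k \<in> K \<Longrightarrow> l \<in> K \<Longrightarrow> analytic_germ (M k l)) \<Longrightarrow>
    (\<And>k l p. k \<in> K \<Longrightarrow> l \<in> K \<Longrightarrow> M k l p = M l k p) \<Longrightarrow>
    (\<And>k l. k \<in> K \<Longrightarrow> l \<in> K \<Longrightarrow> k \<noteq> l \<Longrightarrow> M k l 0 = 0) \<Longrightarrow>
    (\<And>k. k \<in> K \<Longrightarrow> M k k 0 = (c k)\<^sup>2 \<and> c k \<noteq> 0) \<Longrightarrow>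
    (\<And>k. k \<in> K \<Longrightarrow> S (h k)) \<Longrightarrow>
    \<exists>W E. (\<forall>k\<in>K. analytic_germ (W k) \<and> W k 0 = 0 \<and> (\<forall>l. partial_deriv l (W k) 0 = (if l = k then c k else 0))) \<and>
      T E \<and> (\<forall>\<^sub>F p in nhds 0. (\<Sum>k\<in>K. \<Sum>l\<in>K. p $ k * p $ l * M k l p) + (\<Sum>k\<in>K. p $ k * h k p)
        = (\<Sum>k\<in>K. (W k p)\<^sup>2) + E p)"
  using K
proof (induction K arbitrary: M h rule: finite_induct)
  case empty
  show ?case by (intro exI[of _ "\<lambda>_ _. 0"] exI[of _ "\<lambda>_. 0"]) (simp add: T_zero)
next
  case (insert k K)
  have M0: "M k k 0 \<noteq> 0" using insert.prems(4)[of k] by simp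
  have anM: "analytic_germ (M a b)" if "a \<in> insert k K" "b \<in> insert k K" for a b
    by (rule insert.prems(1)[OF that])
  have anI: "analytic_germ (\<lambda>p. inverse (M k k p))" by (rule analytic_germ_inverse[OF anM M0]) auto
  obtain B where B: "analytic_germ B" "B 0 = c k" "\<forall>\<^sub>F p in nhds 0. (B p)\<^sup>2 = M k k p"
    using analytic_germ_root[OF anM, of k k "c k" 2] insert.prems(4)[of k] by auto
  \<comment> \<open>The Schur complement of the entry \<open>M k k\<close>; the linear terms change
    accordingly by multiples of \<open>h k\<close>, which keeps them in S.\<close>
  define M' where "M' a b p = M a b p - M k a p * M k b p * inverse (M k k p)" for a b p
  define h' where "h' a p = h a p + h k p * (- (M k a p * inverse (M k k p)))" for a p
  have Sh: "S (h a)" if "a \<in> insert k K" for a using insert.prems(5)[OF that] .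
  have ih: "\<exists>W E. (\<forall>k\<in>K. analytic_germ (W k) \<and> W k 0 = 0 \<and> (\<forall>l. partial_deriv l (W k) 0 = (if l = k then c k else 0))) \<and>
      T E \<and> (\<forall>\<^sub>F p in nhds 0. (\<Sum>k\<in>K. \<Sum>l\<in>K. p $ k * p $ l * M' k l p) + (\<Sum>k\<in>K. p $ k * h' k p)
        = (\<Sum>k\<in>K. (W k p)\<^sup>2) + E p)"
  proof (rule insert.IH)
    show "analytic_germ (M' a b)" if "a \<in> K" "b \<in> K" for a b
      unfolding M'_def using that by (intro analytic_intros anM anI) auto
    show "M' a b p = M' b a p" if "a \<in> K" "b \<in> K" for a b p
      using that insert.prems(2)[of a b p] by (simp add: M'_def mult_ac)
    have k0: "M k a 0 = 0" if "a \<in> K" for a using insert.prems(3)[of k a] insert.hyps that by auto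
    show "M' a b 0 = 0" if "a \<in> K" "b \<in> K" "a \<noteq> b" for a b
      using that insert.prems(3)[of a b] k0 by (simp add: M'_def)
    show "M' a a 0 = (c a)\<^sup>2 \<and> c a \<noteq> 0" if "a \<in> K" for a
      using that insert.prems(4)[of a] k0 by (simp add: M'_def)
    show "S (h' a)" if "a \<in> K" for a
      unfolding h'_def using that by (intro S_add S_mult Sh analytic_intros anM anI) auto
  qed
  then obtain W E where W: "\<And>a. a \<in> K \<Longrightarrow> analytic_germ (W a) \<and> W a 0 = 0 \<and> (\<forall>l. partial_deriv l (W a) 0 = (if l = a then c a else 0))"
    and E: "T E" and eq: "\<forall>\<^sub>F p in nhds 0. (\<Sum>k\<in>K. \<Sum>l\<in>K. p $ k * p $ l * M' k l p) + (\<Sum>k\<in>K. p $ k * h' k p)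
        = (\<Sum>k\<in>K. (W k p)\<^sup>2) + E p" by blast
  \<comment> \<open>The completed variable; members of S have vanishing first derivatives at 0, so
    the linear part of U is still the coordinate k.\<close>
  define U where "U p = p $ k + ((\<Sum>l\<in>K. M k l p * p $ l) + h k p * (1/2)) * inverse (M k k p)" for p
  have anS: "analytic_germ (\<lambda>p. (\<Sum>l\<in>K. M k l p * p $ l) + h k p * (1/2))"
    by (intro analytic_intros anM) (use S_an[OF Sh[of k]] in auto)
  have anU: "analytic_germ U"
    unfolding U_def[abs_def] by (intro analytic_germ_add analytic_germ_mult anS anI analytic_germ_nth)
  have hk: "analytic_germ (h k)" "h k 0 = 0" "\<And>l. partial_deriv l (h k) 0 = 0" using S_an[OF Sh[of k]] by auto
  have U0: "U 0 = 0" by (simp add: U_def hk)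
  have pS: "partial_deriv l (\<lambda>p. (\<Sum>l\<in>K. M k l p * p $ l) + h k p * (1/2)) 0 = 0" for l
  proof -
    have "partial_deriv l (\<lambda>p. \<Sum>l\<in>K. M k l p * p $ l) 0 = (\<Sum>m\<in>K. partial_deriv l (\<lambda>p. M k m p * p $ m) 0)"
      by (rule partial_deriv_0_sum) (intro analytic_intros anM, auto)
    also have "\<dots> = (\<Sum>m\<in>K. 0)"
    proof (rule sum.cong[OF refl])
      fix m assume m: "m \<in> K"
      have "M k m 0 = 0" using insert.prems(3)[of k m] insert.hyps m by auto
      then show "partial_deriv l (\<lambda>p. M k m p * p $ m) 0 = 0"
        using partial_deriv_0_mult[OF anM analytic_germ_nth, of k m l m] m by simp
    qed
    finally have 1: "partial_deriv l (\<lambda>p. \<Sum>l\<in>K. M k l p * p $ l) 0 = 0" by simp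
    have 2: "partial_deriv l (\<lambda>p. h k p * (1/2)) 0 = 0"
      using partial_deriv_0_mult[OF hk(1) analytic_germ_const, of l "1/2"] hk by simp
    show ?thesis
      using partial_deriv_0_add[of "\<lambda>p. \<Sum>l\<in>K. M k l p * p $ l" "\<lambda>p. h k p * (1/2)" l] 1 2
      by (simp add: analytic_germ_sum analytic_germ_mult analytic_germ_divide_const anM hk)
  qed
  have pU: "partial_deriv l U 0 = (if l = k then 1 else 0)" for l
  proof -
    have "partial_deriv l U 0 = partial_deriv l (\<lambda>p. p $ k) 0 +
        partial_deriv l (\<lambda>p. ((\<Sum>l\<in>K. M k l p * p $ l) + h k p * (1/2)) * inverse (M k k p)) 0"
      unfolding U_def[abs_def] by (intro partial_deriv_0_add analytic_germ_mult anS anI analytic_germ_nth)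
    also have "partial_deriv l (\<lambda>p. ((\<Sum>l\<in>K. M k l p * p $ l) + h k p * (1/2)) * inverse (M k k p)) 0 = 0"
      unfolding partial_deriv_0_mult[OF anS anI] pS by (simp add: hk)
    finally show ?thesis by (simp add: partial_deriv_0_nth)
  qed
  define W' where "W' = W(k := (\<lambda>p. B p * U p))"
  define E' where "E' p = E p + (h k p)\<^sup>2 * (- inverse (M k k p) / 4)" for p
  have "analytic_germ (W' a) \<and> W' a 0 = 0 \<and> (\<forall>l. partial_deriv l (W' a) 0 = (if l = a then c a else 0))"
    if "a \<in> insert k K" for a
  proof (cases "a = k")
    case True
    then show ?thesis using B(1,2) anU U0
      by (auto simp: W'_def partial_deriv_0_mult[OF B(1) anU] pU intro: analytic_germ_mult)
  qed (use that W in \<open>simp add: W'_def\<close>)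
  moreover have "T E'"
    unfolding E'_def by (intro T_add E T_sq Sh analytic_intros anI) auto
  moreover have "\<forall>\<^sub>F p in nhds 0. (\<Sum>a\<in>insert k K. \<Sum>b\<in>insert k K. p $ a * p $ b * M a b p) + (\<Sum>a\<in>insert k K. p $ a * h a p)
        = (\<Sum>a\<in>insert k K. (W' a p)\<^sup>2) + E' p"
    using eq B(3) analytic_germ_nonzero[OF anM M0, simplified]
  proof eventually_elim
    case (elim p)
    let ?m = "M k k p" and ?s = "\<Sum>l\<in>K. M k l p * p $ l"
    have sym: "M a k p = M k a p" if "a \<in> K" for a using insert.prems(2)[of a k p] that by simp
    have 1: "(\<Sum>a\<in>insert k K. \<Sum>b\<in>insert k K. p $ a * p $ b * M a b p)
        = (p $ k)\<^sup>2 * ?m + 2 * p $ k * ?s + (\<Sum>a\<in>K. \<Sum>b\<in>K. p $ a * p $ b * M a b p)"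
      using insert.hyps
      by (simp add: sum.distrib sum_distrib_left sym power2_eq_square mult_ac)
    have 2: "(\<Sum>a\<in>K. \<Sum>b\<in>K. p $ a * p $ b * M' a b p)
        = (\<Sum>a\<in>K. \<Sum>b\<in>K. p $ a * p $ b * M a b p) - ?s * ?s * inverse ?m"
    proof -
      have "?s * ?s * inverse ?m = (\<Sum>a\<in>K. \<Sum>b\<in>K. (M k a p * p $ a) * (M k b p * p $ b) * inverse ?m)"
        by (subst sum_product) (simp only: sum_distrib_right)
      then show ?thesis by (simp add: M'_def algebra_simps sum_subtractf)
    qed
    have 3: "(\<Sum>a\<in>K. p $ a * h' a p) = (\<Sum>a\<in>K. p $ a * h a p) - h k p * ?s * inverse ?m"
      by (simp add: h'_def algebra_simps sum.distrib sum_negf sum_subtractf sum_distrib_left)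
    have 4: "(\<Sum>a\<in>insert k K. (W' a p)\<^sup>2) = ?m * (U p)\<^sup>2 + (\<Sum>a\<in>K. (W a p)\<^sup>2)"
    proof -
      have "(\<Sum>a\<in>K. (W' a p)\<^sup>2) = (\<Sum>a\<in>K. (W a p)\<^sup>2)"
        using insert.hyps by (intro sum.cong) (auto simp: W'_def)
      then show ?thesis using insert.hyps elim(2) by (simp add: W'_def power_mult_distrib)
    qed
    have 5: "?m * (U p)\<^sup>2 = (p $ k)\<^sup>2 * ?m + 2 * p $ k * ?s + p $ k * h k p + ?s * ?s * inverse ?m
        + h k p * ?s * inverse ?m + (h k p)\<^sup>2 * inverse ?m / 4"
      using elim(3) by (simp add: U_def power2_eq_square field_simps)
    have 6: "(\<Sum>a\<in>insert k K. p $ a * h a p) = p $ k * h k p + (\<Sum>a\<in>K. p $ a * h a p)"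
      using insert.hyps by simp
    show ?case
      unfolding 1 4 5 6 E'_def using elim(1) unfolding 2 3 by (simp add: algebra_simps)
  qed
  ultimately show ?case by blast
qed

text \<open>Adding a germ of this kind to the factor of u^3 or y^9 alters neither its value nor its
  derivative in y at 0, which are all that the coefficients b, e and c of the normal form depend
  on.\<close>

definition flat1 :: "'n::finite \<Rightarrow> (complex ^ 'n \<Rightarrow> complex) \<Rightarrow> bool" where
  "flat1 j f \<longleftrightarrow> analytic_germ f \<and> f 0 = 0 \<and> partial_deriv j f 0 = 0"

lemma flat1_add: "flat1 j f \<Longrightarrow> flat1 j g \<Longrightarrow> flat1 j (\<lambda>p. f p + g p)"
  by (auto simp: flat1_def analytic_germ_add partial_deriv_0_add)

lemma flat1_mult: "flat1 j f \<Longrightarrow> analytic_germ g \<Longrightarrow> flat1 j (\<lambda>p. f p * g p)"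
  by (auto simp: flat1_def analytic_germ_mult partial_deriv_0_mult)

lemma flat1_power: "n \<ge> 2 \<Longrightarrow> flat1 j (\<lambda>p. (p $ j) ^ n)"
  by (simp add: flat1_def analytic_intros partial_deriv_0_power)

lemma flat1_power': "flat1 j f \<Longrightarrow> n > 0 \<Longrightarrow> flat1 j (\<lambda>p. f p ^ n)"
  by (auto simp: flat1_def analytic_intros partial_deriv_0_power)

section \<open>The parabola u = 0 and the ideal (u^3, y^9)\<close>

locale tangent_curve =
  fixes i j :: "'n::finite" and s :: complex
  assumes ij: "i \<noteq> j" and s: "s \<noteq> 0"
begin

definition u :: "complex ^ 'n \<Rightarrow> complex" where "u p = (p $ j)\<^sup>2 - s * p $ i"

lemma u_an: "analytic_germ u" unfolding u_def[abs_def] by (intro analytic_intros)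

lemma u_partial: "partial_deriv m u 0 = (if m = i then - s else 0)"
proof -
  have "partial_deriv m (\<lambda>p. (p $ j)\<^sup>2 + (- s) * p $ i) 0 = partial_deriv m (\<lambda>p. (p $ j)\<^sup>2) 0 + partial_deriv m (\<lambda>p. (- s) * p $ i) 0"
    by (intro partial_deriv_0_add analytic_intros)
  also have "\<dots> = (if m = i then - s else 0)"
    unfolding partial_deriv_0_power[OF analytic_germ_nth] partial_deriv_0_cmult[OF analytic_germ_nth] partial_deriv_0_nth by simp
  finally show ?thesis by (simp add: u_def[abs_def])
qed

lemma flat1_u: "flat1 j u"
  using ij by (simp add: flat1_def u_an u_partial) (simp add: u_def)

lemma sx: "s * p $ i = (p $ j)\<^sup>2 - u p" by (simp add: u_def)

definition Tid :: "(complex ^ 'n \<Rightarrow> complex) \<Rightarrow> bool" where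
  "Tid f \<longleftrightarrow> (\<exists>A D. flat1 j A \<and> flat1 j D \<and> (\<forall>\<^sub>F p in nhds 0. f p = (u p)^3 * A p + (p $ j)^9 * D p))"

lemma TidI: "flat1 j A \<Longrightarrow> flat1 j D \<Longrightarrow> (\<And>p. f p = (u p)^3 * A p + (p $ j)^9 * D p) \<Longrightarrow> Tid f"
  unfolding Tid_def by (intro exI[of _ A] exI[of _ D]) simp

lemma Tid_zero: "Tid (\<lambda>_. 0)"
  by (rule TidI[of "\<lambda>_. 0" "\<lambda>_. 0"]) (auto simp: flat1_def)

lemma Tid_add: "Tid f \<Longrightarrow> Tid g \<Longrightarrow> Tid (\<lambda>p. f p + g p)"
proof -
  assume "Tid f" "Tid g"
  then obtain A D A' D' where *: "flat1 j A" "flat1 j D" "\<forall>\<^sub>F p in nhds 0. f p = (u p)^3 * A p + (p $ j)^9 * D p"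
    "flat1 j A'" "flat1 j D'" "\<forall>\<^sub>F p in nhds 0. g p = (u p)^3 * A' p + (p $ j)^9 * D' p"
    unfolding Tid_def by blast
  have "\<forall>\<^sub>F p in nhds 0. f p + g p = (u p)^3 * (A p + A' p) + (p $ j)^9 * (D p + D' p)"
    using *(3,6) by eventually_elim (simp add: algebra_simps)
  then show ?thesis unfolding Tid_def using flat1_add[OF *(1,4)] flat1_add[OF *(2,5)] by blast
qed

lemma Tid_mult: "Tid f \<Longrightarrow> analytic_germ g \<Longrightarrow> Tid (\<lambda>p. f p * g p)"
proof -
  assume "Tid f" and g: "analytic_germ g"
  then obtain A D where *: "flat1 j A" "flat1 j D" "\<forall>\<^sub>F p in nhds 0. f p = (u p)^3 * A p + (p $ j)^9 * D p"
    unfolding Tid_def by blast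
  have "\<forall>\<^sub>F p in nhds 0. f p * g p = (u p)^3 * (A p * g p) + (p $ j)^9 * (D p * g p)"
    using *(3) by eventually_elim (simp add: algebra_simps)
  then show ?thesis unfolding Tid_def using flat1_mult[OF *(1) g] flat1_mult[OF *(2) g] by blast
qed

lemma Tid_sum: "(\<And>a. a \<in> A \<Longrightarrow> Tid (f a)) \<Longrightarrow> Tid (\<lambda>p. \<Sum>a\<in>A. f a p)"
  by (induction A rule: infinite_finite_induct) (auto intro: Tid_add Tid_zero)

lemmas an_intros = analytic_intros u_an

text \<open>Linear terms of the squares; the square of such a germ lies in the ideal of \<open>Tid\<close>.\<close>

definition Sid :: "(complex ^ 'n \<Rightarrow> complex) \<Rightarrow> bool" where
  "Sid f \<longleftrightarrow> (\<exists>a b c d. analytic_germ a \<and> analytic_germ b \<and> analytic_germ c \<and> analytic_germ d \<and>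
     f = (\<lambda>p. (u p)^3 * a p + (p $ j)^4 * ((u p)\<^sup>2 * b p + u p * p $ j * c p + (p $ j)^3 * d p)))"

lemma SidI: "analytic_germ a \<Longrightarrow> analytic_germ b \<Longrightarrow> analytic_germ c \<Longrightarrow> analytic_germ d \<Longrightarrow>
   (\<And>p. f p = (u p)^3 * a p + (p $ j)^4 * ((u p)\<^sup>2 * b p + u p * p $ j * c p + (p $ j)^3 * d p)) \<Longrightarrow> Sid f"
  unfolding Sid_def by blast

lemma Sid_add: "Sid f \<Longrightarrow> Sid g \<Longrightarrow> Sid (\<lambda>p. f p + g p)"
proof -
  assume "Sid f" "Sid g"
  then obtain a b c d a' b' c' d' where *: "analytic_germ a" "analytic_germ b" "analytic_germ c" "analytic_germ d"
    "f = (\<lambda>p. (u p)^3 * a p + (p $ j)^4 * ((u p)\<^sup>2 * b p + u p * p $ j * c p + (p $ j)^3 * d p))"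
    "analytic_germ a'" "analytic_germ b'" "analytic_germ c'" "analytic_germ d'"
    "g = (\<lambda>p. (u p)^3 * a' p + (p $ j)^4 * ((u p)\<^sup>2 * b' p + u p * p $ j * c' p + (p $ j)^3 * d' p))"
    unfolding Sid_def by blast
  show ?thesis
    by (rule SidI[of "\<lambda>p. a p + a' p" "\<lambda>p. b p + b' p" "\<lambda>p. c p + c' p" "\<lambda>p. d p + d' p"])
      (use * in \<open>auto intro: analytic_intros simp: algebra_simps\<close>)
qed

lemma Sid_mult: "Sid f \<Longrightarrow> analytic_germ g \<Longrightarrow> Sid (\<lambda>p. f p * g p)"
proof -
  assume "Sid f" and g: "analytic_germ g"
  then obtain a b c d where *: "analytic_germ a" "analytic_germ b" "analytic_germ c" "analytic_germ d"
    "f = (\<lambda>p. (u p)^3 * a p + (p $ j)^4 * ((u p)\<^sup>2 * b p + u p * p $ j * c p + (p $ j)^3 * d p))"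
    unfolding Sid_def by blast
  show ?thesis
    by (rule SidI[of "\<lambda>p. a p * g p" "\<lambda>p. b p * g p" "\<lambda>p. c p * g p" "\<lambda>p. d p * g p"])
      (use * g in \<open>auto intro: analytic_intros simp: algebra_simps\<close>)
qed

lemma Sid_zero: "Sid (\<lambda>_. 0)"
  by (rule SidI[of "\<lambda>_. 0" "\<lambda>_. 0" "\<lambda>_. 0" "\<lambda>_. 0"]) auto

lemma Sid_sum: "(\<And>a. a \<in> A \<Longrightarrow> Sid (f a)) \<Longrightarrow> Sid (\<lambda>p. \<Sum>a\<in>A. f a p)"
  by (induction A rule: infinite_finite_induct) (auto intro: Sid_add Sid_zero)

lemma Sid_analytic: 
  assumes "Sid f"
  shows "analytic_germ f \<and> f 0 = 0 \<and> (\<forall>l. partial_deriv l f 0 = 0)"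
proof -
  obtain a b c d where an: "analytic_germ a" "analytic_germ b" "analytic_germ c" "analytic_germ d"
    and f: "f = (\<lambda>p. (u p)^3 * a p + (p $ j)^4 * ((u p)\<^sup>2 * b p + u p * p $ j * c p + (p $ j)^3 * d p))"
    using assms unfolding Sid_def by blast
  let ?g = "\<lambda>p. (u p)\<^sup>2 * b p + u p * p $ j * c p + (p $ j)^3 * d p"
  have ag: "analytic_germ ?g" by (intro an_intros an)
  have u0: "u 0 = 0" by (simp add: u_def)
  have 1: "partial_deriv l (\<lambda>p. (u p)^3 * a p) 0 = 0" for l
    using partial_deriv_0_mult[of "\<lambda>p. (u p)^3" a l] by (simp add: an_intros an partial_deriv_0_power[OF u_an] u0)
  have 2: "partial_deriv l (\<lambda>p. (p $ j)^4 * ?g p) 0 = 0" for l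
    using partial_deriv_0_mult[of "\<lambda>p. (p $ j)^4" ?g l] ag
    by (simp add: analytic_intros partial_deriv_0_power[OF analytic_germ_nth])
  have "partial_deriv l f 0 = 0" for l
    unfolding f using partial_deriv_0_add[of "\<lambda>p. (u p)^3 * a p" "\<lambda>p. (p $ j)^4 * ?g p" l] 1 2 ag
    by (simp add: an_intros an)
  moreover have "analytic_germ f" unfolding f by (intro an_intros an)
  ultimately show ?thesis by (simp add: f u0)
qed

text \<open>In the square of y^4 (u^2 b + u y c + y^3 d) the products with b b and b c contain u^3,
  and every other product contributes a further y to y^8.\<close>

lemma Sid_square:
  assumes "Sid f" "analytic_germ g"
  shows "Tid (\<lambda>p. (f p)\<^sup>2 * g p)"
proof -
  obtain a b c d where an: "analytic_germ a" "analytic_germ b" "analytic_germ c" "analytic_germ d"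
    and f: "f = (\<lambda>p. (u p)^3 * a p + (p $ j)^4 * ((u p)\<^sup>2 * b p + u p * p $ j * c p + (p $ j)^3 * d p))"
    using assms unfolding Sid_def by blast
  let ?r = "\<lambda>p. (p $ j)^4 * ((u p)\<^sup>2 * b p + u p * p $ j * c p + (p $ j)^3 * d p)"
  let ?A = "\<lambda>p. (u p)^3 * (a p)\<^sup>2 + (p $ j)^4 * (2 * a p * ((u p)\<^sup>2 * b p + u p * p $ j * c p + (p $ j)^3 * d p))
     + (p $ j)^8 * (u p * (b p)\<^sup>2 + 2 * p $ j * b p * c p)"
  let ?D = "\<lambda>p. u p * (u p * p $ j * (c p)\<^sup>2) + (p $ j)^5 * (d p)\<^sup>2 + u p * (2 * u p * (p $ j)\<^sup>2 * b p * d p)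
     + u p * (2 * (p $ j)^3 * c p * d p)"
  have "Tid (\<lambda>p. (f p)\<^sup>2)"
  proof (rule TidI[of ?A ?D])
    show "flat1 j ?A" by (intro flat1_add flat1_mult[of j "\<lambda>p. (u p)^3"] flat1_mult[of j "\<lambda>p. (p $ j)^4"] flat1_mult[of j "\<lambda>p. (p $ j)^8"] flat1_power' flat1_power flat1_u an_intros an) auto
    show "flat1 j ?D" by (intro flat1_add flat1_mult[of j u] flat1_mult[of j "\<lambda>p. (p $ j)^5"] flat1_power flat1_u an_intros an) auto
    show "(f p)\<^sup>2 = (u p)^3 * ?A p + (p $ j)^9 * ?D p" for p
      unfolding f by (simp add: eval_nat_numeral algebra_simps)
  qed
  then show ?thesis by (rule Tid_mult[OF _ assms(2)])
qed


text \<open>The witnesses are the groups of terms in the binomial expansion of (y^2 - u)^(6-b) y^b,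
  sorted by the exponent of u.\<close>

lemma Sid_monomial:
  assumes "b < 6"
  shows "Sid (\<lambda>p. (p $ i)^(6 - b) * (p $ j)^b)"
proof -
  \<comment> \<open>Multiplication by the unit s^(6-b) replaces x by s x = y^2 - u.\<close>
  have red: "Sid (\<lambda>p. (p $ i)^(6 - b) * (p $ j)^b)" if "Sid (\<lambda>p. (s * p $ i)^(6 - b) * (p $ j)^b)"
  proof -
    have "Sid (\<lambda>p. ((s * p $ i)^(6 - b) * (p $ j)^b) * inverse (s ^ (6 - b)))"
      by (rule Sid_mult[OF that]) simp
    then show ?thesis using s by (simp add: power_mult_distrib field_simps)
  qed
  note an = analytic_germ_power[OF analytic_germ_nth] u_an analytic_germ_power[OF u_an]
  consider "b = 0" | "b = 1" | "b = 2" | "b = 3" | "b = 4" | "b = 5" using assms by linarith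
  then show ?thesis
  proof cases
    case 1
    show ?thesis
      by (rule red, rule SidI[of "\<lambda>p. -20*(p$j)^6 + 15*u p*(p$j)^4 - 6*(u p)^2*(p$j)^2 + (u p)^3"
            "\<lambda>p. 15*(p$j)^4" "\<lambda>p. -6*(p$j)^5" "\<lambda>p. (p$j)^5"])
        (intro an_intros | (simp add: 1 sx, Groebner_Basis.algebra))+
  next
    case 2
    show ?thesis
      by (rule red, rule SidI[of "\<lambda>p. -10*(p$j)^5 + 5*u p*(p$j)^3 - (u p)^2*p$j"
            "\<lambda>p. 10*(p$j)^3" "\<lambda>p. -5*(p$j)^4" "\<lambda>p. (p$j)^4"])
        (intro an_intros | (simp add: 2 sx, Groebner_Basis.algebra))+
  next
    case 3
    show ?thesis
      by (rule red, rule SidI[of "\<lambda>p. -4*(p$j)^4 + u p*(p$j)^2" "\<lambda>p. 6*(p$j)^2" "\<lambda>p. -4*(p$j)^3" "\<lambda>p. (p$j)^3"])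
        (intro an_intros | (simp add: 3 sx, Groebner_Basis.algebra))+
  next
    case 4
    show ?thesis
      by (rule red, rule SidI[of "\<lambda>p. -((p$j)^3)" "\<lambda>p. 3*p$j" "\<lambda>p. -3*(p$j)^2" "\<lambda>p. (p$j)^2"])
        (intro an_intros | (simp add: 4 sx, Groebner_Basis.algebra))+
  next
    case 5
    show ?thesis
      by (rule red, rule SidI[of "\<lambda>p. 0" "\<lambda>p. 1" "\<lambda>p. -2*p$j" "\<lambda>p. p$j"])
        (intro an_intros | (simp add: 5 sx, Groebner_Basis.algebra))+
  next
    case 6
    show ?thesis
      by (rule red, rule SidI[of "\<lambda>p. 0" "\<lambda>p. 0" "\<lambda>p. -1" "\<lambda>p. 1"])
        (intro an_intros | (simp add: 6 sx, Groebner_Basis.algebra))+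
  qed
qed

lemma Tid_scale:
  assumes "Tid (\<lambda>p. s ^ n * f p)"
  shows "Tid f"
proof -
  have "Tid (\<lambda>p. (s ^ n * f p) * inverse (s ^ n))" by (rule Tid_mult[OF assms]) simp
  then show ?thesis using s by (simp add: field_simps)
qed

text \<open>Coefficients of the form u A + y^2 B are flat for arbitrary germs A and B, because u and
  y^2 are; it thus suffices to write f in this shape.\<close>

lemma Tid_poly:
  assumes "\<And>p. s ^ n * f p = (u p)^3 * (u p * A p + (p $ j)\<^sup>2 * B p) + (p $ j)^9 * (u p * C p + (p $ j)\<^sup>2 * D p)"
    "analytic_germ A" "analytic_germ B" "analytic_germ C" "analytic_germ D"
  shows "Tid f"
  by (rule Tid_scale[of n], rule TidI[OF _ _ assms(1)])
    (intro flat1_add flat1_mult flat1_u flat1_power assms(2-); simp)+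

text \<open>In (y^2 - u)^a y^b the terms with u-exponent at most 2 have y-exponent at least 2a + b -
  4, and the listed exponents satisfy 2a + b >= 13.\<close>

lemma Tid_high:
  assumes "m < 4"
  shows "Tid (\<lambda>p. (p $ i)^([4,5,6,7] ! m) * (p $ j)^([5,3,1,0] ! m))"
proof -
  have sc: "s ^ n * ((p $ i)^n * z) = (s * p $ i)^n * z" for n p z by (simp add: power_mult_distrib)
  consider "m = 0" | "m = 1" | "m = 2" | "m = 3" using assms by linarith
  then show ?thesis
  proof cases
    case 1
    have "Tid (\<lambda>p. (p $ i)^4 * (p $ j)^5)"
      by (rule Tid_poly[of 4 _ "\<lambda>p. (p$j)^5" "\<lambda>p. -4*(p$j)^5" "\<lambda>p. 6*u p - 4*(p$j)^2" "\<lambda>p. (p$j)^2"])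
        ((simp only: sc sx, Groebner_Basis.algebra) | intro an_intros)+
    then show ?thesis using 1 by simp
  next
    case 2
    have "Tid (\<lambda>p. (p $ i)^5 * (p $ j)^3)"
      by (rule Tid_poly[of 5 _ "\<lambda>p. 5*(p$j)^5 - u p*(p$j)^3" "\<lambda>p. -10*(p$j)^5" "\<lambda>p. 10*u p - 5*(p$j)^2" "\<lambda>p. (p$j)^2"])
        ((simp only: sc sx, Groebner_Basis.algebra) | intro an_intros)+
    then show ?thesis using 2 by simp
  next
    case 3
    have "Tid (\<lambda>p. (p $ i)^6 * (p $ j))"
      by (rule Tid_poly[of 6 _ "\<lambda>p. 15*(p$j)^5 - 6*u p*(p$j)^3 + (u p)^2*p$j" "\<lambda>p. -20*(p$j)^5" "\<lambda>p. 15*u p - 6*(p$j)^2" "\<lambda>p. (p$j)^2"])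
        ((simp only: sc sx, Groebner_Basis.algebra) | intro an_intros)+
    then show ?thesis using 3 by simp
  next
    case 4
    have "Tid (\<lambda>p. (p $ i)^7 * 1)"
      by (rule Tid_poly[of 7 _ "\<lambda>p. 35*(p$j)^6 - 21*u p*(p$j)^4 + 7*(u p)^2*(p$j)^2 - (u p)^3" "\<lambda>p. -35*(p$j)^6"
            "\<lambda>p. 21*u p*p$j - 7*(p$j)^3" "\<lambda>p. (p$j)^3"])
        ((simp only: sc sx, Groebner_Basis.algebra) | intro an_intros)+
    then show ?thesis using 4 by simp
  qed
qed

end

text \<open>
  The coefficients are chosen such that, written in \<open>u = y ^ 2 - s x\<close> and \<open>y\<close>, the monomials
  \<open>u ^ m y ^ n\<close> with \<open>1 \<le> m \<le> 2\<close> and \<open>n \<le> 8\<close> cancel.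
\<close>

definition low_coeff1 :: "nat \<Rightarrow> nat \<Rightarrow> complex" where
  "low_coeff1 a b = (if (a,b) = (2,5) then -4/3 else if (a,b) = (3,5) then -1/2 else if (a,b) = (3,4) then -3/2
     else if (a,b) = (5,2) then -2/3 else -3/5)"

definition low_coeff2 :: "nat \<Rightarrow> nat \<Rightarrow> complex" where
  "low_coeff2 a b = (if (a,b) = (2,5) then 1/2 else if (a,b) = (3,4) then 3/5 else 0)"

text \<open>For the occurring exponents, trading y^2 for s x keeps both the factor s^(-a) and the
  weight 2a + b with respect to u of weight 2 and y of weight 1, so the coefficients can be
  cancelled by numbers independent of s. The truncated difference b - 4 is harmless since
  \<open>low_coeff2\<close> vanishes where b < 4.\<close>

definition low_pert :: "nat \<Rightarrow> nat \<Rightarrow> complex \<Rightarrow> complex \<Rightarrow> complex \<Rightarrow> complex" where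
  "low_pert a b s x y = low_coeff1 a b * s * (x^(a+1) * y^(b-2)) + low_coeff2 a b * s\<^sup>2 * (x^(a+2) * y^(b-4))"

context tangent_curve
begin

text \<open>Pure powers of y that survive the cancellation and have no flat coefficient over y^9;
  those from the other monomials are y^11 or y^12 and are absorbed.\<close>

definition low_lead :: "nat \<Rightarrow> nat \<Rightarrow> complex \<Rightarrow> complex" where
  "low_lead a b y = (if (a,b) = (2,5) then y^9 / (6 * s\<^sup>2) else if (a,b) = (3,4) then y^10 / (10 * s^3) else 0)"

lemma Tid_low:
  assumes "(a, b) \<in> low_expos"
  shows "Tid (\<lambda>p. (p $ i)^a * (p $ j)^b + low_pert a b s (p $ i) (p $ j) - low_lead a b (p $ j))"
proof -
  have x: "p $ i = ((p $ j)\<^sup>2 - u p) / s" for p using s sx[of p] by (simp add: field_simps)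
  consider "(a,b) = (2,5)" | "(a,b) = (3,5)" | "(a,b) = (3,4)" | "(a,b) = (4,4)" | "(a,b) = (4,3)" | "(a,b) = (5,2)"
    using assms by (auto simp: low_expos_def)
  then show ?thesis
  proof cases
    case 1
    have "Tid (\<lambda>p. (p $ i)^2 * (p $ j)^5 + (-4/3 * s * ((p $ i)^3 * (p $ j)^3) + 1/2 * s^2 * ((p $ i)^4 * p $ j)) - (p $ j)^9 / (6 * s^2))"
      by (rule Tid_poly[of 2 _ "\<lambda>p. 1/2 * p$j" "\<lambda>p. -2/3 * p$j" "\<lambda>p. 0" "\<lambda>p. 0"])
        ((simp add: x field_simps s eval_nat_numeral; fail) | intro an_intros)+
    then show ?thesis using 1 by (simp add: low_pert_def low_coeff1_def low_coeff2_def low_lead_def)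
  next
    case 2
    have "Tid (\<lambda>p. (p $ i)^3 * (p $ j)^5 + (-1/2 * s * ((p $ i)^4 * (p $ j)^3)) - 0)"
      by (rule Tid_poly[of 3 _ "\<lambda>p. -1/2 * (p$j)^3" "\<lambda>p. (p$j)^3" "\<lambda>p. -1" "\<lambda>p. 1/2"])
        ((simp add: x field_simps s eval_nat_numeral; fail) | intro an_intros)+
    then show ?thesis using 2 by (simp add: low_pert_def low_coeff1_def low_coeff2_def low_lead_def)
  next
    case 3
    have "Tid (\<lambda>p. (p $ i)^3 * (p $ j)^4 + (-3/2 * s * ((p $ i)^4 * (p $ j)^2) + 3/5 * s^2 * (p $ i)^5) - (p $ j)^10 / (10 * s^3))"
      by (rule Tid_poly[of 3 _ "\<lambda>p. 3/2 * (p$j)^2 - 3/5 * u p" "\<lambda>p. -((p$j)^2)" "\<lambda>p. 0" "\<lambda>p. 0"])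
        ((simp add: x field_simps s eval_nat_numeral; fail) | intro an_intros)+
    then show ?thesis using 3 by (simp add: low_pert_def low_coeff1_def low_coeff2_def low_lead_def)
  next
    case 4
    have "Tid (\<lambda>p. (p $ i)^4 * (p $ j)^4 + (-3/5 * s * ((p $ i)^5 * (p $ j)^2)) - 0)"
      by (rule Tid_poly[of 4 _ "\<lambda>p. -2 * (p$j)^4 + 3/5 * u p * (p$j)^2" "\<lambda>p. 2 * (p$j)^4" "\<lambda>p. -p$j" "\<lambda>p. 2/5 * p$j"])
        ((simp add: x field_simps s eval_nat_numeral; fail) | intro an_intros)+
    then show ?thesis using 4 by (simp add: low_pert_def low_coeff1_def low_coeff2_def low_lead_def)
  next
    case 5
    have "Tid (\<lambda>p. (p $ i)^4 * (p $ j)^3 + (-3/5 * s * ((p $ i)^5 * p $ j)) - 0)"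
      by (rule Tid_poly[of 4 _ "\<lambda>p. -2 * (p$j)^3 + 3/5 * u p * p$j" "\<lambda>p. 2 * (p$j)^3" "\<lambda>p. -1" "\<lambda>p. 2/5"])
        ((simp add: x field_simps s eval_nat_numeral; fail) | intro an_intros)+
    then show ?thesis using 5 by (simp add: low_pert_def low_coeff1_def low_coeff2_def low_lead_def)
  next
    case 6
    have "Tid (\<lambda>p. (p $ i)^5 * (p $ j)^2 + (-2/3 * s * (p $ i)^6) - 0)"
      by (rule Tid_poly[of 5 _ "\<lambda>p. -5 * (p$j)^4 + 3 * u p * (p$j)^2 - 2/3 * (u p)^2" "\<lambda>p. 10/3 * (p$j)^4" "\<lambda>p. -p$j" "\<lambda>p. 1/3 * p$j"])
        ((simp add: x field_simps s eval_nat_numeral; fail) | intro an_intros)+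
    then show ?thesis using 6 by (simp add: low_pert_def low_coeff1_def low_coeff2_def low_lead_def)
  qed
qed

end

section \<open>The perturbed germ and its coordinates\<close>

lemma analytic_germ_if: "analytic_germ f \<Longrightarrow> analytic_germ g \<Longrightarrow> analytic_germ (\<lambda>p. if b then f p else g p)"
  by (cases b) auto

text \<open>J collects the variables of the residual germ other than i and j; these carry no square
  in \<open>sq_germ\<close> and receive one from the perturbation.\<close>

locale germ_data =
  fixes i j :: "'n::finite" and J :: "'n set" and c :: "nat \<Rightarrow> nat \<Rightarrow> complex"
    and fA :: "complex ^ 'n \<Rightarrow> complex" and fx :: "nat \<Rightarrow> complex ^ 'n \<Rightarrow> complex"
    and fq :: "'n \<Rightarrow> nat \<Rightarrow> complex ^ 'n \<Rightarrow> complex" and fz :: "'n \<Rightarrow> 'n \<Rightarrow> complex ^ 'n \<Rightarrow> complex"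
    and g :: "complex ^ 'n \<Rightarrow> complex"
  assumes ij: "i \<noteq> j" and J: "J \<subseteq> -{i,j}"
    and fA: "analytic_germ fA" "fA 0 = 0" and fx: "\<And>m. analytic_germ (fx m)"
    and fq: "\<And>k b. analytic_germ (fq k b)" and fz: "\<And>k l. analytic_germ (fz k l)" "\<And>k l. fz k l 0 = 0"
    and g: "\<forall>\<^sub>F p in nhds 0. g p = (p $ j)^6 * fA p + (\<Sum>(a,b)\<in>low_expos. c a b * ((p $ i)^a * (p $ j)^b))
      + (\<Sum>m<4. (p $ i)^([4,5,6,7] ! m) * (p $ j)^([5,3,1,0] ! m) * fx m p)
      + (\<Sum>k\<in>-{i,j}. \<Sum>b<6. p $ k * ((p $ i)^(6 - b) * (p $ j)^b) * fq k b p)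
      + (\<Sum>k\<in>-{i,j}. \<Sum>l\<in>-{i,j}. p $ k * p $ l * fz k l p)"
begin

definition sq_germ :: "complex ^ 'n \<Rightarrow> complex" where
  "sq_germ p = g p + (\<Sum>k\<in>-{i,j} - J. (p $ k)\<^sup>2)"

text \<open>A switch that adds y^9 to the perturbation exactly when the monomial x^2 y^5, whose
  repair produces y^9 / (6 s^2), is absent. The coefficient \<open>lead_y\<close> of y^9 is then
  nonzero for every s other than 0.\<close>

definition y9 :: complex where "y9 = (if c 2 5 = 0 then 1 else 0)"

definition curve_u :: "complex \<Rightarrow> complex ^ 'n \<Rightarrow> complex" where
  "curve_u s p = (p $ j)\<^sup>2 - s * p $ i"

text \<open>The first summand turns \<open>y^6 fA\<close> into \<open>u^3 fA\<close>, the second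
  makes the coefficient of u^3 a unit with cube root s at 0, the third repairs the six low
  monomials, the fourth secures y^9, and the last makes the quadratic form in the remaining
  variables nondegenerate.\<close>

definition pert :: "complex \<Rightarrow> complex ^ 'n \<Rightarrow> complex" where
  "pert s p = fA p * ((curve_u s p)^3 - (p $ j)^6) + s^3 * (curve_u s p)^3
     + (\<Sum>(a,b)\<in>low_expos. c a b * low_pert a b s (p $ i) (p $ j))
     + y9 * s^9 * (p $ j)^9 + s * (\<Sum>k\<in>J. (p $ k)\<^sup>2)"

definition lead_y :: "complex \<Rightarrow> complex" where
  "lead_y s = y9 * s^9 + c 2 5 / (6 * s\<^sup>2)"

lemma lead_y_nonzero: "s \<noteq> 0 \<Longrightarrow> lead_y s \<noteq> 0"
  by (auto simp: lead_y_def y9_def)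

text \<open>After completing squares the rest is u^3 times one unit plus y^9 times another one; A
  and D are their cube and ninth roots. Their derivatives in y at 0 are recorded because they
  determine the coefficient e.\<close>

theorem normal_form:
  assumes s: "s \<noteq> 0" and \<delta>: "\<delta> ^ 9 = lead_y s"
  shows "\<exists>\<Phi> A D d. (\<forall>k. analytic_germ (\<lambda>p. \<Phi> p $ k)) \<and> \<Phi> 0 = 0 \<and> analytic_germ A \<and> analytic_germ D \<and>
    A 0 = s \<and> D 0 = \<delta> \<and> 3 * s\<^sup>2 * partial_deriv j A 0 = partial_deriv j fA 0 \<and>
    9 * \<delta>^8 * partial_deriv j D 0 = c 3 4 / (10 * s^3) \<and>
    (\<forall>p. \<Phi> p $ i = curve_u s p * A p \<and> \<Phi> p $ j = p $ j * D p) \<and>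
    (\<forall>k m. partial_deriv m (\<lambda>p. \<Phi> p $ k) 0 = (if k = m then d k else 0)) \<and> (\<forall>k. d k \<noteq> 0) \<and> d j = \<delta> \<and>
    (\<forall>\<^sub>F p in nhds 0. sq_germ p + pert s p = (\<Phi> p $ i)^3 + (\<Phi> p $ j)^9 + (\<Sum>k\<in>-{i,j}. (\<Phi> p $ k)\<^sup>2))"
proof -
  interpret tangent_curve i j s by unfold_locales (fact ij, fact s)
  have u0: "u 0 = 0" by (simp add: u_def)
  have cu: "curve_u s = u" by (simp add: fun_eq_iff curve_u_def u_def)
  define mk where "mk k = (if k \<in> J then s else 1)" for k
  define cc where "cc k = csqrt (mk k)" for k
  have cc: "(cc k)\<^sup>2 = mk k" "cc k \<noteq> 0" for k using s by (auto simp: cc_def mk_def)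
  \<comment> \<open>The coefficients are symmetrised, as required for completing squares; since
    \<open>fz\<close> vanishes at 0, the value of M at 0 is the diagonal matrix
    \<open>mk\<close>.\<close>
  define M where "M k l p = (fz k l p + fz l k p) / 2 + (if k = l then mk k else 0)" for k l p
  define h where "h k p = (\<Sum>b<6. ((p $ i)^(6 - b) * (p $ j)^b) * fq k b p)" for k p
  have "\<exists>W E. (\<forall>k\<in>-{i,j}. analytic_germ (W k) \<and> W k 0 = 0 \<and> (\<forall>l. partial_deriv l (W k) 0 = (if l = k then cc k else 0))) \<and>
      Tid E \<and> (\<forall>\<^sub>F p in nhds 0. (\<Sum>k\<in>-{i,j}. \<Sum>l\<in>-{i,j}. p $ k * p $ l * M k l p) + (\<Sum>k\<in>-{i,j}. p $ k * h k p)
        = (\<Sum>k\<in>-{i,j}. (W k p)\<^sup>2) + E p)"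
  proof (rule complete_squares[where S = Sid and T = Tid])
    show "analytic_germ (M k l)" for k l unfolding M_def[abs_def] by (intro analytic_intros fz)
    show "Sid (h k)" for k
      unfolding h_def[abs_def] by (intro Sid_sum Sid_mult Sid_monomial fq) auto
  qed (use fz cc in \<open>auto simp: M_def intro: Sid_add Sid_mult Tid_zero Tid_add Sid_square dest: Sid_analytic\<close>)
  then obtain W E where W': "\<forall>k\<in>-{i,j}. analytic_germ (W k) \<and> W k 0 = 0 \<and> (\<forall>l. partial_deriv l (W k) 0 = (if l = k then cc k else 0))"
    and E: "Tid E" and Weq: "\<forall>\<^sub>F p in nhds 0. (\<Sum>k\<in>-{i,j}. \<Sum>l\<in>-{i,j}. p $ k * p $ l * M k l p) + (\<Sum>k\<in>-{i,j}. p $ k * h k p)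
        = (\<Sum>k\<in>-{i,j}. (W k p)\<^sup>2) + E p" by (elim exE conjE)
  have W: "analytic_germ (W k) \<and> W k 0 = 0 \<and> (\<forall>l. partial_deriv l (W k) 0 = (if l = k then cc k else 0))"
    if "k \<in> -{i,j}" for k by (rule bspec[OF W' that])
  define lo where "lo p = (\<Sum>(a,b)\<in>low_expos. ((p $ i)^a * (p $ j)^b + low_pert a b s (p $ i) (p $ j) - low_lead a b (p $ j)) * c a b)" for p
  define hi where "hi p = (\<Sum>m<4. ((p $ i)^([4,5,6,7] ! m) * (p $ j)^([5,3,1,0] ! m)) * fx m p)" for p
  have Tlo: "Tid lo" unfolding lo_def[abs_def] case_prod_beta
    by (intro Tid_sum Tid_mult Tid_low) auto
  have Thi: "Tid hi" unfolding hi_def[abs_def]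
    by (intro Tid_sum Tid_mult Tid_high fx) auto
  obtain A1 D1 where A1: "flat1 j A1" and D1: "flat1 j D1"
    and AD: "\<forall>\<^sub>F p in nhds 0. lo p + hi p + E p = (u p)^3 * A1 p + (p $ j)^9 * D1 p"
    using Tid_add[OF Tid_add[OF Tlo Thi] E] unfolding Tid_def by blast
  \<comment> \<open>Apart from flat terms the factor of u^3 is s^3 + \<open>fA\<close>, and that of
    y^9 is \<open>lead_y s\<close> plus the linear term stemming from x^3 y^4.\<close>
  define A3 where "A3 p = s^3 + fA p + A1 p" for p
  define D9 where "D9 p = lead_y s + c 3 4 / (10 * s^3) * p $ j + D1 p" for p
  have anA3: "analytic_germ A3" unfolding A3_def[abs_def] using A1 by (intro analytic_intros fA) (auto simp: flat1_def)
  have anD9: "analytic_germ D9" unfolding D9_def[abs_def] using D1 by (intro analytic_intros) (auto simp: flat1_def)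
  have A30: "A3 0 = s^3" using A1 fA by (simp add: A3_def flat1_def)
  have D90: "D9 0 = \<delta>^9" using D1 \<delta> by (simp add: D9_def flat1_def)
  have \<delta>0: "\<delta> \<noteq> 0" using \<delta> lead_y_nonzero[OF s] by auto
  obtain A where A: "analytic_germ A" "A 0 = s" "\<forall>\<^sub>F p in nhds 0. A p ^ 3 = A3 p"
    using analytic_germ_root[OF anA3, of s 3] A30 s by auto
  obtain D where D: "analytic_germ D" "D 0 = \<delta>" "\<forall>\<^sub>F p in nhds 0. D p ^ 9 = D9 p"
    using analytic_germ_root[OF anD9, of \<delta> 9] D90 \<delta>0 by auto
  have pA: "3 * s\<^sup>2 * partial_deriv j A 0 = partial_deriv j fA 0"
  proof -
    have "partial_deriv j (\<lambda>p. A p ^ 3) 0 = partial_deriv j A3 0" by (rule partial_deriv_0_cong[OF A(3)])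
    moreover have "partial_deriv j A3 0 = partial_deriv j fA 0"
      unfolding A3_def[abs_def] using A1 fA by (simp add: partial_deriv_0_add analytic_intros flat1_def)
    ultimately show ?thesis using A by (simp add: partial_deriv_0_power)
  qed
  have pD: "9 * \<delta>^8 * partial_deriv j D 0 = c 3 4 / (10 * s^3)"
  proof -
    have "partial_deriv j (\<lambda>p. D p ^ 9) 0 = partial_deriv j D9 0" by (rule partial_deriv_0_cong[OF D(3)])
    moreover have "partial_deriv j D9 0 = c 3 4 / (10 * s^3)"
    proof -
      have "partial_deriv j (\<lambda>p. c 3 4 / (10 * s^3) * p $ j) 0 = c 3 4 / (10 * s^3)"
        unfolding partial_deriv_0_cmult[OF analytic_germ_nth] partial_deriv_0_nth by simp
      then show ?thesis
        unfolding D9_def[abs_def] using D1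
        by (simp add: partial_deriv_0_add analytic_germ_add analytic_germ_mult analytic_germ_divide_const flat1_def)
    qed
    ultimately show ?thesis using D by (simp add: partial_deriv_0_power)
  qed
  define \<Phi> where "\<Phi> p = (\<chi> k. if k = i then u p * A p else if k = j then p $ j * D p else W k p)" for p
  have \<Phi>i: "\<Phi> p $ i = u p * A p" and \<Phi>j: "\<Phi> p $ j = p $ j * D p" and \<Phi>k: "k \<in> -{i,j} \<Longrightarrow> \<Phi> p $ k = W k p" for p k
    using ij by (auto simp: \<Phi>_def)
  have an\<Phi>: "analytic_germ (\<lambda>p. \<Phi> p $ k)" for k
  proof -
    consider "k = i" | "k = j" | "k \<in> -{i,j}" by blast
    then show ?thesis
      by cases (use W A(1) D(1) in \<open>auto simp: \<Phi>i \<Phi>j \<Phi>k intro!: analytic_germ_mult u_an\<close>)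
  qed
  have \<Phi>0: "\<Phi> 0 = 0"
  proof -
    have "\<Phi> 0 $ k = 0" for k
    proof -
      consider "k = i" | "k = j" | "k \<in> -{i,j}" by blast
      then show ?thesis
        by cases (use W in \<open>auto simp: \<Phi>i \<Phi>j \<Phi>k u_def\<close>)
    qed
    then show ?thesis by (simp add: vec_eq_iff)
  qed
  define d where "d k = (if k = i then - s * s else if k = j then \<delta> else cc k)" for k
  have pd: "partial_deriv m (\<lambda>p. \<Phi> p $ k) 0 = (if k = m then d k else 0)" for k m
  proof -
    consider (1) "k = i" | (2) "k = j" | (3) "k \<in> -{i,j}" by blast
    then show ?thesis
    proof cases
      case 1
      have "partial_deriv m (\<lambda>p. u p * A p) 0 = (if k = m then d k else 0)"
        unfolding partial_deriv_0_mult[OF u_an A(1)] u_partial A(2) u0 using 1 by (simp add: d_def)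
      then show ?thesis using 1 \<Phi>i by simp
    next
      case 2
      have "partial_deriv m (\<lambda>p. p $ j * D p) 0 = (if k = m then d k else 0)"
        using 2 ij by (simp add: partial_deriv_0_mult[OF analytic_germ_nth D(1)] partial_deriv_0_nth D(2) d_def)
      then show ?thesis using 2 \<Phi>j by simp
    next
      case 3
      then show ?thesis using W[OF 3] by (auto simp: \<Phi>k d_def)
    qed
  qed
  have main: "\<forall>\<^sub>F p in nhds 0. sq_germ p + pert s p = (\<Phi> p $ i)^3 + (\<Phi> p $ j)^9 + (\<Sum>k\<in>-{i,j}. (\<Phi> p $ k)\<^sup>2)"
    using g Weq AD A(3) D(3)
  proof eventually_elim
    case (elim p)
    let ?x = "p $ i" and ?y = "p $ j" and ?Z = "-{i,j}"
    have MM: "(\<Sum>k\<in>?Z. \<Sum>l\<in>?Z. p $ k * p $ l * M k l p) = (\<Sum>k\<in>?Z. \<Sum>l\<in>?Z. p $ k * p $ l * fz k l p) + (\<Sum>k\<in>?Z. mk k * (p $ k)\<^sup>2)"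
    proof -
      have "(\<Sum>k\<in>?Z. \<Sum>l\<in>?Z. p $ k * p $ l * M k l p) =
        (1/2) * (\<Sum>k\<in>?Z. \<Sum>l\<in>?Z. p $ k * p $ l * fz k l p) + (1/2) * (\<Sum>k\<in>?Z. \<Sum>l\<in>?Z. p $ k * p $ l * fz l k p)
        + (\<Sum>k\<in>?Z. \<Sum>l\<in>?Z. if k = l then mk k * (p $ k)\<^sup>2 else 0)"
        unfolding sum_distrib_left sum.distrib[symmetric]
        by (intro sum.cong refl) (simp add: M_def field_simps power2_eq_square)
      also have "(\<Sum>k\<in>?Z. \<Sum>l\<in>?Z. p $ k * p $ l * fz l k p) = (\<Sum>k\<in>?Z. \<Sum>l\<in>?Z. p $ k * p $ l * fz k l p)"
        by (subst sum.swap) (simp add: mult.commute mult.left_commute)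
      also have "(\<Sum>k\<in>?Z. \<Sum>l\<in>?Z. if k = l then mk k * (p $ k)\<^sup>2 else 0) = (\<Sum>k\<in>?Z. mk k * (p $ k)\<^sup>2)"
        by (intro sum.cong refl) simp
      finally show ?thesis by simp
    qed
    have mkq: "(\<Sum>k\<in>?Z. mk k * (p $ k)\<^sup>2) = s * (\<Sum>k\<in>J. (p $ k)\<^sup>2) + (\<Sum>k\<in>?Z - J. (p $ k)\<^sup>2)"
    proof -
      have "(\<Sum>k\<in>?Z. mk k * (p $ k)\<^sup>2) = (\<Sum>k\<in>?Z - J. mk k * (p $ k)\<^sup>2) + (\<Sum>k\<in>J. mk k * (p $ k)\<^sup>2)"
        by (rule sum.subset_diff[OF J finite])
      then show ?thesis by (simp add: mk_def sum_distrib_left)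
    qed
    have hh: "(\<Sum>k\<in>?Z. \<Sum>b<6. p $ k * (?x^(6 - b) * ?y^b) * fq k b p) = (\<Sum>k\<in>?Z. p $ k * h k p)"
      by (simp add: h_def sum_distrib_left mult.assoc)
    have ll: "(\<Sum>(a,b)\<in>low_expos. c a b * (?x^a * ?y^b)) + (\<Sum>(a,b)\<in>low_expos. c a b * low_pert a b s ?x ?y)
        = lo p + c 2 5 * ?y^9 / (6 * s\<^sup>2) + c 3 4 * ?y^10 / (10 * s^3)"
    proof -
      have "(\<Sum>(a,b)\<in>low_expos. c a b * (?x^a * ?y^b)) + (\<Sum>(a,b)\<in>low_expos. c a b * low_pert a b s ?x ?y)
        = lo p + (\<Sum>(a,b)\<in>low_expos. low_lead a b ?y * c a b)"
        unfolding lo_def sum.distrib[symmetric] by (intro sum.cong refl) (auto simp: algebra_simps)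
      also have "(\<Sum>(a,b)\<in>low_expos. low_lead a b ?y * c a b) = c 2 5 * ?y^9 / (6 * s\<^sup>2) + c 3 4 * ?y^10 / (10 * s^3)"
        by (simp add: low_expos_def low_lead_def mult.commute)
      finally show ?thesis by simp
    qed
    have hh2: "(\<Sum>m<4. ?x^([4,5,6,7] ! m) * ?y^([5,3,1,0] ! m) * fx m p) = hi p" by (simp add: hi_def)
    have "sq_germ p + pert s p = (u p)^3 * (s^3 + fA p)
        + ((\<Sum>(a,b)\<in>low_expos. c a b * (?x^a * ?y^b)) + (\<Sum>(a,b)\<in>low_expos. c a b * low_pert a b s ?x ?y))
        + hi p + y9 * s^9 * ?y^9 + (\<Sum>k\<in>?Z. p $ k * h k p)
        + ((\<Sum>k\<in>?Z. \<Sum>l\<in>?Z. p $ k * p $ l * fz k l p) + (\<Sum>k\<in>?Z. mk k * (p $ k)\<^sup>2))"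
      unfolding sq_germ_def pert_def elim(1) hh hh2 mkq cu by (simp add: algebra_simps)
    also have "\<dots> = (u p)^3 * (s^3 + fA p) + (lo p + hi p + E p) + ?y^9 * (lead_y s + c 3 4 / (10 * s^3) * ?y) + (\<Sum>k\<in>?Z. (W k p)\<^sup>2)"
      unfolding ll MM[symmetric] lead_y_def using elim(2) by (simp add: algebra_simps eval_nat_numeral)
    also have "\<dots> = (u p)^3 * A3 p + ?y^9 * D9 p + (\<Sum>k\<in>?Z. (W k p)\<^sup>2)"
      unfolding elim(3) A3_def D9_def by (simp add: algebra_simps)
    also have "\<dots> = (\<Phi> p $ i)^3 + (\<Phi> p $ j)^9 + (\<Sum>k\<in>?Z. (\<Phi> p $ k)\<^sup>2)"
      unfolding \<Phi>i \<Phi>j power_mult_distrib elim(4,5) using \<Phi>k by simp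
    finally show ?case .
  qed
  have dn: "d k \<noteq> 0" for k using s \<delta>0 cc by (simp add: d_def)
  have dj: "d j = \<delta>" using ij by (simp add: d_def)
  show ?thesis
    using an\<Phi> \<Phi>0 A(1,2) D(1,2) pA pD \<Phi>i \<Phi>j pd dn dj main unfolding cu by blast
qed

text \<open>The coefficients of \<open>pert\<close> as a polynomial in s of degree at most 9, needed
  because a deformation has to be a power series jointly in the point and the parameter.\<close>

definition pert_coeff :: "nat \<Rightarrow> complex ^ 'n \<Rightarrow> complex" where
  "pert_coeff n p = (let x = p $ i; y = p $ j in
     if n = 1 then fA p * (-3 * y^4 * x) + (\<Sum>(a,b)\<in>low_expos. c a b * (low_coeff1 a b * (x^(a+1) * y^(b-2)))) + (\<Sum>k\<in>J. (p $ k)\<^sup>2)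
     else if n = 2 then fA p * (3 * y\<^sup>2 * x\<^sup>2) + (\<Sum>(a,b)\<in>low_expos. c a b * (low_coeff2 a b * (x^(a+2) * y^(b-4))))
     else if n = 3 then y^6 - fA p * x^3 else if n = 4 then -3 * y^4 * x else if n = 5 then 3 * y\<^sup>2 * x\<^sup>2
     else if n = 6 then - (x^3) else if n = 9 then y9 * y^9 else 0)"

lemma pert_expand: "pert s p = (\<Sum>n<10. s^n * pert_coeff n p)"
proof -
  let ?x = "p $ i" and ?y = "p $ j"
  have low: "(\<Sum>(a,b)\<in>low_expos. c a b * low_pert a b s ?x ?y) =
      s * (\<Sum>(a,b)\<in>low_expos. c a b * (low_coeff1 a b * (?x^(a+1) * ?y^(b-2))))
      + s\<^sup>2 * (\<Sum>(a,b)\<in>low_expos. c a b * (low_coeff2 a b * (?x^(a+2) * ?y^(b-4))))"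
    unfolding sum_distrib_left sum.distrib[symmetric]
    by (intro sum.cong refl) (auto simp: low_pert_def algebra_simps)
  have "(\<Sum>n<10. s^n * pert_coeff n p) = s * pert_coeff 1 p + s\<^sup>2 * pert_coeff 2 p + s^3 * pert_coeff 3 p
      + s^4 * pert_coeff 4 p + s^5 * pert_coeff 5 p + s^6 * pert_coeff 6 p + s^9 * pert_coeff 9 p"
    by (simp add: eval_nat_numeral pert_coeff_def)
  then show ?thesis
    unfolding pert_def low by (simp add: pert_coeff_def Let_def curve_u_def eval_nat_numeral algebra_simps)
qed

lemma pert_coeff_analytic: "analytic_germ (pert_coeff n)"
proof -
  have 1: "analytic_germ (\<lambda>p. \<Sum>(a,b)\<in>low_expos. f a b * (h a b * ((p $ i)^k a b * (p $ j)^l a b)))" for f h k l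
    unfolding case_prod_beta by (intro analytic_intros)
  show ?thesis
    unfolding pert_coeff_def[abs_def] Let_def by (intro analytic_germ_if analytic_intros fA(1) 1)
qed

lemma pert_coeff_0: "pert_coeff 0 p = 0"
  by (simp add: pert_coeff_def)

lemma pert_at_0: "pert 0 p = 0"
  by (simp add: pert_def curve_u_def low_pert_def case_prod_beta power_mult[symmetric])

lemma pert_coeff_at_0: "pert_coeff n 0 = 0"
  by (simp add: pert_coeff_def Let_def fA(2) case_prod_beta sum.neutral)

end

lemma analytic_family_polynomial:
  fixes M :: "nat \<Rightarrow> complex ^ 'n::finite \<Rightarrow> complex"
  assumes "\<And>n. n < N \<Longrightarrow> analytic_germ (M n)"
  shows "analytic_family 1 (\<lambda>x t. \<Sum>n<N. t 0 ^ n * M n x)"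
proof -
  have "\<forall>\<^sub>F x in nhds 0. \<forall>n\<in>{..<N}. ((\<lambda>\<alpha>. taylor_coeff (M n) \<alpha> * mon \<alpha> x) has_sum M n x) UNIV"
    using has_power_series_taylor[OF assms] unfolding has_power_series_def
    by (intro eventually_ball_finite) auto
  then obtain r where r: "r > 0" "\<And>x n. norm x < r \<Longrightarrow> n < N \<Longrightarrow> ((\<lambda>\<alpha>. taylor_coeff (M n) \<alpha> * mon \<alpha> x) has_sum M n x) UNIV"
    unfolding eventually_nhds_metric by auto
  \<comment> \<open>The multi-index with exponent n in the only parameter; all multi-indices in
    \<open>?B\<close> are of this form.\<close>
  define e where "e n = (\<lambda>k::nat. if k = 0 then n else 0)" for n :: nat
  define A where "A \<alpha> \<beta> = (if \<beta> 0 < N then taylor_coeff (M (\<beta> 0)) \<alpha> else 0)" for \<alpha> and \<beta> :: "nat \<Rightarrow> nat"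
  let ?B = "{\<beta> :: nat \<Rightarrow> nat. \<forall>i\<ge>1. \<beta> i = 0}"
  have eB: "e n \<in> ?B" for n by (simp add: e_def)
  have Be: "\<beta> = e (\<beta> 0)" if "\<beta> \<in> ?B" for \<beta> using that by (auto simp: e_def fun_eq_iff)
  have one: "((\<lambda>(\<alpha>,\<beta>). if \<beta> = e n then taylor_coeff (M n) \<alpha> * (mon \<alpha> x * z) else 0) has_sum (z * M n x)) (UNIV \<times> ?B)"
    if "norm x < r" "n < N" for x n z
  proof -
    have "((\<lambda>\<alpha>. z * (taylor_coeff (M n) \<alpha> * mon \<alpha> x)) has_sum (z * M n x)) UNIV"
      by (intro has_sum_cmult_right r that)
    then have "((\<lambda>(\<alpha>,\<beta>). taylor_coeff (M n) \<alpha> * (mon \<alpha> x * z)) has_sum (z * M n x)) (UNIV \<times> {e n})"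
      using has_sum_reindex_bij_witness[of UNIV fst "\<lambda>\<alpha>. (\<alpha>, e n)" "UNIV \<times> {e n}"
          "\<lambda>(\<alpha>,\<beta>). taylor_coeff (M n) \<alpha> * (mon \<alpha> x * z)" "\<lambda>\<alpha>. z * (taylor_coeff (M n) \<alpha> * mon \<alpha> x)"]
      by (auto simp: mult_ac)
    moreover have "((\<lambda>(\<alpha>,\<beta>). taylor_coeff (M n) \<alpha> * (mon \<alpha> x * z)) has_sum (z * M n x)) (UNIV \<times> {e n}) \<longleftrightarrow>
      ((\<lambda>(\<alpha>,\<beta>). if \<beta> = e n then taylor_coeff (M n) \<alpha> * (mon \<alpha> x * z) else 0) has_sum (z * M n x)) (UNIV \<times> ?B)"
      by (rule has_sum_cong_neutral) (use eB in \<open>auto split: if_splits\<close>)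
    ultimately show ?thesis by simp
  qed
  have sum: "((\<lambda>(\<alpha>,\<beta>). \<Sum>n<N'. if \<beta> = e n then taylor_coeff (M n) \<alpha> * (mon \<alpha> x * w ^ n) else 0) has_sum (\<Sum>n<N'. w ^ n * M n x)) (UNIV \<times> ?B)"
    if "norm x < r" "N' \<le> N" for x N' w
    using that(2)
  proof (induction N')
    case (Suc N')
    from has_sum_add[OF Suc.IH one[OF that(1), of N' "w ^ N'"]] Suc.prems
    show ?case by (simp add: case_prod_beta)
  qed (auto intro!: has_sum_0)
  have "((\<lambda>(\<alpha>, \<beta>). A \<alpha> \<beta> * (mon \<alpha> x * (\<Prod>i<1. t i ^ \<beta> i))) has_sum (\<Sum>n<N. t 0 ^ n * M n x)) (UNIV \<times> ?B)"
    if "norm x < r" for x and t :: "nat \<Rightarrow> complex"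
  proof -
    have "(\<Sum>n<N. if \<beta> = e n then taylor_coeff (M n) \<alpha> * (mon \<alpha> x * t 0 ^ n) else 0) = A \<alpha> \<beta> * (mon \<alpha> x * (\<Prod>i<1. t i ^ \<beta> i))"
      if "\<beta> \<in> ?B" for \<alpha> \<beta>
    proof -
      have "\<beta> = e n \<longleftrightarrow> n = \<beta> 0" for n using Be[OF that] by (auto simp: e_def)
      then have "(\<Sum>n<N. if \<beta> = e n then taylor_coeff (M n) \<alpha> * (mon \<alpha> x * t 0 ^ n) else 0)
        = (\<Sum>n<N. if n = \<beta> 0 then taylor_coeff (M n) \<alpha> * (mon \<alpha> x * t 0 ^ n) else 0)" by simp
      then show ?thesis by (simp add: A_def)
    qed
    then show ?thesis
      by (intro iffD1[OF has_sum_cong sum[OF that order_refl, of "t 0"]]) auto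
  qed
  then show ?thesis unfolding analytic_family_def using r(1) by blast
qed

context germ_data
begin

theorem deforms:
  assumes \<phi>: "biholomorphism_germ \<phi>" and f: "\<forall>\<^sub>F x in nhds 0. f x = sq_germ (\<phi> x)" and fan: "analytic_germ f"
  shows "deforms_to f J30"
proof -
  have \<phi>an: "\<And>k. analytic_germ (\<lambda>x. \<phi> x $ k)" "\<phi> 0 = 0" using \<phi> by (auto simp: biholomorphism_germ_def)
  define M where "M n = (if n = 0 then f else (\<lambda>x. pert_coeff n (\<phi> x)))" for n
  define F where "F x t = (\<Sum>n<10. t 0 ^ n * M n x)" for x and t :: "nat \<Rightarrow> complex"
  have Feq: "F x t = f x + pert (t 0) (\<phi> x)" for x t
  proof -
    have "F x t = (\<Sum>n<10. t 0 ^ n * pert_coeff n (\<phi> x)) + (\<Sum>n<(10::nat). if n = 0 then f x else 0)"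
      unfolding F_def sum.distrib[symmetric] by (intro sum.cong refl) (auto simp: M_def pert_coeff_0)
    then show ?thesis by (simp add: pert_expand)
  qed
  have "analytic_germ (M n)" for n
    unfolding M_def using fan analytic_germ_compose[OF pert_coeff_analytic \<phi>an] by simp
  then have fam: "analytic_family 1 F" unfolding F_def[abs_def] by (intro analytic_family_polynomial)
  have F0: "F x (\<lambda>_. 0) = f x" for x by (simp add: Feq pert_at_0)
  \<comment> \<open>The member b = c = 0 of the family.\<close>
  define H where "H v = (v $ i) ^ 3 + 0 * (v $ i)\<^sup>2 * (v $ j) ^ 3 + (v $ j) ^ 9 + 0 * (v $ i) * (v $ j) ^ 7
              + (\<Sum>k\<in>- {i, j}. (v $ k)\<^sup>2)" for v :: "complex ^ 'n"
  have HJ: "H \<in> J30" unfolding J30_def H_def[abs_def] using ij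
    by (intro CollectI exI[of _ i] exI[of _ j] exI[of _ 0]) simp
  have eq: "smoothly_equiv (\<lambda>x. F x t) H" if t: "t 0 \<noteq> 0" for t
  proof -
    define \<delta> where "\<delta> = exp (Ln (lead_y (t 0)) / 9)"
    have "\<delta> ^ 9 = lead_y (t 0)"
      unfolding \<delta>_def using lead_y_nonzero[OF t] by (subst exp_of_nat_mult[symmetric]) simp
    from normal_form[OF t this] obtain \<Phi> d where \<Phi>: "\<And>k. analytic_germ (\<lambda>p. \<Phi> p $ k)" "\<Phi> 0 = 0"
      "\<And>k m. partial_deriv m (\<lambda>p. \<Phi> p $ k) 0 = (if k = m then d k else 0)" "\<And>k. d k \<noteq> 0"
      and main: "\<forall>\<^sub>F p in nhds 0. sq_germ p + pert (t 0) p = (\<Phi> p $ i)^3 + (\<Phi> p $ j)^9 + (\<Sum>k\<in>-{i,j}. (\<Phi> p $ k)\<^sup>2)"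
      by blast
    obtain \<Psi> where \<Psi>: "\<Psi> 0 = 0" "\<And>k. analytic_germ (\<lambda>x. \<Psi> x $ k)" "\<forall>\<^sub>F x in nhds 0. \<Psi> (\<Phi> x) = x \<and> \<Phi> (\<Psi> x) = x"
      using inverse_function_germ[OF \<Phi>] by blast
    have b: "biholomorphism_germ \<Phi>" by (rule biholomorphism_germI[OF \<Phi>(1,2) \<Psi>])
    have "\<forall>\<^sub>F x in nhds 0. sq_germ (\<phi> x) + pert (t 0) (\<phi> x) = H (\<Phi> (\<phi> x))"
      using eventually_compose_germ[OF tendsto_map_germ[OF \<phi>an] main] by (simp add: H_def)
    with f have "\<forall>\<^sub>F x in nhds 0. F x t = H (\<Phi> (\<phi> x))" by eventually_elim (simp add: Feq)
    then show ?thesis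
      unfolding smoothly_equiv_def using biholomorphism_germ_compose[OF \<phi> b] by blast
  qed
  show ?thesis
    unfolding deforms_to_def
  proof (intro exI[of _ 1] exI[of _ F] conjI allI impI)
    fix \<epsilon> :: real assume \<epsilon>: "\<epsilon> > 0"
    let ?t = "\<lambda>k::nat. if k = 0 then of_real (\<epsilon> / 2) else (0::complex)"
    have "?t \<noteq> (\<lambda>_. 0)" using \<epsilon> by (auto simp: fun_eq_iff)
    moreover have "smoothly_equiv (\<lambda>x. F x ?t) H" by (rule eq) (use \<epsilon> in simp)
    ultimately show "\<exists>t\<in>param_space 1. t \<noteq> (\<lambda>_. 0) \<and> (\<forall>i<1. norm (t i) < \<epsilon>) \<and> (\<exists>g\<in>J30. smoothly_equiv (\<lambda>x. F x t) g)"
      using HJ \<epsilon> by (intro bexI[of _ ?t]) (auto simp: param_space_def)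
  qed (use fam F0 in auto)
qed

text \<open>
  Up to a factor depending only on \<open>s\<close>, \<open>\<gamma> + rho s \<beta>\<close> is the quantity \<open>c + e w\<close>,
  \<open>w = - 2 b / 3\<close>, from which the bi-Lipschitz invariant of the normal form is built.
\<close>

definition rho :: "complex \<Rightarrow> complex \<Rightarrow> complex" where
  "rho s \<beta> = 2/3 * \<beta>\<^sup>2 / s^3 * (2/3 * partial_deriv j fA 0 / s^3 + c 3 4 / (30 * s^3 * lead_y s))"

text \<open>In the coordinates X = u A, Y = y D the terms beta u^2 y^3 and gamma u y^7 become X^2
  Y^3 M and X Y^7 N, where M is beta / (A^2 D^3) and N is gamma / (A D^7), so b and c are read off
  at 0. The derivatives of A and D give e, and R keeps its order under the coordinate
  change.\<close>

theorem family_normal_form: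
  assumes s: "s \<noteq> 0" and \<delta>: "\<delta> ^ 9 = lead_y s"
    and \<phi>: "biholomorphism_germ \<phi>" and f: "\<forall>\<^sub>F x in nhds 0. f x = sq_germ (\<phi> x)"
    and R: "analytic_germ R" "ordge 11 R"
    and q: "\<forall>\<^sub>F x in nhds 0. q x = f x + pert s (\<phi> x) + \<beta> * ((curve_u s (\<phi> x))\<^sup>2 * (\<phi> x $ j)^3)
      + \<gamma> * (curve_u s (\<phi> x) * (\<phi> x $ j)^7) + R x"
  shows "\<exists>\<theta> \<omega> F e. lip_pair \<theta> \<omega> \<and> (\<forall>\<^sub>F x in nhds 0. q x = F (\<theta> x)) \<and>
    lip_normal_form i j F (\<beta> / (s\<^sup>2 * \<delta>^3)) e (\<gamma> / (s * \<delta>^7)) \<and>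
    \<gamma> / (s * \<delta>^7) + e * (- 2 * (\<beta> / (s\<^sup>2 * \<delta>^3)) / 3) = (\<gamma> + rho s \<beta>) / (s * \<delta>^7)"
proof -
  obtain \<psi> where \<phi>an: "\<And>k. analytic_germ (\<lambda>x. \<phi> x $ k)" "\<phi> 0 = 0"
    and \<psi>: "\<psi> 0 = 0" "\<And>k. analytic_germ (\<lambda>x. \<psi> x $ k)" "\<forall>\<^sub>F x in nhds 0. \<psi> (\<phi> x) = x \<and> \<phi> (\<psi> x) = x"
    using \<phi> by (auto simp: biholomorphism_germ_def)
  have \<delta>0: "\<delta> \<noteq> 0" using \<delta> lead_y_nonzero[OF s] by auto
  from normal_form[OF s \<delta>] obtain \<Phi> A D d where \<Phi>: "\<And>k. analytic_germ (\<lambda>p. \<Phi> p $ k)" "\<Phi> 0 = 0"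
    "\<And>k m. partial_deriv m (\<lambda>p. \<Phi> p $ k) 0 = (if k = m then d k else 0)" "\<And>k. d k \<noteq> 0"
    and AD: "analytic_germ A" "analytic_germ D" "A 0 = s" "D 0 = \<delta>"
    and pA: "3 * s\<^sup>2 * partial_deriv j A 0 = partial_deriv j fA 0"
    and pD: "9 * \<delta>^8 * partial_deriv j D 0 = c 3 4 / (10 * s^3)"
    and \<Phi>ij: "\<And>p. \<Phi> p $ i = curve_u s p * A p" "\<And>p. \<Phi> p $ j = p $ j * D p" and dj: "d j = \<delta>"
    and main: "\<forall>\<^sub>F p in nhds 0. sq_germ p + pert s p = (\<Phi> p $ i)^3 + (\<Phi> p $ j)^9 + (\<Sum>k\<in>-{i,j}. (\<Phi> p $ k)\<^sup>2)"
    by blast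
  obtain \<Psi> where \<Psi>: "\<Psi> 0 = 0" "\<And>k. analytic_germ (\<lambda>x. \<Psi> x $ k)" "\<forall>\<^sub>F x in nhds 0. \<Psi> (\<Phi> x) = x \<and> \<Phi> (\<Psi> x) = x"
    "\<And>k m. partial_deriv m (\<lambda>x. \<Psi> x $ k) 0 = (if k = m then inverse (d k) else 0)"
    using inverse_function_germ[OF \<Phi>] by blast
  define IA where "IA p = inverse (A p)" for p
  define ID where "ID p = inverse (D p)" for p
  have anI: "analytic_germ IA" "analytic_germ ID"
    unfolding IA_def[abs_def] ID_def[abs_def] using AD s \<delta>0 by (auto intro: analytic_germ_inverse)
  have I0: "IA 0 = inverse s" "ID 0 = inverse \<delta>" by (simp_all add: IA_def ID_def AD)
  have pIA: "partial_deriv j IA 0 = - partial_deriv j A 0 / s\<^sup>2"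
    unfolding IA_def[abs_def] using partial_deriv_0_inverse[OF AD(1)] s by (simp add: AD)
  have pID: "partial_deriv j ID 0 = - partial_deriv j D 0 / \<delta>\<^sup>2"
    unfolding ID_def[abs_def] using partial_deriv_0_inverse[OF AD(2)] \<delta>0 by (simp add: AD)
  \<comment> \<open>The factors relating u^2 y^3 to X^2 Y^3 and, for n, u y^7 to X Y^7.\<close>
  define m where "m p = (IA p)\<^sup>2 * (ID p)^3" for p
  define n where "n p = IA p * (ID p)^7" for p
  have anm: "analytic_germ m" "analytic_germ n"
    unfolding m_def[abs_def] n_def[abs_def] by (intro analytic_intros anI)+
  have pm: "partial_deriv j m 0 = 2 * IA 0 * partial_deriv j IA 0 * (ID 0)^3 + (IA 0)\<^sup>2 * (3 * (ID 0)\<^sup>2 * partial_deriv j ID 0)"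
    unfolding m_def[abs_def]
    by (simp add: partial_deriv_0_mult partial_deriv_0_power analytic_germ_power anI)
  define \<theta> where "\<theta> x = \<Phi> (\<phi> x)" for x
  define \<omega> where "\<omega> x = \<psi> (\<Psi> x)" for x
  have lp1: "lip_pair \<phi> \<psi>" by (rule lip_pair_if_biholo[OF \<phi>an \<psi>])
  have lp2: "lip_pair \<Phi> \<Psi>" by (rule lip_pair_if_biholo[OF \<Phi>(1,2) \<Psi>(1,2,3)])
  have lp: "lip_pair \<theta> \<omega>" unfolding \<theta>_def[abs_def] \<omega>_def[abs_def] by (rule lip_pair_compose[OF lp1 lp2])
  have an\<omega>: "\<And>k. analytic_germ (\<lambda>x. \<omega> x $ k)" "\<omega> 0 = 0"
    unfolding \<omega>_def using analytic_map_compose[OF \<Psi>(2,1) \<psi>(2)] \<Psi>(1) \<psi>(1) by auto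
  define Mf where "Mf x = \<beta> * m (\<Psi> x)" for x
  define Nf where "Nf x = \<gamma> * n (\<Psi> x)" for x
  define Rf where "Rf x = R (\<omega> x)" for x
  define F where "F = nf_expr i j Mf Nf Rf"
  have anf: "analytic_germ Mf" "analytic_germ Nf" "analytic_germ Rf"
    unfolding Mf_def[abs_def] Nf_def[abs_def] Rf_def[abs_def]
    by (intro analytic_intros analytic_germ_compose[OF anm(1) \<Psi>(2,1)] analytic_germ_compose[OF anm(2) \<Psi>(2,1)]
        analytic_germ_compose[OF R(1) an\<omega>])+
  have R11: "ordge 11 Rf"
  proof -
    obtain C where C: "\<forall>\<^sub>F x in nhds 0. norm (R x) \<le> C * norm x ^ 11" using R(2) by (auto simp: ordge_def)
    have lg: "lip_germ \<omega>" using lp by (simp add: lip_pair_def)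
    obtain L r where L: "r > 0" "L-lipschitz_on (ball 0 r) \<omega>" using lg unfolding lip_germ_def by blast
    have "\<forall>\<^sub>F x in nhds 0. x \<in> ball (0 :: complex ^ 'n) r" using L(1) by (intro eventually_nhds_in_open) auto
    with eventually_compose_germ[OF lip_germ_filterlim[OF lg] C]
    have "\<forall>\<^sub>F x in nhds 0. norm (Rf x) \<le> (\<bar>C\<bar> * L^11) * norm x ^ 11"
    proof eventually_elim
      case (elim x)
      have "dist (\<omega> x) (\<omega> 0) \<le> L * dist x 0" by (rule lipschitz_onD[OF L(2)]) (use elim L in auto)
      then have "norm (\<omega> x) \<le> L * norm x" by (simp add: an\<omega>)
      then have "norm (\<omega> x) ^ 11 \<le> (L * norm x) ^ 11" by (intro power_mono) auto
      have "norm (Rf x) \<le> \<bar>C\<bar> * norm (\<omega> x) ^ 11"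
        unfolding Rf_def by (rule order_trans[OF elim(1)]) (intro mult_right_mono, auto)
      also have "\<dots> \<le> \<bar>C\<bar> * (L * norm x) ^ 11" by (intro mult_left_mono) (fact, simp)
      finally show ?case by (simp add: power_mult_distrib mult_ac)
    qed
    then show ?thesis by (auto simp: ordge_def)
  qed
  define e where "e = partial_deriv j Mf 0"
  have nf: "lip_normal_form i j F (\<beta> / (s\<^sup>2 * \<delta>^3)) e (\<gamma> / (s * \<delta>^7))"
    unfolding lip_normal_form_def
    by (rule exI[of _ Mf], rule exI[of _ Nf], rule exI[of _ Rf])
      (simp add: anf R11 F_def e_def, simp add: Mf_def Nf_def m_def n_def \<Psi>(1) I0 field_simps)
  have ee: "e = \<beta> * (inverse \<delta> * partial_deriv j m 0)"
  proof -
    have "e = \<beta> * partial_deriv j (\<lambda>x. m (\<Psi> x)) 0"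
      unfolding e_def Mf_def[abs_def] by (rule partial_deriv_0_cmult[OF analytic_germ_compose[OF anm(1) \<Psi>(2,1)]])
    also have "partial_deriv j (\<lambda>x. m (\<Psi> x)) 0 = (\<Sum>k\<in>UNIV. partial_deriv j (\<lambda>x. \<Psi> x $ k) 0 * partial_deriv k m 0)"
      by (rule partial_deriv_0_compose[OF anm(1) \<Psi>(2,1)])
    also have "\<dots> = (\<Sum>k\<in>UNIV. if k = j then inverse \<delta> * partial_deriv j m 0 else 0)"
      by (intro sum.cong refl) (simp add: \<Psi>(4) dj)
    finally show ?thesis by simp
  qed
  have val: "\<gamma> / (s * \<delta>^7) + e * (- 2 * (\<beta> / (s\<^sup>2 * \<delta>^3)) / 3) = (\<gamma> + rho s \<beta>) / (s * \<delta>^7)"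
  proof -
    have pA': "partial_deriv j A 0 = partial_deriv j fA 0 / (3 * s\<^sup>2)" using pA s by (simp add: field_simps)
    have pD': "partial_deriv j D 0 = c 3 4 / (90 * s^3 * \<delta>^8)" using pD s \<delta>0 by (simp add: field_simps)
    show ?thesis
      unfolding ee pm pIA pID I0 pA' pD' rho_def \<delta>[symmetric]
      using s \<delta>0 by (simp add: field_simps eval_nat_numeral)
  qed
  have nzA: "\<forall>\<^sub>F p in nhds 0. A p \<noteq> 0" and nzD: "\<forall>\<^sub>F p in nhds 0. D p \<noteq> 0"
    using analytic_germ_nonzero AD s \<delta>0 by auto
  have "\<forall>\<^sub>F x in nhds 0. q x = F (\<theta> x)"
    using q f eventually_compose_germ[OF tendsto_map_germ[OF \<phi>an] main]
      eventually_compose_germ[OF tendsto_map_germ[OF \<phi>an] \<Psi>(3)]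
      eventually_compose_germ[OF tendsto_map_germ[OF \<phi>an] nzA]
      eventually_compose_germ[OF tendsto_map_germ[OF \<phi>an] nzD] \<psi>(3)
  proof eventually_elim
    case (elim x)
    have nz: "A (\<phi> x) \<noteq> 0" "D (\<phi> x) \<noteq> 0" using elim by auto
    have "F (\<theta> x) = (\<theta> x $ i)^3 + (\<theta> x $ j)^9 + (\<Sum>k\<in>-{i,j}. (\<theta> x $ k)\<^sup>2)
        + (\<theta> x $ i)\<^sup>2 * (\<theta> x $ j)^3 * (\<beta> * m (\<phi> x)) + \<theta> x $ i * (\<theta> x $ j)^7 * (\<gamma> * n (\<phi> x)) + R x"
      using elim(4,7) by (simp add: F_def nf_expr_def Mf_def Nf_def Rf_def \<theta>_def \<omega>_def)
    also have "(\<theta> x $ i)\<^sup>2 * (\<theta> x $ j)^3 * (\<beta> * m (\<phi> x)) = \<beta> * ((curve_u s (\<phi> x))\<^sup>2 * (\<phi> x $ j)^3)"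
      using nz by (simp add: \<theta>_def \<Phi>ij m_def IA_def ID_def power_mult_distrib field_simps)
    also have "\<theta> x $ i * (\<theta> x $ j)^7 * (\<gamma> * n (\<phi> x)) = \<gamma> * (curve_u s (\<phi> x) * (\<phi> x $ j)^7)"
      using nz by (simp add: \<theta>_def \<Phi>ij n_def IA_def ID_def power_mult_distrib field_simps)
    also have "(\<theta> x $ i)^3 + (\<theta> x $ j)^9 + (\<Sum>k\<in>-{i,j}. (\<theta> x $ k)\<^sup>2) = f x + pert s (\<phi> x)"
      using elim(2,3) by (simp add: \<theta>_def)
    finally show ?case using elim(1) by simp
  qed
  then show ?thesis using lp nf val by blast
qed

end

section \<open>Dimension of semialgebraic sets of jets\<close>

lemma lookup_scaleR: "Poly_Mapping.lookup (a *\<^sub>R x) n = a *\<^sub>R Poly_Mapping.lookup (x :: 'a \<Rightarrow>\<^sub>0 'b::real_normed_vector) n"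
proof -
  have "finite {i. a *\<^sub>R Poly_Mapping.lookup x i \<noteq> 0}"
    by (rule finite_subset[of _ "Poly_Mapping.keys x"]) (auto simp: in_keys_iff)
  then show ?thesis by (simp add: scaleR_poly_mapping_def Abs_poly_mapping_inverse)
qed

lemma norm_poly_mapping_eq:
  "norm (x :: 'a \<Rightarrow>\<^sub>0 'b::real_normed_vector) = (\<Sum>n\<in>Poly_Mapping.keys x. norm (Poly_Mapping.lookup x n))"
  by (simp add: norm_poly_mapping_def dist_poly_mapping_def)

lemma bounded_linear_lookup: "bounded_linear (\<lambda>x :: 'a \<Rightarrow>\<^sub>0 'b::real_normed_vector. Poly_Mapping.lookup x n)"
proof (rule bounded_linear_intro[of _ 1])
  fix x :: "'a \<Rightarrow>\<^sub>0 'b"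
  show "norm (Poly_Mapping.lookup x n) \<le> norm x * 1"
  proof (cases "n \<in> Poly_Mapping.keys x")
    case True
    then show ?thesis unfolding norm_poly_mapping_eq
      using member_le_sum[of n "Poly_Mapping.keys x" "\<lambda>n. norm (Poly_Mapping.lookup x n)"] by simp
  qed (simp add: in_keys_iff)
qed (simp_all add: lookup_add lookup_scaleR)

lemma bounded_linear_single: "bounded_linear (Poly_Mapping.single n :: 'b \<Rightarrow> 'a \<Rightarrow>\<^sub>0 'b::real_normed_vector)"
proof (rule bounded_linear_intro[of _ 1])
  fix x y :: 'b and r :: real
  show "Poly_Mapping.single n (x + y) = Poly_Mapping.single n x + Poly_Mapping.single n y" by (simp add: single_add)
  show "Poly_Mapping.single n (r *\<^sub>R x) = r *\<^sub>R Poly_Mapping.single n x"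
    by (rule poly_mapping_eqI) (simp add: lookup_scaleR lookup_single when_def)
  show "norm (Poly_Mapping.single n x) \<le> norm x * 1"
    by (cases "x = 0") (auto simp: norm_poly_mapping_eq)
qed

lemma lookup_sum_single:
  "finite K \<Longrightarrow> Poly_Mapping.lookup (\<Sum>\<alpha>\<in>K. Poly_Mapping.single \<alpha> (f \<alpha>)) \<beta> = (if \<beta> \<in> K then f \<beta> else 0)"
  by (simp add: lookup_sum lookup_single when_def)

lemma keys_sum_single: "finite K \<Longrightarrow> Poly_Mapping.keys (\<Sum>\<alpha>\<in>K. Poly_Mapping.single \<alpha> (f \<alpha>)) \<subseteq> K"
  by (auto simp: in_keys_iff lookup_sum_single split: if_splits)

text \<open>Invariance of domain: a cell of larger dimension would map an open subset of real
  d-space injectively onto an open set inside the hyperplane where the last coordinate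
  vanishes.\<close>

lemma no_injection_open_cube:
  fixes C :: "('a \<Rightarrow>\<^sub>0 complex) set"
  assumes K: "finite K" and C: "\<And>x. x \<in> C \<Longrightarrow> Poly_Mapping.keys x \<subseteq> K" and hom: "homeomorphism (open_cube d) C \<phi> \<psi>"
  shows "d \<le> 2 * card K"
proof (rule ccontr)
  assume d: "\<not> d \<le> 2 * card K"
  obtain h where h: "bij_betw h {..<card K} K" using K bij_betw_from_nat_into_finite by blast
  define U :: "(nat \<Rightarrow> real) set" where "U = {a \<in> topspace (Euclidean_space d). \<forall>i<d. 0 < a i \<and> a i < 1}"
  define P where "P a = (\<Sum>i<d. Poly_Mapping.single i (a i))" for a :: "nat \<Rightarrow> real"
  \<comment> \<open>Real and imaginary parts of the coefficients occupy the even and odd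
    coordinates; the remaining ones, up to d - 1, are 0.\<close>
  define G where "G a i = (if i < 2 * card K then (if even i then Re else Im) (Poly_Mapping.lookup (\<phi> (P a)) (h (i div 2))) else 0)"
    for a and i :: nat
  have Pl: "Poly_Mapping.lookup (P a) i = (if i < d then a i else 0)" for a i
    unfolding P_def by (subst lookup_sum_single) auto
  have PU: "P a \<in> open_cube d" if "a \<in> U" for a
    using that by (auto simp: open_cube_def coord_space_def U_def Pl in_keys_iff split: if_splits)
  have coord: "continuous_on S (\<lambda>a::nat \<Rightarrow> real. a i)" for S i
    by (rule continuous_on_subset[OF continuous_on_product_coordinates subset_UNIV])
  have Pc: "continuous_on U P"
    unfolding P_def by (intro continuous_on_sum bounded_linear.continuous_on[OF bounded_linear_single] coord)
  have "continuous_on (open_cube d) \<phi>" using hom by (simp add: homeomorphism_def)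
  then have \<phi>P: "continuous_on U (\<lambda>a. \<phi> (P a))"
    by (rule continuous_on_compose2[OF _ Pc]) (use PU in auto)
  have Gc: "continuous_on U G"
  proof (rule continuous_on_coordinatewise_then_product)
    fix i
    have l: "continuous_on U (\<lambda>a. Poly_Mapping.lookup (\<phi> (P a)) (h (i div 2)))"
      by (rule bounded_linear.continuous_on[OF bounded_linear_lookup \<phi>P])
    show "continuous_on U (\<lambda>a. G a i)"
      unfolding G_def by (cases "i < 2 * card K"; cases "even i") (auto intro!: continuous_intros l)
  qed
  have top_sub: "topspace (subtopology (Euclidean_space d) U) = U"
    by (auto simp: U_def)
  have cm: "continuous_map (subtopology (Euclidean_space d) U) (Euclidean_space d) G"
    unfolding cm_Euclidean_space_iff_continuous_on top_sub
    using Gc d by (auto simp: G_def topspace_Euclidean_space)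
  have coordE: "continuous_map (Euclidean_space d) euclideanreal (\<lambda>a. a i)" for i
    using coord unfolding Euclidean_space_def euclidean_product_topology by simp
  have Uopen: "openin (Euclidean_space d) U"
  proof -
    have "U = topspace (Euclidean_space d) \<inter> (\<Inter>i\<in>{..<d}. {a \<in> topspace (Euclidean_space d). a i \<in> {0<..<1}})"
      by (auto simp: U_def)
    moreover have "openin (Euclidean_space d) {a \<in> topspace (Euclidean_space d). a i \<in> {0<..<1}}" for i
      by (rule openin_continuous_map_preimage[OF coordE]) simp
    ultimately show ?thesis by (metis (no_types, lifting) finite_lessThan openin_INT openin_topspace inf_commute)
  qed
  have inj: "inj_on G U"
  proof (rule inj_onI)
    fix a b assume ab: "a \<in> U" "b \<in> U" "G a = G b"
    have img: "\<phi> (P a) \<in> C" "\<phi> (P b) \<in> C" using PU ab hom by (auto simp: homeomorphism_def)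
    have "Poly_Mapping.lookup (\<phi> (P a)) \<alpha> = Poly_Mapping.lookup (\<phi> (P b)) \<alpha>" for \<alpha>
    proof (cases "\<alpha> \<in> K")
      case True
      then obtain m where m: "m < card K" "\<alpha> = h m" using h by (auto simp: bij_betw_def)
      from fun_cong[OF ab(3), of "2 * m"] fun_cong[OF ab(3), of "2 * m + 1"] m show ?thesis
        by (simp add: G_def complex_eq_iff)
    next
      case False
      then show ?thesis using C[OF img(1)] C[OF img(2)] by (metis in_keys_iff subsetD)
    qed
    then have "\<phi> (P a) = \<phi> (P b)" by (rule poly_mapping_eqI)
    then have "P a = P b" using PU[OF ab(1)] PU[OF ab(2)] hom unfolding homeomorphism_def by metis
    then have "a i = b i" if "i < d" for i using Pl[of a i] Pl[of b i] that by simp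
    moreover have "a i = b i" if "\<not> i < d" for i using ab that by (simp add: U_def topspace_Euclidean_space)
    ultimately show "a = b" by (auto simp: fun_eq_iff)
  qed
  have Gopen: "openin (Euclidean_space d) (G ` U)"
    by (rule invariance_of_domain_Euclidean_space[OF Uopen cm inj])
  define a0 where "a0 i = (if i < d then 1/2 else 0 :: real)" for i
  have "a0 \<in> U" by (simp add: U_def a0_def topspace_Euclidean_space)
  define y where "y = G a0"
  have y: "y \<in> G ` U" using \<open>a0 \<in> U\<close> by (simp add: y_def)
  have yE: "y i = 0" if "i \<ge> 2 * card K" for i using that by (simp add: y_def G_def)
  \<comment> \<open>A line through a point of the image in the direction of the last coordinate;
    openness would keep a piece of it in the image.\<close>
  define L where "L s i = (if i = d - 1 then s else y i)" for s :: real and i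
  have Lc: "continuous_map euclideanreal (Euclidean_space d) L"
  proof -
    have "continuous_on UNIV L"
    proof (rule continuous_on_coordinatewise_then_product)
      show "continuous_on UNIV (\<lambda>s. L s i)" for i by (cases "i = d - 1") (auto simp: L_def intro!: continuous_intros)
    qed
    moreover have "L s i = 0" if "i \<ge> d" for s i using that d yE[of i] by (auto simp: L_def)
    ultimately show ?thesis
      unfolding Euclidean_space_def euclidean_product_topology
      by (auto simp: continuous_map_in_subtopology)
  qed
  have "openin euclideanreal {s \<in> topspace euclideanreal. L s \<in> G ` U}"
    by (rule openin_continuous_map_preimage[OF Lc Gopen])
  then have op: "open {s. L s \<in> G ` U}" by simp
  have "L 0 = y" using yE[of "d - 1"] d by (auto simp: L_def fun_eq_iff)
  then have "0 \<in> {s. L s \<in> G ` U}" using y by simp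
  then obtain r where r: "r > 0" "ball 0 r \<subseteq> {s. L s \<in> G ` U}" using op open_contains_ball by blast
  have "L (r/2) \<in> G ` U" using r by (auto simp: subset_iff dist_norm)
  then obtain a where "a \<in> U" "L (r/2) = G a" by auto
  from fun_cong[OF this(2), of "d - 1"] have "r / 2 = 0" using d by (simp add: L_def G_def split: if_splits)
  then show False using r by simp
qed

lemma semialgebraic_dim_le:
  fixes S :: "('a \<Rightarrow>\<^sub>0 complex) set"
  assumes K: "finite K" and V: "\<And>x. x \<in> V \<Longrightarrow> Poly_Mapping.keys x \<subseteq> K" and dim: "has_semialgebraic_dim V S m"
  shows "m \<le> 2 * card K"
proof -
  obtain \<C> :: "('a \<Rightarrow>\<^sub>0 complex) set set" and e where C: "finite \<C>" "\<C> \<noteq> {}" "\<forall>C\<in>\<C>. semialgebraic_cell V C (e C)" "m = Max (e ` \<C>)"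
    using dim unfolding has_semialgebraic_dim_def by blast
  have "m \<in> e ` \<C>" unfolding C(4) by (rule Max_in) (use C in auto)
  then obtain D where D: "D \<in> \<C>" "m = e D" by auto
  then have cell: "semialgebraic_cell V D m" using C by auto
  then have "D \<subseteq> V" unfolding semialgebraic_cell_def semialgebraic_in_def by auto
  obtain \<phi> \<psi> where "homeomorphism (open_cube m) D \<phi> \<psi>" using cell unfolding semialgebraic_cell_def by blast
  then show ?thesis using no_injection_open_cube[OF K] V \<open>D \<subseteq> V\<close> by blast
qed

text \<open>Complex polynomials in real parameters. They live on
  \<open>nat \<Rightarrow> real\<close> and become \<open>real_polynomial_function\<close> after
  composition with polynomial parameters, see \<open>poly_nat_compose\<close>.\<close>

inductive poly_nat :: "((nat \<Rightarrow> real) \<Rightarrow> complex) \<Rightarrow> bool" where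
  poly_nat_const: "poly_nat (\<lambda>_. c)"
| poly_nat_var: "poly_nat (\<lambda>t. of_real (t i))"
| poly_nat_add: "poly_nat f \<Longrightarrow> poly_nat g \<Longrightarrow> poly_nat (\<lambda>t. f t + g t)"
| poly_nat_mult: "poly_nat f \<Longrightarrow> poly_nat g \<Longrightarrow> poly_nat (\<lambda>t. f t * g t)"

lemma poly_nat_power: "poly_nat f \<Longrightarrow> poly_nat (\<lambda>t. f t ^ n)"
  by (induction n) (auto intro: poly_nat.intros)

lemma poly_nat_sum: "(\<And>a. a \<in> A \<Longrightarrow> poly_nat (f a)) \<Longrightarrow> poly_nat (\<lambda>t. \<Sum>a\<in>A. f a t)"
  by (induction A rule: infinite_finite_induct) (auto intro: poly_nat.intros)

lemma poly_nat_if: "(b \<Longrightarrow> poly_nat f) \<Longrightarrow> (\<not> b \<Longrightarrow> poly_nat g) \<Longrightarrow> poly_nat (\<lambda>t. if b then f t else g t)"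
  by (cases b) auto

lemma poly_nat_compose:
  assumes "poly_nat h" and \<tau>: "\<And>i. real_polynomial_function (\<lambda>x. \<tau> x i)"
  shows "real_polynomial_function (\<lambda>x. Re (h (\<tau> x))) \<and> real_polynomial_function (\<lambda>x. Im (h (\<tau> x)))"
  using assms(1) by induction (auto intro!: \<tau>)

lemma continuous_on_real_polynomial:
  "real_polynomial_function f \<Longrightarrow> continuous_on S f"
  by (induction rule: real_polynomial_function.induct)
    (auto intro: continuous_on_add continuous_on_mult linear_continuous_on)

lemma poly_nat_continuous:
  assumes "poly_nat h" and "\<And>i. continuous_on S (\<lambda>x. \<tau> x i)"
  shows "continuous_on S (\<lambda>x. h (\<tau> x))"
  using assms by induction (auto intro!: continuous_intros)

text \<open>Three parameters are dominated by a power of the first one, which plays the role of s;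
  all perturbing terms are then compared through powers of s alone. \<open>cusp_param\<close> maps
  the unit cube onto this region.\<close>

definition cusp_region :: "real \<Rightarrow> nat \<Rightarrow> (nat \<Rightarrow> real) set" where
  "cusp_region \<epsilon> N = {t. 0 < t 0 \<and> t 0 < \<epsilon> \<and> (\<forall>i\<in>{1,2,3}. 0 < t i \<and> t i < t 0 ^ N) \<and> (\<forall>i\<ge>4. t i = 0)}"

definition cusp_param :: "real \<Rightarrow> nat \<Rightarrow> (nat \<Rightarrow> real) \<Rightarrow> nat \<Rightarrow> real" where
  "cusp_param \<epsilon> N u i = (if i = 0 then \<epsilon> * u 0 else if i < 4 then (\<epsilon> * u 0) ^ N * u i else 0)"

lemma semialgebraic_inI:
  assumes "finite P" "finite Q" "\<And>p. p \<in> P \<union> Q \<Longrightarrow> real_polynomial_function p"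
    "S = {x\<in>V. (\<forall>p\<in>P. p x = 0) \<and> (\<forall>q\<in>Q. q x > 0)}"
  shows "semialgebraic_in V S"
  unfolding semialgebraic_in_def using assms by (intro exI[of _ "{(P, Q)}"]) auto

text \<open>The parameters can be recovered from the jet by the polynomial map \<open>lc\<close>.
  Hence the image is cut out by polynomial equations and inequalities without elimination of
  quantifiers, and \<open>lc\<close> also provides the continuous inverse.\<close>

lemma poly_graph_cell:
  fixes coef :: "'a \<Rightarrow> (nat \<Rightarrow> real) \<Rightarrow> complex" and lc :: "('a \<Rightarrow>\<^sub>0 complex) \<Rightarrow> nat \<Rightarrow> real"
  assumes K: "finite K" and V: "V = {x. Poly_Mapping.keys x \<subseteq> K}"
    and coef: "\<And>\<alpha>. \<alpha> \<in> K \<Longrightarrow> poly_nat (coef \<alpha>)"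
    and lc: "\<And>i. real_polynomial_function (\<lambda>x. lc x i)" and lc4: "\<And>x i. i \<ge> 4 \<Longrightarrow> lc x i = 0"
    and Q_def: "\<And>t. Q t = (\<Sum>\<alpha>\<in>K. Poly_Mapping.single \<alpha> (coef \<alpha> t))"
    and lcQ: "\<And>t. t \<in> cusp_region \<epsilon> N \<Longrightarrow> lc (Q t) = t" and \<epsilon>: "\<epsilon> > 0"
  shows "semialgebraic_cell V (Q ` cusp_region \<epsilon> N) 4"
proof -
  let ?\<Omega> = "cusp_region \<epsilon> N" and ?\<theta> = "cusp_param \<epsilon> N"
  have QV: "Q t \<in> V" for t unfolding Q_def V using keys_sum_single[OF K] by simp
  have Ql: "\<alpha> \<in> K \<Longrightarrow> Poly_Mapping.lookup (Q t) \<alpha> = coef \<alpha> t" for \<alpha> t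
    unfolding Q_def by (simp add: lookup_sum_single[OF K])
  have xQ: "x = Q t" if "x \<in> V" "\<And>\<alpha>. \<alpha> \<in> K \<Longrightarrow> Poly_Mapping.lookup x \<alpha> = coef \<alpha> t" for x t
  proof (rule poly_mapping_eqI)
    fix \<alpha>
    show "Poly_Mapping.lookup x \<alpha> = Poly_Mapping.lookup (Q t) \<alpha>"
    proof (cases "\<alpha> \<in> K")
      case False
      then show ?thesis using that(1) QV[of t] unfolding V by (metis (no_types, lifting) in_keys_iff mem_Collect_eq subsetD)
    qed (use that Ql in simp)
  qed
  have lkR: "real_polynomial_function (\<lambda>x :: 'a \<Rightarrow>\<^sub>0 complex. Re (Poly_Mapping.lookup x \<alpha>))"
    and lkI: "real_polynomial_function (\<lambda>x :: 'a \<Rightarrow>\<^sub>0 complex. Im (Poly_Mapping.lookup x \<alpha>))" for \<alpha>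
    by (intro real_polynomial_function.intros(1) bounded_linear_compose[OF bounded_linear_Re bounded_linear_lookup]
        bounded_linear_compose[OF bounded_linear_Im bounded_linear_lookup])+
  have pw: "real_polynomial_function (\<lambda>x. f x ^ n)" if "real_polynomial_function f" for f :: "'v::real_normed_vector \<Rightarrow> real" and n
    using that by (induction n) auto
  have sa: "semialgebraic_in V (Q ` ?\<Omega>)"
  proof (rule semialgebraic_inI)
    \<comment> \<open>The equations say that x is the member of the family at the parameters
      \<open>lc x\<close>; the inequalities say that these parameters lie in the region.\<close>
    let ?P = "(\<lambda>\<alpha> x. Re (Poly_Mapping.lookup x \<alpha>) - Re (coef \<alpha> (lc x))) ` K \<union> (\<lambda>\<alpha> x. Im (Poly_Mapping.lookup x \<alpha>) - Im (coef \<alpha> (lc x))) ` K"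
    let ?Q = "{\<lambda>x. lc x 0, \<lambda>x. \<epsilon> - lc x 0} \<union> (\<lambda>i x. lc x i) ` {1,2,3} \<union> (\<lambda>i x. lc x 0 ^ N - lc x i) ` {1,2,3}"
    show "finite ?P" "finite ?Q" using K by auto
    show "real_polynomial_function p" if "p \<in> ?P \<union> ?Q" for p
      using that poly_nat_compose[OF coef lc] by (auto intro!: lkR lkI lc pw)
    show "Q ` ?\<Omega> = {x \<in> V. (\<forall>p\<in>?P. p x = 0) \<and> (\<forall>q\<in>?Q. q x > 0)}"
    proof (intro equalityI subsetI)
      fix x assume "x \<in> Q ` ?\<Omega>"
      then obtain t where t: "t \<in> ?\<Omega>" "x = Q t" by auto
      then show "x \<in> {x \<in> V. (\<forall>p\<in>?P. p x = 0) \<and> (\<forall>q\<in>?Q. q x > 0)}"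
        using QV[of t] by (auto simp: lcQ Ql cusp_region_def)
    next
      fix x assume x: "x \<in> {x \<in> V. (\<forall>p\<in>?P. p x = 0) \<and> (\<forall>q\<in>?Q. q x > 0)}"
      then have "\<forall>p\<in>?P. p x = 0" unfolding mem_Collect_eq by (elim conjE)
      then have xP: "p x = 0" if "p \<in> ?P" for p using that by (rule bspec)
      have "Poly_Mapping.lookup x \<alpha> = coef \<alpha> (lc x)" if "\<alpha> \<in> K" for \<alpha>
        using xP[OF UnI1[OF imageI[OF that]]] xP[OF UnI2[OF imageI[OF that]]] by (simp add: complex_eq_iff)
      then have xe: "x = Q (lc x)" using x by (intro xQ) auto
      have "lc x \<in> ?\<Omega>" using x lc4 by (simp add: cusp_region_def)
      then show "x \<in> Q ` ?\<Omega>" using xe by blast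
    qed
  qed
  define \<phi> where "\<phi> u = Q (?\<theta> (Poly_Mapping.lookup u))" for u
  \<comment> \<open>Undoes the rescaling of \<open>cusp_param\<close>.\<close>
  define g where "g x i = (if i = 0 then lc x 0 / \<epsilon> else lc x i / lc x 0 ^ N)" for x and i :: nat
  define \<psi> where "\<psi> x = (\<Sum>i<4. Poly_Mapping.single i (g x i))" for x
  have n4: "i < 4 \<longleftrightarrow> i = 0 \<or> i = 1 \<or> i = 2 \<or> i = 3" for i :: nat by auto
  have \<theta>\<Omega>: "?\<theta> (Poly_Mapping.lookup u) \<in> ?\<Omega>" if u: "u \<in> open_cube 4" for u
  proof -
    have b: "0 < Poly_Mapping.lookup u i" "Poly_Mapping.lookup u i < 1" if "i < 4" for i
      using u that by (auto simp: open_cube_def)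
    have e: "0 < \<epsilon> * Poly_Mapping.lookup u 0" using b(1)[of 0] \<epsilon> by simp
    have e1: "\<epsilon> * Poly_Mapping.lookup u 0 < \<epsilon>" using b(2)[of 0] \<epsilon> by simp
    have "(\<epsilon> * Poly_Mapping.lookup u 0) ^ N * Poly_Mapping.lookup u i < (\<epsilon> * Poly_Mapping.lookup u 0) ^ N" if "i < 4" for i
      using b(2)[OF that] zero_less_power[OF e, of N] by simp
    then show ?thesis using e e1 b by (simp add: cusp_region_def cusp_param_def)
  qed
  have lkc: "Poly_Mapping.lookup u i = 0" if "u \<in> open_cube 4" "\<not> i < 4" for u and i :: nat
    using that by (auto simp: open_cube_def coord_space_def in_keys_iff)
  have g\<theta>: "g (\<phi> u) i = Poly_Mapping.lookup u i" if u: "u \<in> open_cube 4" and i: "i < 4" for u i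
  proof -
    have "0 < Poly_Mapping.lookup u 0" using u by (auto simp: open_cube_def)
    then show ?thesis using \<epsilon> i by (simp add: g_def \<phi>_def lcQ[OF \<theta>\<Omega>[OF u]] cusp_param_def)
  qed
  have \<psi>l: "Poly_Mapping.lookup (\<psi> x) i = (if i < 4 then g x i else 0)" for x i
    unfolding \<psi>_def by (subst lookup_sum_single) auto
  have \<psi>\<phi>: "\<psi> (\<phi> u) = u" if "u \<in> open_cube 4" for u
    by (rule poly_mapping_eqI) (use g\<theta>[OF that] lkc[OF that] in \<open>auto simp: \<psi>l\<close>)
  have \<theta>g: "?\<theta> (Poly_Mapping.lookup (\<psi> (Q t))) = t" and \<psi>cube: "\<psi> (Q t) \<in> open_cube 4" if t: "t \<in> ?\<Omega>" for t
  proof -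
    have t0: "0 < t 0" "t 0 < \<epsilon>" using t by (auto simp: cusp_region_def)
    have ti: "0 < t i" "t i < t 0 ^ N" if "i < 4" "i \<noteq> 0" for i
      using t that unfolding n4 by (auto simp: cusp_region_def)
    show "?\<theta> (Poly_Mapping.lookup (\<psi> (Q t))) = t"
    proof
      fix i
      consider "i = 0" | "0 < i" "i < (4::nat)" | "i \<ge> 4" by linarith
      then show "?\<theta> (Poly_Mapping.lookup (\<psi> (Q t))) i = t i"
        by cases (use t t0 \<epsilon> in \<open>auto simp: cusp_param_def \<psi>l g_def lcQ[OF t] cusp_region_def\<close>)
    qed
    have "0 < g (Q t) i \<and> g (Q t) i < 1" if "i < 4" for i
      using t0 ti[OF that] \<epsilon> zero_less_power[OF t0(1), of N] by (auto simp: g_def lcQ[OF t])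
    then show "\<psi> (Q t) \<in> open_cube 4"
      by (auto simp: open_cube_def coord_space_def \<psi>l in_keys_iff split: if_splits)
  qed
  have \<theta>c: "continuous_on S (\<lambda>u. ?\<theta> (Poly_Mapping.lookup u) i)" for S :: "(nat \<Rightarrow>\<^sub>0 real) set" and i
    unfolding cusp_param_def
    by (cases "i = 0"; cases "i < 4") (auto intro!: continuous_intros bounded_linear.continuous_on[OF bounded_linear_lookup])
  have \<phi>c: "continuous_on (open_cube 4) \<phi>"
    unfolding \<phi>_def[abs_def] Q_def
    by (intro continuous_on_sum bounded_linear.continuous_on[OF bounded_linear_single] poly_nat_continuous[OF coef] \<theta>c)
  have \<psi>c: "continuous_on (Q ` ?\<Omega>) \<psi>"
    unfolding \<psi>_def[abs_def]
  proof (intro continuous_on_sum bounded_linear.continuous_on[OF bounded_linear_single])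
    fix i
    have nz: "\<forall>x\<in>Q ` ?\<Omega>. lc x 0 ^ N \<noteq> 0" by (auto simp: lcQ cusp_region_def)
    show "continuous_on (Q ` ?\<Omega>) (\<lambda>x. g x i)"
      unfolding g_def
      by (cases "i = 0") (use \<epsilon> nz in \<open>auto intro!: continuous_intros continuous_on_real_polynomial[OF lc]\<close>)
  qed
  have hom: "homeomorphism (open_cube 4) (Q ` ?\<Omega>) \<phi> \<psi>"
    unfolding homeomorphism_def
  proof (intro conjI ballI)
    show "\<phi> ` open_cube 4 = Q ` ?\<Omega>"
    proof (intro equalityI subsetI)
      fix x assume "x \<in> Q ` ?\<Omega>"
      then obtain t where t: "t \<in> ?\<Omega>" "x = Q t" by auto
      then have "x = \<phi> (\<psi> (Q t))" using \<theta>g[OF t(1)] by (simp add: \<phi>_def)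
      then show "x \<in> \<phi> ` open_cube 4" using \<psi>cube[OF t(1)] by blast
    qed (use \<theta>\<Omega> in \<open>auto simp: \<phi>_def\<close>)
    show "\<psi> ` Q ` ?\<Omega> = open_cube 4"
    proof (intro equalityI subsetI)
      fix u :: "nat \<Rightarrow>\<^sub>0 real" assume u: "u \<in> open_cube 4"
      have "u = \<psi> (Q (?\<theta> (Poly_Mapping.lookup u)))" using \<psi>\<phi>[OF u] by (simp add: \<phi>_def)
      then show "u \<in> \<psi> ` Q ` ?\<Omega>" using \<theta>\<Omega>[OF u] by blast
    qed (use \<psi>cube in auto)
    show "\<phi> (\<psi> x) = x" if "x \<in> Q ` ?\<Omega>" for x
      using that \<theta>g by (auto simp: \<phi>_def)
  qed (use \<phi>c \<psi>c \<psi>\<phi> in auto)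
  have graph: "semialgebraic_in (coord_space 4 \<times> V) ((\<lambda>u. (u, \<phi> u)) ` open_cube 4)"
  proof (rule semialgebraic_inI)
    let ?t = "\<lambda>z :: (nat \<Rightarrow>\<^sub>0 real) \<times> ('a \<Rightarrow>\<^sub>0 complex). ?\<theta> (Poly_Mapping.lookup (fst z))"
    let ?P = "(\<lambda>\<alpha> z. Re (Poly_Mapping.lookup (snd z) \<alpha>) - Re (coef \<alpha> (?t z))) ` K \<union> (\<lambda>\<alpha> z. Im (Poly_Mapping.lookup (snd z) \<alpha>) - Im (coef \<alpha> (?t z))) ` K"
    let ?Q = "(\<lambda>i z. Poly_Mapping.lookup (fst z) i) ` {..<4::nat} \<union> (\<lambda>i z. 1 - Poly_Mapping.lookup (fst z) i) ` {..<4::nat}"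
    show "finite ?P" "finite ?Q" using K by auto
    have l1: "real_polynomial_function (\<lambda>z :: (nat \<Rightarrow>\<^sub>0 real) \<times> ('a \<Rightarrow>\<^sub>0 complex). Poly_Mapping.lookup (fst z) i)" for i
      by (intro real_polynomial_function.intros(1) bounded_linear_compose[OF bounded_linear_lookup bounded_linear_fst])
    have l2: "real_polynomial_function (\<lambda>z :: (nat \<Rightarrow>\<^sub>0 real) \<times> ('a \<Rightarrow>\<^sub>0 complex). Re (Poly_Mapping.lookup (snd z) \<alpha>))"
        "real_polynomial_function (\<lambda>z :: (nat \<Rightarrow>\<^sub>0 real) \<times> ('a \<Rightarrow>\<^sub>0 complex). Im (Poly_Mapping.lookup (snd z) \<alpha>))" for \<alpha>
      by (intro real_polynomial_function.intros(1)
          bounded_linear_compose[OF bounded_linear_Re bounded_linear_compose[OF bounded_linear_lookup bounded_linear_snd]]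
          bounded_linear_compose[OF bounded_linear_Im bounded_linear_compose[OF bounded_linear_lookup bounded_linear_snd]])+
    have l3: "real_polynomial_function (\<lambda>z. ?t z i)" for i
      unfolding cusp_param_def
      by (cases "i = 0"; cases "i < 4") (simp_all, (intro real_polynomial_function.intros(2,4) l1 pw)+)
    show "real_polynomial_function p" if "p \<in> ?P \<union> ?Q" for p
      using that poly_nat_compose[OF coef l3] by (auto intro!: l1 l2)
    show "(\<lambda>u. (u, \<phi> u)) ` open_cube 4 = {z \<in> coord_space 4 \<times> V. (\<forall>p\<in>?P. p z = 0) \<and> (\<forall>q\<in>?Q. q z > 0)}"
    proof (intro equalityI subsetI)
      fix z assume "z \<in> (\<lambda>u. (u, \<phi> u)) ` open_cube 4"
      then show "z \<in> {z \<in> coord_space 4 \<times> V. (\<forall>p\<in>?P. p z = 0) \<and> (\<forall>q\<in>?Q. q z > 0)}"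
        using QV by (auto simp: \<phi>_def Ql open_cube_def)
    next
      fix z assume z: "z \<in> {z \<in> coord_space 4 \<times> V. (\<forall>p\<in>?P. p z = 0) \<and> (\<forall>q\<in>?Q. q z > 0)}"
      obtain u x where ux: "z = (u, x)" by (cases z)
      note zz = z[unfolded mem_Collect_eq]
      note zV = zz[THEN conjunct1] and zP = bspec[OF zz[THEN conjunct2, THEN conjunct1]] and zQ = bspec[OF zz[THEN conjunct2, THEN conjunct2]]
      have "0 < Poly_Mapping.lookup u m \<and> Poly_Mapping.lookup u m < 1" if "m < 4" for m
        using zQ[OF UnI1[OF imageI], of m] zQ[OF UnI2[OF imageI], of m] that by (simp add: ux)
      then have u: "u \<in> open_cube 4" using zV ux by (auto simp: open_cube_def)
      have "Poly_Mapping.lookup x \<alpha> = coef \<alpha> (?\<theta> (Poly_Mapping.lookup u))" if "\<alpha> \<in> K" for \<alpha>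
        using zP[OF UnI1[OF imageI[OF that]]] zP[OF UnI2[OF imageI[OF that]]] by (simp add: ux complex_eq_iff)
      then have "x = \<phi> u" unfolding \<phi>_def using zV ux by (intro xQ) auto
      then show "z \<in> (\<lambda>u. (u, \<phi> u)) ` open_cube 4" using u ux by blast
    qed
  qed
  show ?thesis unfolding semialgebraic_cell_def using sa hom graph by blast
qed

lemma cusp_region_limit:
  assumes Q: "\<And>\<alpha>. \<alpha> \<in> K \<Longrightarrow> poly_nat (coef \<alpha>)" and \<epsilon>: "\<epsilon> > 0"
  shows "(\<Sum>\<alpha>\<in>K. Poly_Mapping.single \<alpha> (coef \<alpha> (\<lambda>_. 0))) \<in>
    closure ((\<lambda>t. \<Sum>\<alpha>\<in>K. Poly_Mapping.single \<alpha> (coef \<alpha> t)) ` cusp_region \<epsilon> (Suc N))"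
proof -
  \<comment> \<open>An arc inside the region that ends at the zero parameter; the exponent
    \<open>Suc N\<close> is positive so that the last three parameters vanish at the end
    point.\<close>
  define \<tau> where "\<tau> n i = (if i = 0 then \<epsilon> * n else if i < 4 then (\<epsilon> * n) ^ Suc N / 2 else 0)" for n :: real and i :: nat
  have c: "continuous_on UNIV (\<lambda>n. \<tau> n i)" for i
    unfolding \<tau>_def by (cases "i = 0"; cases "i < 4") (auto intro!: continuous_intros)
  let ?Q = "\<lambda>t. \<Sum>\<alpha>\<in>K. Poly_Mapping.single \<alpha> (coef \<alpha> t)"
  have "continuous_on UNIV (\<lambda>n. ?Q (\<tau> n))"
    by (intro continuous_on_sum bounded_linear.continuous_on[OF bounded_linear_single] poly_nat_continuous[OF Q] c)
  then have "isCont (\<lambda>n. ?Q (\<tau> n)) 0" by (simp add: continuous_on_eq_continuous_at)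
  moreover have "(\<lambda>n. 1 / (real n + 2)) \<longlonglongrightarrow> 0" by real_asymp
  ultimately have "(\<lambda>n. ?Q (\<tau> (1 / (real n + 2)))) \<longlonglongrightarrow> ?Q (\<tau> 0)"
    by (rule isCont_tendsto_compose)
  moreover have "\<tau> 0 = (\<lambda>_. 0)" by (auto simp: \<tau>_def fun_eq_iff)
  moreover have "\<tau> (1 / (real n + 2)) \<in> cusp_region \<epsilon> (Suc N)" for n
  proof -
    have e: "0 < \<epsilon> * (1 / (real n + 2))" "\<epsilon> * (1 / (real n + 2)) < \<epsilon>" using \<epsilon> by (simp_all add: field_simps add_pos_nonneg)
    from zero_less_power[OF e(1), of "Suc N"] have "0 < (\<epsilon> * (1 / (real n + 2))) ^ Suc N" .
    then show ?thesis using e unfolding cusp_region_def \<tau>_def by (simp del: power_Suc)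
  qed
  ultimately show ?thesis unfolding closure_sequential
    by (intro exI[of _ "\<lambda>n. ?Q (\<tau> (1 / (real n + 2)))"] conjI allI imageI) simp_all
qed

section \<open>The Milnor number\<close>

text \<open>The exponents of the ten monomials of degree at most 3 in two variables.\<close>

definition cubic_expos :: "(nat \<times> nat) list" where
  "cubic_expos = [(0,0),(1,0),(0,1),(2,0),(1,1),(0,2),(3,0),(2,1),(1,2),(0,3)]"

text \<open>On the plane of the coordinates i and j the squares have zero derivative and g has order
  7, so members of the Jacobian ideal have order 6 there. The monomials of degree at most 3 are
  therefore independent modulo it, and ten of them give k >= 11.\<close>

lemma milnor_number_ge:
  fixes f g :: "complex ^ 'n::finite \<Rightarrow> complex"
  assumes ij: "i \<noteq> j" and K: "K \<subseteq> -{i,j}" and g: "analytic_germ g" "ordge 7 g"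
    and \<phi>: "biholomorphism_germ \<phi>" and f: "\<forall>\<^sub>F x in nhds 0. f x = g (\<phi> x) + (\<Sum>k\<in>K. (\<phi> x $ k)\<^sup>2)"
  shows "enat 10 \<le> milnor_number f"
proof -
  define G where "G p = g p + (\<Sum>k\<in>K. (p $ k)\<^sup>2)" for p :: "complex ^ 'n"
  obtain \<psi> where \<phi>an: "\<And>k. analytic_germ (\<lambda>x. \<phi> x $ k)" "\<phi> 0 = 0"
    and \<psi>: "\<psi> 0 = 0" "\<And>k. analytic_germ (\<lambda>x. \<psi> x $ k)" "\<forall>\<^sub>F x in nhds 0. \<psi> (\<phi> x) = x \<and> \<phi> (\<psi> x) = x"
    using \<phi> by (auto simp: biholomorphism_germ_def)
  have Gan: "analytic_germ G" unfolding G_def[abs_def] by (intro analytic_intros g)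
  have fG: "\<forall>\<^sub>F x in nhds 0. f x = G (\<phi> x)" using f by (simp add: G_def)
  have fan: "analytic_germ f" using analytic_germ_cong[OF fG] analytic_germ_compose[OF Gan \<phi>an] by simp
  define \<alpha> where "\<alpha> n = (case cubic_expos ! n of (a, b) \<Rightarrow> expo i j a b)" for n
  have \<alpha>inj: "m = n" if "\<alpha> m = \<alpha> n" "m < 10" "n < 10" for m n
  proof -
    obtain a b a' b' where ab: "cubic_expos ! m = (a, b)" "cubic_expos ! n = (a', b')" by force
    then have "expo i j a b = expo i j a' b'" using that by (simp add: \<alpha>_def)
    from fun_cong[OF this, of i] fun_cong[OF this, of j] ij have "(a, b) = (a', b')" by (simp add: expo_def)
    then have "cubic_expos ! m = cubic_expos ! n" using ab by simp
    moreover have "distinct cubic_expos" "length cubic_expos = 10" by (simp_all add: cubic_expos_def)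
    ultimately show ?thesis using that by (simp add: nth_eq_iff_index_eq)
  qed
  have \<alpha>deg: "mdeg (\<alpha> n) \<le> 3" if "n < 10" for n
  proof -
    have "\<forall>(a,b)\<in>set cubic_expos. a + b \<le> 3" by (simp add: cubic_expos_def)
    moreover have "cubic_expos ! n \<in> set cubic_expos" by (rule nth_mem) (use that in \<open>simp add: cubic_expos_def\<close>)
    ultimately show ?thesis by (auto simp: \<alpha>_def mdeg_expo[OF ij] split: prod.splits)
  qed
  define e where "e n x = mon (\<alpha> n) (\<phi> x)" for n x
  have ean: "analytic_germ (e n)" for n
    unfolding e_def[abs_def] by (rule analytic_germ_compose[OF analytic_germ_mon \<phi>an])
  have ind: "\<forall>n<10. c n = 0" if ideal: "(\<lambda>x. \<Sum>n<10. c n * e n x) \<in> jacobian_ideal f" for c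
  proof -
    define P where "P p = (\<Sum>n<10. c n * mon (\<alpha> n) p)" for p :: "complex ^ 'n"
    obtain u where u: "\<And>k. analytic_germ (u k)" and eq: "\<forall>\<^sub>F x in nhds 0. (\<Sum>n<10. c n * e n x) = (\<Sum>k\<in>UNIV. u k x * partial_deriv k f x)"
      using ideal unfolding jacobian_ideal_def by auto
    have "lip_germ \<phi>" by (rule lip_germ_if_analytic[OF \<phi>an])
    then obtain L r where L: "r > 0" "L-lipschitz_on (ball 0 r) \<phi>" unfolding lip_germ_def by blast
    have L0: "L \<ge> 0" using L(2) by (rule lipschitz_on_nonneg)
    have "\<forall>k. \<exists>B. \<forall>\<^sub>F x in nhds 0. norm (u k x) \<le> B"
      using analytic_ordge_0[OF u] by (simp add: ordge_def)
    then obtain B where B: "\<And>k. \<forall>\<^sub>F x in nhds 0. norm (u k x) \<le> B k" by metis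
    have Ball: "\<forall>\<^sub>F x in nhds 0. \<forall>k. norm (u k x) \<le> B k" by (rule eventually_all_finite[OF B])
    have near: "\<forall>\<^sub>F x in nhds 0. x \<in> ball (0 :: complex ^ 'n) r" using L(1) by (intro eventually_nhds_in_open) auto
    have fG': "\<forall>\<^sub>F x in nhds 0. \<forall>\<^sub>F y in nhds x. f y = G (\<phi> y)" using fG by (simp add: eventually_eventually)
    have "\<forall>\<^sub>F x in nhds 0. norm (P (\<phi> x)) \<le> (\<Sum>k\<in>UNIV. B k) * ((\<Sum>k\<in>UNIV. norm (partial_deriv k G (\<phi> x))) * L)"
      using eq Ball near fG' analytic_germ_holoD[OF fan] eventually_compose_germ[OF tendsto_map_germ[OF \<phi>an] analytic_germ_holoD[OF Gan]]
    proof eventually_elim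
      case (elim x)
      have lipx: "\<forall>\<^sub>F y in nhds x. norm (\<phi> y - \<phi> x) \<le> L * norm (y - x)"
        using eventually_nhds_in_open[OF open_ball elim(3)]
        by eventually_elim (use lipschitz_onD[OF L(2)] elim(3) in \<open>simp add: dist_norm\<close>)
      have d: "norm (partial_deriv k f x) \<le> (\<Sum>k\<in>UNIV. norm (partial_deriv k G (\<phi> x))) * L" for k
        by (rule partial_deriv_transfer[OF elim(6) elim(5) refl L0 lipx elim(4)])
      have "norm (P (\<phi> x)) = norm (\<Sum>k\<in>UNIV. u k x * partial_deriv k f x)" using elim(1) by (simp add: P_def e_def)
      also have "\<dots> \<le> (\<Sum>k\<in>UNIV. B k * ((\<Sum>k\<in>UNIV. norm (partial_deriv k G (\<phi> x))) * L))"
        by (rule sum_norm_le) (use elim(2) d order_trans[OF norm_ge_zero] in \<open>auto simp: norm_mult intro!: mult_mono\<close>)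
      finally show ?case by (simp add: sum_distrib_right)
    qed
    from eventually_compose_germ[OF tendsto_map_germ[OF \<psi>(2,1)] this]
    have PG: "\<forall>\<^sub>F p in nhds 0. norm (P p) \<le> (\<Sum>k\<in>UNIV. B k) * ((\<Sum>k\<in>UNIV. norm (partial_deriv k G p)) * L)"
      using \<psi>(3) by eventually_elim simp
    have "\<forall>k. \<exists>C. \<forall>\<^sub>F p in at 0. norm (partial_deriv k g p) \<le> C * norm p ^ 6"
      using partial_deriv_ordge[OF g(1), of 6] g(2) by simp
    then obtain C where C: "\<And>k. \<forall>\<^sub>F p in at 0. norm (partial_deriv k g p) \<le> C k * norm p ^ 6" by metis
    have Call: "\<forall>\<^sub>F p in at 0. \<forall>k. norm (partial_deriv k g p) \<le> C k * norm p ^ 6" by (rule eventually_all_finite[OF C])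
    define Q where "Q = (\<Sum>k\<in>UNIV. B k) * ((\<Sum>k\<in>UNIV. C k) * L)"
    have nz: "eventually h (nhds 0) \<Longrightarrow> eventually h (at 0)" for h :: "complex ^ 'n \<Rightarrow> bool"
      by (simp add: eventually_at_filter eventually_mono)
    have B0: "0 \<le> (\<Sum>k\<in>UNIV. B k)"
      using eventually_nhds_x_imp_x[OF Ball] order_trans[OF norm_ge_zero] by (intro sum_nonneg) blast
    \<comment> \<open>The coordinate change is removed by the Lipschitz comparison of derivatives,
      which leaves an estimate by the derivatives of G; on the plane they are those of g.\<close>
    have bd: "\<forall>\<^sub>F p in at 0. (\<forall>k\<in>-{i,j}. p $ k = 0) \<longrightarrow> norm (P p) \<le> Q * norm p ^ 6"
      using nz[OF PG] Call nz[OF analytic_germ_holoD[OF g(1)]]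
    proof eventually_elim
      case (elim p)
      show ?case
      proof
        assume p: "\<forall>k\<in>-{i,j}. p $ k = 0"
        have dG: "partial_deriv m G p = partial_deriv m g p" for m
        proof -
          have "G (p + axis m s) = g (p + axis m s) + (if m \<in> K then s\<^sup>2 else 0)" for s
          proof -
            have "(\<Sum>k\<in>K. ((p + axis m s) $ k)\<^sup>2) = (\<Sum>k\<in>K. if k = m then s\<^sup>2 else 0)"
            proof (intro sum.cong refl)
              fix k assume "k \<in> K"
              then have "p $ k = 0" using p K by blast
              then show "((p + axis m s) $ k)\<^sup>2 = (if k = m then s\<^sup>2 else 0)" by (simp add: axis_def)
            qed
            then show ?thesis by (simp add: G_def)
          qed
          moreover obtain D where D: "(g has_derivative D) (at p)" "complex_linear D" using elim(3) by (auto simp: holo_at_def)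
          have "((\<lambda>s. g (p + axis m s) + (if m \<in> K then s\<^sup>2 else 0)) has_field_derivative partial_deriv m g p + 0) (at 0)"
            unfolding has_derivative_imp_partial_deriv(2)[OF D]
            by (intro DERIV_add has_derivative_imp_partial_deriv(1)[OF D])
              (cases "m \<in> K", auto intro!: derivative_eq_intros)
          ultimately show ?thesis unfolding partial_deriv_def[of m G p] by (auto intro: DERIV_imp_deriv)
        qed
        have "(\<Sum>k\<in>UNIV. norm (partial_deriv k G p)) \<le> (\<Sum>k\<in>UNIV. C k * norm p ^ 6)"
          unfolding dG by (rule sum_mono) (use elim(2) in auto)
        then have "(\<Sum>k\<in>UNIV. B k) * ((\<Sum>k\<in>UNIV. norm (partial_deriv k G p)) * L) \<le>
            (\<Sum>k\<in>UNIV. B k) * ((\<Sum>k\<in>UNIV. C k * norm p ^ 6) * L)"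
          using B0 L0 by (intro mult_left_mono mult_right_mono)
        then show "norm (P p) \<le> Q * norm p ^ 6" using elim(1) by (simp add: Q_def sum_distrib_right[symmetric] mult_ac)
      qed
    qed
    have Pan: "analytic_germ P" unfolding P_def[abs_def] by (intro analytic_intros)
    have axc: "filterlim (\<lambda>s::complex. axis i s :: complex ^ 'n) (at 0) (at 0)"
    proof (rule filterlim_atI)
      show "((\<lambda>s. axis i s :: complex ^ 'n) \<longlongrightarrow> 0) (at (0::complex))"
        using linear_continuous_at[OF bounded_linear_axis, of "0::complex" i] by (simp add: isCont_def)
      show "\<forall>\<^sub>F s in at (0::complex). axis i s \<noteq> (0 :: complex ^ 'n)" by (simp add: eventually_at_filter)
    qed
    \<comment> \<open>The estimate holds off 0 only; the value at 0 is its limit along an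
      axis.\<close>
    have P0: "P 0 = 0"
    proof -
      have "\<forall>\<^sub>F s in at (0::complex). norm (P (axis i s)) \<le> Q * norm s ^ 6"
        using eventually_compose_filterlim[OF bd axc]
      proof eventually_elim
        case (elim s)
        have "\<forall>k\<in>-{i,j}. (axis i s :: complex ^ 'n) $ k = 0" by (auto simp: axis_def)
        with elim have "norm (P (axis i s)) \<le> Q * norm (axis i s :: complex ^ 'n) ^ 6" by (rule mp)
        then show ?case unfolding norm_axis .
      qed
      moreover have "((\<lambda>s::complex. Q * norm s ^ 6) \<longlongrightarrow> 0) (at 0)" by (auto intro!: tendsto_eq_intros)
      ultimately have "((\<lambda>s. P (axis i s)) \<longlongrightarrow> 0) (at (0::complex))" by (rule Lim_null_comparison)
      moreover have "((\<lambda>s. P (axis i s)) \<longlongrightarrow> P 0) (at (0::complex))"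
        by (rule filterlim_compose[OF analytic_germ_tendsto[OF Pan]])
          (use axc in \<open>simp add: filterlim_at\<close>)
      ultimately show ?thesis by (rule LIM_unique[symmetric])
    qed
    have bd0: "\<forall>\<^sub>F p in nhds 0. (\<forall>k\<in>-{i,j}. p $ k = 0) \<longrightarrow> norm (P p) \<le> Q * norm p ^ 6"
      using bd unfolding eventually_at_filter by eventually_elim (use P0 in auto)
    \<comment> \<open>P depends on two coordinates only, so the projection to their plane carries
      the estimate to a full neighbourhood.\<close>
    define \<pi> where "\<pi> p = (\<chi> k. if k \<in> {i,j} then p $ k else 0)" for p :: "complex ^ 'n"
    have \<pi>an: "analytic_germ (\<lambda>p. \<pi> p $ k)" for k by (cases "k \<in> {i,j}") (auto simp: \<pi>_def)
    have \<pi>0: "\<pi> 0 = 0" by (simp add: \<pi>_def vec_eq_iff)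
    have P\<pi>: "P (\<pi> p) = P p" for p
      unfolding P_def \<alpha>_def by (intro sum.cong refl) (auto simp: mon_expo[OF ij] \<pi>_def split: prod.splits)
    have n\<pi>: "norm (\<pi> p) \<le> norm p" for p
      by (rule norm_le_componentwise_cart) (simp add: \<pi>_def)
    have "\<forall>\<^sub>F p in nhds 0. norm (P p) \<le> \<bar>Q\<bar> * norm p ^ 6"
      using eventually_compose_germ[OF tendsto_map_germ[OF \<pi>an \<pi>0] bd0]
    proof eventually_elim
      case (elim p)
      have "norm (P p) \<le> Q * norm (\<pi> p) ^ 6" using elim by (simp add: P\<pi>) (simp add: \<pi>_def)
      also have "\<dots> \<le> \<bar>Q\<bar> * norm p ^ 6" by (intro mult_mono power_mono n\<pi>) auto
      finally show ?case .
    qed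
    then have "ordge 6 P" unfolding ordge_def by blast
    moreover have "has_power_series P (\<lambda>\<beta>. \<Sum>n<10. if \<beta> = \<alpha> n then c n else 0)"
      unfolding P_def[abs_def] by (rule has_power_series_sum) (auto intro: has_power_series_mon)
    ultimately have z: "(\<Sum>n<10. if \<beta> = \<alpha> n then c n else 0) = 0" if "mdeg \<beta> < 6" for \<beta>
      using coeffs_zero_if_ordge that by blast
    show ?thesis
    proof (intro allI impI)
      fix m :: nat assume m: "m < 10"
      have "(\<Sum>n<10. if \<alpha> m = \<alpha> n then c n else 0) = (\<Sum>n<10. if n = m then c n else 0)"
        by (intro sum.cong refl) (use \<alpha>inj m in auto)
      then show "c m = 0" using z[of "\<alpha> m"] \<alpha>deg[OF m] m by simp
    qed
  qed
  show ?thesis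
    unfolding milnor_number_def by (intro Sup_upper imageI CollectI exI[of _ e] conjI allI impI ean) (use ind in auto)
qed

section \<open>Jets\<close>

definition jet_expos :: "nat \<Rightarrow> ('n::finite \<Rightarrow> nat) set" where
  "jet_expos k = {\<alpha>. 1 \<le> mdeg \<alpha> \<and> mdeg \<alpha> \<le> k}"

lemma finite_jet_expos: "finite (jet_expos k)"
  by (rule finite_subset[OF _ finite_mdeg_le[of k]]) (auto simp: jet_expos_def)

lemma lookup_jet: "Poly_Mapping.lookup (jet k f) \<alpha> = (if mdeg \<alpha> \<le> k then taylor_coeff f \<alpha> else 0)"
  unfolding jet_def by (simp add: lookup_sum_single[OF finite_mdeg_le])

lemma has_power_series_poly_eval: "has_power_series (poly_eval p) (Poly_Mapping.lookup p)"
proof -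
  have "has_power_series (\<lambda>x. \<Sum>\<alpha>\<in>Poly_Mapping.keys p. Poly_Mapping.lookup p \<alpha> * mon \<alpha> x)
      (\<lambda>\<beta>. \<Sum>\<alpha>\<in>Poly_Mapping.keys p. if \<beta> = \<alpha> then Poly_Mapping.lookup p \<alpha> else 0)"
    by (intro has_power_series_sum has_power_series_mon) simp
  moreover have "(\<Sum>\<alpha>\<in>Poly_Mapping.keys p. if \<beta> = \<alpha> then Poly_Mapping.lookup p \<alpha> else 0) = Poly_Mapping.lookup p \<beta>" for \<beta>
    by (simp add: in_keys_iff)
  ultimately show ?thesis by (simp add: poly_eval_def[abs_def])
qed

lemma taylor_coeff_mdeg_0:
  assumes "analytic_germ f" "mdeg \<alpha> = 0"
  shows "taylor_coeff f \<alpha> = f 0"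
proof -
  have "\<alpha> = (\<lambda>_. 0)" using assms(2) by (auto simp: mdeg_def fun_eq_iff)
  then show ?thesis using power_series_at_0[OF has_power_series_taylor[OF assms(1)]] by simp
qed

lemma jet_space_eq: "jet_space k = {x :: ('n::finite \<Rightarrow> nat) \<Rightarrow>\<^sub>0 complex. Poly_Mapping.keys x \<subseteq> jet_expos k}"
proof (intro equalityI subsetI CollectI)
  fix x \<alpha> assume "x \<in> jet_space k" and \<alpha>: "\<alpha> \<in> Poly_Mapping.keys (x :: ('n \<Rightarrow> nat) \<Rightarrow>\<^sub>0 complex)"
  then obtain f where f: "analytic_germ f" "f 0 = 0" "x = jet k f" by (auto simp: jet_space_def max_ideal_def)
  have "mdeg \<alpha> \<noteq> 0" using \<alpha> f taylor_coeff_mdeg_0[of f \<alpha>] by (auto simp: in_keys_iff lookup_jet split: if_splits)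
  then show "\<alpha> \<in> jet_expos k" using \<alpha> f by (auto simp: in_keys_iff lookup_jet jet_expos_def split: if_splits)
next
  fix x :: "('n \<Rightarrow> nat) \<Rightarrow>\<^sub>0 complex" assume "x \<in> {x. Poly_Mapping.keys x \<subseteq> jet_expos k}"
  then have x: "Poly_Mapping.lookup x \<alpha> = 0" if "\<alpha> \<notin> jet_expos k" for \<alpha> using that by (auto simp: in_keys_iff)
  have "poly_eval x 0 = 0"
    unfolding power_series_at_0[OF has_power_series_poly_eval] by (rule x) (simp add: jet_expos_def mdeg_def)
  then have "poly_eval x \<in> max_ideal"
    using has_power_series_poly_eval[of x] by (auto simp: max_ideal_def analytic_germ_def)
  moreover have "jet k (poly_eval x) = x"
    by (rule poly_mapping_eqI)
      (use x in \<open>auto simp: lookup_jet taylor_coeff_eqI[OF has_power_series_poly_eval] jet_expos_def\<close>)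
  ultimately show "x \<in> jet_space k" unfolding jet_space_def by (metis image_eqI)
qed

section \<open>Separating the parameters\<close>

text \<open>In a narrow cone about the positive real axis the cube determines the ray: the quotient
  of the two numbers has a positive cube and an argument too small for a nontrivial root of
  unity.\<close>

lemma cone_cube_eq:
  fixes x y x' y' L L' :: real
  assumes pos: "x > 0" "x' > 0" "L > 0" "L' > 0" and y: "\<bar>y\<bar> \<le> x / 2" "\<bar>y'\<bar> \<le> x' / 2"
    and eq: "(Complex x y)^3 * of_real L' = (Complex x' y')^3 * of_real L"
  shows "y * x' = x * y' \<and> x^3 * L' = x'^3 * L"
proof -
  let ?z = "Complex x y" and ?z' = "Complex x' y'"
  \<comment> \<open>a and b are the real and imaginary parts of z times the conjugate of z'. The
    cube being real gives b (3 a^2 - b^2) = 0, and the cone makes the second factor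
    positive.\<close>
  define a where "a = x * x' + y * y'"
  define b where "b = y * x' - x * y'"
  have p: "?z * cnj ?z' = Complex a b" by (simp add: complex_eq_iff a_def b_def algebra_simps)
  have "(Complex a b)^3 * of_real L' = (?z^3 * of_real L') * cnj ?z' ^ 3"
    unfolding p[symmetric] by (simp add: power_mult_distrib)
  also have "\<dots> = (?z' * cnj ?z')^3 * of_real L" unfolding eq by (simp add: power_mult_distrib)
  also have "\<dots> = of_real (((cmod ?z')\<^sup>2)^3 * L)" unfolding complex_norm_square[symmetric] by simp
  finally have "Im ((Complex a b)^3 * of_real L') = 0" by simp
  moreover have "Im ((Complex a b)^3 * of_real L') = b * (3 * a\<^sup>2 - b\<^sup>2) * L'"
    by (simp add: power3_eq_cube power2_eq_square algebra_simps)
  ultimately have b0: "b * (3 * a\<^sup>2 - b\<^sup>2) = 0" using pos by simp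
  have "\<bar>y * y'\<bar> \<le> (x / 2) * (x' / 2)" unfolding abs_mult by (intro mult_mono y) (use pos in auto)
  then have a: "a \<ge> 3/4 * (x * x')" unfolding a_def by linarith
  have "\<bar>y * x'\<bar> \<le> (x / 2) * x'" "\<bar>x * y'\<bar> \<le> x * (x' / 2)"
    unfolding abs_mult using y pos by (auto intro!: mult_mono)
  then have "\<bar>b\<bar> \<le> x * x'" unfolding b_def by linarith
  then have "b\<^sup>2 \<le> (x * x')\<^sup>2" using power_mono[of "\<bar>b\<bar>" "x * x'" 2] by simp
  moreover have "(3/4 * (x * x'))\<^sup>2 \<le> a\<^sup>2" by (rule power_mono[OF a]) (use pos in simp)
  moreover have "(x * x')\<^sup>2 > 0" using pos by simp
  ultimately have "3 * a\<^sup>2 - b\<^sup>2 > 0" by (simp add: power_mult_distrib power2_eq_square)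
  then have y': "y * x' = x * y'" using b0 by (simp add: b_def)
  have "?z = of_real (x / x') * ?z'" using y' pos by (simp add: complex_eq_iff field_simps)
  then have "?z^3 = of_real (x / x') ^ 3 * ?z'^3" by (simp only: power_mult_distrib)
  then have "(of_real (x / x'))^3 * of_real L' * ?z'^3 = of_real L * ?z'^3" using eq by (simp only: mult_ac)
  moreover have "?z'^3 \<noteq> 0" by (rule power_not_zero) (use pos in \<open>simp add: complex_eq_iff\<close>)
  ultimately have "complex_of_real ((x / x')^3 * L') = of_real L" by simp
  then have "(x / x')^3 * L' = L" by (simp only: of_real_eq_iff)
  then show ?thesis using y' pos by (simp add: field_simps)
qed

text \<open>The powers 1, z, ..., z^(n-1) of a nontrivial root sum to 0, which is impossible when
  each of them is at distance less than 1 from 1.\<close>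

lemma root_of_unity_near_1:
  fixes z :: complex
  assumes z: "z ^ n = 1" and n: "n > 0" and d: "norm (z - 1) < 1 / n"
  shows "z = 1"
proof (rule ccontr)
  assume "z \<noteq> 1"
  have "norm z ^ n = 1" using z by (metis norm_one norm_power)
  then have nz: "norm z = 1" using n power_eq_imp_eq_base[of "norm z" n 1] by simp
  have "(z - 1) * (\<Sum>k<n. z ^ k) = 0" using z by (simp add: power_diff_1_eq[symmetric])
  then have "(\<Sum>k<n. z ^ k - 1) = - of_nat n" using \<open>z \<noteq> 1\<close> by (simp add: sum_subtractf)
  then have "real n = norm (\<Sum>k<n. z ^ k - 1)" by simp
  also have "\<dots> \<le> (\<Sum>k<n. real n * norm (z - 1))"
  proof (rule sum_norm_le)
    fix k assume "k \<in> {..<n}"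
    have "norm (z ^ k - 1 ^ k) \<le> real k * norm (z - 1)" by (rule norm_power_diff) (use nz in auto)
    also have "\<dots> \<le> real n * norm (z - 1)" using \<open>k \<in> {..<n}\<close> by (intro mult_right_mono) auto
    finally show "norm (z ^ k - 1) \<le> real n * norm (z - 1)" by simp
  qed
  also have "\<dots> < n" using d n by (simp add: field_simps)
  finally show False by simp
qed

text \<open>The quotient a / b is a ninth root of unity at distance at most 6/197 from 1, which is
  below 1/9.\<close>

lemma power9_eq_near:
  fixes a b :: complex
  assumes eq: "a ^ 9 = b ^ 9" and T: "T > 0" and a: "norm (a - of_real T) \<le> 3/200 * T" and b: "norm (b - of_real T) \<le> 3/200 * T"
  shows "a = b"
proof -
  define r where "r = complex_of_real T"
  have r: "norm r = T" using T by (simp add: r_def)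
  have "norm r \<le> norm b + norm (b - r)" using norm_triangle_ineq4[of b "b - r"] by simp
  then have nb: "norm b \<ge> 197/200 * T" using b r unfolding r_def[symmetric] by linarith
  then have b0: "b \<noteq> 0" using T by auto
  have "norm (a - b) \<le> 6/200 * T"
    using norm_triangle_ineq4[of "a - r" "b - r"] a b unfolding r_def[symmetric] by simp
  then have "norm (a - b) < 1/9 * norm b" using nb T by linarith
  moreover have "a / b - 1 = (a - b) / b" using b0 by (simp add: field_simps)
  ultimately have "norm (a / b - 1) < 1 / real 9" using b0 by (simp add: norm_divide field_simps)
  moreover have "(a / b) ^ 9 = 1" using eq b0 by (simp add: power_divide)
  ultimately have "a / b = 1" using root_of_unity_near_1[of "a / b" 9] by simp
  then show ?thesis using b0 by simp
qed

section \<open>A four-parameter family of inequivalent jets\<close>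

context germ_data
begin

text \<open>With \<open>lead_exp\<close>, writes s^6 \<open>lead_y s\<close> as a constant times a
  power of s in both cases of \<open>y9\<close>; this is the denominator of b^3.\<close>

definition lead_const :: complex where "lead_const = (if c 2 5 = 0 then 1 else c 2 5 / 6)"
definition lead_exp :: nat where "lead_exp = (if c 2 5 = 0 then 15 else 4)"

lemma lead_const_nonzero: "lead_const \<noteq> 0"
  by (simp add: lead_const_def)

lemma lead_y_eq: "s \<noteq> 0 \<Longrightarrow> s ^ 6 * lead_y s = lead_const * s ^ lead_exp"
  by (auto simp: lead_y_def y9_def lead_const_def lead_exp_def field_simps power_add[symmetric])

text \<open>The square of beta has size tau^40, and the denominators s^6 and s^6
  \<open>lead_y s\<close> are of size at least tau^15 up to a constant.\<close>

lemma rho_bound: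
  "\<exists>C\<ge>0. \<forall>\<tau> \<beta>. 0 < \<tau> \<and> \<tau> < 1 \<and> norm \<beta> \<le> B * \<tau> ^ 20 \<longrightarrow> norm (rho (of_real \<tau>) \<beta>) \<le> C * \<tau> ^ 25"
proof -
  define C where "C = 2/3 * B\<^sup>2 * (norm (2/3 * partial_deriv j fA 0) + norm (c 3 4 / (30 * lead_const)))"
  have "norm (rho (of_real \<tau>) \<beta>) \<le> C * \<tau> ^ 25" if \<tau>: "0 < \<tau>" "\<tau> < 1" and \<beta>: "norm \<beta> \<le> B * \<tau> ^ 20" for \<tau> \<beta>
  proof -
    let ?s = "complex_of_real \<tau>"
    have s: "?s \<noteq> 0" using \<tau> by simp
    have inv: "1 / \<tau> ^ n \<le> 1 / \<tau> ^ 15" if "n \<le> 15" for n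
      using power_decreasing[OF that, of \<tau>] \<tau> by (intro divide_left_mono) auto
    have L: "1 / (?s ^ 6 * lead_y ?s) = 1 / (lead_const * ?s ^ lead_exp)" unfolding lead_y_eq[OF s] ..
    have "rho ?s \<beta> = 2/3 * \<beta>\<^sup>2 * (2/3 * partial_deriv j fA 0 / ?s ^ 6 + c 3 4 / 30 * (1 / (?s ^ 6 * lead_y ?s)))"
      unfolding rho_def using s lead_y_nonzero[OF s] by (simp add: field_simps power_add[symmetric])
    also have "c 3 4 / 30 * (1 / (?s ^ 6 * lead_y ?s)) = c 3 4 / (30 * lead_const) / ?s ^ lead_exp" unfolding L by simp
    finally have "norm (rho ?s \<beta>) = 2/3 * (norm \<beta>)\<^sup>2 * norm (2/3 * partial_deriv j fA 0 / ?s ^ 6 + c 3 4 / (30 * lead_const) / ?s ^ lead_exp)"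
      by (simp only: norm_mult norm_power) simp
    also have "\<dots> \<le> 2/3 * (B * \<tau> ^ 20)\<^sup>2 * ((norm (2/3 * partial_deriv j fA 0) + norm (c 3 4 / (30 * lead_const))) * (1 / \<tau> ^ 15))"
    proof (intro mult_mono mult_left_mono power_mono \<beta>)
      have "norm (2/3 * partial_deriv j fA 0 / ?s ^ 6) = norm (2/3 * partial_deriv j fA 0) * (1 / \<tau> ^ 6)"
        using \<tau> by (simp add: norm_divide norm_power)
      also have "\<dots> \<le> norm (2/3 * partial_deriv j fA 0) * (1 / \<tau> ^ 15)" by (intro mult_left_mono inv) auto
      finally have 1: "norm (2/3 * partial_deriv j fA 0 / ?s ^ 6) \<le> norm (2/3 * partial_deriv j fA 0) * (1 / \<tau> ^ 15)" .
      have "norm (c 3 4 / (30 * lead_const) / ?s ^ lead_exp) = norm (c 3 4 / (30 * lead_const)) * (1 / \<tau> ^ lead_exp)"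
        using \<tau> by (simp add: norm_divide norm_mult norm_power)
      also have "\<dots> \<le> norm (c 3 4 / (30 * lead_const)) * (1 / \<tau> ^ 15)"
        by (intro mult_left_mono inv) (auto simp: lead_exp_def)
      finally show "norm (2/3 * partial_deriv j fA 0 / ?s ^ 6 + c 3 4 / (30 * lead_const) / ?s ^ lead_exp) \<le>
        (norm (2/3 * partial_deriv j fA 0) + norm (c 3 4 / (30 * lead_const))) * (1 / \<tau> ^ 15)"
        unfolding distrib_right by (intro norm_triangle_le add_mono 1)
    qed auto
    also have "\<dots> = C * (\<tau> ^ 40 / \<tau> ^ 15)" by (simp add: C_def power_mult_distrib power_mult[symmetric])
    also have "\<tau> ^ 40 / \<tau> ^ 15 = \<tau> ^ 25" using \<tau> power_diff[of \<tau> 15 40] by simp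
    finally show ?thesis .
  qed
  moreover have "C \<ge> 0" by (simp add: C_def)
  ultimately show ?thesis by blast
qed

text \<open>The coordinate changes of the two normal forms and the given equivalence combine to a
  bi-Lipschitz equivalence of the normal forms. Their second invariant is, up to the ninth power of
  -2/3, the stated product.\<close>

lemma bilipschitz_family_invariants:
  assumes \<phi>: "biholomorphism_germ \<phi>" and f: "\<forall>\<^sub>F x in nhds 0. f x = sq_germ (\<phi> x)"
    and s: "s \<noteq> 0" "\<delta> ^ 9 = lead_y s" and s': "s' \<noteq> 0" "\<delta>' ^ 9 = lead_y s'"
    and R: "analytic_germ R" "ordge 11 R" and R': "analytic_germ R'" "ordge 11 R'"
    and q: "\<forall>\<^sub>F x in nhds 0. q x = f x + pert s (\<phi> x) + \<beta> * ((curve_u s (\<phi> x))\<^sup>2 * (\<phi> x $ j)^3)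
      + \<gamma> * (curve_u s (\<phi> x) * (\<phi> x $ j)^7) + R x"
    and q': "\<forall>\<^sub>F x in nhds 0. q' x = f x + pert s' (\<phi> x) + \<beta>' * ((curve_u s' (\<phi> x))\<^sup>2 * (\<phi> x $ j)^3)
      + \<gamma>' * (curve_u s' (\<phi> x) * (\<phi> x $ j)^7) + R' x"
    and equiv: "bilipschitz_equiv q q'"
    and b: "b = \<beta> / (s\<^sup>2 * \<delta>^3)" "Re (b ^ 3) > 0" and b': "b' = \<beta>' / (s'\<^sup>2 * \<delta>'^3)" "Re (b' ^ 3) > 0"
  shows "b ^ 3 = b' ^ 3 \<and> (b * ((\<gamma> + rho s \<beta>) / (s * \<delta>^7))) ^ 9 = (b' * ((\<gamma>' + rho s' \<beta>') / (s' * \<delta>'^7))) ^ 9"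
proof -
  obtain \<theta> \<omega> F e where F: "lip_pair \<theta> \<omega>" "\<forall>\<^sub>F x in nhds 0. q x = F (\<theta> x)" "lip_normal_form i j F b e (\<gamma> / (s * \<delta>^7))"
    and e: "\<gamma> / (s * \<delta>^7) + e * (- 2 * b / 3) = (\<gamma> + rho s \<beta>) / (s * \<delta>^7)"
    using family_normal_form[OF s \<phi> f R q] unfolding b(1) by blast
  obtain \<theta>' \<omega>' F' e' where F': "lip_pair \<theta>' \<omega>'" "\<forall>\<^sub>F x in nhds 0. q' x = F' (\<theta>' x)" "lip_normal_form i j F' b' e' (\<gamma>' / (s' * \<delta>'^7))"
    and e': "\<gamma>' / (s' * \<delta>'^7) + e' * (- 2 * b' / 3) = (\<gamma>' + rho s' \<beta>') / (s' * \<delta>'^7)"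
    using family_normal_form[OF s' \<phi> f R' q'] unfolding b'(1) by blast
  obtain h where h: "bilipschitz_germ h" "\<forall>\<^sub>F x in nhds 0. q x = q' (h x)" using equiv unfolding bilipschitz_equiv_def by blast
  obtain h' where hp: "lip_pair h h'" by (rule bilipschitz_germ_lip_pair[OF h(1)])
  note lp = lip_pair_compose[OF lip_pair_compose[OF lip_pair_sym[OF F(1)] hp] F'(1)]
  have \<omega>l: "filterlim \<omega> (nhds 0) (nhds 0)" and hl: "filterlim h (nhds 0) (nhds 0)"
    using F(1) hp by (auto simp: lip_pair_def intro: lip_germ_filterlim)
  have "\<forall>\<^sub>F p in nhds 0. \<omega> (\<theta> p) = p \<and> \<theta> (\<omega> p) = p" using F(1) by (simp add: lip_pair_def)
  then have "\<forall>\<^sub>F p in nhds 0. F p = F' (\<theta>' (h (\<omega> p)))"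
    using eventually_compose_germ[OF \<omega>l F(2)] eventually_compose_germ[OF \<omega>l h(2)]
      eventually_compose_germ[OF \<omega>l eventually_compose_germ[OF hl F'(2)]]
    by eventually_elim simp
  from lip_normal_form_invariants[OF ij F(3) F'(3) lp this b(2) b'(2)]
  have inv: "b ^ 3 = b' ^ 3" "(\<gamma> / (s * \<delta>^7) * (- 2 * b / 3) + e * (- 2 * b / 3)\<^sup>2) ^ 9 = (\<gamma>' / (s' * \<delta>'^7) * (- 2 * b' / 3) + e' * (- 2 * b' / 3)\<^sup>2) ^ 9"
    by auto
  have w: "g * (- 2 * b / 3) + e * (- 2 * b / 3)\<^sup>2 = - 2/3 * (b * (g + e * (- 2 * b / 3)))" for g e b :: complex
    by (simp add: power2_eq_square field_simps)
  have "X ^ 9 = Y ^ 9" if "(- 2/3 * X) ^ 9 = (- 2/3 * Y) ^ 9" for X Y :: complex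
    using that by (simp add: power_mult_distrib power_divide)
  then show ?thesis using inv unfolding w e e' by blast
qed

end

section \<open>The family of jets and its parameters\<close>

locale jet_family = germ_data i j J c fA fx fq fz g
  for i j :: "'n::finite" and J c fA fx fq fz g +
  fixes \<phi> :: "complex ^ 'n \<Rightarrow> complex ^ 'n" and f :: "complex ^ 'n \<Rightarrow> complex" and k :: nat
  assumes \<phi>: "biholomorphism_germ \<phi>" and f: "\<forall>\<^sub>F x in nhds 0. f x = sq_germ (\<phi> x)" and fan: "analytic_germ f"
    and f0: "f 0 = 0" and k: "11 \<le> k"
begin

lemma \<phi>an: "analytic_germ (\<lambda>x. \<phi> x $ m)" and \<phi>0: "\<phi> 0 = 0"
  using \<phi> by (auto simp: biholomorphism_germ_def)

text \<open>A cube root that cancels \<open>lead_const\<close> in b^3, leaving the cube of a number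
  in the cone divided by a positive real power of s.\<close>

definition eta :: complex where "eta = exp (Ln lead_const / 3)"

lemma eta_cube: "eta ^ 3 = lead_const"
  unfolding eta_def exp_of_nat_mult[symmetric] using lead_const_nonzero by simp

text \<open>Up to \<open>eta\<close> this lies in the cone where the imaginary part is at most half
  the real part, because \<open>t 1\<close> is below \<open>t 0 ^ 20\<close> on the cusp.\<close>

definition bet :: "(nat \<Rightarrow> real) \<Rightarrow> complex" where
  "bet t = eta * (of_real (t 0) ^ 20 + \<i> / 2 * of_real (t 1))"

text \<open>Stays within 2/200 of \<open>t 0 ^ 20\<close> relatively; another 1/200 is reserved for
  the contribution of \<open>rho\<close>, which adds up to the 3/200 of
  \<open>power9_eq_near\<close>.\<close>

definition gam :: "(nat \<Rightarrow> real) \<Rightarrow> complex" where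
  "gam t = of_real (t 0) ^ 20 + 1 / 200 * (of_real (t 2) + \<i> * of_real (t 3))"

text \<open>Parameter factors of the perturbation: powers of s for \<open>pert\<close>, then those
  from the expansions of beta u^2 y^3 (three terms) and gamma u y^7 (two terms).
  \<open>fam_germ\<close> lists the corresponding germs.\<close>

definition fam_coeff :: "nat \<Rightarrow> (nat \<Rightarrow> real) \<Rightarrow> complex" where
  "fam_coeff n t = (if n < 10 then of_real (t 0) ^ n else if n = 10 then bet t else if n = 11 then -2 * (bet t * of_real (t 0))
     else if n = 12 then bet t * of_real (t 0) ^ 2 else if n = 13 then gam t else -1 * (gam t * of_real (t 0)))"

definition fam_germ :: "nat \<Rightarrow> complex ^ 'n \<Rightarrow> complex" where
  "fam_germ n p = (if n < 10 then pert_coeff n p else if n = 10 then (p $ j) ^ 7 else if n = 11 then p $ i * (p $ j) ^ 5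
     else if n = 12 then (p $ i)\<^sup>2 * (p $ j) ^ 3 else if n = 13 then (p $ j) ^ 9 else p $ i * (p $ j) ^ 7)"

lemma fam_coeff_poly: "poly_nat (fam_coeff n)"
  unfolding fam_coeff_def[abs_def] bet_def gam_def by (intro poly_nat_if poly_nat_power poly_nat.intros)

lemma fam_coeff_0: "1 \<le> n \<Longrightarrow> fam_coeff n (\<lambda>_. 0) = 0"
  by (simp add: fam_coeff_def bet_def gam_def)

lemma fam_germ_analytic: "analytic_germ (\<lambda>x. fam_germ n (\<phi> x))"
proof -
  have "analytic_germ (fam_germ n)"
    unfolding fam_germ_def[abs_def] by (intro analytic_germ_if analytic_intros) (simp add: pert_coeff_analytic)
  then show ?thesis by (rule analytic_germ_compose[OF _ \<phi>an \<phi>0])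
qed

lemma fam_germ_0: "fam_germ n 0 = 0"
  by (simp add: fam_germ_def pert_coeff_at_0)

lemma fam_sum:
  "(\<Sum>n\<in>{1..<15}. fam_coeff n t * fam_germ n p) = pert (of_real (t 0)) p
    + bet t * ((curve_u (of_real (t 0)) p)\<^sup>2 * (p $ j)^3) + gam t * (curve_u (of_real (t 0)) p * (p $ j)^7)"
proof -
  let ?s = "complex_of_real (t 0)"
  have "pert ?s p = (\<Sum>n\<in>{1..<10}. ?s ^ n * pert_coeff n p)"
    unfolding pert_expand lessThan_atLeast0 by (simp add: sum.atLeast_Suc_lessThan pert_coeff_0)
  also have "\<dots> = (\<Sum>n\<in>{1..<10}. fam_coeff n t * fam_germ n p)"
    by (intro sum.cong refl) (simp add: fam_coeff_def fam_germ_def)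
  finally have 1: "pert ?s p = (\<Sum>n\<in>{1..<10}. fam_coeff n t * fam_germ n p)" .
  have "{10..<15} = {10,11,12,13,14::nat}" by auto
  then have "(\<Sum>n\<in>{10..<15}. fam_coeff n t * fam_germ n p) =
      bet t * (p $ j)^7 - 2 * (bet t * ?s) * (p $ i * (p $ j)^5) + bet t * ?s\<^sup>2 * ((p $ i)\<^sup>2 * (p $ j)^3)
      + gam t * (p $ j)^9 - gam t * ?s * (p $ i * (p $ j)^7)"
    by (simp add: fam_coeff_def fam_germ_def)
  also have "\<dots> = bet t * ((curve_u ?s p)\<^sup>2 * (p $ j)^3) + gam t * (curve_u ?s p * (p $ j)^7)"
    by (simp add: curve_u_def eval_nat_numeral algebra_simps)
  finally have "(\<Sum>n\<in>{10..<15}. fam_coeff n t * fam_germ n p) =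
      bet t * ((curve_u ?s p)\<^sup>2 * (p $ j)^3) + gam t * (curve_u ?s p * (p $ j)^7)" .
  then show ?thesis unfolding 1 using sum.atLeastLessThan_concat[of 1 10 15 "\<lambda>n. fam_coeff n t * fam_germ n p"] by (simp add: add.assoc)
qed

text \<open>
  The perturbations are needed modulo terms of degree \<open>11\<close> only. As \<open>k \<ge> 11\<close>, this leaves two
  monomials of degree \<open>k\<close> in which the parameters can be recorded, so that they are linear
  functions of the jet and the family is semialgebraic.
\<close>

definition coef :: "('n \<Rightarrow> nat) \<Rightarrow> (nat \<Rightarrow> real) \<Rightarrow> complex" where
  "coef \<alpha> t = taylor_coeff f \<alpha>
     + (\<Sum>n\<in>{1..<15}. fam_coeff n t * (if mdeg \<alpha> \<le> 10 then taylor_coeff (\<lambda>x. fam_germ n (\<phi> x)) \<alpha> else 0))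
     + (if \<alpha> = expo i j k 0 then of_real (t 0) + \<i> * of_real (t 1) else 0)
     + (if \<alpha> = expo i j (k - 1) 1 then of_real (t 2) + \<i> * of_real (t 3) else 0)"

definition fam :: "(nat \<Rightarrow> real) \<Rightarrow> ('n \<Rightarrow> nat) \<Rightarrow>\<^sub>0 complex" where
  "fam t = (\<Sum>\<alpha>\<in>jet_expos k. Poly_Mapping.single \<alpha> (coef \<alpha> t))"

definition params :: "(('n \<Rightarrow> nat) \<Rightarrow>\<^sub>0 complex) \<Rightarrow> nat \<Rightarrow> real" where
  "params x m = (let A = \<lambda>\<alpha>. Poly_Mapping.lookup x \<alpha> - taylor_coeff f \<alpha> in
     if m = 0 then Re (A (expo i j k 0)) else if m = 1 then Im (A (expo i j k 0))
     else if m = 2 then Re (A (expo i j (k - 1) 1)) else if m = 3 then Im (A (expo i j (k - 1) 1)) else 0)"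

lemma coef_poly: "poly_nat (coef \<alpha>)"
  unfolding coef_def[abs_def] by (intro poly_nat_if poly_nat.intros poly_nat_sum fam_coeff_poly)

lemma lookup_fam: "Poly_Mapping.lookup (fam t) \<alpha> = (if \<alpha> \<in> jet_expos k then coef \<alpha> t else 0)"
  unfolding fam_def by (rule lookup_sum_single[OF finite_jet_expos])

lemma expo_top: "expo i j k 0 \<in> jet_expos k" "expo i j (k - 1) 1 \<in> jet_expos k"
  "mdeg (expo i j k 0) = k" "mdeg (expo i j (k - 1) 1) = k" "expo i j k 0 \<noteq> expo i j (k - 1) 1"
proof -
  show "expo i j k 0 \<noteq> expo i j (k - 1) 1" using ij by (auto simp: expo_def fun_eq_iff)
qed (use k in \<open>auto simp: jet_expos_def mdeg_expo[OF ij]\<close>)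

lemma params_fam: "t \<in> cusp_region \<epsilon> N \<Longrightarrow> params (fam t) = t"
proof
  fix m :: nat assume t: "t \<in> cusp_region \<epsilon> N"
  consider "m = 0" | "m = 1" | "m = 2" | "m = 3" | "m \<ge> 4" by linarith
  then show "params (fam t) m = t m"
    by cases (use k t expo_top in \<open>auto simp: params_def lookup_fam coef_def cusp_region_def\<close>)
qed

lemma params_poly: "real_polynomial_function (\<lambda>x. params x m)"
proof -
  have "real_polynomial_function (\<lambda>x :: ('n \<Rightarrow> nat) \<Rightarrow>\<^sub>0 complex. Re (Poly_Mapping.lookup x \<alpha>))"
    and "real_polynomial_function (\<lambda>x :: ('n \<Rightarrow> nat) \<Rightarrow>\<^sub>0 complex. Im (Poly_Mapping.lookup x \<alpha>))" for \<alpha>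
    by (intro real_polynomial_function.intros(1) bounded_linear_compose[OF bounded_linear_Re bounded_linear_lookup]
        bounded_linear_compose[OF bounded_linear_Im bounded_linear_lookup])+
  note lk = this
  consider "m = 0" | "m = 1" | "m = 2" | "m = 3" | "m \<ge> 4" by linarith
  then show ?thesis
    by cases (auto simp: params_def intro!: real_polynomial_function_diff lk)
qed

lemma fam_0: "fam (\<lambda>_. 0) = jet k f"
proof (rule poly_mapping_eqI)
  fix \<alpha> :: "'n \<Rightarrow> nat"
  have "mdeg \<alpha> = 0 \<Longrightarrow> taylor_coeff f \<alpha> = 0" using taylor_coeff_mdeg_0[OF fan] f0 by simp
  then show "Poly_Mapping.lookup (fam (\<lambda>_. 0)) \<alpha> = Poly_Mapping.lookup (jet k f) \<alpha>"
    by (auto simp: lookup_fam lookup_jet coef_def fam_coeff_0 jet_expos_def)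
qed

text \<open>R consists of what truncation removes, in degree above 10 for the perturbation and above
  k for f, and of the two monomials that record the parameters; none of it has degree below
  11.\<close>

lemma poly_eval_fam:
  "\<exists>R. analytic_germ R \<and> ordge 11 R \<and> (\<forall>\<^sub>F x in nhds 0. poly_eval (fam t) x = f x + pert (of_real (t 0)) (\<phi> x)
    + bet t * ((curve_u (of_real (t 0)) (\<phi> x))\<^sup>2 * (\<phi> x $ j)^3) + gam t * (curve_u (of_real (t 0)) (\<phi> x) * (\<phi> x $ j)^7) + R x)"
proof -
  define H where "H x = (\<Sum>n\<in>{1..<15}. fam_coeff n t * fam_germ n (\<phi> x))" for x
  define h where "h \<alpha> = (\<Sum>n\<in>{1..<15}. fam_coeff n t * taylor_coeff (\<lambda>x. fam_germ n (\<phi> x)) \<alpha>)" for \<alpha>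
  define R where "R x = poly_eval (fam t) x - f x - H x" for x
  have hH: "has_power_series H h"
    unfolding H_def[abs_def] h_def[abs_def]
    by (intro has_power_series_sum has_power_series_cmult has_power_series_taylor fam_germ_analytic) simp
  have hR: "has_power_series R (\<lambda>\<alpha>. Poly_Mapping.lookup (fam t) \<alpha> - taylor_coeff f \<alpha> - h \<alpha>)"
    unfolding R_def[abs_def]
    by (intro has_power_series_diff has_power_series_poly_eval has_power_series_taylor fan hH)
  have "ordge 11 R"
  proof (rule ordge_if_coeffs_zero[OF hR])
    fix \<alpha> :: "'n \<Rightarrow> nat" assume m: "mdeg \<alpha> < 11"
    show "Poly_Mapping.lookup (fam t) \<alpha> - taylor_coeff f \<alpha> - h \<alpha> = 0"
    proof (cases "mdeg \<alpha> = 0")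
      case True
      then show ?thesis
        using taylor_coeff_mdeg_0[OF fan True] taylor_coeff_mdeg_0[OF fam_germ_analytic True] f0
        by (simp add: lookup_fam jet_expos_def h_def \<phi>0 fam_germ_0)
    next
      case False
      have "\<alpha> \<noteq> expo i j k 0" "\<alpha> \<noteq> expo i j (k - 1) 1" using m k expo_top(3,4) by auto
      then show ?thesis using False m k by (simp add: lookup_fam jet_expos_def coef_def h_def)
    qed
  qed
  moreover have "analytic_germ R" using hR by (auto simp: analytic_germ_def)
  moreover have "poly_eval (fam t) x = f x + H x + R x" for x by (simp add: R_def)
  ultimately show ?thesis unfolding H_def fam_sum by (intro exI[of _ R]) (simp add: add.assoc)
qed

text \<open>The equality of b^3 places both parameters on the same ray of the cone and yields
  \<open>t 0\<close> and then \<open>t 1\<close>. Now b and \<open>rho\<close> agree for both jets,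
  so the second invariant compares the ninth powers of two numbers close to the same positive real
  one, which yields \<open>gam\<close>.\<close>

lemma fam_inequivalent:
  assumes t: "t \<in> cusp_region \<epsilon> 20" and t': "t' \<in> cusp_region \<epsilon> 20" and \<epsilon>: "\<epsilon> \<le> 1" "C * \<epsilon> \<le> 1/200" "C \<ge> 0"
    and C: "\<And>\<tau> \<beta>. 0 < \<tau> \<Longrightarrow> \<tau> < 1 \<Longrightarrow> norm \<beta> \<le> 2 * norm eta * \<tau> ^ 20 \<Longrightarrow> norm (rho (of_real \<tau>) \<beta>) \<le> C * \<tau> ^ 25"
    and equiv: "bilipschitz_equiv (poly_eval (fam t)) (poly_eval (fam t'))"
  shows "t = t'"
proof -
  define \<delta> where "\<delta> s = exp (Ln (lead_y s) / 9)" for s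
  have \<delta>: "\<delta> s ^ 9 = lead_y s" if "s \<noteq> 0" for s
    unfolding \<delta>_def exp_of_nat_mult[symmetric] using lead_y_nonzero[OF that] by simp
  define b where "b t = bet t / ((of_real (t 0))\<^sup>2 * \<delta> (of_real (t 0)) ^ 3)" for t
  define Z where "Z t = Complex (t 0 ^ 20) (t 1 / 2)" for t :: "nat \<Rightarrow> real"
  have betZ: "bet t = eta * Z t" for t
    by (simp add: bet_def Z_def complex_eq_iff flip: of_real_power)
  have b3: "b t ^ 3 = Z t ^ 3 / of_real (t 0 ^ lead_exp)" if "t 0 > 0" for t
  proof -
    let ?s = "complex_of_real (t 0)"
    have s: "?s \<noteq> 0" using that by simp
    have "b t ^ 3 = eta ^ 3 * Z t ^ 3 / (?s ^ 6 * \<delta> ?s ^ 9)"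
      by (simp add: b_def betZ power_mult_distrib power_divide flip: power_mult)
    then show ?thesis unfolding \<delta>[OF s] lead_y_eq[OF s] eta_cube using lead_const_nonzero by simp
  qed
  have reg: "0 < t 0" "t 0 < 1" "\<bar>t 1 / 2\<bar> < t 0 ^ 20 / 2" "\<bar>t 2\<bar> \<le> t 0 ^ 20" "\<bar>t 3\<bar> \<le> t 0 ^ 20" "t 0 ^ 20 > 0" "t 0 < \<epsilon>"
    if "t \<in> cusp_region \<epsilon> 20" for t
    using that \<epsilon> by (auto simp: cusp_region_def)
  have Repos: "Re (b t ^ 3) > 0" if tt: "t \<in> cusp_region \<epsilon> 20" for t
  proof -
    define x y where "x = t 0 ^ 20" and "y = t 1 / 2"
    have xy: "x > 0" "\<bar>y\<bar> \<le> x / 2" using reg[OF tt] by (auto simp: x_def y_def)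
    have "y\<^sup>2 \<le> (x / 2)\<^sup>2" using power_mono[OF xy(2), of 2] by simp
    then have "4 * y\<^sup>2 \<le> x\<^sup>2" by (simp add: power_divide)
    moreover have "x\<^sup>2 > 0" using xy by simp
    ultimately have "x\<^sup>2 - 3 * y\<^sup>2 > 0" using zero_le_power2[of y] by linarith
    then have "x * (x\<^sup>2 - 3 * y\<^sup>2) > 0" using xy(1) by (rule mult_pos_pos[rotated])
    moreover have "Re (Z t ^ 3) = x * (x\<^sup>2 - 3 * y\<^sup>2)"
      by (simp add: Z_def x_def y_def power3_eq_cube power2_eq_square algebra_simps)
    ultimately show ?thesis using reg(1)[OF tt] unfolding b3[of t, OF reg(1)[OF tt]] Re_divide_of_real by simp
  qed
  have s: "complex_of_real (t 0) \<noteq> 0" "complex_of_real (t' 0) \<noteq> 0" using reg(1)[OF t] reg(1)[OF t'] by auto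
  obtain R where R: "analytic_germ R" "ordge 11 R" and q: "\<forall>\<^sub>F x in nhds 0. poly_eval (fam t) x = f x + pert (of_real (t 0)) (\<phi> x)
    + bet t * ((curve_u (of_real (t 0)) (\<phi> x))\<^sup>2 * (\<phi> x $ j)^3) + gam t * (curve_u (of_real (t 0)) (\<phi> x) * (\<phi> x $ j)^7) + R x"
    using poly_eval_fam by blast
  obtain R' where R': "analytic_germ R'" "ordge 11 R'" and q': "\<forall>\<^sub>F x in nhds 0. poly_eval (fam t') x = f x + pert (of_real (t' 0)) (\<phi> x)
    + bet t' * ((curve_u (of_real (t' 0)) (\<phi> x))\<^sup>2 * (\<phi> x $ j)^3) + gam t' * (curve_u (of_real (t' 0)) (\<phi> x) * (\<phi> x $ j)^7) + R' x"
    using poly_eval_fam by blast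
  note inv = bilipschitz_family_invariants[OF \<phi> f s(1) \<delta>[OF s(1)] s(2) \<delta>[OF s(2)] R R' q q' equiv
      b_def Repos[OF t] b_def Repos[OF t']]
  have "Z t ^ 3 * of_real (t' 0 ^ lead_exp) = Z t' ^ 3 * of_real (t 0 ^ lead_exp)"
    using inv[THEN conjunct1] s unfolding b3[of t, OF reg(1)[OF t]] b3[of t', OF reg(1)[OF t']] by (simp add: field_simps)
  then have cone: "t 1 / 2 * t' 0 ^ 20 = t 0 ^ 20 * (t' 1 / 2) \<and> (t 0 ^ 20) ^ 3 * t' 0 ^ lead_exp = (t' 0 ^ 20) ^ 3 * t 0 ^ lead_exp"
    unfolding Z_def by (intro cone_cube_eq) (use reg[OF t] reg[OF t'] in auto)
  \<comment> \<open>The ray leaves the relation between t^60 and t^lead_exp. As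
    \<open>lead_exp\<close> is 15 or 4, the quotient is a positive power and determines
    \<open>t 0\<close>.\<close>
  have "lead_exp \<le> 60" by (simp add: lead_exp_def)
  then have e60: "x ^ 60 = x ^ (60 - lead_exp) * x ^ lead_exp" for x :: real by (simp flip: power_add)
  have "t 0 ^ 60 * t' 0 ^ lead_exp = t' 0 ^ 60 * t 0 ^ lead_exp" using cone by (simp flip: power_mult)
  then have "t 0 ^ (60 - lead_exp) = t' 0 ^ (60 - lead_exp)" unfolding e60 using s by simp
  then have t0: "t 0 = t' 0"
    by (rule power_eq_imp_eq_base) (use reg(1)[OF t] reg(1)[OF t'] in \<open>auto simp: lead_exp_def\<close>)
  have t1: "t 1 = t' 1" using cone s unfolding t0 by simp
  have bet_eq: "bet t = bet t'" using t0 t1 by (simp add: bet_def)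
  then have b_eq: "b t = b t'" by (simp add: b_def t0)
  have b0: "b t' \<noteq> 0" using Repos[OF t'] by auto
  have \<delta>0: "\<delta> (of_real (t' 0)) \<noteq> 0" by (simp add: \<delta>_def)
  let ?s = "complex_of_real (t' 0)"
  have nine: "(gam t + rho ?s (bet t')) ^ 9 = (gam t' + rho ?s (bet t')) ^ 9"
    using inv[THEN conjunct2] b0 \<delta>0 s(2) unfolding t0 b_eq bet_eq by (simp add: power_mult_distrib power_divide)
  \<comment> \<open>\<open>rho\<close> has size C tau^25, at most C epsilon times tau^20; the choice
    of epsilon makes this at most 1/200 of tau^20.\<close>
  have near: "norm (gam u + rho ?s (bet t') - of_real (t' 0 ^ 20)) \<le> 3/200 * t' 0 ^ 20"
    if u: "u \<in> cusp_region \<epsilon> 20" "u 0 = t' 0" for u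
  proof -
    have "norm (Z t') \<le> \<bar>t' 0 ^ 20\<bar> + \<bar>t' 1 / 2\<bar>" using cmod_le[of "Z t'"] by (simp add: Z_def)
    also have "\<dots> \<le> 2 * t' 0 ^ 20" using reg[OF t'] by simp
    finally have "norm (bet t') \<le> 2 * norm eta * t' 0 ^ 20"
      using mult_left_mono[OF _ norm_ge_zero[of eta]] by (fastforce simp: betZ norm_mult mult.assoc mult.left_commute)
    then have "norm (rho ?s (bet t')) \<le> C * t' 0 ^ 25" using C reg[OF t'] by blast
    also have "\<dots> = C * t' 0 * (t' 0 ^ 4 * t' 0 ^ 20)" by (simp add: eval_nat_numeral)
    also have "\<dots> \<le> C * \<epsilon> * (1 * t' 0 ^ 20)"
      using reg[OF t'] \<epsilon> by (intro mult_mono mult_right_mono power_le_one) auto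
    also have "\<dots> \<le> 1/200 * (1 * t' 0 ^ 20)" by (rule mult_right_mono[OF \<epsilon>(2)]) (use reg[OF t'] in auto)
    finally have r: "norm (rho ?s (bet t')) \<le> 1/200 * t' 0 ^ 20" by simp
    have "norm (of_real (u 2) + \<i> * of_real (u 3)) \<le> \<bar>u 2\<bar> + \<bar>u 3\<bar>" using cmod_le[of "of_real (u 2) + \<i> * of_real (u 3)"] by simp
    also have "\<dots> \<le> 2 * t' 0 ^ 20" using reg(4,5)[OF u(1)] u(2) by simp
    finally have "norm (gam u - of_real (t' 0 ^ 20)) \<le> 2/200 * t' 0 ^ 20" by (simp add: gam_def u(2) norm_divide)
    then show ?thesis using r norm_triangle_ineq[of "gam u - of_real (t' 0 ^ 20)" "rho ?s (bet t')"] by (simp add: algebra_simps)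
  qed
  have "gam t + rho ?s (bet t') = gam t' + rho ?s (bet t')"
    by (rule power9_eq_near[OF nine reg(6)[OF t'] near[OF t t0] near[OF t' refl]])
  then have "t 2 = t' 2 \<and> t 3 = t' 3" by (simp add: gam_def t0 complex_eq_iff)
  then have t23: "t 2 = t' 2" "t 3 = t' 3" by auto
  show ?thesis
  proof
    fix m :: nat
    consider "m = 0" | "m = 1" | "m = 2" | "m = 3" | "m \<ge> 4" by linarith
    then show "t m = t' m" by cases (use t t' t0 t1 t23 in \<open>auto simp: cusp_region_def\<close>)
  qed
qed

theorem lipschitz_modality_ge: "2 \<le> lipschitz_modality k f"
proof -
  obtain C where C: "C \<ge> 0" "\<And>\<tau> \<beta>. 0 < \<tau> \<Longrightarrow> \<tau> < 1 \<Longrightarrow> norm \<beta> \<le> 2 * norm eta * \<tau> ^ 20 \<Longrightarrow> norm (rho (of_real \<tau>) \<beta>) \<le> C * \<tau> ^ 25"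
    using rho_bound[of "2 * norm eta"] by blast
  \<comment> \<open>Ensures that C epsilon is at most 1/200, as needed to separate ninth
    roots.\<close>
  define \<epsilon> where "\<epsilon> = 1 / (200 * (C + 1))"
  have \<epsilon>: "\<epsilon> > 0" "\<epsilon> \<le> 1" "C * \<epsilon> \<le> 1/200" using C(1) by (auto simp: \<epsilon>_def field_simps)
  define S where "S = fam ` cusp_region \<epsilon> 20"
  let ?P = "\<lambda>m. \<exists>S :: (('n \<Rightarrow> nat) \<Rightarrow>\<^sub>0 complex) set. S \<subseteq> jet_space k \<and> semialgebraic_in (jet_space k) S \<and>
        has_semialgebraic_dim (jet_space k) S m \<and> jet k f \<in> closure S \<and>
        (\<forall>g1\<in>S. \<forall>g2\<in>S. g1 \<noteq> g2 \<longrightarrow> \<not> bilipschitz_equiv (poly_eval g1) (poly_eval g2))"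
  have cell: "semialgebraic_cell (jet_space k) S 4"
    unfolding S_def
    by (rule poly_graph_cell[OF finite_jet_expos jet_space_eq coef_poly params_poly _ fam_def params_fam \<epsilon>(1)])
      (auto simp: params_def)
  then have sa: "semialgebraic_in (jet_space k) S" by (simp add: semialgebraic_cell_def)
  have dim: "has_semialgebraic_dim (jet_space k) S 4"
    unfolding has_semialgebraic_dim_def using cell by (intro exI[of _ "{S}"] exI[of _ "\<lambda>_. 4"]) (auto simp: disjoint_def)
  have sub: "S \<subseteq> jet_space k" using sa unfolding semialgebraic_in_def by auto
  have "jet k f \<in> closure S"
    using cusp_region_limit[where K = "jet_expos k" and N = 19 and coef = coef, OF coef_poly \<epsilon>(1)] fam_0 unfolding S_def fam_def by simp
  moreover have "\<not> bilipschitz_equiv (poly_eval g1) (poly_eval g2)" if "g1 \<in> S" "g2 \<in> S" "g1 \<noteq> g2" for g1 g2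
    using that fam_inequivalent[OF _ _ \<epsilon>(2,3) C] unfolding S_def by blast
  ultimately have P4: "?P 4" using sub sa dim by blast
  \<comment> \<open>\<open>Greatest_le_nat\<close> requires an upper bound for the admissible
    dimensions; the real dimension of the jet space supplies one. The dimension 4 then gives 4 div 2
    = 2.\<close>
  have bound: "m \<le> 2 * card (jet_expos k :: ('n \<Rightarrow> nat) set)" if "?P m" for m
    using that semialgebraic_dim_le[OF finite_jet_expos, of "jet_space k"] jet_space_eq by blast
  have "4 \<le> (GREATEST m. ?P m)" by (rule Greatest_le_nat[of ?P, OF P4 bound])
  then show ?thesis unfolding lipschitz_modality_def by linarith
qed

end

text \<open>The bound on the corank provides two residual variables. Germs of corank 1 such as x^7
  also have zero residual 6-jet, but the corank cannot increase under deformation, and members of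
  J_{3,0} have corank 2.\<close>

theorem proposition6p4:
  fixes f :: "complex ^ 'n::finite \<Rightarrow> complex"
  assumes "isolated_singularity f"
    and "corank f \<ge> 2"
    and "zero_residual_jet 6 f"
  shows "deforms_to f J30 \<and>
    (\<forall>k. enat k \<ge> milnor_number f + 1 \<longrightarrow> lipschitz_modality k f \<ge> 2)"
proof -
  obtain I g where I: "card I = corank f" and gm: "g \<in> max_ideal_sq" and jet: "jet 6 g = 0"
    and eq: "smoothly_equiv f (\<lambda>x. g x + (\<Sum>i\<in>-I. (x $ i)\<^sup>2))"
    using assms(3) unfolding zero_residual_jet_def residual_germ_def by blast
  obtain \<phi> where \<phi>: "biholomorphism_germ \<phi>" and fg: "\<forall>\<^sub>F x in nhds 0. f x = g (\<phi> x) + (\<Sum>i\<in>-I. (\<phi> x $ i)\<^sup>2)"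
    using eq unfolding smoothly_equiv_def by blast
  obtain i j where neq: "i \<in> I" "j \<in> I" "i \<noteq> j"
  proof -
    have "\<not> card I \<le> Suc 0" using I assms(2) by simp
    then show ?thesis using that card_le_Suc0_iff_eq[OF finite, of I] by blast
  qed
  have msq: "analytic_germ h \<and> h 0 = 0" if h: "h \<in> max_ideal_sq" for h :: "complex ^ 'n \<Rightarrow> complex"
  proof -
    obtain N u v where uv: "\<forall>m<(N::nat). u m \<in> max_ideal \<and> v m \<in> max_ideal" and he: "\<forall>\<^sub>F x in nhds 0. h x = (\<Sum>m<N. u m x * v m x)"
      using h unfolding max_ideal_sq_def by blast
    have "analytic_germ (\<lambda>x. \<Sum>m<N. u m x * v m x)"
      by (intro analytic_intros) (use uv in \<open>auto simp: max_ideal_def\<close>)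
    moreover have "h 0 = 0" using eventually_nhds_x_imp_x[OF he] uv by (simp add: max_ideal_def)
    ultimately show ?thesis using analytic_germ_cong[OF he] by simp
  qed
  have fan: "analytic_germ f" "f 0 = 0" using msq assms(1) by (auto simp: isolated_singularity_def)
  have gan: "analytic_germ g" using msq[OF gm] by simp
  have z: "taylor_coeff g \<alpha> = 0" if "mdeg \<alpha> \<le> 6" for \<alpha>
    using lookup_jet[of 6 g \<alpha>] that by (simp add: jet)
  have g7: "ordge 7 g" by (rule ordge_if_coeffs_zero[OF has_power_series_taylor[OF gan]]) (simp add: z)
  define J where "J = I - {i,j}"
  \<comment> \<open>The squares in the splitting run over the coordinates outside {i, j} that are
    not in J, which is the form of \<open>sq_germ\<close>.\<close>
  have mI: "-I = -{i,j} - J" using neq by (auto simp: J_def)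
  have "\<exists>c fA fx fq fz. germ_data i j J c fA fx fq fz g"
    by (rule ex_forward[OF zero_6jet_decomposition[OF neq(3) has_power_series_taylor[OF gan]]], erule z)
      (elim ex_forward conjE, unfold_locales, (use neq in \<open>auto simp: J_def\<close>))
  then obtain c fA fx fq fz where "germ_data i j J c fA fx fq fz g" by blast
  then interpret germ_data i j J c fA fx fq fz g .
  have fs: "\<forall>\<^sub>F x in nhds 0. f x = sq_germ (\<phi> x)" using fg by (simp add: sq_germ_def mI)
  show ?thesis
  proof (intro conjI allI impI)
    show "deforms_to f J30" by (rule deforms[OF \<phi> fs fan(1)])
    fix k assume k: "milnor_number f + 1 \<le> enat k"
    \<comment> \<open>The only use of the Milnor number: it turns the condition on k into k >=
      11.\<close>
    have "enat 10 \<le> milnor_number f"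
      by (rule milnor_number_ge[OF neq(3) _ gan g7 \<phi> fg]) (use neq in auto)
    then have "enat 10 + 1 \<le> enat k" using order_trans[OF add_right_mono k] by blast
    then have "11 \<le> k" by (simp add: one_enat_def)
    then interpret jet_family i j J c fA fx fq fz g \<phi> f k
      by unfold_locales (use \<phi> fs fan in auto)
    show "2 \<le> lipschitz_modality k f" by (rule lipschitz_modality_ge)
  qed
qed

end
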